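(* Let $\phi\in\mathcal{H}_d^*$ and suppose that every point of $\Omega(\phi)=\{\xi_1,\dots,\xi_K\}$ is of positive-homogeneous type for $\widehat\phi$. For $k=1,\dots,K$, let $\alpha_k$, $P_k$, $R_k=\operatorname{Re}P_k$, $\mu_k$, $\Upsilon_k$ be the associated data at $\xi_k$, let $A_k\in \mathrm{GL}_d(\mathbb{R})$ be such that $\xi\mapsto P_k(A_k\xi)$ is positive semi-elliptic with $\mathbf{m}_k=(m_{1,k},\dots,m_{d,k})\in\mathbb{N}_+^d$, set $m_k=\operatorname{lcm}(m_{1,k},\dots,m_{d,k})$, and let $Q_{\lambda,k}^n$ be the differential operators $Q_\lambda^n$ constructed from $(P_k,\Upsilon_k)$ and $A_k$. Then, for any $L>0$ and any choice of orders of accuracy $\lambda_1,\dots,\lambda_K\in\mathbb{N}$, there are positive constants $M_1,\dots,M_K$ and $C_1,\dots,C_K$ for which $$\left|\phi^{(n)}(x)-\sum_{k=1}^K\sum_{\lambda=0}^{\lambda_k}e^{-ix\cdot\xi_k}\widehat\phi(\xi_k)^n\,(Q_{\lambda,k}^nH_{P_k}^n)(x-n\alpha_k)\right|\leq\sum_{k=1}^K\frac{C_k}{n^{\mu_k+(\lambda_k+1)/2m_k}}\exp\left(-nM_kR_k^{\#}\left(\frac{x-n\alpha_k}{n}\right)\right)$$ for all $n\in\mathbb{N}_+$ and $x\in\mathbb{Z}^d$ with $|x|\leq nL$. In the case that $\phi$ is finitely supported, for any $\lambda_1,\dots,\lambda_K\in\mathbb{N}$ there are positive constants $C_1,\dots,C_K,M_1,\dots,M_K$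 for which the same inequality holds for all $n\in\mathbb{N}_+$ and all $x\in\mathbb{Z}^d$.
   Context: $\mathbb{N}=\{0,1,2,\dots\}$, $\mathbb{N}_+=\{1,2,\dots\}$, $|\cdot|$ is the Euclidean norm on $\mathbb{R}^d$, $\mathbb{T}^d=(-\pi,\pi]^d$; $(\lambda_k+1)/2m_k$ means $(\lambda_k+1)/(2m_k)$. Convolution powers. For $\phi\in\ell^1(\mathbb{Z}^d)$ (complex-valued, absolutely summable), $(\phi*\lambda)(x)=\sum_{y\in\mathbb{Z}^d}\phi(x-y)\lambda(y)$, $\phi^{(1)}=\phi$ and $\phi^{(n)}=\phi^{(n-1)}*\phi$ for $n\ge 2$. $\widehat{\phi}(\xi)=\sum_{x\in\mathbb{Z}^d}\phi(x)e^{ix\cdot\xi}$. $\mathcal{H}_d$ is the set of $\phi\in\ell^1(\mathbb{Z}^d)$ for which $\widehat\phi$ is holomorphic on (extends holomorphically to) a neighborhood of $\mathbb{T}^d$ in $\mathbb{C}^d$; $\mathcal{H}_d^*$ is the set of $\phi\in\mathcal{H}_d$ with $\sup_{\xi\in\mathbb{T}^d}|\widehat\phi(\xi)|=1$; $\Omega(\phi)=\{\xi\in\mathbb{T}^d:|\widehat\phi(\xi)|=1\}$. Positive-homogeneous polynomials. For a real $d\times d$ matrix $E$ and $t>0$, $t^E=\exp((\ln t)E)$. For $P:\mathbb{R}^d\to\mathbb{C}$, $\operatorname{Exp}(P)$ is the set of real $d\times d$ matrices $E$ with $tP(\xi)=P(t^E\xi)$ for all $t>0$, $\xi\in\mathbb{R}^d$.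 A complex polynomial $P$ in $d$ variables is positive-homogeneous if $\operatorname{Exp}(P)\neq\varnothing$ and $R=\operatorname{Re}P$ on $\mathbb{R}^d$ is positive-definite ($R\geq0$ and $R(\xi)=0$ only when $\xi=0$). Its homogeneous order is $\mu_P=\operatorname{tr}E$ for any $E\in\operatorname{Exp}(P)$ (positive and independent of $E$). $R^{\#}(x)=\sup_{\xi\in\mathbb{R}^d}\{x\cdot\xi-R(\xi)\}$. For $\mathbf{n}\in\mathbb{N}_+^d$ and a multi-index $\beta\in\mathbb{N}^d$, $|\beta:\mathbf{n}|=\sum_j\beta_j/n_j$. A polynomial is positive semi-elliptic with $\mathbf{m}\in\mathbb{N}_+^d$ if it has the form $\sum_{|\beta:\mathbf{m}|=2}a_\beta\xi^\beta$, $a_\beta\in\mathbb{C}$, with positive-definite real part $\sum_{|\beta:\mathbf{m}|=2}\operatorname{Re}(a_\beta)\xi^\beta$. For every positive-homogeneous polynomial $P$ there is $A\in\mathrm{GL}_d(\mathbb{R})$ such that $P_A(\xi)=P(A\xi)$ is positive semi-elliptic with some $\mathbf{m}$. Type of points. For $\xi_0\in\Omega(\phi)$, $\Gamma_{\xi_0}(\xi)=\operatorname{Log}(\widehat\phi(\xi+\xi_0)/\widehat\phi(\xi_0))$ (principal branch), holomorphic near $0\in\mathbb{C}^d$. $\xi_0$ is of positive-homogeneous type for $\widehat\phi$ if $\Gamma_{\xi_0}(\xi)=i\alpha_{\xi_0}\cdot\xi-P_{\xi_0}(\xi)+\Upsilon_{\xi_0}(\xi)$ with $\alpha_{\xi_0}\in\mathbb{R}^d$,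 $P_{\xi_0}$ a positive-homogeneous polynomial, and $\Upsilon_{\xi_0}(\xi)=o(\operatorname{Re}P_{\xi_0}(\xi))$ as $\xi\to0$ in $\mathbb{R}^d$. If all points of $\Omega(\phi)$ are of this type, $\Omega(\phi)$ is finite and one writes $\alpha_k=\alpha_{\xi_k}$, $P_k=P_{\xi_k}$, $\Upsilon_k=\Upsilon_{\xi_k}$, $\mu_k=\mu_{P_k}$. Attractors. For a positive-homogeneous polynomial $P$, $H_P^t(x)=\frac{1}{(2\pi)^d}\int_{\mathbb{R}^d}e^{-tP(\xi)}e^{-ix\cdot\xi}\,d\xi$ for $t>0$, $x\in\mathbb{R}^d$. Operators $Q_\lambda^n$. Complete Bell polynomials $B_\lambda$ are defined by the formal identity $\exp\left(\sum_{l\ge1}\frac{s_l}{l!}t^l\right)=\sum_{\lambda\ge0}\frac{B_\lambda(s_1,\dots,s_\lambda)}{\lambda!}t^\lambda$. Let $P$ be positive-homogeneous with $R=\operatorname{Re}P$, $\Upsilon$ holomorphic near $0\in\mathbb{C}^d$ with $\Upsilon(\xi)=o(R(\xi))$ as $\xi\to0$ in $\mathbb{R}^d$, and $A$ such that $P_A$ is positive semi-elliptic with $\mathbf{m}$. Set $m=\operatorname{lcm}(m_1,\dots,m_d)$, $\kappa=(\kappa_1,\dots,\kappa_d)\in\mathbb{N}_+^d$ with $m_j\kappa_j=m$, $\Lambda(\beta)=\beta\cdot\kappa-2m$. Then $\Upsilon_A(z)=\Upsilon(Az)=\sum_{|\beta:2\mathbf{m}|>1}b_\beta z^\beta$ near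 $0$ (all other Maclaurin coefficients vanish), and for $\lambda\in\mathbb{N}_+$ one sets $S_\lambda(z)=\lambda!\sum_{\Lambda(\beta)=\lambda}b_\beta z^\beta$. Then $Q_\lambda^n=\frac{1}{\lambda!}B_\lambda\big(nS_1(A^{-1}(i\partial)),\dots,nS_\lambda(A^{-1}(i\partial))\big)$, with $i\partial=(i\partial_1,\dots,i\partial_d)$, i.e. the constant-coefficient differential operator obtained from the polynomial $\xi\mapsto\frac1{\lambda!}B_\lambda(nS_1(A^{-1}\xi),\dots,nS_\lambda(A^{-1}\xi))$ by substituting $\xi_j\to i\partial_j$; $Q_0^n$ is the identity. $(Q_\lambda^nH_P^n)$ is $Q_\lambda^n$ applied to $x\mapsto H_P^n(x)$. *)

theory Defs
  imports
    "HOL-Analysis.Analysis"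
    "HOL-Library.Landau_Symbols"
    "HOL-Library.Poly_Mapping"
    "HOL-Computational_Algebra.Formal_Power_Series"
begin

section \<open>Vectors\<close>

definition real_vec :: "int ^ 'd \<Rightarrow> real ^ 'd"
  where "real_vec x = (\<chi> j. real_of_int (x $ j))"

definition cplx_vec :: "real ^ 'd \<Rightarrow> complex ^ 'd"
  where "cplx_vec \<xi> = (\<chi> j. complex_of_real (\<xi> $ j))"

definition cplx_mat :: "real ^ 'd ^ 'd \<Rightarrow> complex ^ 'd ^ 'd"
  where "cplx_mat A = (\<chi> i j. complex_of_real (A $ i $ j))"

text \<open>The bilinear (not sesquilinear) extension of the dot product.\<close>

definition cdot :: "complex ^ 'd \<Rightarrow> complex ^ 'd \<Rightarrow> complex"
  where "cdot z w = (\<Sum>j\<in>UNIV. z $ j * w $ j)"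


section \<open>Convolution powers and Fourier transform\<close>

definition conv :: "(int ^ 'd \<Rightarrow> complex) \<Rightarrow> (int ^ 'd \<Rightarrow> complex) \<Rightarrow> int ^ 'd \<Rightarrow> complex"
  where "conv \<phi> \<psi> x = (\<Sum>\<^sub>\<infinity>y. \<phi> (x - y) * \<psi> y)"

text \<open>Meaningful for \<open>n \<ge> 1\<close> only; the value at \<open>n = 0\<close> is never used.\<close>

definition conv_power :: "(int ^ 'd \<Rightarrow> complex) \<Rightarrow> nat \<Rightarrow> int ^ 'd \<Rightarrow> complex"
  where "conv_power \<phi> n = ((\<lambda>\<psi>. conv \<psi> \<phi>) ^^ (n - 1)) \<phi>"

definition fourier :: "(int ^ 'd \<Rightarrow> complex) \<Rightarrow> real ^ 'd \<Rightarrow> complex"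
  where "fourier \<phi> \<xi> = (\<Sum>\<^sub>\<infinity>x. \<phi> x * exp (\<i> * complex_of_real (real_vec x \<bullet> \<xi>)))"

definition torus :: "(real ^ 'd) set"
  where "torus = {\<xi>. \<forall>j. - pi < \<xi> $ j \<and> \<xi> $ j \<le> pi}"

text \<open>Holomorphy in several variables: the Frechet derivative exists and is complex-linear.
  Only used for open sets.\<close>

definition holomorphic_vec_on :: "(complex ^ 'd \<Rightarrow> complex) \<Rightarrow> (complex ^ 'd) set \<Rightarrow> bool"
  where "holomorphic_vec_on F U \<longleftrightarrow>
    (\<forall>z\<in>U. \<exists>D. (F has_derivative D) (at z) \<and> (\<forall>c v. D (c *s v) = c * D v))"

text \<open>The extension has to agree with the (periodic) Fourier transform at all real points of
  the neighbourhood, not merely on the half-open cube \<open>torus\<close>: the neighbourhood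
  contains real points beyond the faces \<open>\<xi> $ j = pi\<close>.\<close>

definition holomorphic_extension ::
    "(int ^ 'd \<Rightarrow> complex) \<Rightarrow> (complex ^ 'd \<Rightarrow> complex) \<Rightarrow> bool"
  where "holomorphic_extension \<phi> F \<longleftrightarrow>
    (\<exists>U. open U \<and> cplx_vec ` torus \<subseteq> U \<and> holomorphic_vec_on F U \<and>
         (\<forall>\<xi>. cplx_vec \<xi> \<in> U \<longrightarrow> F (cplx_vec \<xi>) = fourier \<phi> \<xi>))"

definition class_H :: "(int ^ 'd \<Rightarrow> complex) set"
  where "class_H = {\<phi>. (\<lambda>x. norm (\<phi> x)) summable_on UNIV \<and> (\<exists>F. holomorphic_extension \<phi> F)}"

definition class_H_star :: "(int ^ 'd \<Rightarrow> complex) set"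
  where "class_H_star = {\<phi> \<in> class_H. (SUP \<xi>\<in>torus. norm (fourier \<phi> \<xi>)) = 1}"

text \<open>Any two extensions agree near every point of \<open>torus\<close>, so that the choice is
  immaterial for everything below, which only depends on germs at points of \<open>torus\<close>.\<close>

definition fourier_cplx :: "(int ^ 'd \<Rightarrow> complex) \<Rightarrow> complex ^ 'd \<Rightarrow> complex"
  where "fourier_cplx \<phi> = (SOME F. holomorphic_extension \<phi> F)"

definition Omega :: "(int ^ 'd \<Rightarrow> complex) \<Rightarrow> (real ^ 'd) set"
  where "Omega \<phi> = {\<xi> \<in> torus. norm (fourier \<phi> \<xi>) = 1}"


section \<open>Polynomials in \<open>d\<close> variables\<close>

text \<open>Finitely supported families of coefficients indexed by multi-indices. Multi-indices add
  componentwise, so that \<open>*\<close> on this type is multiplication of polynomials.\<close>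

type_synonym 'd cpoly = "(nat, 'd) vec \<Rightarrow>\<^sub>0 complex"

definition monomial :: "complex ^ 'd \<Rightarrow> nat ^ 'd \<Rightarrow> complex"
  where "monomial z \<beta> = (\<Prod>j\<in>UNIV. (z $ j) ^ (\<beta> $ j))"

definition eval_poly :: "'d::finite cpoly \<Rightarrow> complex ^ 'd \<Rightarrow> complex"
  where "eval_poly p z =
    (\<Sum>\<beta>\<in>Poly_Mapping.keys p. Poly_Mapping.lookup p \<beta> * monomial z \<beta>)"

definition const_poly :: "complex \<Rightarrow> 'd::finite cpoly"
  where "const_poly c = Poly_Mapping.single 0 c"

definition var_poly :: "'d::finite \<Rightarrow> 'd cpoly"
  where "var_poly j = Poly_Mapping.single (axis j 1) 1"

text \<open>The polynomial \<open>\<xi> \<mapsto> p (B \<xi>)\<close>.\<close>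

definition lin_subst :: "real ^ 'd ^ 'd \<Rightarrow> 'd::finite cpoly \<Rightarrow> 'd cpoly"
  where "lin_subst B p =
    (\<Sum>\<beta>\<in>Poly_Mapping.keys p. const_poly (Poly_Mapping.lookup p \<beta>) *
       (\<Prod>j\<in>UNIV. (\<Sum>k\<in>UNIV. const_poly (complex_of_real (B $ j $ k)) * var_poly k) ^ (\<beta> $ j)))"

definition real_part :: "'d::finite cpoly \<Rightarrow> real ^ 'd \<Rightarrow> real"
  where "real_part p \<xi> = Re (eval_poly p (cplx_vec \<xi>))"

definition pos_definite :: "(real ^ 'd \<Rightarrow> real) \<Rightarrow> bool"
  where "pos_definite R \<longleftrightarrow> (\<forall>\<xi>. 0 \<le> R \<xi> \<and> (R \<xi> = 0 \<longrightarrow> \<xi> = 0))"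


section \<open>Positive-homogeneous polynomials\<close>

text \<open>The multiplication \<open>*\<close> of the type \<open>real ^ 'd ^ 'd\<close> is componentwise, and the type has
  no instance for \<open>exp\<close>; the exponential series is therefore spelled out with \<open>**\<close>.\<close>

definition matrix_exp :: "real ^ 'd ^ 'd \<Rightarrow> real ^ 'd ^ 'd"
  where "matrix_exp A = suminf (\<lambda>k. (1 / fact k) *\<^sub>R (((**) A) ^^ k) (mat 1))"

definition matrix_powr :: "real \<Rightarrow> real ^ 'd ^ 'd \<Rightarrow> real ^ 'd ^ 'd"
  where "matrix_powr t E = matrix_exp (ln t *\<^sub>R E)"

definition Exp_set :: "(real ^ 'd \<Rightarrow> complex) \<Rightarrow> (real ^ 'd ^ 'd) set"
  where "Exp_set P = {E. \<forall>t>0. \<forall>\<xi>. complex_of_real t * P \<xi> = P (matrix_powr t E *v \<xi>)}"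

definition positive_homogeneous :: "'d::finite cpoly \<Rightarrow> bool"
  where "positive_homogeneous P \<longleftrightarrow>
    Exp_set (\<lambda>\<xi>. eval_poly P (cplx_vec \<xi>)) \<noteq> {} \<and> pos_definite (real_part P)"

text \<open>The trace does not depend on the choice of \<open>E\<close> if \<open>P\<close> is positive-homogeneous.\<close>

definition hom_order :: "'d::finite cpoly \<Rightarrow> real"
  where "hom_order P = trace (SOME E. E \<in> Exp_set (\<lambda>\<xi>. eval_poly P (cplx_vec \<xi>)))"

definition legendre :: "(real ^ 'd \<Rightarrow> real) \<Rightarrow> real ^ 'd \<Rightarrow> real"
  where "legendre R x = (SUP \<xi>. x \<bullet> \<xi> - R \<xi>)"

definition positive_semi_elliptic :: "nat ^ 'd \<Rightarrow> 'd::finite cpoly \<Rightarrow> bool"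
  where "positive_semi_elliptic m p \<longleftrightarrow>
    (\<forall>j. 1 \<le> m $ j) \<and>
    (\<forall>\<beta>\<in>Poly_Mapping.keys p. (\<Sum>j\<in>UNIV. real (\<beta> $ j) / real (m $ j)) = 2) \<and>
    pos_definite (real_part p)"


section \<open>Points of positive-homogeneous type\<close>

definition Gamma_log :: "(int ^ 'd \<Rightarrow> complex) \<Rightarrow> real ^ 'd \<Rightarrow> complex ^ 'd \<Rightarrow> complex"
  where "Gamma_log \<phi> \<xi>0 z =
    Ln (fourier_cplx \<phi> (z + cplx_vec \<xi>0) / fourier_cplx \<phi> (cplx_vec \<xi>0))"

text \<open>The remainder in \<open>\<Gamma> = \<i> \<alpha> \<cdot> z - P + \<Upsilon>\<close>.\<close>

definition Upsilon ::
    "(int ^ 'd \<Rightarrow> complex) \<Rightarrow> real ^ 'd \<Rightarrow> real ^ 'd \<Rightarrow> 'd::finite cpoly \<Rightarrow> complex ^ 'd \<Rightarrow> complex"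
  where "Upsilon \<phi> \<xi>0 \<alpha> P z =
    Gamma_log \<phi> \<xi>0 z - \<i> * cdot (cplx_vec \<alpha>) z + eval_poly P z"

definition pos_hom_type_data ::
    "(int ^ 'd \<Rightarrow> complex) \<Rightarrow> real ^ 'd \<Rightarrow> real ^ 'd \<Rightarrow> 'd::finite cpoly \<Rightarrow> bool"
  where "pos_hom_type_data \<phi> \<xi>0 \<alpha> P \<longleftrightarrow>
    positive_homogeneous P \<and>
    (\<lambda>\<xi>. norm (Upsilon \<phi> \<xi>0 \<alpha> P (cplx_vec \<xi>))) \<in> o[at 0](real_part P)"

definition pos_hom_type :: "(int ^ 'd::finite \<Rightarrow> complex) \<Rightarrow> real ^ 'd \<Rightarrow> bool"
  where "pos_hom_type \<phi> \<xi>0 \<longleftrightarrow> (\<exists>\<alpha> P. pos_hom_type_data \<phi> \<xi>0 \<alpha> P)"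


section \<open>Attractors\<close>

definition attractor :: "'d::finite cpoly \<Rightarrow> real \<Rightarrow> real ^ 'd \<Rightarrow> complex"
  where "attractor P t x =
    1 / (2 * complex_of_real pi) ^ CARD('d) *
    (LINT \<xi>|lborel. exp (- (complex_of_real t * eval_poly P (cplx_vec \<xi>))) *
                    exp (- (\<i> * complex_of_real (x \<bullet> \<xi>))))"


section \<open>The operators \<open>Q\<close>\<close>

text \<open>\<open>\<i> \<partial>\<^sub>j\<close>\<close>

definition i_partial :: "'d::finite \<Rightarrow> (real ^ 'd \<Rightarrow> complex) \<Rightarrow> real ^ 'd \<Rightarrow> complex"
  where "i_partial j f x = \<i> * vector_derivative (\<lambda>t. f (x + t *\<^sub>R axis j 1)) (at 0)"

text \<open>\<open>(\<i> \<partial>)\<^sup>\<beta>\<close>. The type \<open>'d\<close> carries no order, so the partial derivatives are taken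
  in the order of some enumeration of the coordinates; for smooth functions it does not matter
  which.\<close>

definition i_partials :: "nat ^ 'd \<Rightarrow> (real ^ 'd::finite \<Rightarrow> complex) \<Rightarrow> real ^ 'd \<Rightarrow> complex"
  where "i_partials \<beta> f =
    foldr (\<lambda>j. i_partial j ^^ (\<beta> $ j)) (SOME js. distinct js \<and> set js = (UNIV :: 'd set)) f"

text \<open>The operator \<open>p(\<i> \<partial>)\<close>.\<close>

definition diff_op :: "'d::finite cpoly \<Rightarrow> (real ^ 'd \<Rightarrow> complex) \<Rightarrow> real ^ 'd \<Rightarrow> complex"
  where "diff_op p f x =
    (\<Sum>\<beta>\<in>Poly_Mapping.keys p. Poly_Mapping.lookup p \<beta> * i_partials \<beta> f x)"

text \<open>Complete Bell polynomials, evaluated in the ring of polynomials: \<open>bell s l\<close> is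
  \<open>l!\<close> times the coefficient of \<open>t ^ l\<close> in \<open>exp (\<Sum>r\<ge>1. s r / r! * t ^ r)\<close>. The library's
  \<open>fps_exp\<close> needs coefficients in a field.\<close>

definition bell :: "(nat \<Rightarrow> 'd::finite cpoly) \<Rightarrow> nat \<Rightarrow> 'd cpoly"
  where "bell s l = const_poly (fact l) *
    fps_nth (Abs_fps (\<lambda>r. const_poly (1 / fact r))
              oo Abs_fps (\<lambda>r. if r = 0 then 0 else const_poly (1 / fact r) * s r)) l"

text \<open>The coefficients of the power series of \<open>f\<close> at the origin (for \<open>f\<close> holomorphic there).\<close>

definition maclaurin :: "(complex ^ 'd \<Rightarrow> complex) \<Rightarrow> nat ^ 'd \<Rightarrow> complex"
  where "maclaurin f = (THE b. \<forall>\<^sub>F z in nhds 0. ((\<lambda>\<beta>. b \<beta> * monomial z \<beta>) has_sum f z) UNIV)"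

definition lcm_vec :: "nat ^ 'd \<Rightarrow> nat"
  where "lcm_vec m = Lcm (range (\<lambda>j. m $ j))"

definition Lambda_weight :: "nat ^ 'd \<Rightarrow> nat ^ 'd \<Rightarrow> int"
  where "Lambda_weight m \<beta> =
    (\<Sum>j\<in>UNIV. int (\<beta> $ j) * int (lcm_vec m div m $ j)) - 2 * int (lcm_vec m)"

definition S_poly ::
    "real ^ 'd ^ 'd \<Rightarrow> nat ^ 'd \<Rightarrow> (complex ^ 'd \<Rightarrow> complex) \<Rightarrow> nat \<Rightarrow> 'd::finite cpoly"
  where "S_poly A m \<Upsilon> l = const_poly (fact l) *
    (\<Sum>\<beta> | Lambda_weight m \<beta> = int l.
       Poly_Mapping.single \<beta> (maclaurin (\<lambda>z. \<Upsilon> (cplx_mat A *v z)) \<beta>))"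

definition Q_poly ::
    "real ^ 'd ^ 'd \<Rightarrow> nat ^ 'd \<Rightarrow> (complex ^ 'd \<Rightarrow> complex) \<Rightarrow> nat \<Rightarrow> nat \<Rightarrow> 'd::finite cpoly"
  where "Q_poly A m \<Upsilon> l n = const_poly (1 / fact l) *
    bell (\<lambda>r. const_poly (of_nat n) * lin_subst (matrix_inv A) (S_poly A m \<Upsilon> r)) l"

definition Q_op ::
    "real ^ 'd ^ 'd \<Rightarrow> nat ^ 'd \<Rightarrow> (complex ^ 'd \<Rightarrow> complex) \<Rightarrow> nat \<Rightarrow> nat \<Rightarrow>
     (real ^ 'd::finite \<Rightarrow> complex) \<Rightarrow> real ^ 'd \<Rightarrow> complex"
  where "Q_op A m \<Upsilon> l n = diff_op (Q_poly A m \<Upsilon> l n)"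

end

theory Submission
  imports Defs "HOL-Complex_Analysis.Complex_Analysis"
begin

no_notation fps_nth (infixl "$" 75)

text \<open>
  Fourier inversion over a period cell writes \<open>(2 \<pi>)^d \<phi>\<^sup>(\<^sup>n\<^sup>)(x)\<close> as the integral of
  \<open>e^(-i x \<cdot> \<xi>) (fourier \<phi> \<xi>)^n\<close>. Away from the finitely many points of \<open>Omega \<phi>\<close> the integrand is
  exponentially small in \<open>n\<close>, so only small balls around these points matter. At such a point the
  integrand is, up to a unimodular constant, \<open>e^(-i y \<cdot> \<eta>) e^(-n P(\<eta>)) e^(n \<Upsilon>(\<eta>))\<close> with
  \<open>y = x - n \<alpha>\<close>. Expanding \<open>e^(n \<Upsilon>)\<close> along the weights for which \<open>P\<close> is homogeneous produces exactly
  the polynomials \<open>Q_poly\<close>; the Fourier integral of \<open>Q_poly \<cdot> e^(-n P)\<close> over all of \<open>\<real>^d\<close> is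
  the differential operator \<open>Q_op\<close> applied to the attractor.

  Two mechanisms give the size of the error. The power of \<open>n\<close> comes from homogeneity. In the
  coordinates that make \<open>P\<close> semi-elliptic, \<open>|e^(-n P) \<sigma>| \<le> C e^(-n c N)\<close> holds for the relevant
  polynomials \<open>\<sigma>\<close>, where \<open>N \<eta> = \<Sum>\<^sub>j |\<eta>\<^sub>j|^(2 m\<^sub>j)\<close> is the function \<open>quasi\<close>, and the first neglected
  weight contributes \<open>N^((\<lambda> + 1) / 2m)\<close>, that is \<open>n^(-(\<lambda> + 1) / 2m)\<close> after absorbing a power of
  \<open>n N\<close> into the exponential (\<open>semi_elliptic_estimates\<close>). Scaling the integral of \<open>e^(-n c N)\<close> gives
  the factor \<open>n^(-\<mu>)\<close> (\<open>integral_quasi_scaling\<close>, \<open>hom_order_eq\<close>).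

  The exponential factor comes from moving the domain of integration to \<open>\<real>^d - i \<nu>\<close>. On it
  \<open>e^(-i y \<cdot> z)\<close> has modulus \<open>e^(-y \<cdot> \<nu>)\<close>, and the loss in \<open>e^(-n P)\<close> is at most \<open>e^(n M N(\<nu>))\<close>; the
  best choice of \<open>\<nu>\<close> gains \<open>e^(-n \<epsilon> G(y / n))\<close>, where \<open>G\<close> is a function comparable to the Legendre
  transform of \<open>Re P\<close> (\<open>choose_shift\<close>, \<open>legendre_upper\<close>). Since the integrand is holomorphic only near
  the origin, the shift is carried out with a cutoff function instead of contours with ends: the
  derivative of the shifted integral is an integral against the gradient of the cutoff
  (\<open>shift_bound\<close>), which lives where \<open>e^(-n P)\<close> is exponentially small. The condition \<open>|x| \<le> n L\<close>
  keeps the exponential factor of the bound from being smaller than this error. For finitely supported \<open>\<phi>\<close> the convolution power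
  vanishes for \<open>|x| > n L\<close>, and there the terms of the expansion are themselves small enough, because
  they are entire and can be shifted without restriction (\<open>contour_shift\<close>).
\<close>

section \<open>Complex differentiability in several variables\<close>

definition cdiff :: "(complex ^ 'd \<Rightarrow> complex) \<Rightarrow> complex ^ 'd \<Rightarrow> bool"
  where "cdiff F z \<longleftrightarrow> (\<exists>D. (F has_derivative D) (at z) \<and> (\<forall>c v. D (c *s v) = c * D v))"

lemma holomorphic_vec_on_iff: "holomorphic_vec_on F U \<longleftrightarrow> (\<forall>z\<in>U. cdiff F z)"
  by (simp add: holomorphic_vec_on_def cdiff_def)

lemma cdiff_isCont: "cdiff F z \<Longrightarrow> isCont F z"
  unfolding cdiff_def using has_derivative_continuous by blast

lemma cdiff_const [intro]: "cdiff (\<lambda>z. c) z"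
  unfolding cdiff_def by (intro exI[of _ "\<lambda>_. 0"]) auto

lemma cdiff_component [intro]: "cdiff (\<lambda>z. z $ j) z"
  unfolding cdiff_def
  by (intro exI[of _ "\<lambda>v. v $ j"] conjI bounded_linear.has_derivative[OF bounded_linear_vec_nth]
      has_derivative_ident) auto

lemma cdiff_add [intro]: "cdiff F z \<Longrightarrow> cdiff G z \<Longrightarrow> cdiff (\<lambda>z. F z + G z) z"
  unfolding cdiff_def
  by (elim exE conjE, rule exI, rule conjI, rule has_derivative_add) (auto simp: algebra_simps)

lemma cdiff_mult [intro]: "cdiff F z \<Longrightarrow> cdiff G z \<Longrightarrow> cdiff (\<lambda>z. F z * G z) z"
  unfolding cdiff_def
  by (elim exE conjE, rule exI, rule conjI, rule has_derivative_mult) (auto simp: algebra_simps)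

lemma cdiff_minus [intro]: "cdiff F z \<Longrightarrow> cdiff (\<lambda>z. - F z) z"
  using cdiff_mult[OF cdiff_const[of "-1"]] by auto

lemma cdiff_diff [intro]: "cdiff F z \<Longrightarrow> cdiff G z \<Longrightarrow> cdiff (\<lambda>z. F z - G z) z"
  using cdiff_add[OF _ cdiff_minus] by auto

lemma cdiff_sum [intro]: "(\<And>i. i \<in> I \<Longrightarrow> cdiff (F i) z) \<Longrightarrow> cdiff (\<lambda>z. \<Sum>i\<in>I. F i z) z"
  by (induction I rule: infinite_finite_induct) auto

lemma cdiff_prod [intro]: "(\<And>i. i \<in> I \<Longrightarrow> cdiff (F i) z) \<Longrightarrow> cdiff (\<lambda>z. \<Prod>i\<in>I. F i z) z"
  by (induction I rule: infinite_finite_induct) auto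

lemma cdiff_power [intro]: "cdiff F z \<Longrightarrow> cdiff (\<lambda>z. F z ^ n) z"
  by (induction n) auto

lemma cdiff_compose:
  assumes "(f has_field_derivative f') (at (F z))" "cdiff F z"
  shows "cdiff (\<lambda>z. f (F z)) z"
proof -
  from assms(2) obtain D where D: "(F has_derivative D) (at z)" "\<And>c v. D (c *s v) = c * D v"
    unfolding cdiff_def by blast
  have "((\<lambda>z. f (F z)) has_derivative (\<lambda>v. f' * D v)) (at z)"
    using has_derivative_compose[OF D(1)] assms(1) unfolding has_field_derivative_def by blast
  then show ?thesis unfolding cdiff_def by (intro exI[of _ "\<lambda>v. f' * D v"]) (auto simp: D(2))
qed

lemma cdiff_exp [intro]: "cdiff F z \<Longrightarrow> cdiff (\<lambda>z. exp (F z)) z"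
  by (rule cdiff_compose[OF DERIV_exp])

lemma cdiff_compose_linear:
  fixes L :: "complex ^ 'd::finite \<Rightarrow> complex ^ 'd"
  assumes "cdiff F (L z + a)" "\<And>x y. L (x + y) = L x + L y" "\<And>c v. L (c *s v) = c *s L v"
  shows "cdiff (\<lambda>z. F (L z + a)) z"
proof -
  from assms(1) obtain D where D: "(F has_derivative D) (at (L z + a))" "\<And>c v. D (c *s v) = c * D v"
    unfolding cdiff_def by blast
  have "linear L"
  proof
    show "L (r *\<^sub>R x) = r *\<^sub>R L x" for r x
    proof -
      have "r *\<^sub>R x = of_real r *s x" "r *\<^sub>R L x = of_real r *s L x"
        by (simp_all add: vec_eq_iff scaleR_conv_of_real[where 'a=complex])
      then show ?thesis by (simp add: assms(3))
    qed
  qed (rule assms(2))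
  then have "(L has_derivative L) (at z)"
    by (simp add: linear_conv_bounded_linear bounded_linear_imp_has_derivative)
  then have "((\<lambda>z. L z + a) has_derivative L) (at z)"
    using has_derivative_add[of L L "at z" "\<lambda>_. a" "\<lambda>_. 0"] by auto
  then have "((\<lambda>z. F (L z + a)) has_derivative (\<lambda>v. D (L v))) (at z)"
    using has_derivative_compose D(1) by blast
  then show ?thesis unfolding cdiff_def
    by (intro exI[of _ "\<lambda>v. D (L v)"]) (auto simp: D(2) assms(3))
qed

lemma has_derivative_complex_line:
  fixes v :: "complex ^ 'd::finite"
  shows "((\<lambda>w. z + w *s v) has_derivative (\<lambda>h. h *s v)) F"
proof -
  have "linear (\<lambda>h::complex. h *s v)"
    by (intro linearI) (auto simp: algebra_simps vec_eq_iff)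
  then have "((\<lambda>h::complex. h *s v) has_derivative (\<lambda>h. h *s v)) F"
    by (simp add: linear_conv_bounded_linear bounded_linear_imp_has_derivative)
  then show ?thesis
    using has_derivative_add[of "\<lambda>_. z" "\<lambda>_. 0" F] by auto
qed

definition ddir :: "(complex ^ 'd \<Rightarrow> complex) \<Rightarrow> complex ^ 'd \<Rightarrow> complex ^ 'd \<Rightarrow> complex"
  where "ddir F v z = frechet_derivative F (at z) v"

lemma cdiff_line:
  fixes v :: "complex ^ 'd::finite"
  assumes "cdiff F (z + w *s v)"
  shows "((\<lambda>w. F (z + w *s v)) has_field_derivative ddir F v (z + w *s v)) (at w)"
proof -
  from assms obtain D where D: "(F has_derivative D) (at (z + w *s v))" "\<And>c v. D (c *s v) = c * D v"
    unfolding cdiff_def by blast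
  have DD: "D = frechet_derivative F (at (z + w *s v))"
    using D(1) frechet_derivative_at by blast
  have "((\<lambda>w. F (z + w *s v)) has_derivative (\<lambda>h. D (h *s v))) (at w)"
    using has_derivative_compose[OF has_derivative_complex_line D(1)] by blast
  then have "((\<lambda>w. F (z + w *s v)) has_derivative (\<lambda>h. D v * h)) (at w)"
    by (simp add: D(2) mult.commute)
  then show ?thesis unfolding has_field_derivative_def ddir_def DD .
qed

text \<open>Cauchy's formula on a small circle in the direction \<open>v\<close> expresses the derivative by values of
  \<open>F\<close>, and the circle integral depends continuously on its centre. So one complex derivative gives
  continuity of the directional derivatives, which differentiation under the integral sign needs.\<close>

lemma continuous_on_ddir:
  fixes F :: "complex ^ 'd::finite \<Rightarrow> complex"
  assumes "open W" "\<And>z. z \<in> W \<Longrightarrow> cdiff F z"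
  shows "continuous_on W (ddir F v)"
proof (rule continuous_at_imp_continuous_on, rule ballI)
  fix z0 assume "z0 \<in> W"
  then obtain e where e: "e > 0" "cball z0 e \<subseteq> W"
    using assms(1) open_contains_cball by blast
  define r where "r = e / 2 / (1 + norm v)"
  have r: "r > 0" using e by (simp add: r_def add_pos_nonneg)
  have nv: "norm (w *s v) = norm w * norm v" for w :: complex
    by (simp add: norm_vec_def L2_set_def norm_mult power_mult_distrib
        real_sqrt_mult flip: sum_distrib_left)
  have inW: "z + w *s v \<in> W" if "z \<in> cball z0 (e/2)" "norm w \<le> r" for z w
  proof -
    have "norm (w *s v) \<le> r * (1 + norm v)"
      unfolding nv using that r by (intro mult_mono) auto
    also have "\<dots> = e / 2"
    proof -
      have "1 + norm v \<noteq> 0" using norm_ge_zero[of v] by linarith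
      moreover have "k \<noteq> 0 \<Longrightarrow> e / 2 / k * k = e / 2" for k by simp
      ultimately show ?thesis unfolding r_def by blast
    qed
    finally have "dist z0 (z + w *s v) \<le> e"
      using that(1) norm_triangle_ineq4[of "z0 - z" "w *s v"] 
      by (simp add: dist_norm algebra_simps)
    then show ?thesis using e by auto
  qed
  have contF: "continuous_on W F"
    by (rule continuous_at_imp_continuous_on) (simp add: cdiff_isCont[OF assms(2)])
  have eq: "ddir F v z = 1 / (2 * of_real pi * \<i>) *
      integral {0..1} (\<lambda>t. F (z + circlepath 0 r t *s v) / (circlepath 0 r t)\<^sup>2 * 
       (2 * pi * \<i> * r * exp (2 * of_real pi * \<i> * t)))"
    if z: "z \<in> cball z0 (e/2)" for z
  proof -
    let ?g = "\<lambda>w. F (z + w *s v)"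
    have der: "(?g has_field_derivative ddir F v (z + w *s v)) (at w)" if "norm w \<le> r" for w
      using cdiff_line assms(2) inW z that by blast
    have c: "continuous_on (cball 0 r) ?g"
    proof (rule continuous_at_imp_continuous_on, rule ballI)
      fix w :: complex assume "w \<in> cball 0 r"
      then show "isCont ?g w" using DERIV_isCont[OF der[of w]] by simp
    qed
    have h: "?g holomorphic_on ball 0 r"
    proof (rule holomorphic_onI)
      fix w :: complex assume "w \<in> ball 0 r"
      then have "norm w \<le> r" by simp
      from der[OF this] show "?g field_differentiable at w within ball 0 r"
        unfolding field_differentiable_def using has_field_derivative_at_within by blast
    qed
    have "(?g has_field_derivative (1 / (2 * of_real pi * \<i>) *
        contour_integral (circlepath 0 r) (\<lambda>u. ?g u / (u - 0)\<^sup>2))) (at 0)"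
      using Cauchy_derivative_integral_circlepath(2)[OF c h, of 0] r by simp
    moreover have "(?g has_field_derivative ddir F v z) (at 0)" using der[of 0] r by simp
    ultimately have "ddir F v z = 1 / (2 * of_real pi * \<i>) *
        contour_integral (circlepath 0 r) (\<lambda>u. ?g u / u\<^sup>2)"
      using DERIV_unique by fastforce
    then show ?thesis
      by (simp add: contour_integral_integral vector_derivative_circlepath)
  qed
  have "continuous_on (cball z0 (e/2)) (\<lambda>z. integral {0..1} (\<lambda>t. F (z + circlepath 0 r t *s v) / (circlepath 0 r t)\<^sup>2 * 
       (2 * pi * \<i> * r * exp (2 * of_real pi * \<i> * t))))"
  proof -
    have cp: "norm (circlepath 0 r t) = r" for t using r by (simp add: circlepath norm_mult)
    have smc: "continuous_on S (\<lambda>x. fst x + circlepath 0 r (snd x) *s v)" for S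
      unfolding vector_scalar_mult_def circlepath by (intro continuous_intros)
    have "continuous_on (cball z0 (e/2) \<times> cbox 0 1) (\<lambda>x. F (fst x + circlepath 0 r (snd x) *s v))"
      by (rule continuous_on_compose2[OF contF smc]) (use inW cp in force)
    moreover have "circlepath 0 r t \<noteq> 0" for t using cp[of t] r by auto
    ultimately have "continuous_on (cball z0 (e/2) \<times> cbox 0 1) (\<lambda>(z,t). F (z + circlepath 0 r t *s v) / (circlepath 0 r t)\<^sup>2 * 
       (2 * pi * \<i> * r * exp (2 * of_real pi * \<i> * t)))"
      unfolding case_prod_beta circlepath by (intro continuous_intros) simp_all
    from integral_continuous_on_param[OF this] show ?thesis by (simp add: cbox_interval)
  qed
  then have "continuous_on (cball z0 (e/2)) (ddir F v)"
    by (subst continuous_on_cong[OF refl eq]) (auto intro!: continuous_intros)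
  then have "continuous_on (ball z0 (e/2)) (ddir F v)"
    using ball_subset_cball continuous_on_subset by blast
  then show "isCont (ddir F v) z0"
    using e continuous_on_eq_continuous_at[OF open_ball] centre_in_ball by (metis half_gt_zero)
qed

section \<open>Power series in several variables\<close>

lemma summable_prod_vec:
  fixes f :: "'d::finite \<Rightarrow> nat \<Rightarrow> complex"
  assumes "\<And>j. (\<lambda>k. norm (f j k)) summable_on UNIV"
  shows "(\<lambda>\<beta>::nat ^ 'd. norm (\<Prod>j\<in>UNIV. f j (\<beta> $ j))) summable_on UNIV"
proof (rule nonneg_bdd_above_summable_on)
  let ?h = "\<lambda>\<beta>::nat ^ 'd. norm (\<Prod>j\<in>UNIV. f j (\<beta> $ j))"
  show "bdd_above (sum ?h ` {F. F \<subseteq> UNIV \<and> finite F})"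
  proof (rule bdd_aboveI2)
    fix F :: "(nat ^ 'd) set" assume "F \<in> {F. F \<subseteq> UNIV \<and> finite F}"
    then have F: "finite F" by simp
    define n where "n = Suc (Max (insert 0 ((\<lambda>(\<beta>,j). \<beta> $ j) ` (F \<times> UNIV))))"
    have n: "\<beta> $ j < n" if "\<beta> \<in> F" for \<beta> j
    proof -
      have "\<beta> $ j \<le> Max (insert 0 ((\<lambda>(\<beta>,j). \<beta> $ j) ` (F \<times> UNIV)))"
        by (rule Max_ge) (use F that in force)+
      then show ?thesis by (simp add: n_def)
    qed
    have sub: "F \<subseteq> vec_lambda ` (PiE UNIV (\<lambda>_. {..<n}))"
    proof
      fix \<beta> assume "\<beta> \<in> F"
      then have "vec_nth \<beta> \<in> PiE UNIV (\<lambda>_. {..<n})" using n by auto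
      then show "\<beta> \<in> vec_lambda ` (PiE UNIV (\<lambda>_. {..<n}))"
        by (metis image_eqI vec_nth_inverse)
    qed
    have "sum ?h F \<le> sum ?h (vec_lambda ` (PiE UNIV (\<lambda>_. {..<n})))"
      by (rule sum_mono2) (use sub in \<open>auto intro!: finite_imageI finite_PiE\<close>)
    also have "\<dots> = (\<Sum>g\<in>PiE UNIV (\<lambda>_. {..<n}). \<Prod>j\<in>UNIV. norm (f j (g j)))"
      by (subst sum.reindex) (auto simp: inj_on_def vec_lambda_inject prod_norm)
    also have "\<dots> = (\<Prod>j\<in>UNIV. \<Sum>k<n. norm (f j k))"
      by (subst prod_sum_PiE) auto
    also have "\<dots> \<le> (\<Prod>j\<in>UNIV. \<Sum>\<^sub>\<infinity>k. norm (f j k))"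
      by (intro prod_mono conjI sum_nonneg finite_sum_le_infsum) (use assms in auto)
    finally show "sum ?h F \<le> (\<Prod>j\<in>UNIV. \<Sum>\<^sub>\<infinity>k. norm (f j k))" .
  qed
qed auto

lemma has_sum_prod_vec:
  fixes f :: "'d::finite \<Rightarrow> nat \<Rightarrow> complex"
  assumes "\<And>j. (\<lambda>k. norm (f j k)) summable_on UNIV"
  shows "((\<lambda>\<beta>::nat ^ 'd. \<Prod>j\<in>UNIV. f j (\<beta> $ j)) has_sum (\<Prod>j\<in>UNIV. infsum (f j) UNIV)) UNIV"
proof -
  let ?h = "\<lambda>\<beta>::nat ^ 'd. \<Prod>j\<in>UNIV. f j (\<beta> $ j)"
  have "infsum (\<lambda>g. \<Prod>x\<in>UNIV. f x (g x)) (PiE UNIV (\<lambda>_. UNIV)) = (\<Prod>x\<in>UNIV. infsum (f x) UNIV)"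
    by (rule infsum_prod_PiE_abs) (use assms in auto)
  moreover have "infsum ?h UNIV = infsum (\<lambda>g. ?h (vec_lambda g)) UNIV"
    by (rule infsum_reindex_bij_betw[symmetric])
      (rule bij_betw_byWitness[where f'=vec_nth], auto simp: vec_lambda_inverse)
  ultimately have eq: "infsum ?h UNIV = (\<Prod>j\<in>UNIV. infsum (f j) UNIV)" by simp
  have "?h summable_on UNIV"
    using summable_prod_vec[OF assms] by (rule abs_summable_summable)
  then have "(?h has_sum infsum ?h UNIV) UNIV" by (rule has_sum_infsum)
  then show ?thesis unfolding eq .
qed

abbreviation M01 :: "real measure" where "M01 \<equiv> restrict_space lborel {0..1}"
abbreviation e2pi :: "real \<Rightarrow> complex" where "e2pi t \<equiv> exp (2 * of_real pi * \<i> * of_real t)"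

lemma emeasure_M01: "emeasure M01 (space M01) = 1"
  by (simp add: emeasure_restrict_space space_restrict_space)

interpretation M01: finite_measure M01
  by (rule finite_measureI) (use emeasure_M01 in simp)

interpretation PM01: product_sigma_finite "\<lambda>_. M01"
  by (simp add: product_sigma_finite_def M01.sigma_finite_measure_axioms)

lemma finite_measure_PiM_M01: "finite I \<Longrightarrow> finite_measure (PiM I (\<lambda>_. M01))"
proof (rule finite_measureI)
  assume "finite I"
  have "emeasure (PiM I (\<lambda>_. M01)) (space (PiM I (\<lambda>_. M01))) = (\<Prod>i\<in>I. emeasure M01 (space M01))"
    unfolding space_PiM by (rule PM01.emeasure_PiM) (use \<open>finite I\<close> in blast)+
  then show "emeasure (PiM I (\<lambda>_. M01)) (space (PiM I (\<lambda>_. M01))) \<noteq> \<infinity>"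
    unfolding emeasure_M01 by (metis infinity_ennreal_def ennreal_one_neq_top prod.neutral_const)
qed

lemma norm_e2pi [simp]: "norm (e2pi t) = 1" by (simp add: norm_exp_eq_Re)

text \<open>Cauchy's integral formula on a circle, written as an average over a probability space: products
  of copies of this space then serve for several variables.\<close>

lemma Cauchy_average:
  assumes r: "r > 0" and c: "continuous_on (cball 0 r) f" and h: "f holomorphic_on ball 0 r" and w: "norm w < r"
  shows "f w = (LINT t|M01. f (of_real r * e2pi t) * (1 / (1 - w / (of_real r * e2pi t))))"
proof -
  let ?g = "\<lambda>t. f (of_real r * e2pi t) * (1 / (1 - w / (of_real r * e2pi t)))"
  have ne: "of_real r * e2pi t \<noteq> 0" "of_real r * e2pi t \<noteq> w" for t
  proof -
    have "norm (of_real r * e2pi t) = r" using r by (simp add: norm_mult)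
    then show "of_real r * e2pi t \<noteq> 0" "of_real r * e2pi t \<noteq> w" using r w by auto
  qed
  have "((\<lambda>u. f u/(u-w)) has_contour_integral (2 * of_real pi * \<i> * f w)) (circlepath 0 r)"
    using Cauchy_integral_circlepath[OF c h, of w] w by simp
  then have "2 * of_real pi * \<i> * f w = contour_integral (circlepath 0 r) (\<lambda>u. f u/(u-w))"
    by (simp add: contour_integral_unique)
  also have "\<dots> = integral {0..1} (\<lambda>t. f (circlepath 0 r t) / (circlepath 0 r t - w) * (2 * of_real pi * \<i> * r * e2pi t))"
    by (simp add: contour_integral_integral vector_derivative_circlepath)
  also have "\<dots> = integral {0..1} (\<lambda>t. 2 * of_real pi * \<i> * ?g t)"
    using ne r by (intro arg_cong[of _ _ "integral {0..1}"] ext) (simp add: circlepath divide_simps)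
  also have "\<dots> = 2 * of_real pi * \<i> * integral {0..1} ?g"
    by (rule integral_mult_right)
  finally have eq: "f w = integral {0..1} ?g" by simp
  have "continuous_on {0..1} ?g"
  proof -
    have "continuous_on {0..1} (\<lambda>t. f (of_real r * e2pi t))"
      by (rule continuous_on_compose2[OF c]) (use r in \<open>auto intro!: continuous_intros simp: norm_mult\<close>)
    moreover have "1 - w / (of_real r * e2pi t) \<noteq> 0" for t using ne[of t] by (simp add: divide_simps)
    ultimately show ?thesis using ne by (intro continuous_intros) auto
  qed
  then have "set_integrable lborel {0..1} ?g"
    by (intro borel_integrable_compact[unfolded set_integrable_def[symmetric]] | simp add: set_integrable_def borel_integrable_compact)+
  then show ?thesis unfolding eq
    using set_borel_integral_eq_integral(2)[of "{0..1}" ?g]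
    by (simp add: integral_restrict_space set_lebesgue_integral_def)
qed

text \<open>The point whose coordinates in \<open>S\<close> have been moved to the circle of radius \<open>r\<close>; induction over
  \<open>S\<close> replaces one coordinate after the other.\<close>

definition torus_pt :: "real \<Rightarrow> 'd set \<Rightarrow> complex ^ 'd \<Rightarrow> ('d \<Rightarrow> real) \<Rightarrow> complex ^ 'd"
  where "torus_pt r S z t = (\<chi> j. if j \<in> S then of_real r * e2pi (t j) else z $ j)"

definition polydisc :: "real \<Rightarrow> (complex ^ 'd) set"
  where "polydisc r = {z. \<forall>j. norm (z $ j) \<le> r}"

lemma compact_polydisc: "compact (polydisc r :: (complex ^ 'd::finite) set)"
proof -
  have "closed (polydisc r :: (complex ^ 'd) set)"
    unfolding polydisc_def by (intro closed_Collect_all closed_Collect_le continuous_intros)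
  moreover have "bounded (polydisc r :: (complex ^ 'd) set)"
  proof (rule boundedI)
    fix z :: "complex ^ 'd" assume "z \<in> polydisc r"
    then have "(\<Sum>j\<in>UNIV. norm (z $ j)) \<le> (\<Sum>j\<in>(UNIV::'d set). r)"
      by (intro sum_mono) (auto simp: polydisc_def)
    then show "norm z \<le> (\<Sum>j\<in>(UNIV::'d set). r)" 
      using L2_set_le_sum[of UNIV "\<lambda>j. norm (z $ j)"] by (simp add: norm_vec_def)
  qed
  ultimately show ?thesis by (simp add: compact_eq_bounded_closed)
qed

lemma torus_pt_measurable [measurable]:
  fixes z :: "complex ^ 'd::finite"
  shows "torus_pt r S z \<in> borel_measurable (PiM S (\<lambda>_. M01))"
proof (subst borel_measurable_euclidean_space, rule ballI)
  fix i :: "complex ^ 'd" assume "i \<in> Basis"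
  then obtain j b where i: "i = axis j b" by (auto simp: Basis_vec_def)
  have m: "(\<lambda>t. t j) \<in> borel_measurable (PiM S (\<lambda>_. M01))" if "j \<in> S"
    using measurable_component_singleton[OF that, of "\<lambda>_. M01"]
      measurable_restrict_space2_iff[of "\<lambda>t. t j" "PiM S (\<lambda>_. M01)" lborel "{0..1}"] by simp
  show "(\<lambda>t. torus_pt r S z t \<bullet> i) \<in> borel_measurable (PiM S (\<lambda>_. M01))"
  proof (cases "j \<in> S")
    case True
    note m[OF True, measurable]
    have "(\<lambda>t. (of_real r * e2pi (t j)) \<bullet> b) \<in> borel_measurable (PiM S (\<lambda>_. M01))"
      by measurable
    then show ?thesis using True by (simp add: i inner_axis torus_pt_def)
  next
    case False
    then show ?thesis by (simp add: i inner_axis torus_pt_def)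
  qed
qed

lemma torus_pt_in_polydisc: "r > 0 \<Longrightarrow> z \<in> polydisc r \<Longrightarrow> torus_pt r S z t \<in> polydisc r"
  by (auto simp: torus_pt_def polydisc_def norm_mult)

lemma integrable_torus_pt:
  fixes F :: "complex ^ 'd::finite \<Rightarrow> complex"
  assumes r: "r > 0" and c: "continuous_on (polydisc r) F" and z: "z \<in> polydisc r"
    and g [measurable]: "g \<in> borel_measurable (PiM S (\<lambda>_. M01))" and b: "\<And>t. norm (g t) \<le> B"
  shows "integrable (PiM S (\<lambda>_. M01)) (\<lambda>t. F (torus_pt r S z t) * g t)"
proof -
  interpret finite_measure "PiM S (\<lambda>_. M01)" by (rule finite_measure_PiM_M01) simp
  have [measurable]: "(\<lambda>x. indicator (polydisc r) x *\<^sub>R F x) \<in> borel_measurable borel"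
    by (rule borel_measurable_continuous_on_indicator[OF _ c]) (simp add: compact_polydisc borel_compact)
  have "(\<lambda>t. indicator (polydisc r) (torus_pt r S z t) *\<^sub>R F (torus_pt r S z t) * g t) \<in> borel_measurable (PiM S (\<lambda>_. M01))"
    by (intro borel_measurable_times g measurable_compose[OF torus_pt_measurable \<open>(\<lambda>x. indicator (polydisc r) x *\<^sub>R F x) \<in> _\<close>])
  then have m: "(\<lambda>t. F (torus_pt r S z t) * g t) \<in> borel_measurable (PiM S (\<lambda>_. M01))"
    using torus_pt_in_polydisc[OF r z] by simp
  have "bounded (F ` polydisc r)" 
    using compact_continuous_image[OF c compact_polydisc] compact_imp_bounded by blast
  then obtain C where C: "\<And>x. x \<in> polydisc r \<Longrightarrow> norm (F x) \<le> C"
    unfolding bounded_iff by auto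
  show ?thesis
  proof (rule integrable_const_bound[where B="C * B", OF _ m], rule AE_I2)
    fix t
    show "norm (F (torus_pt r S z t) * g t) \<le> C * B"
      unfolding norm_mult
    proof (rule mult_mono)
      show 1: "norm (F (torus_pt r S z t)) \<le> C" using C[OF torus_pt_in_polydisc[OF r z]] .
      show "norm (g t) \<le> B" by (rule b)
      show "0 \<le> C" using 1 norm_ge_zero order_trans by metis
    qed simp
  qed
qed

lemma kernel_bound:
  assumes "r > 0" "norm w < r"
  shows "norm (1 / (1 - w / (of_real r * e2pi t))) \<le> 1 / (1 - norm w / r)"
proof -
  have "1 - norm w / r \<le> norm (1 - w / (of_real r * e2pi t))"
    using norm_triangle_ineq2[of 1 "w / (of_real r * e2pi t)"] assms by (simp add: norm_mult norm_divide)
  moreover have "1 - norm w / r > 0" using assms by simp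
  ultimately show ?thesis by (simp add: norm_divide frac_le)
qed

text \<open>One coordinate at a time: the one-dimensional formula applies in the new coordinate while the
  others stay fixed, and Fubini for finite product measures combines the averages.\<close>

theorem Cauchy_polydisc:
  fixes F :: "complex ^ 'd::finite \<Rightarrow> complex"
  assumes r: "r > 0" and c: "continuous_on (polydisc r) F"
    and h: "\<And>z i. z \<in> polydisc r \<Longrightarrow> (\<lambda>w. F (\<chi> k. if k = i then w else z $ k)) holomorphic_on ball 0 r"
    and z: "\<And>j. norm (z $ j) < r"
  shows "F z = (LINT t|PiM S (\<lambda>_. M01). F (torus_pt r S z t) * (\<Prod>j\<in>S. 1 / (1 - z $ j / (of_real r * e2pi (t j)))))"
proof (induction S rule: finite_induct[OF finite])
  case 1
  then show ?case
    by (simp add: torus_pt_def PiM_empty lebesgue_integral_count_space_finite)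
next
  case (2 i S)
  have zp: "z \<in> polydisc r" using z less_imp_le by (auto simp: polydisc_def)
  let ?K = "\<lambda>S t. \<Prod>j\<in>S. 1 / (1 - z $ j / (of_real r * e2pi (t j)))"
  have mK: "?K S \<in> borel_measurable (PiM S (\<lambda>_. M01))" for S
  proof (rule borel_measurable_prod)
    fix j assume "j \<in> S"
    then have [measurable]: "(\<lambda>t. t j) \<in> borel_measurable (PiM S (\<lambda>_. M01))"
      using measurable_component_singleton[of j S "\<lambda>_. M01"]
      measurable_restrict_space2_iff[of "\<lambda>t. t j" "PiM S (\<lambda>_. M01)" lborel "{0..1}"] by simp
    show "(\<lambda>t. 1 / (1 - z $ j / (of_real r * e2pi (t j)))) \<in> borel_measurable (PiM S (\<lambda>_. M01))"
      by measurable
  qed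
  have bK: "norm (?K S t) \<le> (\<Prod>j\<in>S. 1 / (1 - norm (z $ j) / r))" for S t
    unfolding prod_norm[symmetric] by (intro prod_mono conjI norm_ge_zero kernel_bound r z)
  have "integrable (PiM (insert i S) (\<lambda>_. M01)) (\<lambda>t. F (torus_pt r (insert i S) z t) * ?K (insert i S) t)"
    by (rule integrable_torus_pt[OF r c zp mK bK])
  then have "(LINT t|PiM (insert i S) (\<lambda>_. M01). F (torus_pt r (insert i S) z t) * ?K (insert i S) t)
    = (LINT t|PiM S (\<lambda>_. M01). LINT y|M01. F (torus_pt r (insert i S) z (t(i:=y))) * ?K (insert i S) (t(i:=y)))"
    by (rule PM01.product_integral_insert[OF 2(1,2)])
  also have "\<dots> = (LINT t|PiM S (\<lambda>_. M01). F (torus_pt r S z t) * ?K S t)"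
  proof (rule Bochner_Integration.integral_cong[OF refl])
    fix t
    let ?p = "torus_pt r S z t"
    let ?f = "\<lambda>w. F (\<chi> k. if k = i then w else ?p $ k)"
    have pp: "?p \<in> polydisc r" by (rule torus_pt_in_polydisc[OF r zp])
    have cf: "continuous_on (cball 0 r) ?f"
    proof (rule continuous_on_compose2[OF c])
      show "continuous_on (cball 0 r) (\<lambda>w. \<chi> k. if k = i then w else ?p $ k)"
      proof (rule continuous_on_vec_lambda)
        show "continuous_on (cball 0 r) (\<lambda>w. if k = i then w else ?p $ k)" for k
          by (cases "k = i") auto
      qed
      show "(\<lambda>w. \<chi> k. if k = i then w else ?p $ k) ` cball 0 r \<subseteq> polydisc r"
        using pp by (auto simp: polydisc_def)
    qed
    have KS: "?K S (t(i:=y)) = ?K S t" for y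
      using 2(2) by (intro prod.cong refl) auto
    have Ki: "?K (insert i S) (t(i:=y)) = 1 / (1 - z $ i / (of_real r * e2pi y)) * ?K S t" for y
      by (subst prod.insert[OF 2(1,2)], subst KS) simp
    have tp: "torus_pt r (insert i S) z (t(i:=y)) = (\<chi> k. if k = i then of_real r * e2pi y else ?p $ k)" for y
      using 2(2) by (auto simp: torus_pt_def vec_eq_iff)
    have "(LINT y|M01. F (torus_pt r (insert i S) z (t(i:=y))) * ?K (insert i S) (t(i:=y)))
      = (LINT y|M01. (?f (of_real r * e2pi y) * (1 / (1 - z $ i / (of_real r * e2pi y)))) * ?K S t)"
      unfolding Ki tp by (simp add: mult.assoc)
    also have "\<dots> = (LINT y|M01. ?f (of_real r * e2pi y) * (1 / (1 - z $ i / (of_real r * e2pi y)))) * ?K S t"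
      by (rule integral_mult_left_zero)
    also have "\<dots> = ?f (z $ i) * ?K S t"
      using Cauchy_average[OF r cf h[OF pp] z] by simp
    also have "(\<chi> k. if k = i then z $ i else ?p $ k) = ?p"
      using 2(2) by (auto simp: torus_pt_def vec_eq_iff)
    finally show "(LINT y|M01. F (torus_pt r (insert i S) z (t(i:=y))) * ?K (insert i S) (t(i:=y))) = F ?p * ?K S t" .
  qed
  also have "\<dots> = F z" using 2(3) by simp
  finally show ?case by simp
qed

lemma integral_norm_bound_integral_any:
  fixes f :: "'a \<Rightarrow> complex"
  assumes "integrable M f" "integrable M g" "\<And>x. x \<in> space M \<Longrightarrow> norm (f x) \<le> g x"
  shows "norm (integral\<^sup>L M f) \<le> integral\<^sup>L M g"
  by (rule order_trans[OF integral_norm_bound integral_mono]) (use assms in auto)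

text \<open>The Cauchy kernel is a product of geometric series, hence a power series that converges
  uniformly on the torus; integrating it term by term gives the coefficients.\<close>

theorem power_series_polydisc:
  fixes F :: "complex ^ 'd::finite \<Rightarrow> complex"
  assumes r: "r > 0" and c: "continuous_on (polydisc r) F"
    and h: "\<And>z i. z \<in> polydisc r \<Longrightarrow> (\<lambda>w. F (\<chi> k. if k = i then w else z $ k)) holomorphic_on ball 0 r"
  shows "\<exists>b. \<forall>z. (\<forall>j. norm (z $ j) < r) \<longrightarrow> ((\<lambda>\<beta>. b \<beta> * monomial z \<beta>) has_sum F z) UNIV"
proof -
  let ?M = "PiM (UNIV::'d set) (\<lambda>_. M01)"
  interpret finite_measure ?M by (rule finite_measure_PiM_M01) simp
  let ?T = "torus_pt r UNIV 0"
  define b where "b \<beta> = (LINT t|?M. F (?T t) * (\<Prod>j\<in>UNIV. (1 / (of_real r * e2pi (t j))) ^ (\<beta> $ j)))" for \<beta> :: "nat ^ 'd"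
  have T: "torus_pt r UNIV z = ?T" for z by (simp add: torus_pt_def fun_eq_iff)
  have 0: "(0 :: complex ^ 'd) \<in> polydisc r" using r by (simp add: polydisc_def)
  have m1 [measurable]: "(\<lambda>t. t j) \<in> borel_measurable ?M" for j
    using measurable_component_singleton[of j UNIV "\<lambda>_. M01"]
      measurable_restrict_space2_iff[of "\<lambda>t. t j" ?M lborel "{0..1}"] by simp
  have "bounded (F ` polydisc r)" 
    using compact_continuous_image[OF c compact_polydisc] compact_imp_bounded by blast
  then obtain C where C: "\<And>x. x \<in> polydisc r \<Longrightarrow> norm (F x) \<le> C"
    unfolding bounded_iff by auto
  have "((\<lambda>\<beta>. b \<beta> * monomial z \<beta>) has_sum F z) UNIV" if z: "\<And>j. norm (z $ j) < r" for z
  proof -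
    define u where "u t j = z $ j / (of_real r * e2pi (t j))" for t j
    define q where "q j = norm (z $ j) / r" for j
    have q: "0 \<le> q j" "q j < 1" for j using z r by (auto simp: q_def)
    have nu: "norm (u t j) = q j" for t j using r by (simp add: u_def q_def norm_divide norm_mult)
    have geo: "(\<lambda>k. norm (x ^ k)) summable_on UNIV" "infsum (\<lambda>k. x ^ k) UNIV = 1 / (1 - x)" if "norm x < 1" for x :: complex
    proof -
      have "summable (\<lambda>k. norm (x ^ k))" using that by (simp add: norm_power)
      then show s: "(\<lambda>k. norm (x ^ k)) summable_on UNIV"
        by (subst summable_on_UNIV_nonneg_real_iff) auto
      have "((\<lambda>k. x ^ k) has_sum (1 / (1 - x))) UNIV"
        using geometric_sums[OF that] s norm_summable_imp_has_sum \<open>summable (\<lambda>k. norm (x ^ k))\<close> by blast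
      then show "infsum (\<lambda>k. x ^ k) UNIV = 1 / (1 - x)" by (rule infsumI)
    qed
    have hs: "((\<lambda>\<beta>::nat ^ 'd. \<Prod>j\<in>UNIV. u t j ^ (\<beta> $ j)) has_sum (\<Prod>j\<in>UNIV. 1 / (1 - u t j))) UNIV" for t
      using has_sum_prod_vec[of "\<lambda>j k. u t j ^ k"] geo[of "u t _"] nu q by simp
    have sq: "(\<lambda>\<beta>::nat ^ 'd. C * (\<Prod>j\<in>UNIV. q j ^ (\<beta> $ j))) summable_on UNIV"
    proof -
      have "(\<lambda>\<beta>::nat ^ 'd. norm (\<Prod>j\<in>UNIV. (complex_of_real (q j)) ^ (\<beta> $ j))) summable_on UNIV"
        by (rule summable_prod_vec[of "\<lambda>j k. complex_of_real (q j) ^ k"]) (use geo q in auto)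
      then show ?thesis using q by (intro summable_on_cmult_right) (simp add: norm_power flip: prod_norm)
    qed
    have bT: "norm (F (?T t)) \<le> C" for t using C torus_pt_in_polydisc[OF r 0] by blast
    have ul: "uniform_limit UNIV (\<lambda>X t. \<Sum>\<beta>\<in>X. F (?T t) * (\<Prod>j\<in>UNIV. u t j ^ (\<beta> $ j)))
       (\<lambda>t. F (?T t) * (\<Prod>j\<in>UNIV. 1 / (1 - u t j))) (finite_subsets_at_top UNIV)"
    proof (rule Weierstrass_m_test_general'[OF _ _ sq])
      fix \<beta> :: "nat ^ 'd" and t
      have "norm (\<Prod>j\<in>UNIV. u t j ^ (\<beta> $ j)) = (\<Prod>j\<in>UNIV. q j ^ (\<beta> $ j))"
        by (simp add: norm_power nu flip: prod_norm)
      then show "norm (F (?T t) * (\<Prod>j\<in>UNIV. u t j ^ (\<beta> $ j))) \<le> C * (\<Prod>j\<in>UNIV. q j ^ (\<beta> $ j))"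
        using bT q by (simp add: norm_mult mult_right_mono prod_nonneg)
    next
      fix t show "((\<lambda>\<beta>::nat ^ 'd. F (?T t) * (\<Prod>j\<in>UNIV. u t j ^ (\<beta> $ j))) has_sum F (?T t) * (\<Prod>j\<in>UNIV. 1 / (1 - u t j))) UNIV"
        by (rule has_sum_cmult_right[OF hs])
    qed
    have term_int: "integrable ?M (\<lambda>t. F (?T t) * (\<Prod>j\<in>UNIV. u t j ^ (\<beta> $ j)))" for \<beta> :: "nat ^ 'd"
    proof (rule integrable_torus_pt[OF r c 0])
      show "(\<lambda>t. \<Prod>j\<in>UNIV. u t j ^ (\<beta> $ j)) \<in> borel_measurable ?M"
        unfolding u_def by measurable
      show "norm (\<Prod>j\<in>UNIV. u t j ^ (\<beta> $ j)) \<le> (\<Prod>j\<in>UNIV. q j ^ (\<beta> $ j))" for t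
        by (simp add: norm_power nu flip: prod_norm)
    qed
    have term_eq: "(LINT t|?M. F (?T t) * (\<Prod>j\<in>UNIV. u t j ^ (\<beta> $ j))) = b \<beta> * monomial z \<beta>" for \<beta>
    proof -
      have "F (?T t) * (\<Prod>j\<in>UNIV. u t j ^ (\<beta> $ j)) =
        (F (?T t) * (\<Prod>j\<in>UNIV. (1 / (of_real r * e2pi (t j))) ^ (\<beta> $ j))) * monomial z \<beta>" for t
        by (simp add: u_def monomial_def power_divide prod_dividef)
      then show ?thesis unfolding b_def by (simp only: integral_mult_left_zero)
    qed
    have lim_int: "integrable ?M (\<lambda>t. F (?T t) * (\<Prod>j\<in>UNIV. 1 / (1 - u t j)))"
    proof (rule integrable_torus_pt[OF r c 0])
      show "(\<lambda>t. \<Prod>j\<in>UNIV. 1 / (1 - u t j)) \<in> borel_measurable ?M"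
        unfolding u_def by measurable
      show "norm (\<Prod>j\<in>UNIV. 1 / (1 - u t j)) \<le> (\<Prod>j\<in>UNIV. 1 / (1 - norm (z $ j) / r))" for t
        unfolding prod_norm[symmetric] u_def by (intro prod_mono conjI norm_ge_zero kernel_bound r z)
    qed
    have Fz: "F z = (LINT t|?M. F (?T t) * (\<Prod>j\<in>UNIV. 1 / (1 - u t j)))"
      using Cauchy_polydisc[OF r c h z, of UNIV] unfolding T[of z] u_def by blast
    show ?thesis unfolding has_sum_def
    proof (rule tendstoI)
      fix e :: real assume e: "e > 0"
      have zero_le_measure_M: "0 \<le> measure ?M (space ?M)" by (rule measure_nonneg)
      define K where "K = measure ?M (space ?M) + 1"
      have K: "K > 0" unfolding K_def using zero_le_measure_M by linarith
      have "\<forall>\<^sub>F X in finite_subsets_at_top UNIV. \<forall>t\<in>UNIV. dist (\<Sum>\<beta>\<in>X. F (?T t) * (\<Prod>j\<in>UNIV. u t j ^ (\<beta> $ j))) (F (?T t) * (\<Prod>j\<in>UNIV. 1 / (1 - u t j))) < e / K"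
        using uniform_limitD[OF ul, of "e / K"] e K by simp
      then show "\<forall>\<^sub>F X in finite_subsets_at_top UNIV. dist (\<Sum>\<beta>\<in>X. b \<beta> * monomial z \<beta>) (F z) < e"
      proof (rule eventually_mono)
        fix X :: "(nat ^ 'd) set"
        let ?d = "\<lambda>t. (\<Sum>\<beta>\<in>X. F (?T t) * (\<Prod>j\<in>UNIV. u t j ^ (\<beta> $ j))) - F (?T t) * (\<Prod>j\<in>UNIV. 1 / (1 - u t j))"
        assume "\<forall>t\<in>UNIV. dist (\<Sum>\<beta>\<in>X. F (?T t) * (\<Prod>j\<in>UNIV. u t j ^ (\<beta> $ j))) (F (?T t) * (\<Prod>j\<in>UNIV. 1 / (1 - u t j))) < e / K"
        then have d: "norm (?d t) \<le> e / K" for t by (simp add: dist_norm less_imp_le)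
        have "(\<Sum>\<beta>\<in>X. b \<beta> * monomial z \<beta>) - F z = (LINT t|?M. ?d t)"
          unfolding Fz using term_int lim_int by (simp add: term_eq Bochner_Integration.integral_sum)
        also have "norm \<dots> \<le> (LINT t|?M. e / K)"
          by (rule integral_norm_bound_integral_any)
            (use term_int lim_int d in \<open>auto intro!: Bochner_Integration.integrable_diff Bochner_Integration.integrable_sum\<close>)
        also have "\<dots> = e / K * measure ?M (space ?M)" by simp
        also have "\<dots> < e / K * K" using e K by (intro mult_strict_left_mono) (auto simp: K_def)
        also have "\<dots> = e" using K by simp
        finally show "dist (\<Sum>\<beta>\<in>X. b \<beta> * monomial z \<beta>) (F z) < e" by (simp add: dist_norm)
      qed
    qed
  qed
  then show ?thesis by blast
qed

corollary power_series_cdiff: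
  fixes F :: "complex ^ 'd::finite \<Rightarrow> complex"
  assumes "\<rho> > 0" "\<And>z. norm z < \<rho> \<Longrightarrow> cdiff F z"
  shows "\<exists>r>0. \<exists>b. \<forall>z. (\<forall>j. norm (z $ j) < r) \<longrightarrow> ((\<lambda>\<beta>. b \<beta> * monomial z \<beta>) has_sum F z) UNIV"
proof -
  define r where "r = \<rho> / (real CARD('d) + 1)"
  have r: "r > 0" using assms by (simp add: r_def)
  have in_ball: "norm z < \<rho>" if "z \<in> polydisc r" for z :: "complex ^ 'd"
  proof -
    have "norm z \<le> (\<Sum>j\<in>UNIV. norm (z $ j))"
      using L2_set_le_sum[of UNIV "\<lambda>j. norm (z $ j)"] by (simp add: norm_vec_def)
    also have "\<dots> \<le> (\<Sum>j\<in>(UNIV::'d set). r)"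
      using that by (intro sum_mono) (auto simp: polydisc_def)
    also have "\<dots> = real CARD('d) * r" by simp
    also have "\<dots> < (real CARD('d) + 1) * r" using r by (simp add: algebra_simps)
    also have "\<dots> = \<rho>" by (simp add: r_def)
    finally show ?thesis .
  qed
  have "\<exists>b. \<forall>z. (\<forall>j. norm (z $ j) < r) \<longrightarrow> ((\<lambda>\<beta>. b \<beta> * monomial z \<beta>) has_sum F z) UNIV"
  proof (rule power_series_polydisc[OF r])
    show "continuous_on (polydisc r) F"
      by (rule continuous_at_imp_continuous_on) (simp add: cdiff_isCont[OF assms(2)[OF in_ball]])
    fix z :: "complex ^ 'd" and i assume z: "z \<in> polydisc r"
    show "(\<lambda>w. F (\<chi> k. if k = i then w else z $ k)) holomorphic_on ball 0 r"
    proof (rule holomorphic_onI)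
      fix w :: complex assume w: "w \<in> ball 0 r"
      define z0 :: "complex ^ 'd" where "z0 = (\<chi> k. if k = i then 0 else z $ k)"
      have eq: "(\<chi> k. if k = i then w else z $ k) = z0 + w *s axis i 1" for w
        by (auto simp: z0_def vec_eq_iff axis_def)
      have "z0 + w *s axis i 1 \<in> polydisc r"
        using z w unfolding eq[symmetric] by (auto simp: polydisc_def)
      then have "cdiff F (z0 + w *s axis i 1)" by (rule assms(2)[OF in_ball])
      from has_field_derivative_at_within[OF cdiff_line[OF this]]
      have "(\<lambda>w. F (z0 + w *s axis i 1)) field_differentiable at w within ball 0 r"
        unfolding field_differentiable_def by blast
      then show "(\<lambda>w. F (\<chi> k. if k = i then w else z $ k)) field_differentiable at w within ball 0 r"
        by (simp only: eq)
    qed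
  qed
  then show ?thesis using r by blast
qed

section \<open>Evaluation of polynomials\<close>

lemma monomial_add: "monomial z (\<alpha> + \<beta>) = monomial z \<alpha> * monomial z \<beta>"
  for z :: "complex ^ 'd::finite"
  by (simp add: monomial_def power_add prod.distrib)

lemma monomial_0 [simp]: "monomial z 0 = 1"
  for z :: "complex ^ 'd::finite"
  by (simp add: monomial_def)

lemma eval_poly_superset:
  assumes "finite S" "Poly_Mapping.keys p \<subseteq> S"
  shows "eval_poly p z = (\<Sum>\<beta>\<in>S. Poly_Mapping.lookup p \<beta> * monomial z \<beta>)"
  unfolding eval_poly_def
  by (rule sum.mono_neutral_left) (use assms in \<open>auto simp: in_keys_iff\<close>)

lemma eval_poly_add [simp]: "eval_poly (p + q) z = eval_poly p z + eval_poly q z"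
proof -
  let ?S = "Poly_Mapping.keys p \<union> Poly_Mapping.keys q"
  have "eval_poly (p + q) z = (\<Sum>\<beta>\<in>?S. Poly_Mapping.lookup (p + q) \<beta> * monomial z \<beta>)"
    by (rule eval_poly_superset) (use Poly_Mapping.keys_add[of p q] in auto)
  also have "\<dots> = eval_poly p z + eval_poly q z"
    by (simp add: lookup_add ring_distribs sum.distrib
        eval_poly_superset[of ?S p z] eval_poly_superset[of ?S q z])
  finally show ?thesis .
qed

lemma eval_poly_0 [simp]: "eval_poly 0 z = 0" by (simp add: eval_poly_def)

lemma eval_poly_single [simp]: "eval_poly (Poly_Mapping.single \<beta> c) z = c * monomial z \<beta>"
  by (cases "c = 0") (simp_all add: eval_poly_def)

lemma eval_poly_sum [simp]: "eval_poly (\<Sum>i\<in>I. p i) z = (\<Sum>i\<in>I. eval_poly (p i) z)"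
  by (induction I rule: infinite_finite_induct) auto

lemma sum_of_singles:
  fixes p :: "'d::finite cpoly"
  shows "p = (\<Sum>\<beta>\<in>Poly_Mapping.keys p. Poly_Mapping.single \<beta> (Poly_Mapping.lookup p \<beta>))"
  by (rule poly_mapping_eqI) (auto simp: lookup_sum lookup_single when_def in_keys_iff)

lemma eval_poly_mult [simp]: "eval_poly (p * q) z = eval_poly p z * eval_poly q z"
proof -
  have "p * q = (\<Sum>\<alpha>\<in>Poly_Mapping.keys p. \<Sum>\<beta>\<in>Poly_Mapping.keys q.
      Poly_Mapping.single (\<alpha> + \<beta>) (Poly_Mapping.lookup p \<alpha> * Poly_Mapping.lookup q \<beta>))"
    by (subst (1) sum_of_singles[of p], subst (1) sum_of_singles[of q])
       (simp add: sum_product mult_single)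
  then show ?thesis
    by (simp add: eval_poly_def[of p] eval_poly_def[of q] sum_product monomial_add mult_ac)
qed

lemma eval_poly_const [simp]: "eval_poly (const_poly c) z = c"
  by (simp add: const_poly_def)

lemma eval_poly_1 [simp]: "eval_poly 1 z = 1"
  by (simp flip: single_one)

lemma eval_poly_power [simp]: "eval_poly (p ^ n) z = eval_poly p z ^ n"
  by (induction n) auto

lemma eval_poly_prod [simp]: "eval_poly (\<Prod>i\<in>I. p i) z = (\<Prod>i\<in>I. eval_poly (p i) z)"
  by (induction I rule: infinite_finite_induct) auto

lemma eval_poly_var [simp]: "eval_poly (var_poly j) z = z $ j"
proof -
  have "monomial z (axis j 1) = (\<Prod>i\<in>UNIV. if i = j then z $ i else 1)"
    unfolding monomial_def by (rule prod.cong) (auto simp: axis_def)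
  then show ?thesis by (simp add: var_poly_def)
qed

lemma eval_lin_subst: "eval_poly (lin_subst B p) z = eval_poly p (cplx_mat B *v z)"
  by (simp add: lin_subst_def eval_poly_def[of p] monomial_def cplx_mat_def matrix_vector_mult_def)

lemma cdiff_eval_poly [intro]: "cdiff (eval_poly p) z"
  unfolding eval_poly_def[abs_def] monomial_def by (intro cdiff_sum cdiff_mult cdiff_const cdiff_prod cdiff_power cdiff_component)

lemma continuous_on_eval_poly [continuous_intros]:
  "continuous_on S f \<Longrightarrow> continuous_on S (\<lambda>x. eval_poly p (f x))"
  unfolding eval_poly_def monomial_def by (intro continuous_intros)

section \<open>Real and complex vectors and matrices\<close>

lemma cplx_vec_nth [simp]: "cplx_vec x $ j = complex_of_real (x $ j)"
  by (simp add: cplx_vec_def)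

lemma cplx_mat_vec: "cplx_mat A *v cplx_vec x = cplx_vec (A *v x)"
  by (simp add: cplx_mat_def cplx_vec_def matrix_vector_mult_def vec_eq_iff)

lemma cplx_mat_mult: "cplx_mat (A ** B) = cplx_mat A ** cplx_mat B"
  by (simp add: cplx_mat_def matrix_matrix_mult_def vec_eq_iff)

lemma cplx_mat_one: "cplx_mat (mat 1) = mat 1"
  by (simp add: cplx_mat_def mat_def vec_eq_iff)

lemma matrix_inv_mult:
  fixes A :: "real ^ 'd::finite ^ 'd"
  assumes "invertible A"
  shows "matrix_inv A ** A = mat 1" "A ** matrix_inv A = mat 1"
  using someI_ex[OF assms[unfolded invertible_def]] unfolding matrix_inv_def by auto

lemma cplx_mat_inv_vec:
  fixes A :: "real ^ 'd::finite ^ 'd"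
  assumes "invertible A"
  shows "cplx_mat A *v (cplx_mat (matrix_inv A) *v z) = z" "cplx_mat (matrix_inv A) *v (cplx_mat A *v z) = z"
  using matrix_inv_mult[OF assms]
  by (simp_all add: matrix_vector_mul_assoc matrix_vector_mul_lid flip: cplx_mat_mult cplx_mat_one)
     (simp_all add: cplx_mat_one matrix_vector_mul_lid)

lemma cplx_vec_add: "cplx_vec (x + y) = cplx_vec x + cplx_vec y"
  by (simp add: cplx_vec_def vec_eq_iff)

lemma cplx_vec_scaleR: "cplx_vec (r *\<^sub>R x) = of_real r *s cplx_vec x"
  by (simp add: cplx_vec_def vec_eq_iff)

lemma continuous_on_cplx_vec [continuous_intros]:
  "continuous_on S f \<Longrightarrow> continuous_on S (\<lambda>x. cplx_vec (f x))"
  unfolding cplx_vec_def by (intro continuous_intros)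

lemma norm_cplx_vec [simp]: "norm (cplx_vec x) = norm x"
  by (simp add: norm_vec_def)

section \<open>Polynomials that vanish on real space\<close>

text \<open>Induction over the set \<open>S\<close> of variables that occur. Fixing all variables but one leaves a
  polynomial in one variable with infinitely many zeros.\<close>

lemma polynomial_vanishing_aux:
  fixes c :: "nat ^ 'd::finite \<Rightarrow> complex"
  assumes "finite S" "finite Bs" "\<And>\<beta> j. \<beta> \<in> Bs \<Longrightarrow> j \<notin> S \<Longrightarrow> \<beta> $ j = 0"
    "\<And>x :: real ^ 'd. (\<Sum>\<beta>\<in>Bs. c \<beta> * monomial (cplx_vec x) \<beta>) = 0" "\<beta> \<in> Bs"
  shows "c \<beta> = 0"
  using assms
proof (induction S arbitrary: Bs c \<beta> rule: finite_induct)
  case empty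
  have "\<beta>' = 0" if "\<beta>' \<in> Bs" for \<beta>' using empty(2)[OF that] by (simp add: vec_eq_iff)
  then have "Bs = {0}" "\<beta> = 0" using empty(4) by auto
  then show ?case using empty(3)[of 0] by simp
next
  case (insert i S)
  let ?z = "\<lambda>\<beta>::nat ^ 'd. (\<chi> j. if j = i then 0 else \<beta> $ j)"
  define k where "k = \<beta> $ i"
  let ?B = "{\<gamma> \<in> Bs. \<gamma> $ i = k}"
  have inj: "inj_on ?z ?B"
    by (auto simp: inj_on_def vec_eq_iff) metis
  have split: "monomial (cplx_vec (\<chi> j. if j = i then t else x $ j)) \<gamma> = of_real t ^ (\<gamma> $ i) * monomial (cplx_vec x) (?z \<gamma>)" 
    for t and x :: "real ^ 'd" and \<gamma>
  proof -
    have "monomial (cplx_vec (\<chi> j. if j = i then t else x $ j)) \<gamma> 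
      = of_real t ^ (\<gamma> $ i) * (\<Prod>j\<in>UNIV - {i}. of_real (x $ j) ^ (\<gamma> $ j))"
      unfolding monomial_def by (subst prod.remove[of _ i]) (auto intro!: prod.cong)
    moreover have "monomial (cplx_vec x) (?z \<gamma>) = (\<Prod>j\<in>UNIV - {i}. of_real (x $ j) ^ (\<gamma> $ j))"
      unfolding monomial_def by (subst prod.remove[of _ i]) (auto intro!: prod.cong)
    ultimately show ?thesis by simp
  qed
  have key: "(\<Sum>\<gamma>\<in>?B. c \<gamma> * monomial (cplx_vec x) (?z \<gamma>)) = 0" for x :: "real ^ 'd"
  proof -
    define n where "n = Max ((\<lambda>\<gamma>. \<gamma> $ i) ` Bs)"
    have n: "\<gamma> $ i \<le> n" if "\<gamma> \<in> Bs" for \<gamma>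
      unfolding n_def using insert(4) that by (intro Max_ge) auto
    define d where "d l = (\<Sum>\<gamma> | \<gamma> \<in> Bs \<and> \<gamma> $ i = l. c \<gamma> * monomial (cplx_vec x) (?z \<gamma>))" for l
    have "(\<Sum>l\<le>n. d l * complex_of_real t ^ l) = 0" for t
    proof -
      have "(\<Sum>l\<le>n. d l * complex_of_real t ^ l) = 
        (\<Sum>l\<le>n. \<Sum>\<gamma> | \<gamma> \<in> Bs \<and> \<gamma> $ i = l. c \<gamma> * monomial (cplx_vec (\<chi> j. if j = i then t else x $ j)) \<gamma>)"
        unfolding d_def sum_distrib_right split by (intro sum.cong refl) (auto simp: mult_ac)
      also have "\<dots> = (\<Sum>\<gamma>\<in>Bs. c \<gamma> * monomial (cplx_vec (\<chi> j. if j = i then t else x $ j)) \<gamma>)"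
        by (rule sum.group[OF insert(4)]) (use n in auto)
      also have "\<dots> = 0" by (rule insert(6))
      finally show ?thesis .
    qed
    then have "range complex_of_real \<subseteq> {z. (\<Sum>l\<le>n. d l * z ^ l) = 0}" by auto
    moreover have "infinite (range complex_of_real)"
      using infinite_UNIV_char_0 finite_imageD inj_of_real by blast
    ultimately have "infinite {z. (\<Sum>l\<le>n. d l * z ^ l) = 0}" using infinite_super by blast
    then have "\<forall>l\<le>n. d l = 0" using polyfun_finite_roots[of d n] by blast
    moreover have "k \<le> n" using n insert(7) k_def by blast
    ultimately show ?thesis unfolding d_def by blast
  qed
  define c' where "c' \<gamma> = c (the_inv_into ?B ?z \<gamma>)" for \<gamma>
  have c': "c' (?z \<gamma>) = c \<gamma>" if "\<gamma> \<in> ?B" for \<gamma>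
    unfolding c'_def using the_inv_into_f_f[OF inj that] by simp
  have "c' (?z \<beta>) = 0"
  proof (rule insert.IH[of "?z ` ?B"])
    show "finite (?z ` ?B)" using insert(4) by simp
    show "\<gamma> $ j = 0" if "\<gamma> \<in> ?z ` ?B" "j \<notin> S" for \<gamma> j
      using that insert(5) by auto
    show "(\<Sum>\<gamma>\<in>?z ` ?B. c' \<gamma> * monomial (cplx_vec x) \<gamma>) = 0" for x :: "real ^ 'd"
    proof -
      have "(\<Sum>\<gamma>\<in>?z ` ?B. c' \<gamma> * monomial (cplx_vec x) \<gamma>) = (\<Sum>\<gamma>\<in>?B. c' (?z \<gamma>) * monomial (cplx_vec x) (?z \<gamma>))"
        by (subst sum.reindex[OF inj]) simp
      also have "\<dots> = (\<Sum>\<gamma>\<in>?B. c \<gamma> * monomial (cplx_vec x) (?z \<gamma>))"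
        by (intro sum.cong refl arg_cong2[of _ _ _ _ "(*)"] c')
      finally show ?thesis using key by simp
    qed
    show "?z \<beta> \<in> ?z ` ?B" using insert(7) by (auto simp: k_def)
  qed
  then show ?case using c'[of \<beta>] insert(7) by (simp add: k_def)
qed

lemma polynomial_vanishing:
  fixes c :: "nat ^ 'd::finite \<Rightarrow> complex"
  assumes "finite Bs" "\<And>x :: real ^ 'd. (\<Sum>\<beta>\<in>Bs. c \<beta> * monomial (cplx_vec x) \<beta>) = 0" "\<beta> \<in> Bs"
  shows "c \<beta> = 0"
  using polynomial_vanishing_aux[OF finite assms(1) _ assms(2,3), of UNIV] by simp

section \<open>The polynomials Q as Taylor coefficients\<close>

lemma eval_fps_power:
  fixes G :: "'d::finite cpoly fps"
  shows "eval_poly (fps_nth (G ^ i) l) z = fps_nth (Abs_fps (\<lambda>r. eval_poly (fps_nth G r) z) ^ i) l"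
  by (induction i arbitrary: l) (simp_all add: fps_mult_nth)

lemma eval_fps_compose:
  fixes G H :: "'d::finite cpoly fps"
  shows "eval_poly (fps_nth (H oo G) l) z =
    fps_nth (Abs_fps (\<lambda>r. eval_poly (fps_nth H r) z) oo Abs_fps (\<lambda>r. eval_poly (fps_nth G r) z)) l"
  by (simp add: fps_compose_nth eval_fps_power)

lemma eval_S_poly:
  "eval_poly (S_poly A m \<Upsilon> l) w =
    fact l * (\<Sum>\<beta> | Lambda_weight m \<beta> = int l. maclaurin (\<lambda>z. \<Upsilon> (cplx_mat A *v z)) \<beta> * monomial w \<beta>)"
  by (simp add: S_poly_def)

text \<open>Evaluation at a point is a ring homomorphism, so it commutes with the formal composition that
  defines the Bell polynomials. At a fixed point \<open>Q_poly\<close> is therefore a Taylor coefficient, in an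
  auxiliary variable, of the exponential of a numerical power series.\<close>

lemma eval_Q_poly:
  "eval_poly (Q_poly A m \<Upsilon> l n) z =
    fps_nth (fps_exp 1 oo Abs_fps (\<lambda>r. if r = 0 then 0 else of_nat n *
      (\<Sum>\<beta> | Lambda_weight m \<beta> = int r. maclaurin (\<lambda>z. \<Upsilon> (cplx_mat A *v z)) \<beta> *
         monomial (cplx_mat (matrix_inv A) *v z) \<beta>))) l"
proof -
  have e: "Abs_fps (\<lambda>r. 1 / fact r) = (fps_exp 1 :: complex fps)"
    by (simp add: fps_eq_iff)
  have "eval_poly (Q_poly A m \<Upsilon> l n) z =
    fps_nth (Abs_fps (\<lambda>r. 1 / fact r) oo Abs_fps (\<lambda>r. eval_poly (if r = 0 then 0 else const_poly (1 / fact r) *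
      (const_poly (of_nat n) * lin_subst (matrix_inv A) (S_poly A m \<Upsilon> r))) z)) l"
    unfolding Q_poly_def bell_def by (simp add: eval_fps_compose)
  also have "(\<lambda>r. eval_poly (if r = 0 then 0 else const_poly (1 / fact r) *
      (const_poly (of_nat n) * lin_subst (matrix_inv A) (S_poly A m \<Upsilon> r))) z) =
    (\<lambda>r. if r = 0 then 0 else of_nat n *
      (\<Sum>\<beta> | Lambda_weight m \<beta> = int r. maclaurin (\<lambda>z. \<Upsilon> (cplx_mat A *v z)) \<beta> *
         monomial (cplx_mat (matrix_inv A) *v z) \<beta>))"
    by (auto simp: fun_eq_iff eval_lin_subst eval_S_poly)
  finally show ?thesis unfolding e .
qed

section \<open>Weighted degrees\<close>

text \<open>The degree that counts a factor \<open>z\<^sub>j\<close> with weight \<open>w\<^sub>j\<close>. With \<open>w = kappa m\<close> the monomials of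
  a semi-elliptic polynomial are those of weighted degree \<open>2 * lcm_vec m\<close>.\<close>

definition wdeg :: "nat ^ 'd \<Rightarrow> nat ^ 'd \<Rightarrow> nat"
  where "wdeg w \<beta> = (\<Sum>j\<in>UNIV. \<beta> $ j * w $ j)"

definition kappa :: "nat ^ 'd \<Rightarrow> nat ^ 'd"
  where "kappa m = (\<chi> j. lcm_vec m div m $ j)"

lemma finite_wdeg:
  fixes w :: "nat ^ 'd::finite"
  assumes "\<And>j. w $ j \<ge> 1"
  shows "finite {\<beta>. wdeg w \<beta> = k}"
proof -
  have "finite (vec_lambda ` (PiE (UNIV :: 'd set) (\<lambda>_. {..k})))"
    by (intro finite_imageI finite_PiE) auto
  moreover have "{\<beta>. wdeg w \<beta> = k} \<subseteq> vec_lambda ` (PiE (UNIV :: 'd set) (\<lambda>_. {..k}))"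
  proof
    fix \<beta> assume "\<beta> \<in> {\<beta>. wdeg w \<beta> = k}"
    then have k: "wdeg w \<beta> = k" by simp
    have "\<beta> $ j \<le> k" for j
    proof -
      have "\<beta> $ j * 1 \<le> \<beta> $ j * w $ j" using assms by (intro mult_left_mono) auto
      also have "\<dots> \<le> wdeg w \<beta>" unfolding wdeg_def by (rule member_le_sum) auto
      finally show ?thesis using k by simp
    qed
    then have "vec_nth \<beta> \<in> PiE UNIV (\<lambda>_. {..k})" by auto
    then show "\<beta> \<in> vec_lambda ` (PiE UNIV (\<lambda>_. {..k}))"
      by (metis image_eqI vec_nth_inverse)
  qed
  ultimately show ?thesis using finite_subset by blast
qed

lemma monomial_weighted:
  fixes z :: "complex ^ 'd::finite"
  shows "monomial (\<chi> j. t ^ (w $ j) * z $ j) \<beta> = t ^ wdeg w \<beta> * monomial z \<beta>"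
  by (simp add: monomial_def wdeg_def power_mult_distrib prod.distrib power_sum mult.commute flip: power_mult)

lemma norm_monomial_le:
  fixes z :: "complex ^ 'd::finite"
  assumes "\<And>j. norm (z $ j) \<le> \<rho> ^ (w $ j)"
  shows "norm (monomial z \<beta>) \<le> \<rho> ^ wdeg w \<beta>"
proof -
  have "norm (monomial z \<beta>) = (\<Prod>j\<in>UNIV. norm (z $ j) ^ (\<beta> $ j))"
    by (simp add: monomial_def norm_power flip: prod_norm)
  also have "\<dots> \<le> (\<Prod>j\<in>UNIV. (\<rho> ^ (w $ j)) ^ (\<beta> $ j))"
    by (intro prod_mono conjI power_mono assms) auto
  also have "\<dots> = \<rho> ^ wdeg w \<beta>"
    by (simp add: wdeg_def power_sum mult.commute flip: power_mult)
  finally show ?thesis .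
qed

lemma has_sum_group_wdeg:
  fixes b :: "nat ^ 'd::finite \<Rightarrow> complex"
  assumes w: "\<And>j. w $ j \<ge> 1" and s: "(b has_sum S) UNIV"
  shows "((\<lambda>k. \<Sum>\<beta> | wdeg w \<beta> = k. b \<beta>) has_sum S) UNIV"
proof -
  have bij: "bij_betw snd (SIGMA k:UNIV. {\<beta>. wdeg w \<beta> = k}) (UNIV :: (nat ^ 'd) set)"
    by (rule bij_betw_byWitness[where f' = "\<lambda>\<beta>. (wdeg w \<beta>, \<beta>)"]) auto
  have "((\<lambda>x. b (snd x)) has_sum S) (SIGMA k:UNIV. {\<beta>. wdeg w \<beta> = k})"
    by (subst has_sum_reindex_bij_betw[OF bij]) (rule s)
  then show ?thesis
    by (rule has_sum_SigmaD) (use finite_wdeg[OF w] in \<open>auto intro!: has_sum_finiteI\<close>)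
qed

text \<open>Otherwise the first non-vanishing term would dominate as \<open>t\<close> tends to \<open>0\<close>.\<close>

lemma power_series_coeff_vanish:
  fixes c :: "nat \<Rightarrow> complex"
  assumes t0: "t0 > 0" and s: "\<And>t. 0 < t \<Longrightarrow> t < t0 \<Longrightarrow> (\<lambda>k. c k * complex_of_real t ^ k) sums g t"
    and l: "((\<lambda>t. g t / of_real t ^ M) \<longlongrightarrow> 0) (at_right 0)" and k: "k \<le> M"
  shows "c k = 0"
  using k
proof (induction k rule: less_induct)
  case (less k)
  define f where "f x = suminf (\<lambda>i. c (i + k) * x ^ i)" for x :: complex
  have sm: "summable (\<lambda>i. c (i + k) * x ^ i)" if "norm x < t0 / 2" for x
  proof -
    have "summable (\<lambda>i. c i * complex_of_real (t0 / 2) ^ i)"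
      using s[of "t0 / 2"] t0 sums_summable by force
    then have "summable (\<lambda>i. c (i + k) * complex_of_real (t0 / 2) ^ (i + k))"
      by (rule summable_ignore_initial_segment)
    then have "summable (\<lambda>i. (c (i + k) * complex_of_real (t0 / 2) ^ i) * complex_of_real (t0 / 2) ^ k)"
      by (simp add: power_add mult_ac)
    then have "summable (\<lambda>i. (c (i + k) * complex_of_real (t0 / 2) ^ i) * complex_of_real (t0 / 2) ^ k * inverse (complex_of_real (t0 / 2) ^ k))"
      by (rule summable_mult2)
    moreover have "complex_of_real (t0 / 2) ^ k \<noteq> 0" using t0 by simp
    ultimately have "summable (\<lambda>i. c (i + k) * complex_of_real (t0 / 2) ^ i)"
      by (simp add: mult.assoc)
    then show ?thesis by (rule powser_inside) (use that t0 in auto)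
  qed
  have lim: "(f \<longlongrightarrow> c (0 + k)) (at 0)"
    by (rule powser_limit_0[of "t0 / 2"]) (use sm t0 in \<open>auto simp: f_def summable_sums\<close>)
  have "((\<lambda>t. f (complex_of_real t)) \<longlongrightarrow> c (0 + k)) (at_right 0)"
    by (rule filterlim_compose[OF lim])
      (auto simp: filterlim_at eventually_at_right_field intro!: exI[of _ 1] tendsto_eq_intros)
  moreover have "((\<lambda>t. f (complex_of_real t)) \<longlongrightarrow> 0) (at_right 0)"
  proof (rule Lim_transform_eventually)
    have "((\<lambda>t. g t / of_real t ^ M * of_real t ^ (M - k)) \<longlongrightarrow> 0 * of_real 0 ^ (M - k)) (at_right 0)"
      by (intro tendsto_mult l tendsto_power tendsto_of_real tendsto_ident_at)
    then show "((\<lambda>t. g t / of_real t ^ M * of_real t ^ (M - k)) \<longlongrightarrow> 0) (at_right 0)" by simp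
    have "g t / of_real t ^ M * of_real t ^ (M - k) = f (complex_of_real t)" if t: "0 < t" "t < t0 / 2" for t
    proof -
      have "(\<lambda>i. c (i + k) * complex_of_real t ^ (i + k)) sums (g t - (\<Sum>i<k. c i * complex_of_real t ^ i))"
        by (rule sums_split_initial_segment[OF s]) (use t in auto)
      moreover have "(\<Sum>i<k. c i * complex_of_real t ^ i) = 0"
        using less by (intro sum.neutral) auto
      ultimately have 1: "(\<lambda>i. complex_of_real t ^ k * (c (i + k) * complex_of_real t ^ i)) sums g t"
        by (simp add: power_add mult_ac)
      have "(\<lambda>i. complex_of_real t ^ k * (c (i + k) * complex_of_real t ^ i)) sums (complex_of_real t ^ k * f (of_real t))"
        unfolding f_def by (intro sums_mult summable_sums sm) (use t in auto)
      with 1 have "g t = complex_of_real t ^ k * f (of_real t)" using sums_unique2 by blast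
      moreover have "complex_of_real t ^ M = complex_of_real t ^ k * complex_of_real t ^ (M - k)"
        using less(2) by (simp flip: power_add)
      ultimately show ?thesis using t by simp
    qed
    then show "\<forall>\<^sub>F t in at_right 0. g t / of_real t ^ M * of_real t ^ (M - k) = f (complex_of_real t)"
      using t0 unfolding eventually_at_right_field by (intro exI[of _ "t0 / 2"]) auto
  qed
  ultimately show ?case using tendsto_unique trivial_limit_at_right_real by fastforce
qed

text \<open>Along a curve \<open>t \<mapsto> (t^(w\<^sub>j) x\<^sub>j)\<^sub>j\<close> the coefficient of \<open>t^k\<close> is the part of weighted degree
  \<open>k\<close> evaluated at \<open>x\<close>. If these parts vanish at all real \<open>x\<close>, so do their coefficients. This is how
  the hypothesis \<open>\<Upsilon> = o(Re P)\<close> removes the low weights.\<close>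

lemma weighted_vanishing:
  fixes b :: "nat ^ 'd::finite \<Rightarrow> complex"
  assumes w: "\<And>j. w $ j \<ge> 1" and r: "r > 0"
    and s: "\<And>z. (\<And>j. norm (z $ j) < r) \<Longrightarrow> ((\<lambda>\<beta>. b \<beta> * monomial z \<beta>) has_sum f z) UNIV"
    and l: "\<And>x :: real ^ 'd. ((\<lambda>t. f (cplx_vec (\<chi> j. t ^ (w $ j) * x $ j)) / of_real t ^ M) \<longlongrightarrow> 0) (at_right 0)"
    and k: "wdeg w \<beta> \<le> M"
  shows "b \<beta> = 0"
proof (rule polynomial_vanishing[of "{\<gamma>. wdeg w \<gamma> = wdeg w \<beta>}" b])
  show "finite {\<gamma>. wdeg w \<gamma> = wdeg w \<beta>}" by (rule finite_wdeg[OF w])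
  fix x :: "real ^ 'd"
  define c where "c k = (\<Sum>\<gamma> | wdeg w \<gamma> = k. b \<gamma> * monomial (cplx_vec x) \<gamma>)" for k
  define t0 where "t0 = min 1 (r / (1 + norm x))"
  have nx: "1 + norm x > 0" using norm_ge_zero[of x] by linarith
  have t0: "t0 > 0" using r nx by (simp add: t0_def)
  have "c (wdeg w \<beta>) = 0"
  proof (rule power_series_coeff_vanish[OF t0 _ l[of x] k])
    fix t :: real assume t: "0 < t" "t < t0"
    have eq: "cplx_vec (\<chi> j. t ^ (w $ j) * x $ j) = (\<chi> j. of_real t ^ (w $ j) * cplx_vec x $ j)"
      by (simp add: vec_eq_iff)
    have "((\<lambda>\<beta>. b \<beta> * monomial (cplx_vec (\<chi> j. t ^ (w $ j) * x $ j)) \<beta>) has_sum f (cplx_vec (\<chi> j. t ^ (w $ j) * x $ j))) UNIV"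
    proof (rule s)
      fix j
      have "t ^ (w $ j) \<le> t ^ 1" using t w by (intro power_decreasing) (auto simp: t0_def)
      then have "norm (cplx_vec (\<chi> j. t ^ (w $ j) * x $ j) $ j) \<le> t * (1 + norm x)"
        using t component_le_norm_cart[of x j] unfolding cplx_vec_nth norm_of_real by (simp add: abs_mult mult_mono)
      also have "\<dots> < r / (1 + norm x) * (1 + norm x)"
        using t nx by (intro mult_strict_right_mono) (auto simp: t0_def)
      also have "\<dots> = r" using nx by simp
      finally show "norm (cplx_vec (\<chi> j. t ^ (w $ j) * x $ j) $ j) < r" .
    qed
    then have "((\<lambda>k. \<Sum>\<gamma> | wdeg w \<gamma> = k. b \<gamma> * monomial (cplx_vec (\<chi> j. t ^ (w $ j) * x $ j)) \<gamma>) has_sum f (cplx_vec (\<chi> j. t ^ (w $ j) * x $ j))) UNIV"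
      by (rule has_sum_group_wdeg[OF w])
    moreover have "(\<Sum>\<gamma> | wdeg w \<gamma> = k. b \<gamma> * monomial (cplx_vec (\<chi> j. t ^ (w $ j) * x $ j)) \<gamma>) = c k * of_real t ^ k" for k
      unfolding c_def eq monomial_weighted sum_distrib_right by (intro sum.cong refl) auto
    ultimately have "((\<lambda>k. c k * of_real t ^ k) has_sum f (cplx_vec (\<chi> j. t ^ (w $ j) * x $ j))) UNIV"
      by simp
    then show "(\<lambda>k. c k * complex_of_real t ^ k) sums f (cplx_vec (\<chi> j. t ^ (w $ j) * x $ j))"
      by (rule has_sum_imp_sums)
  qed
  then show "(\<Sum>\<gamma> | wdeg w \<gamma> = wdeg w \<beta>. b \<gamma> * monomial (cplx_vec x) \<gamma>) = 0"
    by (simp add: c_def)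
qed simp

section \<open>Maclaurin coefficients\<close>

lemma eventually_nhds_polydisc:
  fixes P :: "complex ^ 'd::finite \<Rightarrow> bool"
  shows "(\<forall>\<^sub>F z in nhds 0. P z) \<longleftrightarrow> (\<exists>r>0. \<forall>z. (\<forall>j. norm (z $ j) < r) \<longrightarrow> P z)"
proof
  assume "\<forall>\<^sub>F z in nhds 0. P z"
  then obtain e where e: "e > 0" "\<And>z. norm z < e \<Longrightarrow> P z"
    unfolding eventually_nhds_metric by (auto simp: dist_norm)
  show "\<exists>r>0. \<forall>z. (\<forall>j. norm (z $ j) < r) \<longrightarrow> P z"
  proof (intro exI conjI allI impI)
    show "e / real CARD('d) > 0" using e by simp
    fix z :: "complex ^ 'd" assume z: "\<forall>j. norm (z $ j) < e / real CARD('d)"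
    have "norm z \<le> (\<Sum>j\<in>UNIV. norm (z $ j))"
      using L2_set_le_sum[of UNIV "\<lambda>j. norm (z $ j)"] by (simp add: norm_vec_def)
    also have "\<dots> < (\<Sum>j\<in>(UNIV::'d set). e / real CARD('d))"
      by (rule sum_strict_mono) (use z in auto)
    also have "\<dots> = e" by simp
    finally show "P z" by (rule e(2))
  qed
next
  assume "\<exists>r>0. \<forall>z. (\<forall>j. norm (z $ j) < r) \<longrightarrow> P z"
  then obtain r where r: "r > 0" "\<And>z. (\<forall>j. norm (z $ j) < r) \<Longrightarrow> P z" by blast
  show "\<forall>\<^sub>F z in nhds 0. P z"
    unfolding eventually_nhds_metric
  proof (intro exI[of _ r] conjI allI impI r)
    fix z :: "complex ^ 'd" and j assume "dist z 0 < r"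
    then show "norm (z $ j) < r" using Finite_Cartesian_Product.norm_nth_le[of z j] by (simp add: dist_norm)
  qed
qed

text \<open>Uniqueness of the expansion is needed as well as existence, since \<open>maclaurin\<close> is a definite
  description; it follows from the vanishing lemma applied to the difference of two expansions.\<close>

lemma maclaurin_has_sum:
  fixes f :: "complex ^ 'd::finite \<Rightarrow> complex"
  assumes "\<forall>\<^sub>F z in nhds 0. cdiff f z"
  shows "\<exists>r>0. \<forall>z. (\<forall>j. norm (z $ j) < r) \<longrightarrow> ((\<lambda>\<beta>. maclaurin f \<beta> * monomial z \<beta>) has_sum f z) UNIV"
proof -
  let ?Q = "\<lambda>b. \<forall>\<^sub>F z in nhds 0. ((\<lambda>\<beta>. b \<beta> * monomial z \<beta>) has_sum f z) UNIV"
  obtain \<rho> where \<rho>: "\<rho> > 0" "\<And>z. norm z < \<rho> \<Longrightarrow> cdiff f z"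
    using assms unfolding eventually_nhds_metric by (auto simp: dist_norm)
  from power_series_cdiff[OF this] obtain b where b: "?Q b"
    unfolding eventually_nhds_polydisc by blast
  have "b' = b" if b': "?Q b'" for b'
  proof
    fix \<beta>
    have "\<forall>\<^sub>F z in nhds 0. ((\<lambda>\<beta>. (b' \<beta> - b \<beta>) * monomial z \<beta>) has_sum 0) UNIV"
      using b b'
    proof eventually_elim
      case (elim z)
      then have "((\<lambda>\<beta>. b' \<beta> * monomial z \<beta> + (- (b \<beta> * monomial z \<beta>))) has_sum (f z + - f z)) UNIV"
        by (intro has_sum_add) (auto simp: has_sum_uminus)
      then show ?case by (simp add: algebra_simps)
    qed
    then obtain r where r: "r > 0" "\<And>z. (\<And>j. norm (z $ j) < r) \<Longrightarrow> ((\<lambda>\<beta>. (b' \<beta> - b \<beta>) * monomial z \<beta>) has_sum 0) UNIV"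
      unfolding eventually_nhds_polydisc by blast
    have "b' \<beta> - b \<beta> = 0"
      by (rule weighted_vanishing[where w = "\<chi> j. 1" and f = "\<lambda>_. 0", OF _ r(1) r(2)]) auto
    then show "b' \<beta> = b \<beta>" by simp
  qed
  then have "?Q (maclaurin f)" unfolding maclaurin_def using theI[of ?Q b] b by blast
  then show ?thesis unfolding eventually_nhds_polydisc .
qed

section \<open>Exponentials of power series\<close>

definition exp_coeff :: "(nat \<Rightarrow> complex) \<Rightarrow> nat \<Rightarrow> complex"
  where "exp_coeff \<sigma> l = fps_nth (fps_exp 1 oo Abs_fps (\<lambda>r. if r = 0 then 0 else \<sigma> r)) l"

text \<open>Cauchy's inequality for \<open>t \<mapsto> exp (\<Sum>\<^sub>l \<sigma> l t^l)\<close> on the circle of radius \<open>T / 2\<close>, where this function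
  is at most \<open>e^B\<close>. Halving \<open>T\<close> keeps the closed disc inside the disc of holomorphy, at the price of the
  factor \<open>2^l\<close>. For \<open>T \<ge> 2\<close> the expansion converges at \<open>t = 1\<close>.\<close>

lemma exp_coeff_bounds:
  fixes \<sigma> :: "nat \<Rightarrow> complex"
  assumes T: "T > 0" and b: "\<And>L. (\<Sum>l=1..L. norm (\<sigma> l) * T ^ l) \<le> B"
  shows "norm (exp_coeff \<sigma> l) \<le> (2 / T) ^ l * exp B"
    and "T \<ge> 2 \<Longrightarrow> (\<lambda>l. if l = 0 then 0 else \<sigma> l) sums S \<Longrightarrow> exp_coeff \<sigma> sums exp S"
proof -
  let ?\<sigma> = "\<lambda>l. if l = 0 then 0 else \<sigma> l"
  define G where "G = Abs_fps ?\<sigma>"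
  have part: "(\<Sum>l<L. norm (?\<sigma> l) * T ^ l) \<le> B" for L
  proof -
    have "(\<Sum>l<L. norm (?\<sigma> l) * T ^ l) \<le> (\<Sum>l\<in>insert 0 {1..L}. norm (?\<sigma> l) * T ^ l)"
      by (rule sum_mono2) (use T in auto)
    also have "\<dots> = (\<Sum>l=1..L. norm (\<sigma> l) * T ^ l)" by simp
    finally show ?thesis using b[of L] by linarith
  qed
  have sm: "summable (\<lambda>l. norm (?\<sigma> l) * T ^ l)"
    by (rule bounded_imp_summable[OF _ part[of "Suc _", unfolded lessThan_Suc_atMost]]) (use T in auto)
  have le: "suminf (\<lambda>l. norm (?\<sigma> l) * T ^ l) \<le> B" by (rule suminf_le_const[OF sm part])
  have sm': "summable (\<lambda>l. ?\<sigma> l * t ^ l)" "norm (suminf (\<lambda>l. ?\<sigma> l * t ^ l)) \<le> B" if "norm t \<le> T" for t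
  proof -
    have le1: "norm (?\<sigma> l * t ^ l) \<le> norm (?\<sigma> l) * T ^ l" for l
      unfolding norm_mult norm_power by (intro mult_left_mono power_mono that) auto
    have s1: "summable (\<lambda>l. norm (?\<sigma> l * t ^ l))"
      by (rule summable_comparison_test'[OF sm, of 0]) (use le1 in simp)
    then show "summable (\<lambda>l. ?\<sigma> l * t ^ l)" by (rule summable_norm_cancel)
    have "norm (suminf (\<lambda>l. ?\<sigma> l * t ^ l)) \<le> suminf (\<lambda>l. norm (?\<sigma> l * t ^ l))" by (rule summable_norm[OF s1])
    also have "\<dots> \<le> suminf (\<lambda>l. norm (?\<sigma> l) * T ^ l)" by (rule suminf_le[OF le1 s1 sm])
    finally show "norm (suminf (\<lambda>l. ?\<sigma> l * t ^ l)) \<le> B" using le by linarith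
  qed
  have ev: "eval_fps G t = (suminf (\<lambda>l. ?\<sigma> l * t ^ l))" for t
    by (simp add: eval_fps_def G_def)
  have "norm (complex_of_real T) \<le> conv_radius (fps_nth G)"
    by (rule conv_radius_geI) (use sm'(1)[of "of_real T"] T in \<open>simp add: G_def\<close>)
  then have rad: "fps_conv_radius G \<ge> T" using T by (simp add: fps_conv_radius_def)
  then have rad0: "fps_conv_radius G > 0" using T by (metis ereal_less(2) less_le_trans)
  have holG: "eval_fps G holomorphic_on ball 0 T"
  proof (rule holomorphic_on_eval_fps)
    show "ball 0 T \<subseteq> eball 0 (fps_conv_radius G)" using rad by (rule ball_eball_mono)
  qed
  let ?E = "\<lambda>t. exp (1 * eval_fps G t)"
  have exp: "((\<lambda>t. exp (1 * t)) \<circ> eval_fps G) has_fps_expansion (fps_exp 1 oo G)"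
    by (rule has_fps_expansion_compose[OF has_fps_expansion_exp eval_fps_has_fps_expansion[OF rad0]]) (simp add: G_def)
  have q: "exp_coeff \<sigma> l = (deriv ^^ l) ?E 0 / fact l" for l
    unfolding exp_coeff_def using fps_nth_fps_expansion[OF exp, of l] by (simp add: G_def o_def)
  have hol: "?E holomorphic_on ball 0 T" 
    using holomorphic_on_compose[OF holG holomorphic_on_exp] by (simp add: o_def)
  show "norm (exp_coeff \<sigma> l) \<le> (2 / T) ^ l * exp B"
  proof -
    have "norm ((deriv ^^ l) ?E 0) \<le> fact l * exp B / (T / 2) ^ l"
    proof (rule Cauchy_inequality)
      show "?E holomorphic_on ball 0 (T / 2)" using hol holomorphic_on_subset[OF _ subset_ball] T by fastforce
      show "continuous_on (cball 0 (T / 2)) ?E"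
        by (rule continuous_on_subset[OF holomorphic_on_imp_continuous_on[OF hol]]) (use T in auto)
      show "0 < T / 2" using T by simp
      fix t :: complex assume "norm (0 - t) = T / 2"
      then have "norm (eval_fps G t) \<le> B" unfolding ev using T by (intro sm') auto
      then show "norm (?E t) \<le> exp B" 
        unfolding norm_exp_eq_Re using complex_Re_le_cmod[of "1 * eval_fps G t"] by simp
    qed
    then have "norm ((deriv ^^ l) ?E 0) / fact l \<le> fact l * exp B / (T / 2) ^ l / fact l"
      by (rule divide_right_mono) simp
    also have "\<dots> = (2 / T) ^ l * exp B" using T by (simp add: power_divide)
    finally show ?thesis unfolding q by (simp add: norm_divide)
  qed
  show "exp_coeff \<sigma> sums exp S" if "T \<ge> 2" "?\<sigma> sums S"
  proof -
    have "(\<lambda>l. (deriv ^^ l) ?E 0 / fact l * (1 - 0) ^ l) sums ?E 1"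
      by (rule holomorphic_power_series[OF hol]) (use that in auto)
    moreover have "eval_fps G 1 = S" unfolding ev using that(2) sums_unique by force
    ultimately show ?thesis by (simp add: q[abs_def])
  qed
qed

lemma suminf_norm_le_any:
  fixes f :: "nat \<Rightarrow> complex"
  assumes "summable g" "\<And>i. norm (f i) \<le> g i"
  shows "norm (suminf f) \<le> suminf g"
proof -
  have s: "summable (\<lambda>i. norm (f i))" by (rule summable_comparison_test'[OF assms(1), of 0]) (use assms(2) in simp)
  show ?thesis using summable_norm[OF s] suminf_le[OF assms(2) s assms(1)] by linarith
qed

text \<open>If \<open>z\<close> has weighted size \<open>\<rho>\<close>, the part of \<open>f\<close> of weight \<open>M + l\<close> is of size \<open>\<rho>^(M + l)\<close>. The
  previous lemma with \<open>T\<close> proportional to \<open>1 / \<rho>\<close> and \<open>B = \<epsilon> n \<rho>^M\<close> then bounds the coefficients, and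
  summing a geometric series bounds the remainder. The number \<open>\<epsilon>\<close> is arbitrary because all weights
  exceed \<open>M\<close>, so that \<open>s\<close> can be taken small.\<close>

lemma weighted_exp_bounds:
  fixes b :: "nat ^ 'd::finite \<Rightarrow> complex"
  assumes w: "\<And>j. w $ j \<ge> 1" and r: "r > 0"
    and s: "\<And>z. (\<And>j. norm (z $ j) < r) \<Longrightarrow> ((\<lambda>\<beta>. b \<beta> * monomial z \<beta>) has_sum f z) UNIV"
    and v: "\<And>\<beta>. wdeg w \<beta> \<le> M \<Longrightarrow> b \<beta> = 0"
    and \<epsilon>: "\<epsilon> > 0"
  defines "q \<equiv> \<lambda>n z. exp_coeff (\<lambda>l. of_nat n * (\<Sum>\<beta> | wdeg w \<beta> = M + l. b \<beta> * monomial z \<beta>))"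
  shows "\<exists>s>0. \<forall>n z \<rho>. \<rho> > 0 \<longrightarrow> (\<forall>j. norm (z $ j) \<le> \<rho> ^ (w $ j)) \<longrightarrow>
    (\<forall>l. norm (q n z l) \<le> (\<rho> / s) ^ l * exp (\<epsilon> * (real n * \<rho> ^ M))) \<and>
    (\<rho> \<le> s / 2 \<longrightarrow> (\<forall>N. norm (exp (of_nat n * f z) - (\<Sum>l\<le>N. q n z l)) \<le> 2 * (\<rho> / s) ^ Suc N * exp (\<epsilon> * (real n * \<rho> ^ M))))"
proof -
  define \<delta> where "\<delta> = min 1 r / 2"
  have \<delta>: "0 < \<delta>" "\<delta> < 1" "\<delta> < r" using r by (auto simp: \<delta>_def)
  have \<delta>w: "\<delta> ^ (w $ j) < r" for j
  proof -
    have "\<delta> ^ (w $ j) \<le> \<delta> ^ 1" using \<delta> w by (intro power_decreasing) auto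
    then show ?thesis using \<delta> by simp
  qed
  define a where "a l = (\<Sum>\<beta> | wdeg w \<beta> = M + l. norm (b \<beta>))" for l
  have "(\<lambda>\<beta>. b \<beta> * monomial (\<chi> j. complex_of_real \<delta> ^ (w $ j) * 1) \<beta>) summable_on UNIV"
    using s[of "\<chi> j. complex_of_real \<delta> ^ (w $ j) * 1"] \<delta> \<delta>w by (auto simp: norm_power summable_on_def)
  then have "(\<lambda>\<beta>. norm (b \<beta> * monomial (\<chi> j. complex_of_real \<delta> ^ (w $ j) * 1) \<beta>)) summable_on UNIV"
    by (simp add: summable_on_iff_abs_summable_on_complex)
  moreover have mon: "monomial (\<chi> j. complex_of_real \<delta> ^ (w $ j) * 1) \<beta> = of_real \<delta> ^ wdeg w \<beta>" for \<beta>
    using monomial_weighted[of "of_real \<delta>" w "\<chi> j. 1" \<beta>] by (simp add: monomial_def)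
  ultimately have sm: "(\<lambda>\<beta>. norm (b \<beta>) * \<delta> ^ wdeg w \<beta>) summable_on UNIV"
    using \<delta> by (simp add: norm_mult norm_power)
  define A where "A = infsum (\<lambda>\<beta>. norm (b \<beta>) * \<delta> ^ wdeg w \<beta>) UNIV / \<delta> ^ M"
  have A0: "A \<ge> 0" unfolding A_def using \<delta> by (intro divide_nonneg_nonneg infsum_nonneg) auto
  have aA: "(\<Sum>l=1..L. a l * \<delta> ^ l) \<le> A" for L
  proof -
    have "(\<Sum>l=1..L. a l * \<delta> ^ l) * \<delta> ^ M = (\<Sum>l=1..L. \<Sum>\<beta> | wdeg w \<beta> = M + l. norm (b \<beta>) * \<delta> ^ wdeg w \<beta>)"
      unfolding a_def sum_distrib_right by (intro sum.cong refl) (auto simp: power_add mult_ac)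
    also have "\<dots> = (\<Sum>\<beta>\<in>(\<Union>l\<in>{1..L}. {\<beta>. wdeg w \<beta> = M + l}). norm (b \<beta>) * \<delta> ^ wdeg w \<beta>)"
      by (rule sum.UNION_disjoint[symmetric]) (use finite_wdeg[OF w] in auto)
    also have "\<dots> \<le> infsum (\<lambda>\<beta>. norm (b \<beta>) * \<delta> ^ wdeg w \<beta>) UNIV"
      by (rule finite_sum_le_infsum[OF sm]) (use finite_wdeg[OF w] \<delta> in auto)
    finally show ?thesis unfolding A_def using \<delta> by (simp add: pos_le_divide_eq)
  qed
  define s1 where "s1 = min \<delta> (\<epsilon> * \<delta> / (A + 1))"
  have s1: "s1 > 0" "s1 \<le> \<delta>" "A * (s1 / \<delta>) \<le> \<epsilon>"
  proof -
    show "s1 > 0" "s1 \<le> \<delta>" using \<delta> \<epsilon> A0 by (auto simp: s1_def)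
    have "A * (s1 / \<delta>) \<le> A * ((\<epsilon> * \<delta> / (A + 1)) / \<delta>)"
      using A0 \<delta> by (intro mult_left_mono divide_right_mono) (auto simp: s1_def)
    also have "\<dots> = \<epsilon> * (A / (A + 1))" using \<delta> by simp
    also have "\<dots> \<le> \<epsilon> * 1" using A0 \<epsilon> by (intro mult_left_mono) auto
    finally show "A * (s1 / \<delta>) \<le> \<epsilon>" by simp
  qed
  have aS: "(\<Sum>l=1..L. a l * s1 ^ l) \<le> \<epsilon>" for L
  proof -
    have "s1 ^ l \<le> (s1 / \<delta>) * \<delta> ^ l" if "l \<ge> 1" for l
    proof -
      have "s1 ^ l = s1 * s1 ^ (l - 1)" using that by (metis power_eq_if not_one_le_zero)
      also have "\<dots> \<le> s1 * \<delta> ^ (l - 1)" using s1 by (intro mult_left_mono power_mono) auto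
      also have "\<dots> = (s1 / \<delta>) * \<delta> ^ l" using that \<delta> by (cases l) auto
      finally show ?thesis .
    qed
    then have "(\<Sum>l=1..L. a l * s1 ^ l) \<le> (\<Sum>l=1..L. a l * ((s1 / \<delta>) * \<delta> ^ l))"
      by (intro sum_mono mult_left_mono) (auto simp: a_def sum_nonneg)
    also have "\<dots> = (\<Sum>l=1..L. a l * \<delta> ^ l) * (s1 / \<delta>)"
      unfolding sum_distrib_right by (intro sum.cong refl) (simp only: mult_ac)
    also have "\<dots> \<le> A * (s1 / \<delta>)" using aA s1 \<delta> by (intro mult_right_mono) auto
    finally show ?thesis using s1 by linarith
  qed
  show ?thesis
  proof (intro exI[of _ "s1 / 2"] conjI allI impI)
    show "s1 / 2 > 0" using s1 by simp
    fix n :: nat and z :: "complex ^ 'd" and \<rho> :: real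
    assume \<rho>: "\<rho> > 0" and z: "\<forall>j. norm (z $ j) \<le> \<rho> ^ (w $ j)"
    define \<sigma> where "\<sigma> l = (\<Sum>\<beta> | wdeg w \<beta> = M + l. b \<beta> * monomial z \<beta>)" for l
    have \<sigma>: "norm (\<sigma> l) \<le> \<rho> ^ M * (a l * \<rho> ^ l)" for l
    proof -
      have "norm (\<sigma> l) \<le> (\<Sum>\<beta> | wdeg w \<beta> = M + l. norm (b \<beta>) * \<rho> ^ (M + l))"
        unfolding \<sigma>_def
      proof (rule sum_norm_le)
        fix \<beta> assume "\<beta> \<in> {\<beta>. wdeg w \<beta> = M + l}"
        then show "norm (b \<beta> * monomial z \<beta>) \<le> norm (b \<beta>) * \<rho> ^ (M + l)"
          using norm_monomial_le[of z \<rho> w \<beta>] z by (auto simp: norm_mult intro!: mult_left_mono)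
      qed
      also have "\<dots> = \<rho> ^ M * (a l * \<rho> ^ l)" by (simp add: a_def sum_distrib_left sum_distrib_right power_add mult_ac)
      finally show ?thesis .
    qed
    define T where "T = s1 / \<rho>"
    have T: "T > 0" using s1 \<rho> by (simp add: T_def)
    have bound: "(\<Sum>l=1..L. norm (of_nat n * \<sigma> l) * T ^ l) \<le> \<epsilon> * (real n * \<rho> ^ M)" for L
    proof -
      have "norm (of_nat n * \<sigma> l) * T ^ l \<le> real n * \<rho> ^ M * (a l * s1 ^ l)" for l
      proof -
        have "norm (of_nat n * \<sigma> l) * T ^ l \<le> real n * (\<rho> ^ M * (a l * \<rho> ^ l)) * T ^ l"
          using \<sigma>[of l] T by (intro mult_right_mono) (auto simp: norm_mult intro!: mult_left_mono)
        also have "\<dots> = real n * \<rho> ^ M * (a l * s1 ^ l)" using \<rho> by (simp add: T_def power_divide)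
        finally show ?thesis .
      qed
      then have "(\<Sum>l=1..L. norm (of_nat n * \<sigma> l) * T ^ l) \<le> (\<Sum>l=1..L. real n * \<rho> ^ M * (a l * s1 ^ l))"
        by (intro sum_mono)
      also have "\<dots> = real n * \<rho> ^ M * (\<Sum>l=1..L. a l * s1 ^ l)" by (simp add: sum_distrib_left)
      also have "\<dots> \<le> real n * \<rho> ^ M * \<epsilon>" using aS \<rho> by (intro mult_left_mono) auto
      finally show ?thesis by (simp add: mult_ac)
    qed
    have q: "q n z = exp_coeff (\<lambda>l. of_nat n * \<sigma> l)" by (simp add: q_def \<sigma>_def)
    show bq: "norm (q n z l) \<le> (\<rho> / (s1 / 2)) ^ l * exp (\<epsilon> * (real n * \<rho> ^ M))" for l
      using exp_coeff_bounds(1)[OF T bound, of l] unfolding q by (simp add: T_def mult.commute)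
    show "norm (exp (of_nat n * f z) - (\<Sum>l\<le>N. q n z l)) \<le> 2 * (\<rho> / (s1 / 2)) ^ Suc N * exp (\<epsilon> * (real n * \<rho> ^ M))"
      if small: "\<rho> \<le> s1 / 2 / 2" for N
    proof -
      have zr: "norm (z $ j) < r" for j
      proof -
        have "norm (z $ j) \<le> \<rho> ^ (w $ j)" using z by simp
        also have "\<dots> \<le> \<delta> ^ (w $ j)" using \<rho> small s1 by (intro power_mono) auto
        finally show ?thesis using \<delta>w[of j] by linarith
      qed
      have "(\<lambda>k. \<Sum>\<beta> | wdeg w \<beta> = k. b \<beta> * monomial z \<beta>) sums f z"
        by (rule has_sum_imp_sums[OF has_sum_group_wdeg[OF w s[OF zr]]])
      from sums_split_initial_segment[OF this, of M]
      have "(\<lambda>l. \<sigma> l) sums (f z - (\<Sum>k<M. \<Sum>\<beta> | wdeg w \<beta> = k. b \<beta> * monomial z \<beta>))"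
        by (simp add: \<sigma>_def add.commute)
      moreover have "(\<Sum>k<M. \<Sum>\<beta> | wdeg w \<beta> = k. b \<beta> * monomial z \<beta>) = 0"
        by (intro sum.neutral ballI) (auto simp: v)
      ultimately have "\<sigma> sums f z" by simp
      moreover have "\<sigma> 0 = 0" unfolding \<sigma>_def by (intro sum.neutral) (auto simp: v)
      then have "\<sigma> = (\<lambda>l. if l = 0 then 0 else \<sigma> l)" by auto
      ultimately have "(\<lambda>l. if l = 0 then 0 else \<sigma> l) sums f z" by simp
      from sums_mult[OF this, of "of_nat n"]
      have "(\<lambda>l. if l = 0 then 0 else of_nat n * \<sigma> l) sums (of_nat n * f z)"
        by (simp add: if_distrib cong: if_cong)
      moreover have "T \<ge> 2" using small \<rho> s1 by (simp add: T_def field_simps)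
      ultimately have sq: "q n z sums exp (of_nat n * f z)"
        unfolding q by (intro exp_coeff_bounds(2)[OF T bound])
      define x where "x = \<rho> / (s1 / 2)"
      have x: "0 < x" "x \<le> 1 / 2" using small \<rho> s1 by (auto simp: x_def field_simps)
      let ?e = "exp (\<epsilon> * (real n * \<rho> ^ M))"
      have tail: "(\<lambda>i. q n z (i + Suc N)) sums (exp (of_nat n * f z) - (\<Sum>l\<le>N. q n z l))"
        using sums_split_initial_segment[OF sq, of "Suc N"] by (simp add: lessThan_Suc_atMost)
      have geo: "(\<lambda>i. x ^ i * (x ^ Suc N * ?e)) sums (1 / (1 - x) * (x ^ Suc N * ?e))"
        by (intro sums_mult2 geometric_sums) (use x in auto)
      have "norm (exp (of_nat n * f z) - (\<Sum>l\<le>N. q n z l)) \<le> 1 / (1 - x) * (x ^ Suc N * ?e)"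
      proof (subst sums_unique[OF tail], subst sums_unique[OF geo], rule suminf_norm_le_any)
        show "summable (\<lambda>i. x ^ i * (x ^ Suc N * ?e))" using geo sums_summable by blast
        show "norm (q n z (i + Suc N)) \<le> x ^ i * (x ^ Suc N * ?e)" for i
          using bq[of "i + Suc N"] by (simp add: power_add x_def mult_ac)
      qed
      also have "\<dots> \<le> 2 * (x ^ Suc N * ?e)"
        using x by (intro mult_right_mono) (auto simp: field_simps)
      finally show ?thesis by (simp add: x_def mult_ac)
    qed
  qed
qed

section \<open>Positive semi-elliptic polynomials\<close>

text \<open>This trades a power of \<open>n\<close> against a small part of an exponential decay in \<open>n\<close>.\<close>

lemma powr_le_exp:
  fixes a \<epsilon> :: real
  assumes "a \<ge> 0" "\<epsilon> > 0"
  shows "\<exists>C>0. \<forall>y\<ge>0. y powr a \<le> C * exp (\<epsilon> * y)"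
proof (cases "a = 0")
  case True
  show ?thesis
  proof (intro exI[of _ 1] conjI allI impI)
    fix y :: real assume "y \<ge> 0"
    then have "exp (\<epsilon> * y) \<ge> 1" using assms by simp
    then show "y powr a \<le> 1 * exp (\<epsilon> * y)" using True by (simp add: powr_def)
  qed simp
next
  case False
  then have a: "a > 0" using assms by simp
  show ?thesis
  proof (intro exI[of _ "(a / \<epsilon>) powr a"] conjI allI impI)
    show "(a / \<epsilon>) powr a > 0" using a assms by simp
    fix y :: real assume y: "y \<ge> 0"
    have "\<epsilon> * y / a \<le> exp (\<epsilon> * y / a)" using exp_ge_add_one_self[of "\<epsilon> * y / a"] by linarith
    then have "(a / \<epsilon>) * (\<epsilon> * y / a) \<le> (a / \<epsilon>) * exp (\<epsilon> * y / a)"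
      using a assms by (intro mult_left_mono) auto
    then have "y \<le> (a / \<epsilon>) * exp (\<epsilon> * y / a)" using a assms by simp
    then have "y powr a \<le> ((a / \<epsilon>) * exp (\<epsilon> * y / a)) powr a"
      using y a by (intro powr_mono2) auto
    also have "\<dots> = (a / \<epsilon>) powr a * exp (\<epsilon> * y / a) powr a"
      by (rule powr_mult)
    also have "exp (\<epsilon> * y / a) powr a = exp (\<epsilon> * y)"
      using a by (simp add: exp_powr_real)
    finally show "y powr a \<le> (a / \<epsilon>) powr a * exp (\<epsilon> * y)" .
  qed
qed

text \<open>The model for \<open>Re P\<close>, homogeneous under the same anisotropic dilations.\<close>

definition quasi :: "nat ^ 'd \<Rightarrow> complex ^ 'd \<Rightarrow> real"
  where "quasi m z = (\<Sum>j\<in>UNIV. norm (z $ j) ^ (2 * m $ j))"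

context
  fixes m :: "nat ^ 'd::finite"
  assumes m1: "\<And>j. m $ j \<ge> 1"
begin

lemma lcm_vec_pos: "lcm_vec m > 0"
proof -
  have "0 \<notin> range (\<lambda>j. m $ j)" using m1 by (metis imageE not_one_le_zero)
  then have "Lcm (range (\<lambda>j. m $ j)) \<noteq> 0" by (simp add: Lcm_0_iff)
  then show ?thesis unfolding lcm_vec_def by (meson gr0I)
qed

lemma kappa_mult: "kappa m $ j * m $ j = lcm_vec m"
  by (simp add: kappa_def lcm_vec_def)

lemma kappa_ge_1: "kappa m $ j \<ge> 1"
  using kappa_mult[of j] lcm_vec_pos by (metis One_nat_def Suc_leI gr0I mult_zero_left)

lemma Lambda_weight_iff: "Lambda_weight m \<beta> = int l \<longleftrightarrow> wdeg (kappa m) \<beta> = 2 * lcm_vec m + l"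
proof -
  have "Lambda_weight m \<beta> = int (wdeg (kappa m) \<beta>) - 2 * int (lcm_vec m)"
    by (simp add: Lambda_weight_def wdeg_def kappa_def)
  then show ?thesis by linarith
qed

lemma quasi_nonneg: "quasi m z \<ge> 0"
  unfolding quasi_def by (intro sum_nonneg) auto

lemma quasi_scale:
  assumes "t \<ge> 0"
  shows "quasi m (\<chi> j. of_real t ^ (kappa m $ j) * z $ j) = t ^ (2 * lcm_vec m) * quasi m z"
  unfolding quasi_def sum_distrib_left
proof (rule sum.cong[OF refl])
  fix j
  have "(t ^ (kappa m $ j)) ^ (2 * m $ j) = t ^ (2 * lcm_vec m)"
    by (simp flip: power_mult kappa_mult[of j] add: mult_ac)
  then show "norm ((\<chi> j. of_real t ^ (kappa m $ j) * z $ j) $ j) ^ (2 * m $ j) = t ^ (2 * lcm_vec m) * norm (z $ j) ^ (2 * m $ j)"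
    using assms by (simp add: norm_mult norm_power power_mult_distrib)
qed

lemma quasi_component: "norm (z $ j) ^ (2 * m $ j) \<le> quasi m z"
  unfolding quasi_def by (rule member_le_sum) auto

text \<open>A bound on \<open>quasi\<close> is a bound on the weighted size in the sense of \<open>weighted_exp_bounds\<close>.\<close>

lemma quasi_bound:
  assumes "\<rho> \<ge> 0" "quasi m z \<le> \<rho> ^ (2 * lcm_vec m)"
  shows "norm (z $ j) \<le> \<rho> ^ (kappa m $ j)"
proof -
  have "norm (z $ j) ^ (2 * m $ j) \<le> (\<rho> ^ (kappa m $ j)) ^ (2 * m $ j)"
    using quasi_component[of z j] assms(2) by (simp flip: power_mult kappa_mult[of j] add: mult_ac)
  then show ?thesis
    by (rule power_mono_iff[THEN iffD1, rotated -1]) (use assms m1[of j] in auto)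
qed

lemma quasi_eq_0: "quasi m z = 0 \<longleftrightarrow> z = 0"
proof
  assume "quasi m z = 0"
  then have "norm (z $ j) ^ (2 * m $ j) = 0" for j
    using quasi_component[of z j] zero_le_power[OF norm_ge_zero, of "z $ j" "2 * m $ j"] by linarith
  then show "z = 0" by (simp add: vec_eq_iff)
next
  assume "z = 0"
  moreover have "(0::real) ^ (2 * m $ j) = 0" for j
    by (rule zero_power) (use m1[of j] in linarith)
  ultimately show "quasi m z = 0" unfolding quasi_def by (simp only: zero_index norm_zero sum.neutral_const)
qed

lemma continuous_on_quasi [continuous_intros]:
  "continuous_on S f \<Longrightarrow> continuous_on S (\<lambda>x. quasi m (f x))"
  unfolding quasi_def by (intro continuous_intros)

lemma compact_quasi: 
  assumes "closed S" "\<And>x. x \<in> S \<Longrightarrow> quasi m (cplx_vec (fst x)) \<le> 1 \<and> quasi m (cplx_vec (snd x)) \<le> 1"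
  shows "compact (S :: ((real ^ 'd) \<times> (real ^ 'd)) set)"
proof -
  have b: "norm x \<le> real CARD('d)" if "quasi m (cplx_vec x) \<le> 1" for x :: "real ^ 'd"
  proof -
    have "\<bar>x $ j\<bar> \<le> 1" for j
      using quasi_bound[of 1 "cplx_vec x" j] that by simp
    then have "(\<Sum>j\<in>UNIV. \<bar>x $ j\<bar>) \<le> (\<Sum>j\<in>(UNIV::'d set). 1)" by (intro sum_mono)
    then show ?thesis using norm_le_l1_cart[of x] by simp
  qed
  have "S \<subseteq> cball 0 (real CARD('d)) \<times> cball 0 (real CARD('d))"
    using assms(2) b by fastforce
  then have "bounded S" using bounded_subset bounded_Times bounded_cball by metis
  then show ?thesis using assms(1) by (simp add: compact_eq_bounded_closed)
qed

lemma quasi_sum_le: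
  "quasi m (cplx_vec \<xi> - \<i> *s cplx_vec \<nu>) \<le> (\<Sum>j\<in>UNIV. 2 ^ (m $ j)) * (quasi m (cplx_vec \<xi>) + quasi m (cplx_vec \<nu>))"
proof -
  have "norm ((cplx_vec \<xi> - \<i> *s cplx_vec \<nu>) $ j) ^ (2 * m $ j) 
     \<le> (\<Sum>j\<in>UNIV. 2 ^ (m $ j)) * (norm (cplx_vec \<xi> $ j) ^ (2 * m $ j) + norm (cplx_vec \<nu> $ j) ^ (2 * m $ j))" for j
  proof -
    let ?a = "(\<xi> $ j)\<^sup>2" and ?b = "(\<nu> $ j)\<^sup>2"
    have "(norm ((cplx_vec \<xi> - \<i> *s cplx_vec \<nu>) $ j))\<^sup>2 = ?a + ?b"
      by (simp add: cmod_power2)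
    also have "\<dots> \<le> 2 * max ?a ?b" by simp
    finally have "((norm ((cplx_vec \<xi> - \<i> *s cplx_vec \<nu>) $ j))\<^sup>2) ^ (m $ j) \<le> (2 * max ?a ?b) ^ (m $ j)"
      by (intro power_mono) auto
    also have "\<dots> = 2 ^ (m $ j) * max ?a ?b ^ (m $ j)" by (simp add: power_mult_distrib)
    also have "\<dots> \<le> 2 ^ (m $ j) * (?a ^ (m $ j) + ?b ^ (m $ j))"
      by (intro mult_left_mono) (auto simp: max_def)
    also have "\<dots> \<le> (\<Sum>j\<in>UNIV. 2 ^ (m $ j)) * (?a ^ (m $ j) + ?b ^ (m $ j))"
      by (intro mult_right_mono member_le_sum) auto
    finally show ?thesis by (simp add: power_mult)
  qed
  then show ?thesis unfolding quasi_def sum_distrib_left sum.distrib[symmetric]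
    by (intro sum_mono) (simp add: sum_distrib_left sum_distrib_right)
qed

lemma semi_elliptic_scale:
  assumes "positive_semi_elliptic m p"
  shows "eval_poly p (\<chi> j. t ^ (kappa m $ j) * z $ j) = t ^ (2 * lcm_vec m) * eval_poly p z"
    and "\<beta> \<in> Poly_Mapping.keys p \<Longrightarrow> wdeg (kappa m) \<beta> = 2 * lcm_vec m"
proof -
  show deg: "wdeg (kappa m) \<beta> = 2 * lcm_vec m" if "\<beta> \<in> Poly_Mapping.keys p" for \<beta>
  proof -
    have "(\<Sum>j\<in>UNIV. real (\<beta> $ j) / real (m $ j)) = 2"
      using assms that by (simp add: positive_semi_elliptic_def)
    then have "(\<Sum>j\<in>UNIV. real (\<beta> $ j) / real (m $ j)) * real (lcm_vec m) = 2 * real (lcm_vec m)" by simp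
    moreover have "real (\<beta> $ j) / real (m $ j) * real (lcm_vec m) = real (\<beta> $ j * kappa m $ j)" for j
      using m1[of j] by (simp flip: kappa_mult[of j])
    ultimately have "real (wdeg (kappa m) \<beta>) = real (2 * lcm_vec m)"
      by (simp add: wdeg_def sum_distrib_right)
    then show ?thesis by (rule of_nat_eq_iff[THEN iffD1])
  qed
  show "eval_poly p (\<chi> j. t ^ (kappa m $ j) * z $ j) = t ^ (2 * lcm_vec m) * eval_poly p z"
    unfolding eval_poly_def monomial_weighted sum_distrib_left
    by (intro sum.cong refl) (simp add: deg mult_ac)
qed

text \<open>Both sides are homogeneous under the dilations with weights \<open>kappa m\<close>, so it suffices to look at
  the compact set where the two values of \<open>quasi\<close> add up to \<open>1\<close>. At \<open>\<nu> = 0\<close> the left side is positive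
  there; by compactness it stays positive while \<open>quasi\<close> of \<open>\<nu>\<close> is small, and a large \<open>M\<close> takes care of
  the rest.\<close>

lemma semi_elliptic_lower_bound:
  assumes p: "positive_semi_elliptic m p"
  shows "\<exists>c>0. \<exists>M>0. \<forall>\<xi> \<nu>. Re (eval_poly p (cplx_vec \<xi> - \<i> *s cplx_vec \<nu>)) \<ge> c * quasi m (cplx_vec \<xi>) - M * quasi m (cplx_vec \<nu>)"
proof -
  have cv: "continuous_on S (\<lambda>x. cplx_vec (fst x) - \<i> *s cplx_vec (snd x))" for S :: "((real ^ 'd) \<times> (real ^ 'd)) set"
    unfolding vector_scalar_mult_def by (intro continuous_intros)
  let ?h = "\<lambda>x. Re (eval_poly p (cplx_vec (fst x) - \<i> *s cplx_vec (snd x)))"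
  let ?q1 = "\<lambda>x. quasi m (cplx_vec (fst x))" and ?q2 = "\<lambda>x. quasi m (cplx_vec (snd x))"
  define S where "S = {x :: (real ^ 'd) \<times> (real ^ 'd). ?q1 x + ?q2 x = 1}"
  have S: "compact S"
  proof (rule compact_quasi)
    show "closed S" unfolding S_def by (intro closed_Collect_eq continuous_intros)
    show "?q1 x \<le> 1 \<and> ?q2 x \<le> 1" if "x \<in> S" for x
      using that quasi_nonneg[of "cplx_vec (fst x)"] quasi_nonneg[of "cplx_vec (snd x)"] by (simp add: S_def)
  qed
  have S0: "compact (S \<inter> {x. ?q2 x = 0})"
    by (intro compact_Int_closed S closed_Collect_eq continuous_intros)
  have pos: "?h x > 0" if "x \<in> S \<inter> {x. ?q2 x = 0}" for x
  proof -
    from that have q: "quasi m (cplx_vec (snd x)) = 0" "quasi m (cplx_vec (fst x)) \<noteq> 0"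
      by (auto simp: S_def)
    then have "cplx_vec (snd x) = 0" "cplx_vec (fst x) \<noteq> 0"
      unfolding quasi_eq_0 .
    then have "?h x = real_part p (fst x)" "fst x \<noteq> 0"
      by (simp add: real_part_def vector_smult_rzero, auto simp: cplx_vec_def vec_eq_iff)
    moreover have "real_part p (fst x) \<ge> 0" "real_part p (fst x) = 0 \<Longrightarrow> fst x = 0"
      using p by (auto simp: positive_semi_elliptic_def pos_definite_def)
    ultimately show ?thesis by fastforce
  qed
  have "\<exists>c>0. \<forall>x\<in>S \<inter> {x. ?q2 x = 0}. ?h x \<ge> 2 * c"
  proof (cases "S \<inter> {x. ?q2 x = 0} = {}")
    case True
    show ?thesis unfolding True by (intro exI[of _ 1]) simp
  next
    case False
    have "continuous_on (S \<inter> {x. ?q2 x = 0}) ?h" by (intro continuous_intros cv)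
    from continuous_attains_inf[OF S0 False this] obtain x0 where x0: "x0 \<in> S \<inter> {x. ?q2 x = 0}"
      "\<forall>x\<in>S \<inter> {x. ?q2 x = 0}. ?h x0 \<le> ?h x" by (rule bexE)
    show ?thesis
    proof (rule exI[of _ "?h x0 / 2"], rule conjI)
      show "?h x0 / 2 > 0" using pos[OF x0(1)] by simp
      show "\<forall>x\<in>S \<inter> {x. ?q2 x = 0}. ?h x \<ge> 2 * (?h x0 / 2)" using x0(2) by simp
    qed
  qed
  then obtain c where c: "c > 0" and c': "\<forall>x\<in>S \<inter> {x. ?q2 x = 0}. ?h x \<ge> 2 * c" by (elim exE conjE)
  let ?g = "\<lambda>x. ?h x - c * ?q1 x"
  have cg: "continuous_on T ?g" for T by (intro continuous_intros cv)
  have S1: "compact (S \<inter> {x. ?g x \<le> 0})"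
    by (intro compact_Int_closed S closed_Collect_le cg continuous_intros)
  have "\<exists>M>0. \<forall>x\<in>S. ?g x + M * ?q2 x \<ge> 0"
  proof (cases "S \<inter> {x. ?g x \<le> 0} = {}")
    case True
    have "?g x + 1 * ?q2 x \<ge> 0" if "x \<in> S" for x
    proof -
      have "\<not> ?g x \<le> 0" using True that by blast
      then show ?thesis using quasi_nonneg[of "cplx_vec (snd x)"] by linarith
    qed
    then show ?thesis by (intro exI[of _ 1]) simp
  next
    case False
    have "continuous_on (S \<inter> {x. ?g x \<le> 0}) ?q2" by (intro continuous_intros)
    from continuous_attains_inf[OF S1 False this] obtain x0 where x0: "x0 \<in> S \<inter> {x. ?g x \<le> 0}"
      and x0': "\<forall>x\<in>S \<inter> {x. ?g x \<le> 0}. ?q2 x0 \<le> ?q2 x" by (rule bexE)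
    from continuous_attains_inf[OF S1 False cg] obtain x1 where 
      x1: "\<forall>x\<in>S \<inter> {x. ?g x \<le> 0}. ?g x1 \<le> ?g x" by (rule bexE)
    have q0: "?q2 x0 > 0"
    proof (rule ccontr)
      assume "\<not> ?q2 x0 > 0"
      then have 0: "?q2 x0 = 0" using quasi_nonneg[of "cplx_vec (snd x0)"] by linarith
      have "x0 \<in> S" using x0 by (rule IntD1)
      then have 1: "?q1 x0 = 1" using 0 by (simp add: S_def)
      have "x0 \<in> S \<inter> {x. ?q2 x = 0}" using \<open>x0 \<in> S\<close> 0 by (intro IntI CollectI)
      with c' have "?h x0 \<ge> 2 * c" by (rule bspec)
      moreover have "?g x0 \<le> 0" using IntD2[OF x0] by (rule CollectD)
      ultimately show False using c unfolding 1 by simp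
    qed
    define M where "M = (\<bar>?g x1\<bar> + 1) / ?q2 x0"
    have M0: "M > 0" using q0 by (simp add: M_def)
    have "?g x + M * ?q2 x \<ge> 0" if "x \<in> S" for x
    proof (cases "?g x \<le> 0")
      case True
      then have xin: "x \<in> S \<inter> {x. ?g x \<le> 0}" using that by (intro IntI CollectI)
      have "M * ?q2 x \<ge> M * ?q2 x0" by (rule mult_left_mono[OF bspec[OF x0' xin] less_imp_le[OF M0]])
      moreover have "M * ?q2 x0 = \<bar>?g x1\<bar> + 1" unfolding M_def using q0 by simp
      ultimately show ?thesis using bspec[OF x1 xin] by linarith
    next
      case False
      then show ?thesis using mult_nonneg_nonneg[OF less_imp_le[OF M0] quasi_nonneg[of "cplx_vec (snd x)"]] by linarith
    qed
    then show ?thesis using M0 by (intro exI[of _ M] conjI ballI)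
  qed
  then obtain M where M: "M > 0" and M': "\<forall>x\<in>S. ?g x + M * ?q2 x \<ge> 0" by (elim exE conjE)
  show ?thesis
  proof (rule exI[of _ c], rule conjI[OF c], rule exI[of _ M], rule conjI[OF M], intro allI)
    fix \<xi> \<nu> :: "real ^ 'd"
    define Q where "Q = quasi m (cplx_vec \<xi>) + quasi m (cplx_vec \<nu>)"
    show "c * quasi m (cplx_vec \<xi>) - M * quasi m (cplx_vec \<nu>) \<le> Re (eval_poly p (cplx_vec \<xi> - \<i> *s cplx_vec \<nu>))"
    proof (cases "Q = 0")
      case True
      then have 0: "quasi m (cplx_vec \<xi>) = 0" "quasi m (cplx_vec \<nu>) = 0"
        using quasi_nonneg[of "cplx_vec \<xi>"] quasi_nonneg[of "cplx_vec \<nu>"] by (auto simp: Q_def)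
      then have "cplx_vec \<xi> = 0" "cplx_vec \<nu> = 0" unfolding quasi_eq_0 .
      moreover have "\<xi> = 0" using \<open>cplx_vec \<xi> = 0\<close> by (simp add: cplx_vec_def vec_eq_iff)
      moreover have "real_part p 0 \<ge> 0" using p by (simp add: positive_semi_elliptic_def pos_definite_def)
      ultimately show ?thesis using 0 by (simp add: real_part_def)
    next
      case False
      then have Q: "Q > 0" using quasi_nonneg[of "cplx_vec \<xi>"] quasi_nonneg[of "cplx_vec \<nu>"] by (simp add: Q_def)
      define t where "t = root (2 * lcm_vec m) (1 / Q)"
      have t: "t > 0" "t ^ (2 * lcm_vec m) = 1 / Q"
        using Q lcm_vec_pos by (auto simp: t_def real_root_pow_pos2)
      define x where "x = ((\<chi> j. t ^ (kappa m $ j) * \<xi> $ j) :: real ^ 'd, (\<chi> j. t ^ (kappa m $ j) * \<nu> $ j) :: real ^ 'd)"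
      have e1: "cplx_vec (fst x) = (\<chi> j. of_real t ^ (kappa m $ j) * cplx_vec \<xi> $ j)"
        and e2: "cplx_vec (snd x) = (\<chi> j. of_real t ^ (kappa m $ j) * cplx_vec \<nu> $ j)"
        by (simp_all add: x_def vec_eq_iff)
      have e3: "cplx_vec (fst x) - \<i> *s cplx_vec (snd x) = (\<chi> j. of_real t ^ (kappa m $ j) * (cplx_vec \<xi> - \<i> *s cplx_vec \<nu>) $ j)"
        unfolding e1 e2 by (simp add: vec_eq_iff right_diff_distrib mult_ac)
      have "?q1 x = t ^ (2 * lcm_vec m) * quasi m (cplx_vec \<xi>)"
        unfolding e1 by (rule quasi_scale[OF less_imp_le[OF t(1)]])
      moreover have "?q2 x = t ^ (2 * lcm_vec m) * quasi m (cplx_vec \<nu>)"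
        unfolding e2 by (rule quasi_scale[OF less_imp_le[OF t(1)]])
      ultimately have q: "?q1 x = quasi m (cplx_vec \<xi>) / Q" "?q2 x = quasi m (cplx_vec \<nu>) / Q"
        by (simp_all add: t(2))
      have "?h x = Re (of_real t ^ (2 * lcm_vec m) * eval_poly p (cplx_vec \<xi> - \<i> *s cplx_vec \<nu>))"
        unfolding e3 by (simp only: semi_elliptic_scale(1)[OF p])
      moreover have "complex_of_real t ^ (2 * lcm_vec m) = complex_of_real (1 / Q)"
        unfolding t(2)[symmetric] by (rule of_real_power[symmetric])
      ultimately have h: "?h x = Re (eval_poly p (cplx_vec \<xi> - \<i> *s cplx_vec \<nu>)) / Q"
        by simp
      have "x \<in> S" using q Q by (simp add: S_def Q_def flip: add_divide_distrib)
      from bspec[OF M' this] have "0 \<le> (Re (eval_poly p (cplx_vec \<xi> - \<i> *s cplx_vec \<nu>)) - c * quasi m (cplx_vec \<xi>) + M * quasi m (cplx_vec \<nu>)) / Q"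
        unfolding q h by (simp add: add_divide_distrib diff_divide_distrib)
      then show ?thesis using Q by (simp add: zero_le_divide_iff)
    qed
  qed
qed

end

section \<open>Exponentials of semi-elliptic polynomials\<close>

text \<open>The bounds of \<open>weighted_exp_bounds\<close> are used with a weighted size \<open>\<rho>\<close> such that
  \<open>\<rho>^(2m) = quasi m z + c1 / n\<close>. The term \<open>c1 / n\<close> allows \<open>\<rho>\<close> to be positive at the origin and costs only
  a constant. A power \<open>\<rho>^l\<close> equals \<open>n^(-l / 2m) (n \<rho>^(2m))^(l / 2m)\<close>; the second factor is absorbed by
  part of the exponential decay of \<open>e^(-n P)\<close>.\<close>

theorem semi_elliptic_estimates:
  fixes p :: "'d::finite cpoly" and f :: "complex ^ 'd \<Rightarrow> complex" and N :: nat
  assumes p: "positive_semi_elliptic m p"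
    and f: "\<forall>\<^sub>F z in nhds 0. cdiff f z" "f 0 = 0" "(\<lambda>\<xi>. norm (f (cplx_vec \<xi>))) \<in> o[at 0](real_part p)"
  defines "q \<equiv> \<lambda>n z. exp_coeff (\<lambda>l. of_nat n * (\<Sum>\<beta> | Lambda_weight m \<beta> = int l. maclaurin f \<beta> * monomial z \<beta>))"
    and "pt \<equiv> \<lambda>\<xi> \<nu>. cplx_vec \<xi> - \<i> *s cplx_vec \<nu>"
    and "E \<equiv> \<lambda>c M \<xi> \<nu>. - (c * quasi m (cplx_vec \<xi>)) + M * quasi m (cplx_vec \<nu>)"
  shows "\<exists>c>0. \<exists>M>0. \<exists>C>0. \<exists>\<delta>>0. \<forall>n\<ge>1. \<forall>\<xi> \<nu>.
     (\<forall>l\<le>N. norm (exp (- (of_nat n * eval_poly p (pt \<xi> \<nu>))) * q n (pt \<xi> \<nu>) l) \<le> C * exp (real n * E c M \<xi> \<nu>)) \<and>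
     (quasi m (pt \<xi> \<nu>) \<le> \<delta> \<longrightarrow>
       norm (exp (- (of_nat n * eval_poly p (pt \<xi> \<nu>))) * (exp (of_nat n * f (pt \<xi> \<nu>)) - (\<Sum>l\<le>N. q n (pt \<xi> \<nu>) l)))
       \<le> C * real n powr (- (real (Suc N) / (2 * real (lcm_vec m)))) * exp (real n * E c M \<xi> \<nu>))"
proof -
  have m1: "m $ j \<ge> 1" for j using p by (simp add: positive_semi_elliptic_def)
  note lcm_vec_pos = lcm_vec_pos[OF m1] and kappa_ge_1 = kappa_ge_1[OF m1]
  let ?mm = "2 * lcm_vec m"
  have mm: "?mm > 0" using lcm_vec_pos by simp
  obtain r where r: "r > 0" and hs: "\<And>z. (\<And>j. norm (z $ j) < r) \<Longrightarrow> ((\<lambda>\<beta>. maclaurin f \<beta> * monomial z \<beta>) has_sum f z) UNIV"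
    using maclaurin_has_sum[OF f(1)] by blast
  have R0: "real_part p x \<ge> 0" for x using p by (simp add: positive_semi_elliptic_def pos_definite_def)
  have Rs: "real_part p (\<chi> j. t ^ (kappa m $ j) * x $ j) = t ^ ?mm * real_part p x" for t x
  proof -
    have "cplx_vec (\<chi> j. t ^ (kappa m $ j) * x $ j) = (\<chi> j. of_real t ^ (kappa m $ j) * cplx_vec x $ j)"
      by (simp add: vec_eq_iff)
    moreover have "complex_of_real t ^ ?mm = complex_of_real (t ^ ?mm)" by simp
    ultimately show ?thesis unfolding real_part_def by (simp only: semi_elliptic_scale(1)[OF m1 p] Re_complex_of_real times_complex.sel Im_complex_of_real mult_zero_left diff_zero)
  qed
  have van: "maclaurin f \<beta> = 0" if "wdeg (kappa m) \<beta> \<le> ?mm" for \<beta>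
  proof (rule weighted_vanishing[OF kappa_ge_1 r hs _ that])
    fix x :: "real ^ 'd"
    let ?c = "\<lambda>t. (\<chi> j. t ^ (kappa m $ j) * x $ j) :: real ^ 'd"
    show "((\<lambda>t. f (cplx_vec (?c t)) / of_real t ^ ?mm) \<longlongrightarrow> 0) (at_right 0)"
    proof (cases "x = 0")
      case True
      then have "cplx_vec (?c t) = 0" for t by (simp add: vec_eq_iff)
      then show ?thesis using f(2) by simp
    next
      case False
      then obtain j where j: "x $ j \<noteq> 0" by (auto simp: vec_eq_iff)
      have "(?c \<longlongrightarrow> (\<chi> j. 0 ^ (kappa m $ j) * x $ j)) (at_right 0)"
        by (intro tendsto_vec_lambda tendsto_intros)
      moreover have "(\<chi> j. 0 ^ (kappa m $ j) * x $ j) = 0"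
      proof -
        have "(0::real) ^ (kappa m $ j) = 0" for j
          by (rule zero_power) (use kappa_ge_1[of j] in linarith)
        then show ?thesis by (simp add: vec_eq_iff)
      qed
      ultimately have "(?c \<longlongrightarrow> 0) (at_right 0)" by simp
      moreover have "\<forall>\<^sub>F t in at_right 0. ?c t \<noteq> 0"
        unfolding eventually_at_right_field
        by (intro exI[of _ 1]) (use j in \<open>auto simp: vec_eq_iff intro!: exI[of _ j]\<close>)
      ultimately have fl: "filterlim ?c (at 0) (at_right 0)" by (simp add: filterlim_at)
      show ?thesis
      proof (rule tendstoI)
        fix e :: real assume e: "e > 0"
        define e1 where "e1 = e / (2 * (1 + real_part p x))"
        have e1: "e1 > 0" using e R0[of x] by (simp add: e1_def)
        have "\<forall>\<^sub>F \<xi> in at 0. norm (norm (f (cplx_vec \<xi>))) \<le> e1 * norm (real_part p \<xi>)"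
          by (rule landau_o.smallD[OF f(3) e1])
        then have "\<forall>\<^sub>F t in at_right 0. norm (norm (f (cplx_vec (?c t)))) \<le> e1 * norm (real_part p (?c t))"
          by (rule eventually_compose_filterlim[OF _ fl])
        moreover have "\<forall>\<^sub>F t in at_right 0. (t::real) > 0"
          by (simp add: eventually_at_right_less)
        ultimately show "\<forall>\<^sub>F t in at_right 0. dist (f (cplx_vec (?c t)) / of_real t ^ ?mm) 0 < e"
        proof eventually_elim
          case (elim t)
          then have "norm (f (cplx_vec (?c t))) \<le> e1 * (t ^ ?mm * real_part p x)"
            using R0[of x] by (simp add: Rs abs_mult)
          then have "norm (f (cplx_vec (?c t)) / of_real t ^ ?mm) \<le> e1 * real_part p x"
            using elim(2) by (simp add: norm_divide norm_power pos_divide_le_eq mult_ac)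
          also have "\<dots> \<le> e / 2" using e R0[of x] by (simp add: e1_def field_simps)
          also have "\<dots> < e" using e by simp
          finally show ?case by simp
        qed
      qed
    qed
  qed
  obtain c0 M0 where c0: "c0 > 0" "M0 > 0" and lower: "\<And>\<xi> \<nu>. c0 * quasi m (cplx_vec \<xi>) - M0 * quasi m (cplx_vec \<nu>) \<le> Re (eval_poly p (pt \<xi> \<nu>))"
    using semi_elliptic_lower_bound[OF m1 p] unfolding pt_def by blast
  define K where "K = (\<Sum>j\<in>UNIV. (2::real) ^ (m $ j))"
  have K: "K > 0" unfolding K_def by (intro sum_pos) auto
  have qs: "quasi m (pt \<xi> \<nu>) \<le> K * (quasi m (cplx_vec \<xi>) + quasi m (cplx_vec \<nu>))" for \<xi> \<nu>
    unfolding pt_def K_def by (rule quasi_sum_le[OF m1])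
  define \<epsilon> where "\<epsilon> = c0 / (4 * K)"
  have \<epsilon>: "\<epsilon> > 0" using c0 K by (simp add: \<epsilon>_def)
  have qeq: "q = (\<lambda>n z. exp_coeff (\<lambda>l. of_nat n * (\<Sum>\<beta> | wdeg (kappa m) \<beta> = ?mm + l. maclaurin f \<beta> * monomial z \<beta>)))"
    unfolding q_def Lambda_weight_iff[OF m1] ..
  obtain s where s: "s > 0" and bounds: "\<And>n z \<rho>. \<rho> > 0 \<Longrightarrow> (\<And>j. norm (z $ j) \<le> \<rho> ^ (kappa m $ j)) \<Longrightarrow>
    (\<forall>l. norm (q n z l) \<le> (\<rho> / s) ^ l * exp (\<epsilon> * (real n * \<rho> ^ ?mm))) \<and>
    (\<rho> \<le> s / 2 \<longrightarrow> (\<forall>N. norm (exp (of_nat n * f z) - (\<Sum>l\<le>N. q n z l)) \<le> 2 * (\<rho> / s) ^ Suc N * exp (\<epsilon> * (real n * \<rho> ^ ?mm))))"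
    using weighted_exp_bounds[OF kappa_ge_1 r hs van \<epsilon>] unfolding qeq by blast
  define a where "a l = real l / real ?mm" for l
  have "\<forall>l. \<exists>D>0. \<forall>y\<ge>0. y powr a l \<le> D * exp (\<epsilon> * y)"
    by (intro allI powr_le_exp \<epsilon>) (simp add: a_def)
  then obtain D where D: "\<And>l. D l > 0" "\<And>l y. y \<ge> 0 \<Longrightarrow> y powr a l \<le> D l * exp (\<epsilon> * y)" by metis
  \<comment> \<open>If \<open>quasi\<close> is at most \<open>c1\<close>, then \<open>\<rho>^(2m) \<le> 2 c1\<close>, that is \<open>\<rho> \<le> s / 2\<close>.\<close>
  define c1 where "c1 = (s / 2) ^ ?mm / 2"
  have c1: "c1 > 0" using s by (simp add: c1_def)
  define CC where "CC = (\<Sum>l\<le>Suc N. 2 * D l / s ^ l * exp (2 * \<epsilon> * c1))"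
  have CC: "2 * D l / s ^ l * exp (2 * \<epsilon> * c1) \<le> CC" if "l \<le> Suc N" for l
  proof -
    have "0 \<le> 2 * D l / s ^ l * exp (2 * \<epsilon> * c1)" for l using D(1)[of l] s by (simp add: less_imp_le)
    then show ?thesis unfolding CC_def by (intro member_le_sum) (use that in auto)
  qed
  have CCpos: "CC > 0" unfolding CC_def using D(1) s by (intro sum_pos) auto
  have main: "2 * (\<rho> / s) ^ l * exp (\<epsilon> * (real n * \<rho> ^ ?mm)) * norm (exp (- (of_nat n * eval_poly p (pt \<xi> \<nu>))))
      \<le> CC * real n powr (- a l) * exp (real n * E (c0 / 2) (M0 + c0 / 2) \<xi> \<nu>)"
    if n: "n \<ge> 1" and l: "l \<le> Suc N" and \<rho>: "\<rho> > 0" "\<rho> ^ ?mm = quasi m (pt \<xi> \<nu>) + c1 / real n" for n l \<rho> \<xi> \<nu>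
  proof -
    define y where "y = real n * \<rho> ^ ?mm"
    have y0: "y \<ge> 0" unfolding y_def using \<rho>(1) by simp
    have y: "y = real n * quasi m (pt \<xi> \<nu>) + c1" unfolding y_def \<rho>(2) using n by (simp add: distrib_left)
    have "\<rho> ^ l = (\<rho> ^ ?mm) powr a l"
      using \<rho>(1) mm by (simp add: a_def powr_powr flip: powr_realpow)
    also have "\<rho> ^ ?mm = y / real n" using n by (simp add: y_def)
    also have "(y / real n) powr a l = y powr a l * real n powr (- a l)"
      using y0 by (simp add: powr_divide powr_minus_divide)
    also have "\<dots> \<le> (D l * exp (\<epsilon> * y)) * real n powr (- a l)"
      by (intro mult_right_mono D y0) auto
    finally have \<rho>l: "\<rho> ^ l \<le> D l * exp (\<epsilon> * y) * real n powr (- a l)" .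
    have "2 * (\<rho> / s) ^ l * exp (\<epsilon> * y) \<le> 2 * (D l * exp (\<epsilon> * y) * real n powr (- a l) / s ^ l) * exp (\<epsilon> * y)"
      unfolding power_divide using \<rho>l s by (intro mult_right_mono mult_left_mono divide_right_mono) auto
    also have "\<dots> = (2 * D l / s ^ l) * real n powr (- a l) * exp (2 * \<epsilon> * y)"
    proof -
      have "exp (2 * \<epsilon> * y) = exp (\<epsilon> * y) * exp (\<epsilon> * y)" unfolding exp_add[symmetric] by simp
      then show ?thesis by simp
    qed
    also have "exp (2 * \<epsilon> * y) = exp (2 * \<epsilon> * c1) * exp (2 * \<epsilon> * (real n * quasi m (pt \<xi> \<nu>)))"
      unfolding exp_add[symmetric] y by (simp add: algebra_simps)
    also have "(2 * D l / s ^ l) * real n powr (- a l) * (exp (2 * \<epsilon> * c1) * exp (2 * \<epsilon> * (real n * quasi m (pt \<xi> \<nu>))))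
      = (2 * D l / s ^ l * exp (2 * \<epsilon> * c1)) * real n powr (- a l) * exp (2 * \<epsilon> * (real n * quasi m (pt \<xi> \<nu>)))" by simp
    also have "\<dots> \<le> CC * real n powr (- a l) * exp (2 * \<epsilon> * (real n * quasi m (pt \<xi> \<nu>)))"
      by (intro mult_right_mono CC l) auto
    finally have 1: "2 * (\<rho> / s) ^ l * exp (\<epsilon> * y) \<le> CC * real n powr (- a l) * exp (2 * \<epsilon> * (real n * quasi m (pt \<xi> \<nu>)))" .
    have 2: "norm (exp (- (of_nat n * eval_poly p (pt \<xi> \<nu>)))) \<le> exp (real n * (- (c0 * quasi m (cplx_vec \<xi>)) + M0 * quasi m (cplx_vec \<nu>)))"
      unfolding norm_exp_eq_Re using mult_left_mono[OF lower[of \<xi> \<nu>], of "real n"] by (simp add: algebra_simps)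
    have "2 * \<epsilon> * (real n * quasi m (pt \<xi> \<nu>)) \<le> 2 * \<epsilon> * (real n * (K * (quasi m (cplx_vec \<xi>) + quasi m (cplx_vec \<nu>))))"
      using \<epsilon> by (intro mult_left_mono qs) auto
    also have "\<dots> = real n * (c0 / 2 * (quasi m (cplx_vec \<xi>) + quasi m (cplx_vec \<nu>)))"
      using K by (simp add: \<epsilon>_def field_simps)
    finally have 3: "2 * \<epsilon> * (real n * quasi m (pt \<xi> \<nu>)) + real n * (- (c0 * quasi m (cplx_vec \<xi>)) + M0 * quasi m (cplx_vec \<nu>))
       \<le> real n * E (c0 / 2) (M0 + c0 / 2) \<xi> \<nu>"
      by (simp add: E_def algebra_simps)
    have "2 * (\<rho> / s) ^ l * exp (\<epsilon> * y) * norm (exp (- (of_nat n * eval_poly p (pt \<xi> \<nu>))))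
      \<le> (CC * real n powr (- a l) * exp (2 * \<epsilon> * (real n * quasi m (pt \<xi> \<nu>)))) * exp (real n * (- (c0 * quasi m (cplx_vec \<xi>)) + M0 * quasi m (cplx_vec \<nu>)))"
      by (intro mult_mono 1 2) (use CCpos in auto)
    also have "\<dots> = CC * real n powr (- a l) * exp (2 * \<epsilon> * (real n * quasi m (pt \<xi> \<nu>)) + real n * (- (c0 * quasi m (cplx_vec \<xi>)) + M0 * quasi m (cplx_vec \<nu>)))"
      by (simp add: exp_add mult_ac)
    also have "\<dots> \<le> CC * real n powr (- a l) * exp (real n * E (c0 / 2) (M0 + c0 / 2) \<xi> \<nu>)"
      using 3 CCpos by (intro mult_left_mono) auto
    finally show ?thesis by (simp add: y_def)
  qed
  have c0': "c0 / 2 > 0" "M0 + c0 / 2 > 0" using c0 by auto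
  show ?thesis
  proof (rule exI[of _ "c0 / 2"], rule conjI[OF c0'(1)], rule exI[of _ "M0 + c0 / 2"], rule conjI[OF c0'(2)],
      rule exI[of _ CC], rule conjI[OF CCpos], rule exI[of _ c1], rule conjI[OF c1], intro allI impI conjI)
    fix n :: nat and \<xi> \<nu> :: "real ^ 'd"
    assume n: "n \<ge> 1"
    define \<rho> where "\<rho> = root ?mm (quasi m (pt \<xi> \<nu>) + c1 / real n)"
    have pos: "quasi m (pt \<xi> \<nu>) + c1 / real n > 0"
      using quasi_nonneg[OF m1, of "pt \<xi> \<nu>"] c1 n by (simp add: add_nonneg_pos)
    have \<rho>: "\<rho> > 0" "\<rho> ^ ?mm = quasi m (pt \<xi> \<nu>) + c1 / real n"
      using pos mm unfolding \<rho>_def by (simp_all add: real_root_pow_pos2)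
    have "quasi m (pt \<xi> \<nu>) \<le> \<rho> ^ ?mm" using \<rho>(2) c1 n by simp
    then have comp: "norm (pt \<xi> \<nu> $ j) \<le> \<rho> ^ (kappa m $ j)" for j
      using quasi_bound[OF m1, of \<rho>] \<rho> by simp
    let ?X = "norm (exp (- (of_nat n * eval_poly p (pt \<xi> \<nu>))))"
    show "norm (exp (- (of_nat n * eval_poly p (pt \<xi> \<nu>))) * q n (pt \<xi> \<nu>) l) \<le> CC * exp (real n * E (c0 / 2) (M0 + c0 / 2) \<xi> \<nu>)"
      if l: "l \<le> N" for l
    proof -
      have "norm (q n (pt \<xi> \<nu>) l) \<le> (\<rho> / s) ^ l * exp (\<epsilon> * (real n * \<rho> ^ ?mm))"
        using bounds[OF \<rho>(1) comp] by blast
      also have "\<dots> \<le> 2 * (\<rho> / s) ^ l * exp (\<epsilon> * (real n * \<rho> ^ ?mm))"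
        using \<rho> s by simp
      finally have "norm (q n (pt \<xi> \<nu>) l) * ?X \<le> 2 * (\<rho> / s) ^ l * exp (\<epsilon> * (real n * \<rho> ^ ?mm)) * ?X"
        by (intro mult_right_mono) auto
      also have "\<dots> \<le> CC * real n powr (- a l) * exp (real n * E (c0 / 2) (M0 + c0 / 2) \<xi> \<nu>)"
        by (rule main[OF n _ \<rho>]) (use l in auto)
      also have "\<dots> \<le> CC * 1 * exp (real n * E (c0 / 2) (M0 + c0 / 2) \<xi> \<nu>)"
      proof (intro mult_right_mono mult_left_mono)
        have "real n powr (- a l) \<le> real n powr 0" using n by (intro powr_mono) (auto simp: a_def)
        then show "real n powr (- a l) \<le> 1" using n by simp
      qed (use CCpos in auto)
      finally show ?thesis by (simp add: norm_mult mult.commute)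
    qed
    show "norm (exp (- (of_nat n * eval_poly p (pt \<xi> \<nu>))) * (exp (of_nat n * f (pt \<xi> \<nu>)) - (\<Sum>l\<le>N. q n (pt \<xi> \<nu>) l)))
       \<le> CC * real n powr (- (real (Suc N) / (2 * real (lcm_vec m)))) * exp (real n * E (c0 / 2) (M0 + c0 / 2) \<xi> \<nu>)"
      if small: "quasi m (pt \<xi> \<nu>) \<le> c1"
    proof -
      have "\<rho> ^ ?mm \<le> c1 + c1" unfolding \<rho>(2) using small c1 n
        by (intro add_mono) (auto simp: divide_le_eq)
      also have "\<dots> = (s / 2) ^ ?mm" by (simp add: c1_def)
      finally have "\<rho> \<le> s / 2" using s \<rho>(1) mm by (subst (asm) power_mono_iff) auto
      then have "norm (exp (of_nat n * f (pt \<xi> \<nu>)) - (\<Sum>l\<le>N. q n (pt \<xi> \<nu>) l)) \<le> 2 * (\<rho> / s) ^ Suc N * exp (\<epsilon> * (real n * \<rho> ^ ?mm))"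
        using bounds[OF \<rho>(1) comp] by blast
      then have "norm (exp (of_nat n * f (pt \<xi> \<nu>)) - (\<Sum>l\<le>N. q n (pt \<xi> \<nu>) l)) * ?X \<le> 2 * (\<rho> / s) ^ Suc N * exp (\<epsilon> * (real n * \<rho> ^ ?mm)) * ?X"
        by (intro mult_right_mono) auto
      also have "\<dots> \<le> CC * real n powr (- a (Suc N)) * exp (real n * E (c0 / 2) (M0 + c0 / 2) \<xi> \<nu>)"
        by (rule main[OF n _ \<rho>]) auto
      finally show ?thesis by (simp add: norm_mult mult.commute a_def)
    qed
  qed
qed

section \<open>Shifting the domain of integration into the complex domain\<close>

lemma continuous_compact_support:
  fixes f :: "real ^ 'd::finite \<Rightarrow> complex"
  assumes c: "continuous_on UNIV f" and z: "\<And>x. norm x \<ge> \<rho> \<Longrightarrow> f x = 0"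
    and B: "\<And>x. norm x \<le> \<rho> \<Longrightarrow> x \<in> B"
  shows "integrable lborel f" "integral B f = integral\<^sup>L lborel f"
proof -
  have "integrable lborel (\<lambda>x. indicator (cball 0 \<rho>) x *\<^sub>R f x)"
    by (rule borel_integrable_compact) (auto intro: continuous_on_subset[OF c])
  moreover have "(\<lambda>x. indicator (cball 0 \<rho>) x *\<^sub>R f x) = f"
    using z by (auto simp: fun_eq_iff indicator_def)
  ultimately show i: "integrable lborel f" by simp
  have "f x = 0" if "x \<notin> B" for x
    using z[of x] B[of x] that by linarith
  then have "(\<lambda>x. if x \<in> B then f x else 0) = f" by (auto simp: fun_eq_iff)
  then have "integral B f = integral UNIV f" 
    by (subst integral_restrict_UNIV[symmetric]) simp
  then show "integral B f = integral\<^sup>L lborel f" using integral_lborel[OF i] by simp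
qed

lemma continuous_glue:
  fixes E :: "'a::real_normed_vector \<Rightarrow> complex" and \<theta> :: "'b::real_normed_vector \<Rightarrow> real"
  assumes E: "\<And>p. p \<in> A \<Longrightarrow> norm (g p) \<le> \<rho> \<Longrightarrow> continuous (at p within A) E"
    and \<theta>: "continuous_on UNIV \<theta>" "\<And>x. norm x \<ge> \<rho> \<Longrightarrow> \<theta> x = 0" and g: "continuous_on A g"
  shows "continuous_on A (\<lambda>p. of_real (\<theta> (g p)) * E p)"
  unfolding continuous_on_eq_continuous_within
proof
  fix p assume p: "p \<in> A"
  show "continuous (at p within A) (\<lambda>p. of_real (\<theta> (g p)) * E p)"
  proof (cases "norm (g p) \<le> \<rho>")
    case True
    have "continuous_on A (\<lambda>p. \<theta> (g p))" using continuous_on_compose2[OF \<theta>(1) g] by simp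
    then have "continuous (at p within A) (\<lambda>p. complex_of_real (\<theta> (g p)))"
      using p by (auto simp: continuous_on_eq_continuous_within intro!: continuous_of_real)
    then show ?thesis using E[OF p True] by (rule continuous_mult)
  next
    case False
    have "continuous_on A (\<lambda>p. norm (g p))" using g by (rule continuous_on_norm)
    then have "((\<lambda>p. norm (g p)) \<longlongrightarrow> norm (g p)) (at p within A)"
      using p by (auto simp: continuous_on_def)
    then have "\<forall>\<^sub>F q in at p within A. norm (g q) > \<rho>" using False by (auto simp: order_tendsto_iff)
    then have "\<forall>\<^sub>F q in at p within A. of_real (\<theta> (g q)) * E q = 0"
      by eventually_elim (simp add: \<theta>(2))
    moreover have "of_real (\<theta> (g p)) * E p = 0" using False by (simp add: \<theta>(2))
    ultimately have "\<forall>\<^sub>F q in at p within A. of_real (\<theta> (g q)) * E q = of_real (\<theta> (g p)) * E p"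
      by (simp only:)
    then show ?thesis unfolding continuous_within by (rule tendsto_eventually)
  qed
qed

lemma lborel_integral_translate:
  fixes f :: "'a::euclidean_space \<Rightarrow> complex"
  assumes [measurable]: "f \<in> borel_measurable borel"
  shows "(LINT x|lborel. f (x + c)) = (LINT x|lborel. f x)"
proof -
  have "(LINT x|lborel. f x) = (LINT x|distr lborel borel ((+) c). f x)" by (simp add: lborel_distr_plus)
  also have "\<dots> = (LINT x|lborel. f (c + x))"
    by (intro integral_distr) auto
  finally show ?thesis by (simp add: add.commute)
qed

text \<open>Translation invariance: the integral of \<open>\<Psi>(x + t \<nu>)\<close> does not depend on \<open>t\<close>, and it may be
  differentiated under the integral sign at \<open>t = 0\<close>.\<close>

lemma integral_directional_derivative_zero:
  fixes \<Psi> :: "real ^ 'd::finite \<Rightarrow> complex"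
  assumes c: "continuous_on UNIV \<Psi>" and c': "continuous_on UNIV \<Psi>'"
    and z: "\<And>x. norm x \<ge> \<rho> \<Longrightarrow> \<Psi> x = 0" and z': "\<And>x. norm x \<ge> \<rho> \<Longrightarrow> \<Psi>' x = 0"
    and d: "\<And>x. ((\<lambda>t. \<Psi> (x + t *\<^sub>R \<nu>)) has_vector_derivative \<Psi>' x) (at 0)"
  shows "(LINT x|lborel. \<Psi>' x) = 0"
proof -
  define R where "R = \<bar>\<rho>\<bar> + norm \<nu>"
  define b :: "real ^ 'd" where "b = (\<chi> j. R)"
  let ?B = "cbox (- b) b"
  have B: "x \<in> ?B" if "norm x \<le> R" for x
  proof -
    have "\<bar>x $ j\<bar> \<le> R" for j using that component_le_norm_cart[of x j] by linarith
    then show ?thesis by (simp add: mem_box_cart b_def abs_le_iff) (metis minus_le_iff)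
  qed
  have zt: "\<Psi> (x + t *\<^sub>R \<nu>) = 0" if "norm x \<ge> R" "t \<in> {-1..1}" for x t
  proof (rule z)
    have "norm (t *\<^sub>R \<nu>) \<le> 1 * norm \<nu>" using that unfolding norm_scaleR by (intro mult_right_mono) auto
    then show "\<rho> \<le> norm (x + t *\<^sub>R \<nu>)"
      using norm_triangle_ineq4[of "x + t *\<^sub>R \<nu>" "t *\<^sub>R \<nu>"] that by (simp add: R_def)
  qed
  have dt: "((\<lambda>t. \<Psi> (x + t *\<^sub>R \<nu>)) has_vector_derivative \<Psi>' (x + t *\<^sub>R \<nu>)) (at t within S)" for x t S
  proof -
    have "((\<lambda>s. \<Psi> ((x + t *\<^sub>R \<nu>) + s *\<^sub>R \<nu>)) has_vector_derivative \<Psi>' (x + t *\<^sub>R \<nu>)) (at (t + (- t)))"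
      using d[of "x + t *\<^sub>R \<nu>"] by simp
    moreover have "((\<lambda>s. s + (- t)) has_vector_derivative 1) (at t)"
      by (auto intro!: derivative_eq_intros)
    ultimately have "((\<lambda>s. \<Psi> ((x + t *\<^sub>R \<nu>) + s *\<^sub>R \<nu>)) \<circ> (\<lambda>s. s + (- t)) has_vector_derivative (1 *\<^sub>R \<Psi>' (x + t *\<^sub>R \<nu>))) (at t)"
      by (intro vector_diff_chain_at)
    moreover have "x + t *\<^sub>R \<nu> + (s + - t) *\<^sub>R \<nu> = x + s *\<^sub>R \<nu>" for s
      by (simp add: scaleR_left_diff_distrib)
    ultimately have "((\<lambda>s. \<Psi> (x + s *\<^sub>R \<nu>)) has_vector_derivative \<Psi>' (x + t *\<^sub>R \<nu>)) (at t)"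
      by (simp only: o_def scaleR_one)
    then show ?thesis by (rule has_vector_derivative_at_within)
  qed
  have const: "integral ?B (\<lambda>x. \<Psi> (x + t *\<^sub>R \<nu>)) = (LINT x|lborel. \<Psi> x)" if "t \<in> {-1..1}" for t
  proof -
    have "continuous_on UNIV (\<lambda>x. \<Psi> (x + t *\<^sub>R \<nu>))"
      by (rule continuous_on_compose2[OF c]) (auto intro!: continuous_intros)
    then have "integral ?B (\<lambda>x. \<Psi> (x + t *\<^sub>R \<nu>)) = (LINT x|lborel. \<Psi> (x + t *\<^sub>R \<nu>))"
      by (rule continuous_compact_support(2)[where \<rho> = R]) (use zt B that in auto)
    then show ?thesis using c by (simp add: lborel_integral_translate borel_measurable_continuous_onI)
  qed
  have "((\<lambda>t. integral ?B (\<lambda>x. \<Psi> (x + t *\<^sub>R \<nu>))) has_vector_derivative integral ?B (\<lambda>x. \<Psi>' (x + 0 *\<^sub>R \<nu>))) (at 0 within {-1..1})"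
  proof (rule leibniz_rule_vector_derivative)
    show "((\<lambda>t. \<Psi> (x + t *\<^sub>R \<nu>)) has_vector_derivative \<Psi>' (x + t *\<^sub>R \<nu>)) (at t within {-1..1})" for x t
      by (rule dt)
    show "(\<lambda>x. \<Psi> (x + t *\<^sub>R \<nu>)) integrable_on ?B" for t
      by (rule integrable_continuous, rule continuous_on_compose2[OF c]) (auto intro!: continuous_intros)
    show "continuous_on ({-1..1} \<times> ?B) (\<lambda>(t, x). \<Psi>' (x + t *\<^sub>R \<nu>))"
      unfolding case_prod_beta by (rule continuous_on_compose2[OF c']) (auto intro!: continuous_intros)
  qed auto
  moreover have "((\<lambda>t. integral ?B (\<lambda>x. \<Psi> (x + t *\<^sub>R \<nu>))) has_vector_derivative 0) (at 0 within {-1..1})"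
    by (rule has_vector_derivative_transform[OF _ const]) auto
  ultimately have "integral ?B \<Psi>' = 0"
    using vector_derivative_unique_within[of 0 "{-1..1::real}"] by (simp add: trivial_limit_within)
  moreover have "integral ?B \<Psi>' = (LINT x|lborel. \<Psi>' x)"
    by (rule continuous_compact_support(2)[OF c' z']) (assumption, rule B, use norm_ge_zero[of \<nu>] abs_ge_self[of \<rho>] R_def in linarith)
  ultimately show ?thesis by simp
qed

text \<open>Let \<open>J(s)\<close> be the integral of \<open>\<theta>(x) D(x - i s \<nu>)\<close>. By complex differentiability \<open>J'(s)\<close> is
  \<open>-i\<close> times the integral of \<open>\<theta>\<close> against the directional derivative of \<open>D\<close>; an integration by parts
  moves the derivative to \<open>\<theta>\<close>. No boundary terms occur, in contrast to a deformation of contours in each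
  coordinate.\<close>

theorem shift_bound:
  fixes D :: "complex ^ 'd::finite \<Rightarrow> complex" and \<nu> :: "real ^ 'd" and \<theta> :: "real ^ 'd \<Rightarrow> real"
  defines "pt \<equiv> \<lambda>s x. cplx_vec x - (\<i> * complex_of_real s) *s cplx_vec \<nu>"
  assumes \<theta>: "\<And>x. (\<theta> has_derivative d\<theta> x) (at x)" "continuous_on UNIV (\<lambda>x. d\<theta> x \<nu>)"
    "\<And>x. norm x \<ge> \<rho> \<Longrightarrow> \<theta> x = 0" "\<And>x. norm x \<ge> \<rho> \<Longrightarrow> d\<theta> x \<nu> = 0"
    and W: "open W" "\<And>z. z \<in> W \<Longrightarrow> cdiff D z"
      "\<And>x s. norm x \<le> \<rho> \<Longrightarrow> 0 \<le> s \<Longrightarrow> s \<le> 1 \<Longrightarrow> pt s x \<in> W"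
    and \<beta>: "integrable lborel \<beta>"
      "\<And>x s. 0 \<le> s \<Longrightarrow> s \<le> 1 \<Longrightarrow> norm (of_real (d\<theta> x \<nu>) * D (pt s x)) \<le> \<beta> x"
  shows "norm ((LINT x|lborel. of_real (\<theta> x) * D (pt 1 x)) - (LINT x|lborel. of_real (\<theta> x) * D (cplx_vec x)))
    \<le> (LINT x|lborel. \<beta> x)"
proof -
  let ?v = "cplx_vec \<nu>"
  let ?dD = "ddir D ?v"
  define b :: "real ^ 'd" where "b = (\<chi> j. \<rho>)"
  let ?B = "cbox (- b) b"
  have B: "x \<in> ?B" if "norm x \<le> \<rho>" for x
  proof -
    have "\<bar>x $ j\<bar> \<le> \<rho>" for j using that component_le_norm_cart[of x j] by linarith
    then show ?thesis by (simp add: mem_box_cart b_def abs_le_iff) (metis minus_le_iff)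
  qed
  have c\<theta>: "continuous_on UNIV \<theta>"
    by (rule continuous_at_imp_continuous_on) (simp add: has_derivative_continuous[OF \<theta>(1)])
  have cD: "continuous_on W D"
    by (rule continuous_at_imp_continuous_on) (simp add: cdiff_isCont[OF W(2)])
  have cdD: "continuous_on W ?dD" by (rule continuous_on_ddir[OF W(1,2)])
  have cpt: "continuous_on S (\<lambda>p. pt (fst p) (snd p))" for S
    unfolding pt_def vector_scalar_mult_def by (intro continuous_intros)
  have cpt1: "continuous_on S (pt s)" for S s
    unfolding pt_def vector_scalar_mult_def by (intro continuous_intros)
  have contE: "continuous (at p within A) (\<lambda>p. G (pt (fst p) (snd p)))" 
    if "p \<in> A" "norm (snd p) \<le> \<rho>" "A \<subseteq> {0..1} \<times> UNIV" "continuous_on W G" for p A and G :: "_ \<Rightarrow> complex"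
  proof -
    have "p \<in> {0..1} \<times> UNIV" using that(1,3) by blast
    then have "pt (fst p) (snd p) \<in> W" by (intro W(3)[OF that(2)]) auto
    then have "isCont G (pt (fst p) (snd p))" using that(4) W(1) by (simp add: continuous_on_eq_continuous_at)
    moreover have "continuous (at p within A) (\<lambda>p. pt (fst p) (snd p))"
      using cpt[of A] that(1) by (simp add: continuous_on_eq_continuous_within)
    ultimately show ?thesis using continuous_within_compose3 by fast
  qed
  have contE1: "isCont (\<lambda>x. G (pt s x)) x" 
    if "norm x \<le> \<rho>" "0 \<le> s" "s \<le> 1" "continuous_on W G" for x s and G :: "_ \<Rightarrow> complex"
  proof -
    have "isCont G (pt s x)" using that W(1,3) by (simp add: continuous_on_eq_continuous_at)
    moreover have "isCont (pt s) x" using cpt1[of UNIV s] by (simp add: continuous_on_eq_continuous_at)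
    ultimately show ?thesis by (rule isCont_o2[rotated])
  qed
  have line: "pt s x + w *s ?v = cplx_vec x + (w - \<i> * complex_of_real s) *s ?v" for s x w
    by (simp add: pt_def vec_eq_iff algebra_simps)
  define J where "J s = integral ?B (\<lambda>x. of_real (\<theta> x) * D (pt s x))" for s
  define J' where "J' s = integral ?B (\<lambda>x. of_real (\<theta> x) * (- \<i> * ?dD (pt s x)))" for s
  have JL: "J s = (LINT x|lborel. of_real (\<theta> x) * D (pt s x))" if "0 \<le> s" "s \<le> 1" for s
    unfolding J_def
    by (rule continuous_compact_support(2)[where \<rho>=\<rho>], rule continuous_glue[where \<rho>=\<rho> and g="\<lambda>x. x"])
       (use contE1 cD that c\<theta> \<theta>(3) B in auto)
  have J'der: "(J has_vector_derivative J' s) (at s within {0..1})" if s: "s \<in> {0..1}" for s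
    unfolding J_def[abs_def] J'_def
  proof (rule leibniz_rule_vector_derivative[OF _ _ _ s])
    fix s x assume s: "s \<in> {0..1::real}" and "x \<in> ?B"
    show "((\<lambda>s. of_real (\<theta> x) * D (pt s x)) has_vector_derivative of_real (\<theta> x) * (- \<i> * ?dD (pt s x))) (at s within {0..1})"
    proof (cases "norm x \<le> \<rho>")
      case True
      have pe: "pt s x = cplx_vec x + (- \<i> * of_real s) *s ?v" for s
        using line[of s x 0] by simp
      have "pt s x \<in> W" using W(3)[OF True] s by simp
      then have "((\<lambda>w. D (cplx_vec x + w *s ?v)) has_field_derivative ?dD (pt s x)) (at (- \<i> * of_real s))"
        using cdiff_line[of D "cplx_vec x" "- \<i> * of_real s" ?v] W(2) unfolding pe by simp
      moreover have "((\<lambda>s. - \<i> * complex_of_real s) has_vector_derivative - \<i>) (at s within {0..1})"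
        by (auto intro!: derivative_eq_intros simp: has_vector_derivative_def scaleR_conv_of_real)
      ultimately have "((\<lambda>w. D (cplx_vec x + w *s ?v)) \<circ> (\<lambda>s. - \<i> * complex_of_real s) has_vector_derivative - \<i> * ?dD (pt s x)) (at s within {0..1})"
        by (intro field_vector_diff_chain_within) (auto intro: has_field_derivative_at_within)
      then show ?thesis unfolding pe o_def by (rule has_vector_derivative_mult_right)
    next
      case False
      then show ?thesis by (simp add: \<theta>(3))
    qed
  next
    fix s :: real assume s: "s \<in> {0..1}"
    show "(\<lambda>x. of_real (\<theta> x) * D (pt s x)) integrable_on ?B"
      by (rule integrable_continuous, rule continuous_glue[where \<rho>=\<rho> and g="\<lambda>x. x"])
        (use contE1[OF _ _ _ cD] s c\<theta> \<theta>(3) in \<open>auto intro: continuous_at_imp_continuous_at_within\<close>)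
  next
    show "continuous_on ({0..1} \<times> ?B) (\<lambda>(s, x). of_real (\<theta> x) * (- \<i> * ?dD (pt s x)))"
      unfolding case_prod_beta
    proof (rule continuous_glue[where \<rho>=\<rho> and g=snd])
      have "continuous_on W (\<lambda>z. - \<i> * ?dD z)" by (intro continuous_intros cdD)
      then show "continuous (at p within {0..1} \<times> ?B) (\<lambda>p. - \<i> * ?dD (pt (fst p) (snd p)))"
        if "p \<in> {0..1} \<times> ?B" "norm (snd p) \<le> \<rho>" for p
        using contE[OF that] by blast
    qed (use c\<theta> \<theta>(3) in \<open>auto intro: continuous_on_snd\<close>)
  qed auto
  have J'b: "norm (J' s) \<le> (LINT x|lborel. \<beta> x)" if s: "0 \<le> s" "s \<le> 1" for s
  proof -
    define \<Psi> where "\<Psi> x = of_real (\<theta> x) * D (pt s x)" for x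
    define \<Psi>1 where "\<Psi>1 x = of_real (d\<theta> x \<nu>) * D (pt s x)" for x
    define \<Psi>2 where "\<Psi>2 x = of_real (\<theta> x) * ?dD (pt s x)" for x
    have c: "continuous_on UNIV \<Psi>" "continuous_on UNIV \<Psi>1" "continuous_on UNIV \<Psi>2"
      unfolding \<Psi>_def \<Psi>1_def \<Psi>2_def
      using contE1[OF _ s cD] contE1[OF _ s cdD] c\<theta> \<theta>(2-4)
      by (auto intro!: continuous_glue[where \<rho>=\<rho> and g="\<lambda>x. x"] continuous_glue[where \<rho>=\<rho> and g="\<lambda>x. x" and \<theta> = "\<lambda>x. d\<theta> x \<nu>"])
    have i: "integrable lborel \<Psi>1" "integrable lborel \<Psi>2"
      using c \<theta>(3,4) by (auto intro!: continuous_compact_support(1)[where \<rho>=\<rho> and B=UNIV] simp: \<Psi>1_def \<Psi>2_def)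
    have "(LINT x|lborel. \<Psi>1 x + \<Psi>2 x) = 0"
    proof (rule integral_directional_derivative_zero[OF c(1), where \<rho>=\<rho> and \<nu>=\<nu>])
      show "continuous_on UNIV (\<lambda>x. \<Psi>1 x + \<Psi>2 x)" using c by (intro continuous_intros)
      show "norm x \<ge> \<rho> \<Longrightarrow> \<Psi> x = 0" "norm x \<ge> \<rho> \<Longrightarrow> \<Psi>1 x + \<Psi>2 x = 0" for x
        by (auto simp: \<Psi>_def \<Psi>1_def \<Psi>2_def \<theta>(3,4))
      fix x
      show "((\<lambda>t. \<Psi> (x + t *\<^sub>R \<nu>)) has_vector_derivative \<Psi>1 x + \<Psi>2 x) (at 0)"
      proof (cases "norm x \<le> \<rho>")
        case True
        have pe: "pt s (x + t *\<^sub>R \<nu>) = pt s x + complex_of_real t *s ?v" for t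
          by (simp add: pt_def cplx_vec_add cplx_vec_scaleR)
        have "pt s x \<in> W" by (rule W(3)[OF True s])
        then have "((\<lambda>w. D (pt s x + w *s ?v)) has_field_derivative ?dD (pt s x)) (at (complex_of_real 0))"
          using cdiff_line[of D "pt s x" 0 ?v] W(2) by simp
        moreover have "(complex_of_real has_vector_derivative 1) (at 0)"
          by (auto intro!: derivative_eq_intros simp: has_vector_derivative_def scaleR_conv_of_real)
        ultimately have "((\<lambda>w. D (pt s x + w *s ?v)) \<circ> complex_of_real has_vector_derivative 1 * ?dD (pt s x)) (at 0)"
          by (intro field_vector_diff_chain_at) auto
        then have 1: "((\<lambda>t. D (pt s (x + t *\<^sub>R \<nu>))) has_vector_derivative ?dD (pt s x)) (at 0)"
          unfolding pe o_def by simp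
        have "((\<lambda>t. \<theta> (x + t *\<^sub>R \<nu>)) has_derivative (\<lambda>t. d\<theta> x (t *\<^sub>R \<nu>))) (at 0)"
          by (rule has_derivative_compose[where g=\<theta>]) (use \<theta>(1)[of x] in \<open>auto intro!: derivative_eq_intros\<close>)
        moreover have "d\<theta> x (t *\<^sub>R \<nu>) = t *\<^sub>R d\<theta> x \<nu>" for t
          by (rule linear_cmul[OF has_derivative_linear[OF \<theta>(1)]])
        ultimately have "((\<lambda>t. complex_of_real (\<theta> (x + t *\<^sub>R \<nu>))) has_vector_derivative complex_of_real (d\<theta> x \<nu>)) (at 0)"
          unfolding has_vector_derivative_def using has_derivative_of_real[of _ _ "at 0"] by (fastforce simp: scaleR_conv_of_real)
        from has_vector_derivative_mult[OF this 1] show ?thesis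
          unfolding \<Psi>_def \<Psi>1_def \<Psi>2_def by (simp add: add.commute)
      next
        case False
        have "((\<lambda>t. norm (x + t *\<^sub>R \<nu>)) \<longlongrightarrow> norm (x + 0 *\<^sub>R \<nu>)) (nhds 0)"
          by (intro tendsto_intros) (simp add: filterlim_ident)
        then have "\<forall>\<^sub>F t in nhds 0. norm (x + t *\<^sub>R \<nu>) > \<rho>" using False by (auto simp: order_tendsto_iff)
        then have ev: "\<forall>\<^sub>F t in nhds 0. (0::complex) = \<Psi> (x + t *\<^sub>R \<nu>)"
          by eventually_elim (simp add: \<Psi>_def \<theta>(3))
        have "\<Psi>1 x + \<Psi>2 x = 0" using False by (simp add: \<Psi>1_def \<Psi>2_def \<theta>(3,4))
        then show ?thesis
          unfolding has_vector_derivative_def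
          using has_derivative_transform_eventually[OF has_derivative_const[of 0 "at 0"], of "\<lambda>t. \<Psi> (x + t *\<^sub>R \<nu>)"]
            eventually_nhds_x_imp_x[OF ev] ev by (simp add: eventually_at_filter eventually_mono)
      qed
    qed
    then have eq: "(LINT x|lborel. \<Psi>2 x) = - (LINT x|lborel. \<Psi>1 x)"
      using i by (simp add: add_eq_0_iff)
    have "J' s = (LINT x|lborel. - \<i> * \<Psi>2 x)"
      unfolding J'_def \<Psi>2_def
      by (subst continuous_compact_support(2)[where \<rho>=\<rho>])
         (use c(3) \<theta>(3) B in \<open>auto simp: \<Psi>2_def mult_ac intro: continuous_on_eq[OF continuous_on_mult[OF continuous_on_const[of _ "- \<i>"] c(3)]]\<close>)
    also have "\<dots> = \<i> * (LINT x|lborel. \<Psi>1 x)" using eq by simp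
    finally have 1: "norm (J' s) = norm (LINT x|lborel. \<Psi>1 x)" by (simp add: norm_mult)
    have 2: "norm (LINT x|lborel. \<Psi>1 x) \<le> (LINT x|lborel. norm (\<Psi>1 x))" by (rule integral_norm_bound)
    have 3: "(LINT x|lborel. norm (\<Psi>1 x)) \<le> (LINT x|lborel. \<beta> x)"
      by (rule integral_mono[OF integrable_norm[OF i(1)] \<beta>(1)]) (simp only: \<Psi>1_def \<beta>(2)[OF s])
    show ?thesis using 1 2 3 by linarith
  qed
  have "norm (J 1 - J 0) \<le> (LINT x|lborel. \<beta> x) * norm (1 - 0 :: real)"
  proof (rule differentiable_bound[of "{0..1::real}" J "\<lambda>s t. t *\<^sub>R J' s"])
    show "(J has_derivative (\<lambda>t. t *\<^sub>R J' s)) (at s within {0..1})" if "s \<in> {0..1}" for s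
      using J'der[OF that] unfolding has_vector_derivative_def .
    show "onorm (\<lambda>t. t *\<^sub>R J' s) \<le> (LINT x|lborel. \<beta> x)" if "s \<in> {0..1}" for s
    proof (rule onorm_bound)
      have J: "norm (J' s) \<le> (LINT x|lborel. \<beta> x)" using J'b[of s] that by simp
      then show "0 \<le> (LINT x|lborel. \<beta> x)" using norm_ge_zero order_trans by blast
      show "norm (t *\<^sub>R J' s) \<le> (LINT x|lborel. \<beta> x) * norm t" for t
        using mult_right_mono[OF J, of "\<bar>t\<bar>"] by (simp add: mult.commute)
    qed
  qed auto
  moreover have "pt 0 x = cplx_vec x" for x by (simp add: pt_def vec_eq_iff)
  ultimately show ?thesis by (simp add: JL)
qed

section \<open>Integrals over Euclidean space\<close>

interpretation lborel_prod: product_sigma_finite "\<lambda>_::'a. lborel :: real measure"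
  by (simp add: product_sigma_finite_def lborel.sigma_finite_measure_axioms)

lemma integral_lborel_prod:
  fixes f :: "'a::euclidean_space \<Rightarrow> real \<Rightarrow> 'b::{real_normed_field,banach,second_countable_topology}"
  assumes i: "\<And>b. b \<in> Basis \<Longrightarrow> integrable lborel (f b)"
  shows "integrable lborel (\<lambda>x::'a. \<Prod>b\<in>Basis. f b (x \<bullet> b))"
    and "(LINT x|lborel. (\<Prod>b\<in>(Basis::'a set). f b (x \<bullet> b))) = (\<Prod>b\<in>Basis. LINT t|lborel. f b t)"
proof -
  let ?M = "\<Pi>\<^sub>M b\<in>(Basis::'a set). lborel :: real measure"
  let ?T = "\<lambda>g::'a \<Rightarrow> real. \<Sum>b\<in>Basis. g b *\<^sub>R b"
  have T: "?T \<in> measurable ?M borel" by measurable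
  have [measurable]: "f b \<in> borel_measurable borel" if "b \<in> Basis" for b
    using borel_measurable_integrable[OF i[OF that]] by simp
  have m: "(\<lambda>x::'a. \<Prod>b\<in>Basis. f b (x \<bullet> b)) \<in> borel_measurable borel"
    by (intro borel_measurable_prod) measurable
  have e: "(\<Prod>b\<in>Basis. f b (?T g \<bullet> b)) = (\<Prod>b\<in>Basis. f b (g b))" for g
    by (intro prod.cong refl) simp
  show "integrable lborel (\<lambda>x::'a. \<Prod>b\<in>Basis. f b (x \<bullet> b))"
    unfolding lborel_eq[where 'a='a] integrable_distr_eq[OF T m] e
    by (rule lborel_prod.product_integrable_prod) (use i in auto)
  show "(LINT x|lborel. (\<Prod>b\<in>(Basis::'a set). f b (x \<bullet> b))) = (\<Prod>b\<in>Basis. LINT t|lborel. f b t)"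
    unfolding lborel_eq[where 'a='a] integral_distr[OF T m] e
    by (rule lborel_prod.product_integral_prod) (use i in auto)
qed

lemma integrable_exp_abs:
  fixes a :: real
  assumes a: "a > 0"
  shows "integrable lborel (\<lambda>t::real. exp (- (a * \<bar>t\<bar>)))"
proof -
  have 1: "set_integrable lborel {0..} (\<lambda>t. exp (- a * t))"
  proof -
    have "(\<lambda>t. exp (- a * t)) absolutely_integrable_on {0..}"
      by (rule nonnegative_absolutely_integrable_1[OF integrable_on_exp_minus_to_infinity[OF a]]) simp
    moreover have "(\<lambda>t. indicator {0..} t *\<^sub>R exp (- a * t)) \<in> borel_measurable borel"
      by measurable
    ultimately show ?thesis unfolding set_integrable_def by (simp add: integrable_completion)
  qed
  then have p: "integrable lborel (\<lambda>t. indicator {0..} t *\<^sub>R exp (- a * t))" by (simp add: set_integrable_def)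
  then have n: "integrable lborel (\<lambda>t. indicator {0..} (0 + (-1) * t) *\<^sub>R exp (- a * (0 + (-1) * t)))"
    by (rule lborel_integrable_real_affine) simp
  show ?thesis
  proof (rule Bochner_Integration.integrable_bound[OF Bochner_Integration.integrable_add[OF p n]])
    show "AE t in lborel. norm (exp (- (a * \<bar>t\<bar>))) \<le> norm (indicator {0..} t *\<^sub>R exp (- a * t) + indicator {0..} (0 + (-1) * t) *\<^sub>R exp (- a * (0 + (-1) * t)))"
      by (rule AE_I2) (auto simp: indicator_def abs_if)
  qed measurable
qed

text \<open>The Euclidean norm dominates a multiple of the sum of the coordinates, which reduces the claim to a
  product of one-dimensional integrals.\<close>

lemma integrable_exp_norm:
  fixes a :: real
  assumes a: "a > 0"
  shows "integrable lborel (\<lambda>x::'a::euclidean_space. exp (- (a * norm x)))"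
proof -
  define c where "c = a / real DIM('a)"
  have c: "c > 0" using a by (simp add: c_def)
  have "integrable lborel (\<lambda>x::'a. \<Prod>b\<in>Basis. exp (- (c * \<bar>x \<bullet> b\<bar>)))"
    by (rule integral_lborel_prod(1)) (rule integrable_exp_abs[OF c])
  then show ?thesis
  proof (rule Bochner_Integration.integrable_bound)
    show "AE x::'a in lborel. norm (exp (- (a * norm x))) \<le> norm (\<Prod>b\<in>(Basis::'a set). exp (- (c * \<bar>x \<bullet> b\<bar>)))"
    proof (rule AE_I2)
      fix x :: 'a
      have "(\<Sum>b\<in>(Basis::'a set). \<bar>x \<bullet> b\<bar>) \<le> (\<Sum>b\<in>(Basis::'a set). norm x)"
        by (intro sum_mono) (simp add: Basis_le_norm)
      then have "c * (\<Sum>b\<in>(Basis::'a set). \<bar>x \<bullet> b\<bar>) \<le> c * (real DIM('a) * norm x)"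
        using c by (intro mult_left_mono) auto
      also have "\<dots> = a * norm x" by (simp add: c_def)
      finally have "exp (- (a * norm x)) \<le> exp (\<Sum>b\<in>(Basis::'a set). - (c * \<bar>x \<bullet> b\<bar>))"
        by (simp add: sum_distrib_left sum_negf)
      then show "norm (exp (- (a * norm x))) \<le> norm (\<Prod>b\<in>(Basis::'a set). exp (- (c * \<bar>x \<bullet> b\<bar>)))"
        by (simp add: exp_sum)
    qed
  qed measurable
qed

section \<open>Differential operators and Fourier integrals\<close>

text \<open>A class of functions stable under multiplication by coordinates whose Fourier integrals can be
  differentiated arbitrarily often.\<close>

definition rapid :: "(real ^ 'd::finite \<Rightarrow> complex) \<Rightarrow> bool"
  where "rapid h \<longleftrightarrow> h \<in> borel_measurable borel \<and> (\<forall>k. integrable lborel (\<lambda>\<xi>. of_real (norm \<xi> ^ k) * h \<xi>))"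

definition four :: "(real ^ 'd::finite \<Rightarrow> complex) \<Rightarrow> real ^ 'd \<Rightarrow> complex"
  where "four h x = (LINT \<xi>|lborel. h \<xi> * exp (- (\<i> * complex_of_real (x \<bullet> \<xi>))))"

lemma rapid_component:
  fixes h :: "real ^ 'd::finite \<Rightarrow> complex"
  assumes "rapid h"
  shows "rapid (\<lambda>\<xi>. of_real (\<xi> $ j) * h \<xi>)"
proof -
  have m [measurable]: "h \<in> borel_measurable borel" using assms by (simp add: rapid_def)
  have mj [measurable]: "(\<lambda>\<xi>::real ^ 'd. \<xi> $ j) \<in> borel_measurable borel"
    by (intro borel_measurable_continuous_onI continuous_intros)
  show ?thesis unfolding rapid_def
  proof (intro conjI allI)
    show "(\<lambda>\<xi>. of_real (\<xi> $ j) * h \<xi>) \<in> borel_measurable borel" by measurable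
    fix k
    have "integrable lborel (\<lambda>\<xi>. of_real (norm \<xi> ^ Suc k) * h \<xi>)" using assms unfolding rapid_def by blast
    then show "integrable lborel (\<lambda>\<xi>. of_real (norm \<xi> ^ k) * (of_real (\<xi> $ j) * h \<xi>))"
    proof (rule Bochner_Integration.integrable_bound)
      show "AE \<xi> in lborel. norm (of_real (norm \<xi> ^ k) * (of_real (\<xi> $ j) * h \<xi>)) \<le> norm (of_real (norm \<xi> ^ Suc k) * h \<xi>)"
      proof (rule AE_I2)
        fix \<xi> :: "real ^ 'd"
        have "norm \<xi> ^ k * \<bar>\<xi> $ j\<bar> * norm (h \<xi>) \<le> norm \<xi> ^ k * norm \<xi> * norm (h \<xi>)"
          by (intro mult_right_mono mult_left_mono component_le_norm_cart) auto
        then show "norm (of_real (norm \<xi> ^ k) * (of_real (\<xi> $ j) * h \<xi>)) \<le> norm (of_real (norm \<xi> ^ Suc k) * h \<xi>)"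
          by (simp add: norm_mult norm_power mult_ac)
      qed
    qed measurable
  qed
qed

lemma norm_exp_i_diff_le: "norm (exp (\<i> * of_real t) - 1) \<le> \<bar>t\<bar>"
  using abs_sin_x_le_abs_x[of "t / 2"] unfolding dist_exp_i_1 by simp

lemma has_vector_derivative_at_0I:
  fixes f :: "real \<Rightarrow> 'a::real_normed_vector"
  assumes "((\<lambda>t. (f t - f 0) /\<^sub>R t) \<longlongrightarrow> D) (at 0)"
  shows "(f has_vector_derivative D) (at 0)"
  unfolding has_vector_derivative_def has_derivative_at
proof
  show "bounded_linear (\<lambda>t. t *\<^sub>R D)" by (rule bounded_linear_scaleR_left)
  have "((\<lambda>t. norm ((f t - f 0) /\<^sub>R t - D)) \<longlongrightarrow> norm (D - D)) (at 0)"
    by (intro tendsto_intros assms)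
  then have "((\<lambda>t. norm ((f t - f 0) /\<^sub>R t - D)) \<longlongrightarrow> 0) (at 0)" by simp
  moreover have "\<forall>\<^sub>F t in at 0. norm ((f t - f 0) /\<^sub>R t - D) = norm (f (0 + t) - f 0 - t *\<^sub>R D) / norm t"
    unfolding eventually_at_filter
  proof (intro always_eventually allI impI)
    fix t :: real assume t: "t \<noteq> 0"
    have "(f t - f 0) /\<^sub>R t - D = (f (0 + t) - f 0 - t *\<^sub>R D) /\<^sub>R t"
      using t by (simp add: scaleR_diff_right)
    then show "norm ((f t - f 0) /\<^sub>R t - D) = norm (f (0 + t) - f 0 - t *\<^sub>R D) / norm t"
      by (simp only: norm_scaleR norm_inverse) (simp add: divide_inverse mult.commute abs_inverse)
  qed
  ultimately show "(\<lambda>t. norm (f (0 + t) - f 0 - t *\<^sub>R D) / norm t) \<midarrow>0\<rightarrow> 0"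
    by (rule Lim_transform_eventually)
qed

text \<open>Differentiation under the integral sign by dominated convergence; the difference quotients of
  the exponential are bounded by \<open>|\<xi>|\<close>.\<close>

lemma i_partial_four:
  fixes h :: "real ^ 'd::finite \<Rightarrow> complex"
  assumes h: "rapid h"
  shows "i_partial j (four h) = four (\<lambda>\<xi>. of_real (\<xi> $ j) * h \<xi>)"
proof
  fix x :: "real ^ 'd"
  have m [measurable]: "h \<in> borel_measurable borel" using h by (simp add: rapid_def)
  have mj [measurable]: "(\<lambda>\<xi>::real ^ 'd. \<xi> $ j) \<in> borel_measurable borel"
    by (intro borel_measurable_continuous_onI continuous_intros)
  let ?e = "\<lambda>x \<xi>. exp (- (\<i> * complex_of_real (x \<bullet> \<xi>)))"
  have me [measurable]: "?e x \<in> borel_measurable borel" for x :: "real ^ 'd"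
    by (intro borel_measurable_continuous_onI continuous_intros)
  have i0: "integrable lborel (\<lambda>\<xi>. h \<xi> * ?e y \<xi>)" for y
  proof (rule Bochner_Integration.integrable_bound)
    show "integrable lborel (\<lambda>\<xi>. of_real (norm \<xi> ^ 0) * h \<xi>)" using h unfolding rapid_def by blast
  qed (auto simp: norm_mult norm_exp_eq_Re)
  have i1: "integrable lborel (\<lambda>\<xi>. of_real (norm \<xi>) * h \<xi>)"
    using h[unfolded rapid_def, THEN conjunct2, THEN spec, of 1] by simp
  let ?D = "LINT \<xi>|lborel. h \<xi> * ?e x \<xi> * (- \<i> * of_real (\<xi> $ j))"
  let ?q = "\<lambda>t \<xi>. h \<xi> * ?e x \<xi> * ((exp (\<i> * of_real (- t * \<xi> $ j)) - 1) / of_real t)"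
  have diff: "(four h (x + t *\<^sub>R axis j 1) - four h x) /\<^sub>R t = (LINT \<xi>|lborel. ?q t \<xi>)" if "t \<noteq> 0" for t
  proof -
    have "?e (x + t *\<^sub>R axis j 1) \<xi> = ?e x \<xi> * exp (\<i> * of_real (- t * \<xi> $ j))" for \<xi>
      unfolding exp_add[symmetric] by (simp add: inner_add_left inner_axis' algebra_simps)
    then have "?q t \<xi> = (h \<xi> * ?e (x + t *\<^sub>R axis j 1) \<xi> - h \<xi> * ?e x \<xi>) / of_real t" for \<xi>
      by (simp add: algebra_simps diff_divide_distrib)
    then have "(LINT \<xi>|lborel. ?q t \<xi>) = (LINT \<xi>|lborel. (h \<xi> * ?e (x + t *\<^sub>R axis j 1) \<xi> - h \<xi> * ?e x \<xi>) / of_real t)"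
      by (simp only:)
    also have "\<dots> = (four h (x + t *\<^sub>R axis j 1) - four h x) / of_real t"
      unfolding four_def by (simp add: i0)
    finally show ?thesis by (simp add: scaleR_conv_of_real divide_inverse mult.commute)
  qed
  have lim: "((\<lambda>t. LINT \<xi>|lborel. ?q t \<xi>) \<longlongrightarrow> ?D) (at 0)"
    unfolding tendsto_at_iff_sequentially comp_def
  proof (intro allI impI)
    fix X :: "nat \<Rightarrow> real" assume X: "\<forall>i. X i \<in> UNIV - {0}" "X \<longlonglongrightarrow> 0"
    show "(\<lambda>i. LINT \<xi>|lborel. ?q (X i) \<xi>) \<longlonglongrightarrow> ?D"
    proof (rule integral_dominated_convergence[where w = "\<lambda>\<xi>. norm (of_real (norm \<xi>) * h \<xi>)"])
      show "AE \<xi> in lborel. (\<lambda>i. ?q (X i) \<xi>) \<longlonglongrightarrow> h \<xi> * ?e x \<xi> * (- \<i> * of_real (\<xi> $ j))"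
      proof (rule AE_I2)
        fix \<xi> :: "real ^ 'd"
        have "((\<lambda>z. exp (z * (- \<i> * of_real (\<xi> $ j)))) has_field_derivative exp (0 * (- \<i> * of_real (\<xi> $ j))) * (1 * (- \<i> * of_real (\<xi> $ j)))) (at 0)"
          by (intro derivative_eq_intros) auto
        then have "((\<lambda>z. (exp (z * (- \<i> * of_real (\<xi> $ j))) - 1) / z) \<longlongrightarrow> - \<i> * of_real (\<xi> $ j)) (at 0)"
          by (simp add: has_field_derivative_iff)
        moreover have "filterlim (\<lambda>i. complex_of_real (X i)) (at 0) sequentially"
          unfolding filterlim_at using X by (auto intro!: tendsto_eq_intros)
        ultimately have "(\<lambda>i. (exp (of_real (X i) * (- \<i> * of_real (\<xi> $ j))) - 1) / of_real (X i)) \<longlonglongrightarrow> - \<i> * of_real (\<xi> $ j)"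
          by (rule filterlim_compose)
        then have "(\<lambda>i. h \<xi> * ?e x \<xi> * ((exp (of_real (X i) * (- \<i> * of_real (\<xi> $ j))) - 1) / of_real (X i))) \<longlonglongrightarrow> h \<xi> * ?e x \<xi> * (- \<i> * of_real (\<xi> $ j))"
          by (rule tendsto_mult_left)
        moreover have "complex_of_real (X i) * (- \<i> * of_real (\<xi> $ j)) = \<i> * of_real (- X i * \<xi> $ j)" for i by simp
        ultimately show "(\<lambda>i. ?q (X i) \<xi>) \<longlonglongrightarrow> h \<xi> * ?e x \<xi> * (- \<i> * of_real (\<xi> $ j))" by (simp only:)
      qed
      show "AE \<xi> in lborel. norm (?q (X i) \<xi>) \<le> norm (of_real (norm \<xi>) * h \<xi>)" for i
      proof (rule AE_I2)
        fix \<xi> :: "real ^ 'd"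
        have Xi: "X i \<noteq> 0" using X by auto
        have e1: "norm (?e x \<xi>) = 1" by (simp add: norm_exp_eq_Re)
        have "norm (exp (\<i> * of_real (- X i * \<xi> $ j)) - 1) \<le> \<bar>- X i * \<xi> $ j\<bar>" by (rule norm_exp_i_diff_le)
        also have "\<dots> \<le> \<bar>X i\<bar> * norm \<xi>" by (simp add: abs_mult component_le_norm_cart mult_left_mono)
        finally have "norm ((exp (\<i> * of_real (- X i * \<xi> $ j)) - 1) / of_real (X i)) \<le> norm \<xi>"
          using Xi by (simp add: norm_divide divide_le_eq mult.commute)
        then have "norm (h \<xi>) * norm ((exp (\<i> * of_real (- X i * \<xi> $ j)) - 1) / of_real (X i)) \<le> norm (h \<xi>) * norm \<xi>"
          by (rule mult_left_mono) simp
        then show "norm (?q (X i) \<xi>) \<le> norm (of_real (norm \<xi>) * h \<xi>)"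
          by (simp only: norm_mult e1 mult_1_right norm_of_real abs_norm_cancel mult.commute[of "norm \<xi>"])
      qed
    qed (use i1 in \<open>auto intro: integrable_norm\<close>)
  qed
  have "((\<lambda>t. (four h (x + t *\<^sub>R axis j 1) - four h x) /\<^sub>R t) \<longlongrightarrow> ?D) (at 0)"
    by (rule Lim_transform_eventually[OF lim]) (simp add: diff eventually_at_filter)
  then have "((\<lambda>t. four h (x + t *\<^sub>R axis j 1)) has_vector_derivative ?D) (at 0)"
    by (intro has_vector_derivative_at_0I) simp
  then have "i_partial j (four h) x = \<i> * ?D" unfolding i_partial_def by (simp add: vector_derivative_at)
  also have "\<dots> = (LINT \<xi>|lborel. \<i> * (h \<xi> * ?e x \<xi> * (- \<i> * of_real (\<xi> $ j))))" by simp
  also have "\<dots> = four (\<lambda>\<xi>. of_real (\<xi> $ j) * h \<xi>) x"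
    unfolding four_def by (intro Bochner_Integration.integral_cong refl) (simp add: mult_ac)
  finally show "i_partial j (four h) x = four (\<lambda>\<xi>. of_real (\<xi> $ j) * h \<xi>) x" .
qed

lemma i_partial_power_four:
  assumes "rapid h"
  shows "(i_partial j ^^ k) (four h) = four (\<lambda>\<xi>. of_real (\<xi> $ j) ^ k * h \<xi>) \<and> rapid (\<lambda>\<xi>. of_real (\<xi> $ j) ^ k * h \<xi>)"
proof (induction k)
  case (Suc k)
  then have e: "(i_partial j ^^ k) (four h) = four (\<lambda>\<xi>. of_real (\<xi> $ j) ^ k * h \<xi>)"
    and r: "rapid (\<lambda>\<xi>. of_real (\<xi> $ j) ^ k * h \<xi>)" by auto
  show ?case using rapid_component[OF r, of j] by (simp add: e i_partial_four[OF r] mult.assoc)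
qed (use assms in simp)

lemma i_partials_four:
  assumes h: "rapid h"
  shows "i_partials \<beta> (four h) = four (\<lambda>\<xi>. monomial (cplx_vec \<xi>) \<beta> * h \<xi>)" "rapid (\<lambda>\<xi>. monomial (cplx_vec \<xi>) \<beta> * h \<xi>)"
proof -
  have main: "foldr (\<lambda>j. i_partial j ^^ (\<beta> $ j)) js (four h) = four (\<lambda>\<xi>. (\<Prod>j\<leftarrow>js. of_real (\<xi> $ j) ^ (\<beta> $ j)) * h \<xi>)
     \<and> rapid (\<lambda>\<xi>. (\<Prod>j\<leftarrow>js. of_real (\<xi> $ j) ^ (\<beta> $ j)) * h \<xi>)" for js
  proof (induction js)
    case (Cons j js)
    then have e: "foldr (\<lambda>j. i_partial j ^^ (\<beta> $ j)) js (four h) = four (\<lambda>\<xi>. (\<Prod>j\<leftarrow>js. of_real (\<xi> $ j) ^ (\<beta> $ j)) * h \<xi>)"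
      and r: "rapid (\<lambda>\<xi>. (\<Prod>j\<leftarrow>js. of_real (\<xi> $ j) ^ (\<beta> $ j)) * h \<xi>)" by auto
    show ?case using i_partial_power_four[OF r] by (simp add: e mult.assoc)
  qed (use h in simp)
  define js where "js = (SOME js. distinct js \<and> set js = (UNIV :: 'a set))"
  have js: "distinct js \<and> set js = UNIV"
    unfolding js_def using finite_distinct_list[OF finite[of "UNIV :: 'a set"]] by (metis (mono_tags, lifting) someI)
  have "(\<Prod>j\<leftarrow>js. of_real (\<xi> $ j) ^ (\<beta> $ j)) = monomial (cplx_vec \<xi>) \<beta>" for \<xi>
    using prod.distinct_set_conv_list[of js "\<lambda>j. complex_of_real (\<xi> $ j) ^ (\<beta> $ j)"] js by (simp add: monomial_def)
  with main[of js] show "i_partials \<beta> (four h) = four (\<lambda>\<xi>. monomial (cplx_vec \<xi>) \<beta> * h \<xi>)" "rapid (\<lambda>\<xi>. monomial (cplx_vec \<xi>) \<beta> * h \<xi>)"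
    by (simp_all add: i_partials_def js_def)
qed

lemma integrable_rapid:
  assumes "rapid h"
  shows "integrable lborel (\<lambda>\<xi>. h \<xi> * exp (- (\<i> * complex_of_real (x \<bullet> \<xi>))))"
proof (rule Bochner_Integration.integrable_bound)
  show "integrable lborel (\<lambda>\<xi>. of_real (norm \<xi> ^ 0) * h \<xi>)" using assms unfolding rapid_def by blast
  have "h \<in> borel_measurable borel" using assms by (simp add: rapid_def)
  moreover have "(\<lambda>\<xi>. exp (- (\<i> * complex_of_real (x \<bullet> \<xi>)))) \<in> borel_measurable borel"
    by (intro borel_measurable_continuous_onI continuous_intros)
  ultimately show "(\<lambda>\<xi>. h \<xi> * exp (- (\<i> * complex_of_real (x \<bullet> \<xi>)))) \<in> borel_measurable lborel" by simp
qed (auto simp: norm_mult norm_exp_eq_Re)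

theorem diff_op_four:
  assumes "rapid h"
  shows "diff_op p (four h) = four (\<lambda>\<xi>. eval_poly p (cplx_vec \<xi>) * h \<xi>)"
proof
  fix x
  have "diff_op p (four h) x = (\<Sum>\<beta>\<in>Poly_Mapping.keys p. Poly_Mapping.lookup p \<beta> *
      (LINT \<xi>|lborel. monomial (cplx_vec \<xi>) \<beta> * h \<xi> * exp (- (\<i> * complex_of_real (x \<bullet> \<xi>)))))"
    unfolding diff_op_def i_partials_four(1)[OF assms] four_def ..
  also have "\<dots> = (LINT \<xi>|lborel. (\<Sum>\<beta>\<in>Poly_Mapping.keys p. Poly_Mapping.lookup p \<beta> *
      (monomial (cplx_vec \<xi>) \<beta> * h \<xi> * exp (- (\<i> * complex_of_real (x \<bullet> \<xi>))))))"
    by (subst Bochner_Integration.integral_sum) (use integrable_rapid[OF i_partials_four(2)[OF assms]] in auto)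
  also have "\<dots> = four (\<lambda>\<xi>. eval_poly p (cplx_vec \<xi>) * h \<xi>) x"
    unfolding four_def eval_poly_def by (simp add: sum_distrib_right mult.assoc)
  finally show "diff_op p (four h) x = four (\<lambda>\<xi>. eval_poly p (cplx_vec \<xi>) * h \<xi>) x" .
qed

lemma rapidI:
  fixes h :: "real ^ 'd::finite \<Rightarrow> complex"
  assumes c: "continuous_on UNIV h" and a: "a > 0" and b: "\<And>\<xi>. norm (h \<xi>) \<le> C * exp (- (a * norm \<xi>))"
  shows "rapid h"
  unfolding rapid_def
proof (intro conjI allI)
  show "h \<in> borel_measurable borel" by (rule borel_measurable_continuous_onI[OF c])
  fix k
  obtain K where K: "K > 0" "\<And>y. y \<ge> 0 \<Longrightarrow> y powr real k \<le> K * exp (a / 2 * y)"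
    using powr_le_exp[of "real k" "a / 2"] a by auto
  have C: "C \<ge> 0" using order_trans[OF norm_ge_zero b[of 0]] by simp
  have "integrable lborel (\<lambda>\<xi>::real ^ 'd. (K + 1) * C * exp (- (a / 2 * norm \<xi>)))"
    by (intro integrable_mult_right integrable_exp_norm) (use a in simp)
  then show "integrable lborel (\<lambda>\<xi>. of_real (norm \<xi> ^ k) * h \<xi>)"
  proof (rule Bochner_Integration.integrable_bound)
    show "(\<lambda>\<xi>. of_real (norm \<xi> ^ k) * h \<xi>) \<in> borel_measurable lborel"
      using borel_measurable_continuous_onI[OF c] by simp
    show "AE \<xi> in lborel. norm (of_real (norm \<xi> ^ k) * h \<xi>) \<le> norm ((K + 1) * C * exp (- (a / 2 * norm \<xi>)))"
    proof (rule AE_I2)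
      fix \<xi> :: "real ^ 'd"
      have k: "norm \<xi> ^ k \<le> (K + 1) * exp (a / 2 * norm \<xi>)"
      proof (cases "\<xi> = 0")
        case True
        then show ?thesis using K(1) by (cases k) auto
      next
        case False
        then have "norm \<xi> ^ k = norm \<xi> powr real k" by (simp add: powr_realpow)
        also have "\<dots> \<le> K * exp (a / 2 * norm \<xi>)" by (rule K(2)) simp
        also have "\<dots> \<le> (K + 1) * exp (a / 2 * norm \<xi>)" by (intro mult_right_mono) auto
        finally show ?thesis .
      qed
      have "norm \<xi> ^ k * norm (h \<xi>) \<le> ((K + 1) * exp (a / 2 * norm \<xi>)) * (C * exp (- (a * norm \<xi>)))"
        using K(1) by (intro mult_mono k b) auto
      also have "\<dots> = (K + 1) * C * (exp (a / 2 * norm \<xi>) * exp (- (a * norm \<xi>)))" by simp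
      also have "exp (a / 2 * norm \<xi>) * exp (- (a * norm \<xi>)) = exp (- (a / 2 * norm \<xi>))"
        unfolding exp_add[symmetric] by simp
      finally show "norm (of_real (norm \<xi> ^ k) * h \<xi>) \<le> norm ((K + 1) * C * exp (- (a / 2 * norm \<xi>)))"
        using K(1) C by (simp add: norm_mult norm_power)
    qed
  qed
qed

section \<open>Linear changes of variables\<close>

lemma nn_integral_translate:
  fixes f :: "'a::euclidean_space \<Rightarrow> ennreal"
  assumes [measurable]: "f \<in> borel_measurable borel"
  shows "(\<integral>\<^sup>+x. f (x + c) \<partial>lborel) = (\<integral>\<^sup>+x. f x \<partial>lborel)"
proof -
  have "(\<integral>\<^sup>+x. f x \<partial>lborel) = (\<integral>\<^sup>+x. f x \<partial>distr lborel borel ((+) c))" by (simp add: lborel_distr_plus)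
  also have "\<dots> = (\<integral>\<^sup>+x. f (c + x) \<partial>lborel)" by (rule nn_integral_distr) auto
  finally show ?thesis by (simp add: add.commute)
qed

text \<open>An auxiliary integrable function with positive integral under every invertible linear map. It
  only serves to define the constant \<open>scaling\<close> below.\<close>

definition bump :: "'a::euclidean_space \<Rightarrow> ennreal" where "bump x = ennreal (exp (- norm x))"

lemma bump_measurable [measurable]: "bump \<in> borel_measurable borel"
  unfolding bump_def[abs_def] by measurable

lemma matrix_measurable [measurable]: "(\<lambda>x. A *v x) \<in> borel_measurable borel"
  for A :: "real ^ 'n::finite ^ 'm::finite"
  by (intro borel_measurable_continuous_onI linear_continuous_on matrix_vector_mul_bounded_linear)

lemma bump_finite_pos:
  fixes A :: "real ^ 'd::finite ^ 'd"
  assumes A: "invertible A"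
  shows "0 < (\<integral>\<^sup>+x. bump (A *v x) \<partial>lborel)" "(\<integral>\<^sup>+x. bump (A *v x) \<partial>lborel) < \<infinity>"
proof -
  let ?B = "matrix_inv A"
  obtain K where K: "K > 0" "\<And>x. norm (?B *v x) \<le> norm x * K"
    using bounded_linear.pos_bounded[OF matrix_vector_mul_bounded_linear[of ?B]] by blast
  have le: "norm x / K \<le> norm (A *v x)" for x
  proof -
    have "?B *v (A *v x) = x"
      using matrix_inv_mult(1)[OF A] by (simp add: matrix_vector_mul_assoc)
    then show ?thesis using K(2)[of "A *v x"] K(1) by (simp add: divide_le_eq)
  qed
  have "(\<integral>\<^sup>+x. bump (A *v x) \<partial>lborel) \<le> nn_integral lborel (\<lambda>x::real ^ 'd. ennreal (exp (- (1 / K * norm x))))"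
    unfolding bump_def by (intro nn_integral_mono ennreal_leI) (use le in simp)
  also have "\<dots> = ennreal (integral\<^sup>L lborel (\<lambda>x::real ^ 'd. exp (- (1 / K * norm x))))"
    by (rule nn_integral_eq_integral[OF integrable_exp_norm]) (use K in auto)
  also have "\<dots> < \<infinity>" by simp
  finally show "(\<integral>\<^sup>+x. bump (A *v x) \<partial>lborel) < \<infinity>" .
  have "(\<integral>\<^sup>+x. bump (A *v x) \<partial>lborel) \<noteq> 0"
  proof
    assume "(\<integral>\<^sup>+x. bump (A *v x) \<partial>lborel) = 0"
    then have "AE x in lborel. bump (A *v x) = 0"
      by (subst (asm) nn_integral_0_iff_AE) measurable
    then have "AE x::real ^ 'd in lborel. False" by (simp add: bump_def)
    then have "emeasure lborel (UNIV :: (real ^ 'd) set) = 0"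
      by (simp add: AE_iff_measurable[OF _ refl])
    then show False by (simp add: emeasure_lborel_UNIV)
  qed
  then show "0 < (\<integral>\<^sup>+x. bump (A *v x) \<partial>lborel)" by (simp add: zero_less_iff_neq_zero)
qed

text \<open>Both sides are double integrals of \<open>f(A x) \<cdot> bump(y)\<close>; translating one variable by the image of
  the other and using Tonelli exchanges the roles of \<open>f\<close> and \<open>bump\<close>. This is the uniqueness argument
  for a translation-invariant measure.\<close>

lemma nn_integral_matrix_bump:
  fixes A :: "real ^ 'd::finite ^ 'd" and f :: "real ^ 'd \<Rightarrow> ennreal"
  assumes A: "invertible A" and f [measurable]: "f \<in> borel_measurable borel"
  shows "(\<integral>\<^sup>+x. f (A *v x) \<partial>lborel) * (\<integral>\<^sup>+y. bump y \<partial>(lborel :: (real ^ 'd) measure))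
    = (\<integral>\<^sup>+y. f y \<partial>lborel) * (\<integral>\<^sup>+x. bump (A *v x) \<partial>lborel)"
proof -
  let ?B = "matrix_inv A"
  have AB: "A *v (?B *v y) = y" for y
    using matrix_inv_mult(2)[OF A] by (simp add: matrix_vector_mul_assoc)
  have mm [measurable]: "(\<lambda>x. A *v x) \<in> borel_measurable borel" by (rule matrix_measurable)
  have "(\<integral>\<^sup>+x. f (A *v x) \<partial>lborel) * (\<integral>\<^sup>+y. bump y \<partial>(lborel :: (real ^ 'd) measure))
     = (\<integral>\<^sup>+y. (\<integral>\<^sup>+x. f (A *v x) \<partial>lborel) * bump (y :: real ^ 'd) \<partial>lborel)"
    by (rule nn_integral_cmult[symmetric]) simp
  also have "\<dots> = (\<integral>\<^sup>+y. \<integral>\<^sup>+x. f (A *v x + y) * bump y \<partial>lborel \<partial>lborel)"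
  proof (rule nn_integral_cong)
    fix y :: "real ^ 'd"
    have "(\<integral>\<^sup>+x. f (A *v x) \<partial>lborel) = (\<integral>\<^sup>+x. f (A *v (x + ?B *v y)) \<partial>lborel)"
      by (rule nn_integral_translate[symmetric]) measurable
    also have "\<dots> = (\<integral>\<^sup>+x. f (A *v x + y) \<partial>lborel)" by (simp add: matrix_vector_right_distrib AB)
    finally show "(\<integral>\<^sup>+x. f (A *v x) \<partial>lborel) * bump y = (\<integral>\<^sup>+x. f (A *v x + y) * bump y \<partial>lborel)"
      by (simp add: nn_integral_multc)
  qed
  also have "\<dots> = (\<integral>\<^sup>+x. \<integral>\<^sup>+y. f (A *v x + y) * bump y \<partial>lborel \<partial>lborel)"
    by (rule lborel_pair.Fubini') measurable
  also have "\<dots> = (\<integral>\<^sup>+x. \<integral>\<^sup>+y. f y * bump (A *v x - y) \<partial>lborel \<partial>lborel)"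
  proof (rule nn_integral_cong)
    fix x :: "real ^ 'd"
    have "(\<integral>\<^sup>+y. f y * bump (A *v x - y) \<partial>lborel) = (\<integral>\<^sup>+y. f (y + A *v x) * bump (A *v x - (y + A *v x)) \<partial>lborel)"
      by (rule nn_integral_translate[symmetric]) measurable
    also have "\<dots> = (\<integral>\<^sup>+y. f (A *v x + y) * bump y \<partial>lborel)"
      by (simp add: bump_def add.commute)
    finally show "(\<integral>\<^sup>+y. f (A *v x + y) * bump y \<partial>lborel) = (\<integral>\<^sup>+y. f y * bump (A *v x - y) \<partial>lborel)" ..
  qed
  also have "\<dots> = (\<integral>\<^sup>+y. \<integral>\<^sup>+x. f y * bump (A *v x - y) \<partial>lborel \<partial>lborel)"
    by (rule lborel_pair.Fubini') measurable
  also have "\<dots> = (\<integral>\<^sup>+y. f y * (\<integral>\<^sup>+x. bump (A *v x) \<partial>lborel) \<partial>lborel)"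
  proof (rule nn_integral_cong)
    fix y :: "real ^ 'd"
    have "(\<integral>\<^sup>+x. bump (A *v x - y) \<partial>lborel) = (\<integral>\<^sup>+x. bump (A *v (x + ?B *v y) - y) \<partial>lborel)"
      by (rule nn_integral_translate[symmetric]) measurable
    also have "\<dots> = (\<integral>\<^sup>+x. bump (A *v x) \<partial>lborel)" by (simp add: matrix_vector_right_distrib AB)
    finally show "(\<integral>\<^sup>+x. f y * bump (A *v x - y) \<partial>lborel) = f y * (\<integral>\<^sup>+x. bump (A *v x) \<partial>lborel)"
      by (simp add: nn_integral_cmult)
  qed
  also have "\<dots> = (\<integral>\<^sup>+y. f y \<partial>lborel) * (\<integral>\<^sup>+x. bump (A *v x) \<partial>lborel)"
    by (rule nn_integral_multc) simp
  finally show ?thesis .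
qed

definition scaling :: "real ^ 'd::finite ^ 'd \<Rightarrow> real"
  where "scaling A = enn2real (\<integral>\<^sup>+x. bump (A *v x) \<partial>lborel) / enn2real (\<integral>\<^sup>+x. bump x \<partial>(lborel :: (real ^ 'd) measure))"

lemma invertible_mat1: "invertible (mat 1 :: real ^ 'd::finite ^ 'd)"
  unfolding invertible_def using matrix_mul_lid by blast

lemma ennreal_cancel:
  assumes "x \<ge> 0" "y \<ge> 0" "0 < G" "G < \<infinity>" "ennreal x * G = ennreal y * G"
  shows "x = y"
proof -
  define g where "g = enn2real G"
  have g: "G = ennreal g" "g > 0" using assms by (simp_all add: g_def enn2real_positive_iff)
  have "ennreal (x * g) = ennreal (y * g)" using assms g by (simp add: ennreal_mult)
  then have "x * g = y * g" using assms g by (subst (asm) ennreal_inj) auto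
  then show ?thesis using g by simp
qed

lemma bump_id: "0 < (\<integral>\<^sup>+x. bump x \<partial>(lborel :: (real ^ 'd::finite) measure))" "(\<integral>\<^sup>+x. bump x \<partial>(lborel :: (real ^ 'd) measure)) < \<infinity>"
  using bump_finite_pos[OF invertible_mat1[where 'd='d]] by (simp_all only: matrix_vector_mul_lid)

lemma scaling_pos: "invertible A \<Longrightarrow> scaling A > 0"
  unfolding scaling_def using bump_finite_pos[of A] bump_id
  by (intro divide_pos_pos) (simp_all add: enn2real_positive_iff)

lemma nn_integral_scaling:
  fixes A :: "real ^ 'd::finite ^ 'd" and f :: "real ^ 'd \<Rightarrow> ennreal"
  assumes A: "invertible A" and f: "f \<in> borel_measurable borel"
  shows "(\<integral>\<^sup>+x. f (A *v x) \<partial>lborel) = ennreal (scaling A) * (\<integral>\<^sup>+y. f y \<partial>lborel)"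
proof -
  let ?G = "\<integral>\<^sup>+x. bump x \<partial>(lborel :: (real ^ 'd) measure)"
  let ?H = "\<integral>\<^sup>+x. bump (A *v x) \<partial>lborel"
  define g where "g = enn2real ?G"
  define h where "h = enn2real ?H"
  have g: "?G = ennreal g" "g > 0"
    using bump_id[where 'd='d] by (simp_all add: g_def enn2real_positive_iff)
  have h: "?H = ennreal h" "h > 0"
    using bump_finite_pos[OF A] by (simp_all add: h_def enn2real_positive_iff)
  have s: "scaling A = h / g" by (simp add: scaling_def g_def h_def)
  have "(\<integral>\<^sup>+x. f (A *v x) \<partial>lborel) * ennreal g = (\<integral>\<^sup>+y. f y \<partial>lborel) * ennreal h"
    using nn_integral_matrix_bump[OF A f] unfolding g h .
  then have "(\<integral>\<^sup>+x. f (A *v x) \<partial>lborel) * ennreal g * ennreal (1 / g) = (\<integral>\<^sup>+y. f y \<partial>lborel) * ennreal h * ennreal (1 / g)"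
    by simp
  then have "(\<integral>\<^sup>+x. f (A *v x) \<partial>lborel) * ennreal (g * (1 / g)) = (\<integral>\<^sup>+y. f y \<partial>lborel) * ennreal (h * (1 / g))"
    using g h by (simp only: mult.assoc ennreal_mult' less_imp_le)
  then show ?thesis using g(2) unfolding s by (simp add: mult.commute)
qed

lemma scaling_mult:
  fixes A B :: "real ^ 'd::finite ^ 'd"
  assumes "invertible A" "invertible B"
  shows "scaling (A ** B) = scaling A * scaling B"
proof -
  let ?G = "\<integral>\<^sup>+x. bump x \<partial>(lborel :: (real ^ 'd) measure)"
  have AB: "invertible (A ** B)" using assms by (rule invertible_mult)
  have "ennreal (scaling (A ** B)) * ?G = (\<integral>\<^sup>+x. bump (A *v (B *v x)) \<partial>lborel)"
    using nn_integral_scaling[OF AB bump_measurable] by (simp add: matrix_vector_mul_assoc)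
  also have "\<dots> = ennreal (scaling B) * (ennreal (scaling A) * ?G)"
    using nn_integral_scaling[OF assms(2), of "\<lambda>y. bump (A *v y)"] nn_integral_scaling[OF assms(1) bump_measurable]
    by (simp add: measurable_compose[OF matrix_measurable bump_measurable])
  also have "\<dots> = ennreal (scaling A * scaling B) * ?G"
    using scaling_pos[OF assms(1)] scaling_pos[OF assms(2)] by (simp add: ennreal_mult less_imp_le) (simp only: mult_ac)
  finally have e: "ennreal (scaling (A ** B)) * ?G = ennreal (scaling A * scaling B) * ?G" .
  show ?thesis
    by (rule ennreal_cancel[OF _ _ bump_id e])
      (use scaling_pos[OF AB] scaling_pos[OF assms(1)] scaling_pos[OF assms(2)] in auto)
qed

lemma scaling_one: "scaling (mat 1 :: real ^ 'd::finite ^ 'd) = 1"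
proof -
  have "0 < enn2real (\<integral>\<^sup>+x. bump x \<partial>(lborel :: (real ^ 'd) measure))"
    using bump_id[where 'd='d] by (simp add: enn2real_positive_iff)
  then show ?thesis by (simp add: scaling_def)
qed

lemma shear_apply:
  fixes x :: "real ^ 'd::finite"
  assumes "m \<noteq> n"
  shows "(\<chi> i j. if i = m \<and> j = n then c else of_bool (i = j)) *v x = (\<chi> i. x $ i + (if i = m then c * x $ n else 0))"
proof (subst vec_eq_iff, rule allI)
  fix i
  have "((\<chi> i j. if i = m \<and> j = n then c else of_bool (i = j)) *v x) $ i
    = (\<Sum>k\<in>UNIV. (if k = i then x $ k else 0) + (if k = n then (if i = m then c * x $ n else 0) else 0))"
    unfolding matrix_vector_mult_def vec_lambda_beta using assms by (intro sum.cong refl) auto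
  also have "\<dots> = x $ i + (if i = m then c * x $ n else 0)" unfolding sum.distrib by simp
  finally show "((\<chi> i j. if i = m \<and> j = n then c else of_bool (i = j)) *v x) $ i = (\<chi> i. x $ i + (if i = m then c * x $ n else 0)) $ i"
    by simp
qed

lemma diagonal_apply:
  fixes x :: "real ^ 'd::finite"
  shows "(\<chi> i j. if i = j then d i else 0) *v x = (\<chi> i. d i * x $ i)"
proof (subst vec_eq_iff, rule allI)
  fix i
  have "((\<chi> i j. if i = j then d i else 0) *v x) $ i = (\<Sum>k\<in>UNIV. if k = i then d i * x $ i else 0)"
    unfolding matrix_vector_mult_def vec_lambda_beta by (intro sum.cong refl) auto
  then show "((\<chi> i j. if i = j then d i else 0) *v x) $ i = (\<chi> i. d i * x $ i) $ i" by simp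
qed

lemma swap_apply:
  fixes x :: "real ^ 'd::finite"
  shows "(\<chi> i j. mat 1 $ i $ Transposition.transpose m n j) *v x = (\<chi> i. x $ Transposition.transpose m n i)"
proof (subst vec_eq_iff, rule allI)
  fix i
  have "((\<chi> i j. mat 1 $ i $ Transposition.transpose m n j) *v x) $ i = (\<Sum>k\<in>UNIV. if k = Transposition.transpose m n i then x $ k else 0)"
    unfolding matrix_vector_mult_def vec_lambda_beta mat_def by (intro sum.cong refl) (auto simp: transpose_involutory)
  then show "((\<chi> i j. mat 1 $ i $ Transposition.transpose m n j) *v x) $ i = (\<chi> i. x $ Transposition.transpose m n i) $ i" by simp
qed

text \<open>By the previous lemmas \<open>scaling\<close> is a multiplicative function on invertible matrices, so it is enough
  to treat elementary ones. For diagonal matrices the claim is a coordinatewise change of variables. A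
  transposition squares to the identity. For a shear \<open>S c\<close> there is a diagonal \<open>D\<close> that conjugates it to
  \<open>S (2 c) = S c ** S c\<close>, hence its value \<open>t\<close> satisfies \<open>t = t^2\<close>.\<close>

lemma scaling_det:
  fixes A :: "real ^ 'd::finite ^ 'd"
  shows "invertible A \<longrightarrow> scaling A * \<bar>det A\<bar> = 1"
proof (induction A rule: induct_matrix_elementary)
  fix A B :: "real ^ 'd ^ 'd"
  assume AB: "invertible A \<longrightarrow> scaling A * \<bar>det A\<bar> = 1" "invertible B \<longrightarrow> scaling B * \<bar>det B\<bar> = 1"
  show "invertible (A ** B) \<longrightarrow> scaling (A ** B) * \<bar>det (A ** B)\<bar> = 1"
  proof
    assume "invertible (A ** B)"
    then have i: "invertible A" "invertible B" by (auto simp: invertible_det_nz det_mul)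
    have "scaling (A ** B) * \<bar>det (A ** B)\<bar> = (scaling A * \<bar>det A\<bar>) * (scaling B * \<bar>det B\<bar>)"
      by (simp add: scaling_mult[OF i] det_mul abs_mult)
    then show "scaling (A ** B) * \<bar>det (A ** B)\<bar> = 1" using AB i by simp
  qed
next
  fix A :: "real ^ 'd ^ 'd" and i
  assume "row i A = 0"
  then show "invertible A \<longrightarrow> scaling A * \<bar>det A\<bar> = 1"
    using det_zero_row(2)[of i A] by (simp add: invertible_det_nz)
next
  fix A :: "real ^ 'd ^ 'd"
  assume d: "\<And>i j. i \<noteq> j \<Longrightarrow> A $ i $ j = 0"
  show "invertible A \<longrightarrow> scaling A * \<bar>det A\<bar> = 1"
  proof
    assume inv: "invertible A"
    have det: "det A = (\<Prod>i\<in>UNIV. A $ i $ i)" by (rule det_diagonal[OF d])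
    then have nz: "A $ i $ i \<noteq> 0" for i using inv by (auto simp: invertible_det_nz)
    define c where "c b = (\<Sum>i\<in>UNIV. if b = axis i 1 then A $ i $ i else 0)" for b :: "real ^ 'd"
    have c: "c (axis i 1) = A $ i $ i" for i by (simp add: c_def axis_eq_axis)
    have Bas: "(Basis :: (real ^ 'd) set) = (\<lambda>i. axis i 1) ` UNIV" by (auto simp: Basis_vec_def)
    have inj: "inj_on (\<lambda>i. axis i 1 :: real ^ 'd) UNIV" by (auto simp: inj_on_def axis_eq_axis)
    have T: "0 + (\<Sum>b\<in>Basis. (c b * (x \<bullet> b)) *\<^sub>R b) = A *v x" for x :: "real ^ 'd"
    proof -
      have "(\<Sum>b\<in>Basis. (c b * (x \<bullet> b)) *\<^sub>R b) = (\<Sum>i\<in>UNIV. (A $ i $ i * x $ i) *\<^sub>R axis i 1)"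
        unfolding Bas by (subst sum.reindex[OF inj]) (simp add: c inner_axis)
      also have "\<dots> = A *v x"
      proof (subst vec_eq_iff, rule allI)
        fix k
        have "(A *v x) $ k = A $ k $ k * x $ k"
          unfolding matrix_vector_mult_def by (simp, subst sum.remove[of _ k]) (auto simp: d intro!: sum.neutral)
        moreover have "(\<Sum>i\<in>UNIV. (A $ i $ i * x $ i) *\<^sub>R axis i (1::real)) $ k = (\<Sum>i\<in>UNIV. if i = k then A $ i $ i * x $ i else 0)"
          unfolding sum_component by (intro sum.cong refl) (auto simp: axis_def)
        ultimately show "(\<Sum>i\<in>UNIV. (A $ i $ i * x $ i) *\<^sub>R axis i 1) $ k = (A *v x) $ k" by simp
      qed
      finally show ?thesis by simp
    qed
    have pr: "(\<Prod>b\<in>Basis. \<bar>c b\<bar>) = \<bar>det A\<bar>"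
      unfolding Bas by (subst prod.reindex[OF inj]) (simp add: c det abs_prod)
    have leb: "lborel = density (distr lborel borel (\<lambda>x. A *v x)) (\<lambda>_. ennreal \<bar>det A\<bar>)"
    proof -
      have "lborel = density (distr lborel borel (\<lambda>x. 0 + (\<Sum>b\<in>Basis. (c b * (x \<bullet> b)) *\<^sub>R b))) (\<lambda>_. ennreal (\<Prod>b\<in>(Basis::(real ^ 'd) set). \<bar>c b\<bar>))"
        by (rule lborel_affine_euclidean) (auto simp: Bas c nz)
      then show ?thesis unfolding T pr .
    qed
    let ?G = "\<integral>\<^sup>+x. bump x \<partial>(lborel :: (real ^ 'd) measure)"
    have "?G = (\<integral>\<^sup>+x. ennreal \<bar>det A\<bar> * bump x \<partial>distr lborel borel (\<lambda>x. A *v x))"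
      by (subst (1) leb, subst nn_integral_density) auto
    also have "\<dots> = (\<integral>\<^sup>+x. ennreal \<bar>det A\<bar> * bump (A *v x) \<partial>lborel)"
      by (rule nn_integral_distr) (auto intro: matrix_measurable)
    also have "\<dots> = ennreal \<bar>det A\<bar> * (ennreal (scaling A) * ?G)"
      using nn_integral_scaling[OF inv bump_measurable]
      by (simp add: nn_integral_cmult measurable_compose[OF matrix_measurable bump_measurable])
    finally have f: "?G = ennreal \<bar>det A\<bar> * (ennreal (scaling A) * ?G)" .
    have "ennreal (scaling A * \<bar>det A\<bar>) = ennreal \<bar>det A\<bar> * ennreal (scaling A)"
      by (subst mult.commute, rule ennreal_mult) (use scaling_pos[OF inv] in auto)
    then have e: "ennreal (scaling A * \<bar>det A\<bar>) * ?G = ennreal 1 * ?G"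
      using f by (simp only: mult.assoc ennreal_1 mult_1)
    show "scaling A * \<bar>det A\<bar> = 1"
      by (rule ennreal_cancel[OF _ _ bump_id e]) (use scaling_pos[OF inv] in auto)
  qed
next
  fix m n :: 'd assume "m \<noteq> n"
  define S where "S = ((\<chi> i j. mat 1 $ i $ Transposition.transpose m n j) :: real ^ 'd ^ 'd)"
  have "S ** S = mat 1"
    unfolding matrix_eq by (simp add: S_def swap_apply vec_eq_iff flip: matrix_vector_mul_assoc)
  note SS = this
  have "invertible S \<longrightarrow> scaling S * \<bar>det S\<bar> = 1"
  proof
    assume inv: "invertible S"
    have "(scaling S * \<bar>det S\<bar>) * (scaling S * \<bar>det S\<bar>) = scaling (S ** S) * \<bar>det (S ** S)\<bar>"
      by (simp add: scaling_mult[OF inv inv] det_mul abs_mult)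
    also have "\<dots> = 1" unfolding SS scaling_one by (simp add: det_I)
    finally have "(scaling S * \<bar>det S\<bar>)\<^sup>2 = 1" by (simp add: power2_eq_square)
    moreover have "scaling S * \<bar>det S\<bar> \<ge> 0" using scaling_pos[OF inv] by simp
    ultimately show "scaling S * \<bar>det S\<bar> = 1" by (auto simp: power2_eq_1_iff)
  qed
  then show "invertible (\<chi> i j. mat 1 $ i $ Transposition.transpose m n j :: real ^ 'd ^ 'd) \<longrightarrow>
      scaling (\<chi> i j. mat 1 $ i $ Transposition.transpose m n j) * \<bar>det (\<chi> i j. mat 1 $ i $ Transposition.transpose m n j :: real ^ 'd ^ 'd)\<bar> = 1"
    unfolding S_def .
next
  fix m n :: 'd and c :: real assume mn: "m \<noteq> n"
  define S where "S c = ((\<chi> i j. if i = m \<and> j = n then c else of_bool (i = j)) :: real ^ 'd ^ 'd)" for c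
  define D where "D = ((\<chi> i j. if i = j then (if i = m then 2 else 1) else 0) :: real ^ 'd ^ 'd)"
  have iD: "invertible D"
    unfolding invertible_det_nz D_def by (subst det_diagonal) auto
  have Sv: "S c *v x = (\<chi> i. x $ i + (if i = m then c * x $ n else 0))" for c x
    unfolding S_def by (rule shear_apply[OF mn])
  have Dv: "D *v x = (\<chi> i. (if i = m then 2 else 1) * x $ i)" for x
    unfolding D_def by (rule diagonal_apply)
  have SS: "S c ** S c = S (2 * c)"
    unfolding matrix_eq using mn by (simp add: Sv vec_eq_iff flip: matrix_vector_mul_assoc)
  have DS: "D ** S c = S (2 * c) ** D"
    unfolding matrix_eq using mn by (simp add: Sv Dv vec_eq_iff flip: matrix_vector_mul_assoc)
  have "invertible (S c) \<longrightarrow> scaling (S c) * \<bar>det (S c)\<bar> = 1"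
  proof
    assume inv: "invertible (S c)"
    have inv2: "invertible (S (2 * c))" unfolding SS[symmetric] by (rule invertible_mult[OF inv inv])
    define t where "t A = scaling A * \<bar>det A\<bar>" for A :: "real ^ 'd ^ 'd"
    have m: "t (A ** B) = t A * t B" if "invertible A" "invertible B" for A B :: "real ^ 'd ^ 'd"
      by (simp add: t_def scaling_mult[OF that] det_mul abs_mult)
    have pos: "t A > 0" if "invertible A" for A
      using scaling_pos[OF that] that by (simp add: t_def invertible_det_nz)
    have "t D * t (S c) = t (S (2 * c)) * t D"
      unfolding m[OF iD inv, symmetric] m[OF inv2 iD, symmetric] DS ..
    then have "t (S c) = t (S (2 * c))" using pos[OF iD] by simp
    also have "\<dots> = t (S c) * t (S c)" unfolding SS[symmetric] by (rule m[OF inv inv])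
    finally have "t (S c) = 1" using pos[OF inv] by simp
    then show "scaling (S c) * \<bar>det (S c)\<bar> = 1" by (simp add: t_def)
  qed
  then show "invertible (\<chi> i j. if i = m \<and> j = n then c else of_bool (i = j) :: real ^ 'd ^ 'd) \<longrightarrow>
      scaling (\<chi> i j. if i = m \<and> j = n then c else of_bool (i = j)) * \<bar>det (\<chi> i j. if i = m \<and> j = n then c else of_bool (i = j) :: real ^ 'd ^ 'd)\<bar> = 1"
    unfolding S_def .
qed

theorem nn_integral_matrix:
  fixes A :: "real ^ 'd::finite ^ 'd" and f :: "real ^ 'd \<Rightarrow> ennreal"
  assumes A: "invertible A" and f: "f \<in> borel_measurable borel"
  shows "ennreal \<bar>det A\<bar> * (\<integral>\<^sup>+x. f (A *v x) \<partial>lborel) = (\<integral>\<^sup>+y. f y \<partial>lborel)"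
proof -
  have "ennreal \<bar>det A\<bar> * ennreal (scaling A) = ennreal (\<bar>det A\<bar> * scaling A)"
    using scaling_pos[OF A] by (simp add: ennreal_mult less_imp_le)
  also have "\<dots> = 1" using scaling_det[of A] A by (simp add: mult.commute)
  finally show ?thesis unfolding nn_integral_scaling[OF A f] by (simp flip: mult.assoc)
qed

section \<open>The homogeneous order\<close>

lemma matrix_mult_scaleR:
  fixes A X :: "real ^ 'd::finite ^ 'd"
  shows "A ** (r *\<^sub>R X) = r *\<^sub>R (A ** X)" "(r *\<^sub>R A) ** X = r *\<^sub>R (A ** X)"
  by (simp_all add: matrix_matrix_mult_def vec_eq_iff sum_distrib_left mult_ac)

text \<open>The entries of \<open>matrix_exp\<close> are numerical power series, which the calculus of one variable covers.\<close>

lemma matrix_exp_nth: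
  fixes E :: "real ^ 'd::finite ^ 'd"
  shows "R \<ge> 0 \<Longrightarrow> summable (\<lambda>k. \<bar>((((**) E) ^^ k) (mat 1)) $ i $ j\<bar> / fact k * R ^ k)"
    and "matrix_exp (s *\<^sub>R E) $ i $ j = suminf (\<lambda>k. ((((**) E) ^^ k) (mat 1)) $ i $ j / fact k * s ^ k)"
proof -
  let ?P = "\<lambda>k. (((**) E) ^^ k) (mat 1)"
  have "linear ((**) E :: real ^ 'd ^ 'd \<Rightarrow> real ^ 'd ^ 'd)"
  proof
    show "E ** (x + y) = E ** x + E ** y" for x y :: "real ^ 'd ^ 'd"
      by (rule matrix_add_ldistrib)
    show "E ** (r *\<^sub>R x) = r *\<^sub>R (E ** x)" for r and x :: "real ^ 'd ^ 'd"
      by (rule matrix_mult_scaleR)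
  qed
  then obtain K where K: "K > 0" "\<And>X :: real ^ 'd ^ 'd. norm (E ** X) \<le> K * norm X"
    using linear_bounded_pos by blast
  have P: "norm (?P k) \<le> K ^ k * norm (mat 1 :: real ^ 'd ^ 'd)" for k
  proof (induction k)
    case (Suc k)
    have "norm (?P (Suc k)) \<le> K * norm (?P k)" using K(2)[of "?P k"] by simp
    also have "\<dots> \<le> K * (K ^ k * norm (mat 1 :: real ^ 'd ^ 'd))" using K Suc by (intro mult_left_mono) auto
    finally show ?case by (simp add: mult.assoc)
  qed simp
  have Pij: "\<bar>X $ i $ j\<bar> \<le> norm X" for X :: "real ^ 'd ^ 'd"
    using component_le_norm_cart[of "X $ i" j] Finite_Cartesian_Product.norm_nth_le[of X i] by linarith
  have maj: "summable (\<lambda>k. norm (mat 1 :: real ^ 'd ^ 'd) * ((K * R) ^ k /\<^sub>R fact k))" for R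
    by (intro summable_mult summable_exp_generic)
  have le: "norm (?P k) / fact k * R ^ k \<le> norm (mat 1 :: real ^ 'd ^ 'd) * ((K * R) ^ k /\<^sub>R fact k)" if "R \<ge> 0" for R k
  proof -
    have "norm (?P k) / fact k * R ^ k \<le> K ^ k * norm (mat 1 :: real ^ 'd ^ 'd) / fact k * R ^ k"
      using that by (intro mult_right_mono divide_right_mono P) auto
    also have "\<dots> = norm (mat 1 :: real ^ 'd ^ 'd) * ((K * R) ^ k /\<^sub>R fact k)"
      by (simp add: power_mult_distrib divide_inverse mult_ac)
    finally show ?thesis .
  qed
  show "summable (\<lambda>k. \<bar>?P k $ i $ j\<bar> / fact k * R ^ k)" if R: "R \<ge> 0" for R
  proof (rule summable_comparison_test'[OF maj[of R], of 0])
    fix k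
    have "\<bar>?P k $ i $ j\<bar> / fact k * R ^ k \<le> norm (?P k) / fact k * R ^ k"
      using R by (intro mult_right_mono divide_right_mono Pij) auto
    with le[OF R, of k] show "norm (\<bar>?P k $ i $ j\<bar> / fact k * R ^ k) \<le> norm (mat 1 :: real ^ 'd ^ 'd) * ((K * R) ^ k /\<^sub>R fact k)"
      using R by simp
  qed
  have Ps: "(((**) (s *\<^sub>R E)) ^^ k) (mat 1) = s ^ k *\<^sub>R ?P k" for k
    by (induction k) (simp_all add: matrix_mult_scaleR)
  have nP: "norm ((1 / fact k) *\<^sub>R (s ^ k *\<^sub>R ?P k)) = norm (?P k) / fact k * \<bar>s\<bar> ^ k" for k
    by (simp add: power_abs)
  have "summable (\<lambda>k. norm ((1 / fact k) *\<^sub>R (s ^ k *\<^sub>R ?P k)))"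
    unfolding nP by (rule summable_comparison_test'[OF maj[of "\<bar>s\<bar>"], of 0]) (use le[of "\<bar>s\<bar>"] in simp)
  then have sm: "summable (\<lambda>k. (1 / fact k) *\<^sub>R (s ^ k *\<^sub>R ?P k))" by (rule summable_norm_cancel)
  have bl: "bounded_linear (\<lambda>X :: real ^ 'd ^ 'd. X $ i $ j)"
    by (rule bounded_linear_compose[OF bounded_linear_vec_nth bounded_linear_vec_nth])
  have "matrix_exp (s *\<^sub>R E) $ i $ j = (suminf (\<lambda>k. (1 / fact k) *\<^sub>R (s ^ k *\<^sub>R ?P k))) $ i $ j"
    unfolding matrix_exp_def Ps ..
  also have "\<dots> = suminf (\<lambda>k. ((1 / fact k) *\<^sub>R (s ^ k *\<^sub>R ?P k)) $ i $ j)"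
    by (rule bounded_linear.suminf[OF bl sm])
  also have "\<dots> = suminf (\<lambda>k. ?P k $ i $ j / fact k * s ^ k)" by (simp add: mult_ac)
  finally show "matrix_exp (s *\<^sub>R E) $ i $ j = suminf (\<lambda>k. ?P k $ i $ j / fact k * s ^ k)" .
qed

lemma matrix_exp_derivative_0:
  fixes E :: "real ^ 'd::finite ^ 'd"
  shows "((\<lambda>s. matrix_exp (s *\<^sub>R E) $ i $ j) has_real_derivative E $ i $ j) (at 0)"
    and "matrix_exp (0 *\<^sub>R E) = mat 1"
proof -
  define c where "c k = ((((**) E) ^^ k) (mat 1)) $ i $ j / fact k" for k
  have sm: "summable (\<lambda>k. c k * (1::real) ^ k)"
  proof (rule summable_norm_cancel)
    show "summable (\<lambda>k. norm (c k * 1 ^ k))" using matrix_exp_nth(1)[of 1 E i j] by (simp add: c_def)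
  qed
  have "((\<lambda>s. suminf (\<lambda>k. c k * s ^ k)) has_real_derivative suminf (\<lambda>k. diffs c k * 0 ^ k)) (at 0)"
    by (rule termdiffs_strong[OF sm]) simp
  moreover have "suminf (\<lambda>k. diffs c k * 0 ^ k) = E $ i $ j"
    unfolding powser_zero by (simp add: diffs_def c_def)
  ultimately show "((\<lambda>s. matrix_exp (s *\<^sub>R E) $ i $ j) has_real_derivative E $ i $ j) (at 0)"
    unfolding matrix_exp_nth(2) c_def by simp
  have "matrix_exp (0 *\<^sub>R E) $ i $ j = mat 1 $ i $ j" for i j
    unfolding matrix_exp_nth(2) powser_zero by simp
  then show "matrix_exp (0 *\<^sub>R E) = mat 1" by (simp add: vec_eq_iff)
qed

lemma det_derivative_at_identity:
  fixes M :: "real \<Rightarrow> real ^ 'd::finite ^ 'd"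
  assumes d: "\<And>i j. ((\<lambda>s. M s $ i $ j) has_real_derivative E $ i $ j) (at 0)" and 0: "M 0 = mat 1"
  shows "((\<lambda>s. det (M s)) has_real_derivative trace E) (at 0)"
proof -
  let ?Perm = "{p. p permutes (UNIV :: 'd set)}"
  have "((\<lambda>s. det (M s)) has_real_derivative
    (\<Sum>p\<in>?Perm. of_int (sign p) * (\<Sum>i\<in>UNIV. E $ i $ p i * (\<Prod>j\<in>UNIV - {i}. M 0 $ j $ p j)))) (at 0)"
    unfolding det_def
    by (intro DERIV_sum DERIV_cmult has_field_derivative_prod d)
  also have "(\<Sum>p\<in>?Perm. of_int (sign p) * (\<Sum>i\<in>UNIV. E $ i $ p i * (\<Prod>j\<in>UNIV - {i}. M 0 $ j $ p j)))
    = (\<Sum>p\<in>?Perm. of_int (sign p) * (if p = id then trace E else 0))"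
  proof (rule sum.cong[OF refl])
    fix p assume "p \<in> ?Perm"
    then have p: "p permutes (UNIV :: 'd set)" by simp
    have "(\<Sum>i\<in>UNIV. E $ i $ p i * (\<Prod>j\<in>UNIV - {i}. M 0 $ j $ p j)) = (if p = id then trace E else 0)"
    proof (cases "p = id")
      case True
      then show ?thesis by (simp add: 0 mat_def trace_def)
    next
      case False
      have z: "(\<Prod>j\<in>UNIV - {i}. M 0 $ j $ p j) = 0" for i
      proof -
        from False obtain k where k: "p k \<noteq> k" by (auto simp: fun_eq_iff)
        have "p (p k) \<noteq> p k" using k permutes_inj[OF p] by (auto dest: injD)
        then obtain l where l: "l \<noteq> i" "p l \<noteq> l" using k by metis
        then show ?thesis by (intro prod_zero) (auto simp: 0 mat_def intro!: bexI[of _ l])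
      qed
      show ?thesis using False by (simp only: z mult_zero_right sum.neutral_const if_False)
    qed
    then show "of_int (sign p) * (\<Sum>i\<in>UNIV. E $ i $ p i * (\<Prod>j\<in>UNIV - {i}. M 0 $ j $ p j)) = of_int (sign p) * (if p = id then trace E else 0)"
      by (simp only:)
  qed
  also have "(\<Sum>p\<in>?Perm. of_int (sign p) * (if p = id then trace E else 0)) = trace E"
    by (subst sum.remove[of _ id]) (auto simp: permutes_id finite_permutations sign_id intro!: sum.neutral)
  finally show ?thesis .
qed

text \<open>The derivative of \<open>det (exp (s E))\<close> at \<open>s = 0\<close> is the trace of \<open>E\<close>. Near \<open>0\<close> the determinant is
  positive, so the absolute value is harmless there.\<close>

lemma trace_eq_growth:
  fixes E :: "real ^ 'd::finite ^ 'd"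
  assumes "\<And>s. invertible (matrix_exp (s *\<^sub>R E)) \<Longrightarrow> \<bar>det (matrix_exp (s *\<^sub>R E))\<bar> = exp (s * \<mu>)"
  shows "trace E = \<mu>"
proof -
  let ?h = "\<lambda>s. det (matrix_exp (s *\<^sub>R E))"
  have d: "(?h has_real_derivative trace E) (at 0)"
    by (rule det_derivative_at_identity[OF matrix_exp_derivative_0])
  then have "isCont ?h 0" by (rule DERIV_isCont)
  moreover have h0: "?h 0 = 1" using matrix_exp_derivative_0(2)[of E] by (simp add: det_I)
  ultimately have "(?h \<longlongrightarrow> 1) (nhds 0)" by (simp add: isCont_def tendsto_nhds_iff) 
  then have "\<forall>\<^sub>F s in nhds 0. ?h s > 0" by (rule order_tendstoD) simp
  then have ev: "\<forall>\<^sub>F s in nhds 0. ?h s = exp (s * \<mu>)"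
  proof eventually_elim
    case (elim s)
    then have "invertible (matrix_exp (s *\<^sub>R E))" by (simp add: invertible_det_nz)
    from assms[OF this] elim show ?case by simp
  qed
  have "((\<lambda>s. exp (s * \<mu>)) has_real_derivative exp (0 * \<mu>) * (1 * \<mu>)) (at 0)"
    by (intro derivative_eq_intros) auto
  then have "(?h has_real_derivative exp (0 * \<mu>) * (1 * \<mu>)) (at 0)"
    by (subst DERIV_cong_ev[OF refl ev refl])
  then show ?thesis using DERIV_unique[OF d] by simp
qed

context
  fixes m :: "nat ^ 'd::finite"
  assumes m1: "\<And>j. m $ j \<ge> 1"
begin

lemma quasi_ge_linear: "quasi m z \<ge> (norm z) - real CARD('d)"
proof -
  have "norm (z $ j) - 1 \<le> norm (z $ j) ^ (2 * m $ j)" for j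
  proof (cases "norm (z $ j) \<ge> 1")
    case True
    then have "norm (z $ j) ^ 1 \<le> norm (z $ j) ^ (2 * m $ j)" using m1[of j] by (intro power_increasing) auto
    then show ?thesis by simp
  next
    case False
    then show ?thesis using zero_le_power[OF norm_ge_zero[of "z $ j"], of "2 * m $ j"] by linarith
  qed
  then have "(\<Sum>j\<in>UNIV. norm (z $ j) - 1) \<le> quasi m z" unfolding quasi_def by (rule sum_mono)
  moreover have "norm z \<le> (\<Sum>j\<in>UNIV. norm (z $ j))"
    using L2_set_le_sum[of UNIV "\<lambda>j. norm (z $ j)"] by (simp add: norm_vec_def)
  ultimately show ?thesis by (simp add: sum_subtractf)
qed

lemma matrix_norm_lower:
  fixes B :: "real ^ 'd ^ 'd"
  assumes "invertible B"
  shows "\<exists>k>0. \<forall>x. k * norm x \<le> norm (B *v x)"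
proof -
  obtain K where K: "K > 0" "\<And>x. norm (matrix_inv B *v x) \<le> norm x * K"
    using bounded_linear.pos_bounded[OF matrix_vector_mul_bounded_linear[of "matrix_inv B"]] by blast
  have "1 / K * norm x \<le> norm (B *v x)" for x
  proof -
    have "matrix_inv B *v (B *v x) = x"
      using matrix_inv_mult(1)[OF assms] by (simp add: matrix_vector_mul_assoc)
    then show ?thesis using K(2)[of "B *v x"] K(1) by (simp add: divide_le_eq)
  qed
  then show ?thesis using K(1) by (intro exI[of _ "1 / K"]) auto
qed

lemma quasi_exp_bound:
  fixes B :: "real ^ 'd ^ 'd"
  assumes B: "invertible B" and c: "c > 0"
  shows "\<exists>a>0. \<exists>K>0. \<forall>x. exp (- (c * quasi m (cplx_vec (B *v x)))) \<le> K * exp (- (a * norm x))"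
proof -
  obtain k where k: "k > 0" "\<And>x. k * norm x \<le> norm (B *v x)" using matrix_norm_lower[OF B] by blast
  have "exp (- (c * quasi m (cplx_vec (B *v x)))) \<le> exp (c * real CARD('d)) * exp (- (c * k * norm x))" for x
  proof -
    have "k * norm x - real CARD('d) \<le> quasi m (cplx_vec (B *v x))"
      using quasi_ge_linear[of "cplx_vec (B *v x)"] k(2)[of x] by simp
    then have "c * (k * norm x - real CARD('d)) \<le> c * quasi m (cplx_vec (B *v x))"
      using c by (intro mult_left_mono) auto
    then have "- (c * quasi m (cplx_vec (B *v x))) \<le> c * real CARD('d) + - (c * k * norm x)"
      by (simp add: right_diff_distrib mult.assoc)
    then show ?thesis unfolding exp_add[symmetric] by simp
  qed
  then show ?thesis using c k(1) by (intro exI[of _ "c * k"] conjI exI[of _ "exp (c * real CARD('d))"] allI) auto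
qed

lemma continuous_quasi_matrix: "continuous_on UNIV (\<lambda>x. exp (- (c * quasi m (cplx_vec (B *v x)))))"
  for B :: "real ^ 'd ^ 'd"
  by (intro continuous_intros continuous_on_quasi[OF m1] linear_continuous_on matrix_vector_mul_bounded_linear)

lemma integrable_quasi:
  fixes B :: "real ^ 'd ^ 'd"
  assumes B: "invertible B" and c: "c > 0"
  shows "integrable lborel (\<lambda>x. exp (- (c * quasi m (cplx_vec (B *v x)))))"
proof -
  obtain a K where aK: "a > 0" "K > 0" "\<And>x. exp (- (c * quasi m (cplx_vec (B *v x)))) \<le> K * exp (- (a * norm x))"
    using quasi_exp_bound[OF B c] by blast
  show ?thesis
  proof (rule Bochner_Integration.integrable_bound)
    show "integrable lborel (\<lambda>x::real ^ 'd. K * exp (- (a * norm x)))"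
      by (intro integrable_mult_right integrable_exp_norm aK)
    show "AE x in lborel. norm (exp (- (c * quasi m (cplx_vec (B *v x))))) \<le> norm (K * exp (- (a * norm x)))"
      using aK by (intro AE_I2) (simp add: less_imp_le)
  qed (simp add: borel_measurable_continuous_onI[OF continuous_quasi_matrix])
qed

definition dilation :: "real \<Rightarrow> real ^ 'd ^ 'd"
  where "dilation t = (\<chi> i j. if i = j then t powr (1 / (2 * real (m $ i))) else 0)"

lemma dilation_apply: "dilation t *v x = (\<chi> i. t powr (1 / (2 * real (m $ i))) * x $ i)"
  unfolding dilation_def by (rule diagonal_apply)

lemma det_dilation:
  assumes "t > 0"
  shows "det (dilation t) = t powr (\<Sum>j\<in>UNIV. 1 / (2 * real (m $ j)))"
  unfolding dilation_def by (subst det_diagonal) (use assms in \<open>auto simp: powr_sum\<close>)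

lemma dilation_power:
  assumes "t > 0"
  shows "dilation t *v x = (\<chi> i. root (2 * lcm_vec m) t ^ (kappa m $ i) * x $ i)"
    and "root (2 * lcm_vec m) t ^ (2 * lcm_vec m) = t"
proof -
  have L: "2 * lcm_vec m > 0" using lcm_vec_pos[OF m1] by simp
  have "root (2 * lcm_vec m) t ^ (kappa m $ i) = t powr (1 / (2 * real (m $ i)))" for i
  proof -
    have "root (2 * lcm_vec m) t ^ (kappa m $ i) = (t powr (1 / real (2 * lcm_vec m))) powr real (kappa m $ i)"
      using assms L by (subst powr_realpow) (auto simp: root_powr_inverse)
    also have "\<dots> = t powr (real (kappa m $ i) / real (2 * (kappa m $ i * m $ i)))"
      by (simp add: powr_powr kappa_mult[OF m1])
    also have "real (kappa m $ i) / real (2 * (kappa m $ i * m $ i)) = 1 / (2 * real (m $ i))"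
      using kappa_ge_1[OF m1, of i] by simp
    finally show ?thesis .
  qed
  then show "dilation t *v x = (\<chi> i. root (2 * lcm_vec m) t ^ (kappa m $ i) * x $ i)"
    by (simp add: dilation_apply)
  show "root (2 * lcm_vec m) t ^ (2 * lcm_vec m) = t" using assms L by (simp add: real_root_pow_pos2)
qed

lemma quasi_dilation:
  assumes "t > 0"
  shows "quasi m (cplx_vec (dilation t *v x)) = t * quasi m (cplx_vec x)"
proof -
  have "cplx_vec (dilation t *v x) = (\<chi> j. of_real (root (2 * lcm_vec m) t) ^ (kappa m $ j) * cplx_vec x $ j)"
    unfolding dilation_power(1)[OF assms] by (simp add: vec_eq_iff)
  then show ?thesis
    using quasi_scale[OF m1 real_root_ge_zero[OF less_imp_le[OF assms]], of "2 * lcm_vec m" "cplx_vec x"]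
    by (simp only: dilation_power(2)[OF assms])
qed

text \<open>The dilation by \<open>t^(1 / 2m\<^sub>j)\<close> in coordinate \<open>j\<close> multiplies \<open>quasi\<close> by \<open>t\<close>, and its determinant is
  \<open>t^(\<Sum> 1 / 2m\<^sub>j)\<close>.\<close>

theorem integral_quasi_scaling:
  fixes B :: "real ^ 'd ^ 'd"
  assumes B: "invertible B" and c: "c > 0" and t: "t > 0"
  shows "(LINT x|lborel. exp (- (t * (c * quasi m (cplx_vec (B *v x))))))
    = t powr (- (\<Sum>j\<in>UNIV. 1 / (2 * real (m $ j)))) * (LINT x|lborel. exp (- (c * quasi m (cplx_vec (B *v x)))))"
proof -
  let ?\<mu> = "\<Sum>j\<in>UNIV. 1 / (2 * real (m $ j))"
  let ?A = "matrix_inv B"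
  let ?T = "?A ** (dilation t ** B)"
  have A: "invertible ?A" using matrix_inv_mult[OF B] unfolding invertible_def by blast
  have D: "invertible (dilation t)" using det_dilation[OF t] t by (simp add: invertible_det_nz)
  have T: "invertible ?T" by (intro invertible_mult A D B)
  have "det ?A * det B = 1" using arg_cong[OF matrix_inv_mult(1)[OF B], of det] by (simp add: det_mul det_I)
  then have detT: "det ?T = t powr ?\<mu>" using det_dilation[OF t] by (simp add: det_mul mult_ac)
  let ?f = "\<lambda>x. exp (- (c * quasi m (cplx_vec (B *v x))))"
  have BT: "B *v (?T *v x) = dilation t *v (B *v x)" for x
    using matrix_inv_mult(2)[OF B] by (simp add: matrix_vector_mul_assoc matrix_mul_assoc)
  have fT: "?f (?T *v x) = exp (- (t * (c * quasi m (cplx_vec (B *v x)))))" for x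
    unfolding BT quasi_dilation[OF t] by (simp add: mult_ac)
  have m: "?f \<in> borel_measurable borel" by (rule borel_measurable_continuous_onI[OF continuous_quasi_matrix])
  have "ennreal \<bar>det ?T\<bar> * (\<integral>\<^sup>+x. ennreal (?f (?T *v x)) \<partial>lborel) = (\<integral>\<^sup>+y. ennreal (?f y) \<partial>lborel)"
    by (rule nn_integral_matrix[OF T]) (use m in measurable)
  moreover have "(\<integral>\<^sup>+y. ennreal (?f y) \<partial>lborel) = ennreal (LINT y|lborel. ?f y)"
    by (rule nn_integral_eq_integral[OF integrable_quasi[OF B c]]) simp
  moreover have "(\<integral>\<^sup>+x. ennreal (?f (?T *v x)) \<partial>lborel) = ennreal (LINT x|lborel. exp (- (t * (c * quasi m (cplx_vec (B *v x))))))"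
    unfolding fT using nn_integral_eq_integral[OF integrable_quasi[OF B, of "t * c"]] t c by (simp add: mult.assoc)
  ultimately have "ennreal (t powr ?\<mu> * (LINT x|lborel. exp (- (t * (c * quasi m (cplx_vec (B *v x))))))) = ennreal (LINT y|lborel. ?f y)"
    unfolding detT by (simp add: ennreal_mult)
  then have "t powr ?\<mu> * (LINT x|lborel. exp (- (t * (c * quasi m (cplx_vec (B *v x)))))) = (LINT y|lborel. ?f y)"
    by (subst (asm) ennreal_inj) (auto intro!: mult_nonneg_nonneg integral_nonneg)
  then show ?thesis using t by (simp add: powr_minus field_simps)
qed

text \<open>For \<open>E\<close> in the exponent set, the integral of \<open>exp (-t Re P)\<close> can be computed with two changes of
  variables, one by the matrix \<open>t^E\<close> and one by the dilations of the semi-elliptic form. Comparison gives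
  \<open>|det (t^E)| = t^(\<Sum> 1 / 2m\<^sub>j)\<close>, and differentiating in \<open>ln t\<close> gives the trace.\<close>

theorem hom_order_eq:
  fixes A :: "real ^ 'd ^ 'd" and P :: "'d cpoly"
  assumes P: "positive_homogeneous P" and A: "invertible A" and p: "positive_semi_elliptic m (lin_subst A P)"
  shows "hom_order P = (\<Sum>j\<in>UNIV. 1 / (2 * real (m $ j)))"
proof -
  let ?\<mu> = "\<Sum>j\<in>UNIV. 1 / (2 * real (m $ j))"
  let ?B = "matrix_inv A"
  let ?ES = "Exp_set (\<lambda>\<xi>. eval_poly P (cplx_vec \<xi>))"
  define E where "E = (SOME E. E \<in> ?ES)"
  have E: "E \<in> ?ES" unfolding E_def using P by (simp add: positive_homogeneous_def some_in_eq)
  have B: "invertible ?B" using matrix_inv_mult[OF A] unfolding invertible_def by blast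
  define R where "R = real_part P"
  have RE: "R (matrix_powr t E *v x) = t * R x" if "t > 0" for t x
  proof -
    have "complex_of_real t * eval_poly P (cplx_vec x) = eval_poly P (cplx_vec (matrix_powr t E *v x))"
      using E that by (simp add: Exp_set_def)
    then show ?thesis unfolding R_def real_part_def by (drule_tac arg_cong[of _ _ Re]) simp
  qed
  have RA: "R (A *v x) = real_part (lin_subst A P) x" for x
    by (simp add: R_def real_part_def eval_lin_subst cplx_mat_vec)
  have RT: "R (A *v (dilation t *v x)) = t * R (A *v x)" if t: "t > 0" for t x
  proof -
    have "cplx_vec (dilation t *v x) = (\<chi> j. of_real (root (2 * lcm_vec m) t) ^ (kappa m $ j) * cplx_vec x $ j)"
      unfolding dilation_power(1)[OF t] by (simp add: vec_eq_iff)
    moreover have "complex_of_real (root (2 * lcm_vec m) t) ^ (2 * lcm_vec m) = complex_of_real t"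
      using dilation_power(2)[OF t] by (metis of_real_power)
    ultimately show ?thesis
      unfolding RA real_part_def using semi_elliptic_scale(1)[OF m1 p, of "of_real (root (2 * lcm_vec m) t)" "cplx_vec x"] by simp
  qed
  obtain c M where c: "c > 0" and lower0: "\<And>\<xi> \<nu>. Re (eval_poly (lin_subst A P) (cplx_vec \<xi> - \<i> *s cplx_vec \<nu>)) \<ge> c * quasi m (cplx_vec \<xi>) - M * quasi m (cplx_vec \<nu>)"
    using semi_elliptic_lower_bound[OF m1 p] by blast
  have lower: "R x \<ge> c * quasi m (cplx_vec (?B *v x))" for x
  proof -
    have "cplx_vec (0 :: real ^ 'd) = 0" by (simp add: vec_eq_iff)
    moreover have "quasi m 0 = 0" using quasi_eq_0[OF m1, of 0] by simp
    ultimately have "real_part (lin_subst A P) (?B *v x) \<ge> c * quasi m (cplx_vec (?B *v x))"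
      using lower0[of "?B *v x" 0] by (simp add: real_part_def)
    then show ?thesis using matrix_inv_mult(2)[OF A] by (simp flip: RA add: matrix_vector_mul_assoc)
  qed
  have cR: "continuous_on UNIV R" unfolding R_def real_part_def[abs_def] by (intro continuous_intros)
  then have mR [measurable]: "R \<in> borel_measurable borel" by (rule borel_measurable_continuous_onI)
  define I where "I t = (\<integral>\<^sup>+x. ennreal (exp (- (t * R x))) \<partial>lborel)" for t
  have fin: "I t < \<infinity>" "I t > 0" if t: "t > 0" for t
  proof -
    have "I t \<le> (\<integral>\<^sup>+x. ennreal (exp (- (t * c * quasi m (cplx_vec (?B *v x))))) \<partial>lborel)"
      unfolding I_def
    proof (intro nn_integral_mono ennreal_leI)
      fix x
      have "t * (c * quasi m (cplx_vec (?B *v x))) \<le> t * R x" using t by (intro mult_left_mono lower) auto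
      then show "exp (- (t * R x)) \<le> exp (- (t * c * quasi m (cplx_vec (?B *v x))))" by (simp add: mult.assoc)
    qed
    also have "\<dots> = ennreal (LINT x|lborel. exp (- (t * c * quasi m (cplx_vec (?B *v x)))))"
      by (rule nn_integral_eq_integral[OF integrable_quasi[OF B]]) (use t c in auto)
    also have "\<dots> < \<infinity>" by simp
    finally show "I t < \<infinity>" .
    have "I t \<noteq> 0"
    proof
      assume "I t = 0"
      then have "AE x in lborel. ennreal (exp (- (t * R x))) = 0"
        unfolding I_def by (subst (asm) nn_integral_0_iff_AE) measurable
      then have "AE x::real ^ 'd in lborel. False" by simp
      then have "emeasure lborel (UNIV :: (real ^ 'd) set) = 0"
        by (simp add: AE_iff_measurable[OF _ refl])
      then show False by (simp add: emeasure_lborel_UNIV)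
    qed
    then show "I t > 0" by (simp add: zero_less_iff_neq_zero)
  qed
  have I1: "I 1 = (\<integral>\<^sup>+x. ennreal (exp (- R x)) \<partial>lborel)" by (simp add: I_def)
  have chg: "ennreal \<bar>det S\<bar> * I t = I 1" if S: "invertible S" and RS: "\<And>x. R (S *v x) = t * R x" for S t
  proof -
    have "ennreal \<bar>det S\<bar> * (\<integral>\<^sup>+x. ennreal (exp (- R (S *v x))) \<partial>lborel) = (\<integral>\<^sup>+x. ennreal (exp (- R x)) \<partial>lborel)"
      by (rule nn_integral_matrix[OF S]) measurable
    then show ?thesis by (simp add: RS I_def)
  qed
  have "trace E = ?\<mu>"
  proof (rule trace_eq_growth)
    fix s :: real
    assume S: "invertible (matrix_exp (s *\<^sub>R E))"
    define t where "t = exp s"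
    have t: "t > 0" "ln t = s" by (simp_all add: t_def)
    let ?T = "A ** (dilation t ** ?B)"
    have D: "invertible (dilation t)" using det_dilation[OF t(1)] t by (simp add: invertible_det_nz)
    have T: "invertible ?T" by (intro invertible_mult A D B)
    have "det A * det ?B = 1" using arg_cong[OF matrix_inv_mult(2)[OF A], of det] by (simp add: det_mul det_I)
    then have detT: "det ?T = t powr ?\<mu>" using det_dilation[OF t(1)] by (simp add: det_mul mult_ac)
    have "?T *v x = A *v (dilation t *v (?B *v x))" for x by (simp add: matrix_vector_mul_assoc matrix_mul_assoc)
    moreover have "A *v (?B *v x) = x" for x using matrix_inv_mult(2)[OF A] by (simp add: matrix_vector_mul_assoc)
    ultimately have "R (?T *v x) = t * R x" for x using RT[OF t(1), of "?B *v x"] by simp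
    from chg[OF T this] have 1: "ennreal \<bar>det ?T\<bar> * I t = I 1" .
    have "R (matrix_exp (s *\<^sub>R E) *v x) = t * R x" for x
      using RE[OF t(1), of x] by (simp add: matrix_powr_def t)
    from chg[OF S this] have "ennreal \<bar>det (matrix_exp (s *\<^sub>R E))\<bar> * I t = ennreal \<bar>det ?T\<bar> * I t" using 1 by simp
    then have "\<bar>det (matrix_exp (s *\<^sub>R E))\<bar> = \<bar>det ?T\<bar>"
      by (intro ennreal_cancel[OF _ _ fin(2)[OF t(1)] fin(1)[OF t(1)]]) auto
    then show "\<bar>det (matrix_exp (s *\<^sub>R E))\<bar> = exp (s * ?\<mu>)"
      unfolding detT by (simp add: t_def powr_def mult.commute)
  qed
  then show ?thesis by (simp add: hom_order_def E_def)
qed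

end

section \<open>Convolution powers and Fourier inversion\<close>

abbreviation chr :: "int ^ 'd::finite \<Rightarrow> real ^ 'd \<Rightarrow> complex"
  where "chr x \<xi> \<equiv> exp (\<i> * complex_of_real (real_vec x \<bullet> \<xi>))"

lemma real_vec_add: "real_vec (x + y) = real_vec x + real_vec y"
  by (simp add: real_vec_def vec_eq_iff)

lemma real_vec_diff: "real_vec (x - y) = real_vec x - real_vec y"
  by (simp add: real_vec_def vec_eq_iff)

lemma real_vec_nth [simp]: "real_vec x $ j = real_of_int (x $ j)"
  by (simp add: real_vec_def)

lemma chr_add: "chr (x + y) \<xi> = chr x \<xi> * chr y \<xi>"
  by (simp add: real_vec_add inner_add_left distrib_left exp_add)

lemma norm_chr [simp]: "norm (chr x \<xi>) = 1" by (simp add: norm_exp_eq_Re)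

lemma conv_summable_product:
  fixes \<psi> \<phi> :: "int ^ 'd::finite \<Rightarrow> complex"
  assumes \<psi>: "(\<lambda>x. norm (\<psi> x)) summable_on UNIV" and \<phi>: "(\<lambda>x. norm (\<phi> x)) summable_on UNIV"
  shows "(\<lambda>(x, y). norm (\<psi> (x - y) * \<phi> y)) summable_on UNIV \<times> UNIV"
proof -
  have "(\<lambda>p. norm ((\<lambda>(x, y). \<psi> x * \<phi> y) p)) summable_on UNIV \<times> UNIV"
  proof -
    have "(\<lambda>(x, y). norm (\<psi> x) * norm (\<phi> y)) summable_on (SIGMA x:UNIV. UNIV)"
    proof (rule summable_on_SigmaI)
      show "((\<lambda>y. case (x, y) of (x, y) \<Rightarrow> norm (\<psi> x) * norm (\<phi> y)) has_sum norm (\<psi> x) * (\<Sum>\<^sub>\<infinity>y. norm (\<phi> y))) UNIV" for x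
        using has_sum_cmult_right[OF has_sum_infsum[OF \<phi>], of "norm (\<psi> x)"] by simp
      show "(\<lambda>x. norm (\<psi> x) * (\<Sum>\<^sub>\<infinity>y. norm (\<phi> y))) summable_on UNIV"
        by (rule summable_on_cmult_left[OF \<psi>])
    qed auto
    then show ?thesis by (simp add: case_prod_unfold norm_mult)
  qed
  moreover have "bij_betw (\<lambda>(x, y). (x - y, y)) (UNIV \<times> UNIV) (UNIV \<times> UNIV :: ((int ^ 'd) \<times> (int ^ 'd)) set)"
    by (rule bij_betw_byWitness[where f' = "\<lambda>(x, y). (x + y, y)"]) auto
  ultimately have "(\<lambda>p. norm ((\<lambda>(x, y). \<psi> x * \<phi> y) ((\<lambda>(x, y). (x - y, y)) p))) summable_on UNIV \<times> UNIV"
    by (subst summable_on_reindex_bij_betw)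
  then show ?thesis by (simp add: case_prod_unfold)
qed

lemma conv_summable:
  fixes \<psi> \<phi> :: "int ^ 'd::finite \<Rightarrow> complex"
  assumes \<psi>: "(\<lambda>x. norm (\<psi> x)) summable_on UNIV" and \<phi>: "(\<lambda>x. norm (\<phi> x)) summable_on UNIV"
  shows "(\<lambda>x. norm (conv \<psi> \<phi> x)) summable_on UNIV"
proof -
  note p = conv_summable_product[OF \<psi> \<phi>]
  have "(\<lambda>x. \<Sum>\<^sub>\<infinity>y. norm (\<psi> (x - y) * \<phi> y)) summable_on UNIV"
    by (rule summable_on_Sigma_banach[OF p])
  then show ?thesis
  proof (rule summable_on_comparison_test)
    fix x :: "int ^ 'd"
    have "(\<lambda>y. norm (\<psi> (x - y) * \<phi> y)) summable_on UNIV"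
      using summable_on_SigmaD1[OF p, of x] by simp
    then show "norm (conv \<psi> \<phi> x) \<le> (\<Sum>\<^sub>\<infinity>y. norm (\<psi> (x - y) * \<phi> y))"
      unfolding conv_def by (rule norm_infsum_bound)
  qed auto
qed

text \<open>The absolutely convergent double sum may be interchanged.\<close>

lemma fourier_conv:
  fixes \<psi> \<phi> :: "int ^ 'd::finite \<Rightarrow> complex"
  assumes \<psi>: "(\<lambda>x. norm (\<psi> x)) summable_on UNIV" and \<phi>: "(\<lambda>x. norm (\<phi> x)) summable_on UNIV"
  shows "fourier (conv \<psi> \<phi>) \<xi> = fourier \<psi> \<xi> * fourier \<phi> \<xi>"
proof -
  have "(\<lambda>p. norm ((\<lambda>(x, y). \<psi> (x - y) * \<phi> y * chr x \<xi>) p)) = (\<lambda>(x, y). norm (\<psi> (x - y) * \<phi> y))"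
    by (simp add: fun_eq_iff norm_mult)
  with conv_summable_product[OF \<psi> \<phi>]
  have "(\<lambda>p. norm ((\<lambda>(x, y). \<psi> (x - y) * \<phi> y * chr x \<xi>) p)) summable_on UNIV \<times> UNIV"
    by (simp add: norm_mult)
  then have s: "(\<lambda>(x, y). \<psi> (x - y) * \<phi> y * chr x \<xi>) summable_on UNIV \<times> UNIV"
    by (rule abs_summable_summable)
  have "fourier (conv \<psi> \<phi>) \<xi> = (\<Sum>\<^sub>\<infinity>x. \<Sum>\<^sub>\<infinity>y. \<psi> (x - y) * \<phi> y * chr x \<xi>)"
    unfolding fourier_def conv_def by (simp add: infsum_cmult_left')
  also have "\<dots> = (\<Sum>\<^sub>\<infinity>y. \<Sum>\<^sub>\<infinity>x. \<psi> (x - y) * \<phi> y * chr x \<xi>)"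
    by (rule infsum_swap_banach[OF s])
  also have "\<dots> = (\<Sum>\<^sub>\<infinity>y. fourier \<psi> \<xi> * (\<phi> y * chr y \<xi>))"
  proof (rule infsum_cong)
    fix y :: "int ^ 'd"
    have "(\<Sum>\<^sub>\<infinity>x. \<psi> (x - y) * \<phi> y * chr x \<xi>) = (\<Sum>\<^sub>\<infinity>x. (\<psi> (x - y) * chr (x - y) \<xi>) * (\<phi> y * chr y \<xi>))"
    proof (rule infsum_cong)
      fix x :: "int ^ 'd"
      show "\<psi> (x - y) * \<phi> y * chr x \<xi> = (\<psi> (x - y) * chr (x - y) \<xi>) * (\<phi> y * chr y \<xi>)"
        using chr_add[of "x - y" y \<xi>] by simp
    qed
    also have "\<dots> = (\<Sum>\<^sub>\<infinity>x. \<psi> (x - y) * chr (x - y) \<xi>) * (\<phi> y * chr y \<xi>)"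
      by (rule infsum_cmult_left')
    also have "(\<Sum>\<^sub>\<infinity>x. \<psi> (x - y) * chr (x - y) \<xi>) = fourier \<psi> \<xi>"
      unfolding fourier_def
      by (rule infsum_reindex_bij_betw, rule bij_betw_byWitness[where f' = "\<lambda>x. x + y"]) auto
    finally show "(\<Sum>\<^sub>\<infinity>x. \<psi> (x - y) * \<phi> y * chr x \<xi>) = fourier \<psi> \<xi> * (\<phi> y * chr y \<xi>)" .
  qed
  also have "\<dots> = fourier \<psi> \<xi> * fourier \<phi> \<xi>"
    unfolding fourier_def by (rule infsum_cmult_right')
  finally show ?thesis .
qed

lemma conv_power_fourier:
  fixes \<phi> :: "int ^ 'd::finite \<Rightarrow> complex"
  assumes \<phi>: "(\<lambda>x. norm (\<phi> x)) summable_on UNIV" and n: "n \<ge> 1"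
  shows "(\<lambda>x. norm (conv_power \<phi> n x)) summable_on UNIV" "fourier (conv_power \<phi> n) \<xi> = fourier \<phi> \<xi> ^ n"
proof -
  have "(\<lambda>x. norm (((\<lambda>\<psi>. conv \<psi> \<phi>) ^^ k) \<phi> x)) summable_on UNIV \<and> fourier (((\<lambda>\<psi>. conv \<psi> \<phi>) ^^ k) \<phi>) \<xi> = fourier \<phi> \<xi> ^ Suc k" for k
  proof (induction k)
    case (Suc k)
    let ?\<psi> = "((\<lambda>\<psi>. conv \<psi> \<phi>) ^^ k) \<phi>"
    have s: "(\<lambda>x. norm (?\<psi> x)) summable_on UNIV" and f: "fourier ?\<psi> \<xi> = fourier \<phi> \<xi> ^ Suc k"
      using Suc by auto
    show ?case using conv_summable[OF s \<phi>] fourier_conv[OF s \<phi>, of \<xi>] f by (simp add: mult.commute)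
  qed (use \<phi> in simp)
  from this[of "n - 1"] show "(\<lambda>x. norm (conv_power \<phi> n x)) summable_on UNIV" "fourier (conv_power \<phi> n) \<xi> = fourier \<phi> \<xi> ^ n"
    using n by (simp_all add: conv_power_def)
qed

lemma fourier_uniform_limit:
  fixes \<phi> :: "int ^ 'd::finite \<Rightarrow> complex"
  assumes \<phi>: "(\<lambda>x. norm (\<phi> x)) summable_on UNIV"
  shows "uniform_limit S (\<lambda>X \<xi>. \<Sum>x\<in>X. \<phi> x * chr x \<xi>) (fourier \<phi>) (finite_subsets_at_top UNIV)"
  unfolding fourier_def[abs_def] by (rule Weierstrass_m_test_general[OF _ \<phi>]) (simp add: norm_mult)

lemma continuous_fourier:
  fixes \<phi> :: "int ^ 'd::finite \<Rightarrow> complex"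
  assumes \<phi>: "(\<lambda>x. norm (\<phi> x)) summable_on UNIV"
  shows "continuous_on UNIV (fourier \<phi>)"
  by (rule uniform_limit_theorem[OF _ fourier_uniform_limit[OF \<phi>]])
     (auto intro!: always_eventually continuous_intros)

lemma exp_2pi_int: "exp (2 * of_int k * of_real pi * \<i>) = 1"
  unfolding exp_eq_1 by auto

lemma fourier_periodic: "fourier \<phi> (\<xi> + (2 * pi) *\<^sub>R real_vec k) = fourier \<phi> \<xi>"
proof -
  have "chr x (\<xi> + (2 * pi) *\<^sub>R real_vec k) = chr x \<xi>" for x
  proof -
    have "real_vec x \<bullet> real_vec k = real_of_int (\<Sum>j\<in>UNIV. x $ j * k $ j)"
      by (simp add: inner_vec_def)
    then have "chr x (\<xi> + (2 * pi) *\<^sub>R real_vec k) = chr x \<xi> * exp (2 * of_int (\<Sum>j\<in>UNIV. x $ j * k $ j) * of_real pi * \<i>)"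
      unfolding exp_add[symmetric] by (simp add: inner_add_right algebra_simps)
    also have "exp (2 * of_int (\<Sum>j\<in>UNIV. x $ j * k $ j) * of_real pi * \<i>) = 1"
      by (rule exp_2pi_int)
    finally show ?thesis by simp
  qed
  then show ?thesis unfolding fourier_def by simp
qed

lemma integral_exp_period:
  fixes k :: int and c :: real
  shows "integrable lborel (\<lambda>t. indicator {c..c + 2 * pi} t *\<^sub>R exp (\<i> * complex_of_real (real_of_int k * t)))"
    and "(LINT t|lborel. indicator {c..c + 2 * pi} t *\<^sub>R exp (\<i> * complex_of_real (real_of_int k * t))) = (if k = 0 then 2 * of_real pi else 0)"
proof -
  let ?f = "\<lambda>t. exp (\<i> * complex_of_real (real_of_int k * t))"
  show i: "integrable lborel (\<lambda>t. indicator {c..c + 2 * pi} t *\<^sub>R ?f t)"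
    by (rule borel_integrable_compact) (auto intro!: continuous_intros)
  then have "(LINT t|lborel. indicator {c..c + 2 * pi} t *\<^sub>R ?f t) = integral {c..c + 2 * pi} ?f"
    using set_borel_integral_eq_integral(2)[of "{c..c + 2 * pi}" ?f] by (simp add: set_integrable_def set_lebesgue_integral_def)
  also have "\<dots> = (if k = 0 then 2 * of_real pi else 0)"
  proof (cases "k = 0")
    case True
    then show ?thesis by (simp add: scaleR_conv_of_real)
  next
    case False
    have "(?f has_integral (?f (c + 2 * pi) / (\<i> * of_int k) - ?f c / (\<i> * of_int k))) {c..c + 2 * pi}"
    proof (rule fundamental_theorem_of_calculus)
      show "c \<le> c + 2 * pi" by simp
      fix t assume "t \<in> {c..c + 2 * pi}"
      have "((\<lambda>z. exp (\<i> * of_int k * z) / (\<i> * of_int k)) has_field_derivative exp (\<i> * of_int k * of_real t)) (at (of_real t))"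
        using False by (auto intro!: derivative_eq_intros)
      then have "((\<lambda>t. exp (\<i> * of_int k * of_real t) / (\<i> * of_int k)) has_vector_derivative exp (\<i> * of_int k * of_real t)) (at t within {c..c + 2 * pi})"
        using has_vector_derivative_real_field has_vector_derivative_at_within by blast
      then show "((\<lambda>t. ?f t / (\<i> * of_int k)) has_vector_derivative ?f t) (at t within {c..c + 2 * pi})"
        by (simp add: mult.assoc)
    qed
    moreover have "?f (c + 2 * pi) = ?f c"
    proof -
      have "?f (c + 2 * pi) = ?f c * exp (2 * of_int k * of_real pi * \<i>)"
        unfolding exp_add[symmetric] by (simp add: algebra_simps)
      also have "exp (2 * of_int k * of_real pi * \<i>) = 1" by (rule exp_2pi_int)
      finally show ?thesis by simp
    qed
    ultimately show ?thesis using False by (simp add: integral_unique)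
  qed
  finally show "(LINT t|lborel. indicator {c..c + 2 * pi} t *\<^sub>R ?f t) = (if k = 0 then 2 * of_real pi else 0)" .
qed

definition cell :: "real \<Rightarrow> (real ^ 'd) set"
  where "cell c = cbox (\<chi> j. c) (\<chi> j. c + 2 * pi)"

lemma mem_cell: "\<xi> \<in> cell c \<longleftrightarrow> (\<forall>j. c \<le> \<xi> $ j \<and> \<xi> $ j \<le> c + 2 * pi)"
  by (simp add: cell_def mem_box_cart)

lemma cell_cont_integral:
  fixes f :: "real ^ 'd::finite \<Rightarrow> complex"
  assumes "continuous_on UNIV f"
  shows "integrable lborel (\<lambda>\<xi>. indicator (cell c) \<xi> *\<^sub>R f \<xi>)"
    "integral (cell c) f = (LINT \<xi>|lborel. indicator (cell c) \<xi> *\<^sub>R f \<xi>)"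
proof -
  show i: "integrable lborel (\<lambda>\<xi>. indicator (cell c) \<xi> *\<^sub>R f \<xi>)"
    by (rule borel_integrable_compact) (auto simp: cell_def intro: continuous_on_subset[OF assms])
  then show "integral (cell c) f = (LINT \<xi>|lborel. indicator (cell c) \<xi> *\<^sub>R f \<xi>)"
    using set_borel_integral_eq_integral(2)[of "cell c" f] by (simp add: set_integrable_def set_lebesgue_integral_def)
qed

lemma integral_chr:
  fixes k :: "int ^ 'd::finite"
  shows "integral (cell c) (chr k) = (if k = 0 then (2 * of_real pi) ^ CARD('d) else 0)"
proof -
  define co :: "real ^ 'd \<Rightarrow> int" where "co b = (\<Sum>i\<in>UNIV. if b = axis i 1 then k $ i else 0)" for b
  let ?g = "\<lambda>b t. indicator {c..c + 2 * pi} t *\<^sub>R exp (\<i> * complex_of_real (real_of_int (co b) * t))"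
  have Bas: "(Basis :: (real ^ 'd) set) = (\<lambda>i. axis i 1) ` UNIV" by (auto simp: Basis_vec_def)
  have inj: "inj_on (\<lambda>i. axis i 1 :: real ^ 'd) UNIV" by (auto simp: inj_on_def axis_eq_axis)
  have g: "?g (axis i 1) t = indicator {c..c + 2 * pi} t *\<^sub>R exp (\<i> * complex_of_real (real_of_int (k $ i) * t))" for i t
    by (simp add: co_def axis_eq_axis)
  have co: "co (axis i 1) = k $ i" for i by (simp add: co_def axis_eq_axis)
  have "indicator (cell c) \<xi> *\<^sub>R chr k \<xi> = (\<Prod>b\<in>Basis. ?g b (\<xi> \<bullet> b))" for \<xi> :: "real ^ 'd"
  proof -
    have "(\<Prod>b\<in>Basis. ?g b (\<xi> \<bullet> b)) = (\<Prod>i\<in>UNIV. indicator {c..c + 2 * pi} (\<xi> $ i) *\<^sub>R exp (\<i> * complex_of_real (real_of_int (k $ i) * \<xi> $ i)))"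
      unfolding Bas by (subst prod.reindex[OF inj]) (simp add: co inner_axis del: of_real_mult)
    also have "\<dots> = (\<Prod>i\<in>UNIV. indicator {c..c + 2 * pi} (\<xi> $ i)) *\<^sub>R (\<Prod>i\<in>UNIV. exp (\<i> * complex_of_real (real_of_int (k $ i) * \<xi> $ i)))"
      by (simp add: scaleR_conv_of_real prod.distrib)
    also have "(\<Prod>i\<in>UNIV. exp (\<i> * complex_of_real (real_of_int (k $ i) * \<xi> $ i))) = chr k \<xi>"
      by (simp add: inner_vec_def sum_distrib_left flip: exp_sum)
    also have "(\<Prod>i\<in>UNIV. indicator {c..c + 2 * pi} (\<xi> $ i)) = (indicator (cell c) \<xi> :: real)"
    proof (cases "\<xi> \<in> cell c")
      case True
      then show ?thesis by (simp add: mem_cell)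
    next
      case False
      then obtain j where "\<xi> $ j \<notin> {c..c + 2 * pi}" by (auto simp: mem_cell)
      then show ?thesis using False by (simp add: prod_zero_iff) (metis indicator_simps(2) atLeastAtMost_iff)
    qed
    finally show ?thesis ..
  qed
  then have "integral (cell c) (chr k) = (LINT \<xi>|lborel. (\<Prod>b\<in>(Basis :: (real ^ 'd) set). ?g b (\<xi> \<bullet> b)))"
    by (subst cell_cont_integral(2)) (auto intro!: continuous_intros)
  also have "\<dots> = (\<Prod>b\<in>(Basis :: (real ^ 'd) set). LINT t|lborel. ?g b t)"
    by (rule integral_lborel_prod(2)) (rule integral_exp_period(1))
  also have "\<dots> = (\<Prod>i\<in>UNIV. if k $ i = 0 then 2 * of_real pi else 0)"
    unfolding Bas by (subst prod.reindex[OF inj]) (simp add: co integral_exp_period(2) del: of_real_mult)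
  also have "\<dots> = (if k = 0 then (2 * of_real pi) ^ CARD('d) else 0)"
  proof (cases "k = 0")
    case False
    then obtain i where "k $ i \<noteq> 0" by (auto simp: vec_eq_iff)
    then show ?thesis using False by (simp add: prod_zero_iff) (metis)
  qed simp
  finally show ?thesis .
qed

text \<open>The Fourier series converges uniformly, so it may be integrated term by term over the cell. The
  corner \<open>c\<close> of the cell is arbitrary in view of later use: it will be chosen such that all points of
  \<open>Omega \<phi>\<close> are interior.\<close>

theorem fourier_inversion:
  fixes \<psi> :: "int ^ 'd::finite \<Rightarrow> complex"
  assumes \<psi>: "(\<lambda>x. norm (\<psi> x)) summable_on UNIV"
  shows "(2 * of_real pi) ^ CARD('d) * \<psi> x = (LINT \<xi>|lborel. indicator (cell c) \<xi> *\<^sub>R (chr (- x) \<xi> * fourier \<psi> \<xi>))"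
proof -
  have ul: "uniform_limit (cell c) (\<lambda>X \<xi>. \<Sum>y\<in>X. \<psi> y * chr (y - x) \<xi>) (\<lambda>\<xi>. chr (- x) \<xi> * fourier \<psi> \<xi>) (finite_subsets_at_top UNIV)"
  proof -
    have "uniform_limit (cell c) (\<lambda>X \<xi>. \<Sum>y\<in>X. \<psi> y * chr (y - x) \<xi>) (\<lambda>\<xi>. \<Sum>\<^sub>\<infinity>y. \<psi> y * chr (y - x) \<xi>) (finite_subsets_at_top UNIV)"
      by (rule Weierstrass_m_test_general[OF _ \<psi>]) (simp add: norm_mult)
    moreover have "(\<Sum>\<^sub>\<infinity>y. \<psi> y * chr (y - x) \<xi>) = chr (- x) \<xi> * fourier \<psi> \<xi>" for \<xi>
    proof -
      have "\<psi> y * chr (y - x) \<xi> = chr (- x) \<xi> * (\<psi> y * chr y \<xi>)" for y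
        using chr_add[of "- x" y \<xi>] by (simp add: mult_ac)
      then have "(\<lambda>y. \<psi> y * chr (y - x) \<xi>) = (\<lambda>y. chr (- x) \<xi> * (\<psi> y * chr y \<xi>))" by (rule ext)
      then show ?thesis unfolding fourier_def by (simp only: infsum_cmult_right')
    qed
    ultimately show ?thesis by simp
  qed
  have cont: "continuous_on (cell c) (\<lambda>\<xi>. \<Sum>y\<in>X. \<psi> y * chr (y - x) \<xi>)" for X
    by (intro continuous_intros)
  obtain I J where I: "\<And>X. ((\<lambda>\<xi>. \<Sum>y\<in>X. \<psi> y * chr (y - x) \<xi>) has_integral I X) (cell c)"
    and J: "((\<lambda>\<xi>. chr (- x) \<xi> * fourier \<psi> \<xi>) has_integral J) (cell c)"
    and lim: "(I \<longlongrightarrow> J) (finite_subsets_at_top UNIV)"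
  proof (rule uniform_limit_integral_cbox[OF ul[unfolded cell_def] cont[unfolded cell_def] finite_subsets_at_top_neq_bot, folded cell_def])
    fix I J
    assume "\<And>X. ((\<lambda>\<xi>. \<Sum>y\<in>X. \<psi> y * chr (y - x) \<xi>) has_integral I X) (cell c)"
      "((\<lambda>\<xi>. chr (- x) \<xi> * fourier \<psi> \<xi>) has_integral J) (cell c)" "(I \<longlongrightarrow> J) (finite_subsets_at_top UNIV)"
    then show thesis by (rule that)
  qed
  have "I X = (2 * of_real pi) ^ CARD('d) * \<psi> x" if "finite X" "x \<in> X" for X
  proof -
    have "I X = integral (cell c) (\<lambda>\<xi>. \<Sum>y\<in>X. \<psi> y * chr (y - x) \<xi>)"
      by (rule integral_unique[OF I, symmetric])
    also have "\<dots> = (\<Sum>y\<in>X. integral (cell c) (\<lambda>\<xi>. \<psi> y * chr (y - x) \<xi>))"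
      unfolding cell_def by (rule integral_sum[OF that(1)]) (intro integrable_continuous continuous_intros)
    also have "\<dots> = (\<Sum>y\<in>X. \<psi> y * (if y - x = 0 then (2 * of_real pi) ^ CARD('d) else 0))"
      unfolding integral_mult_right integral_chr ..
    also have "\<dots> = (\<Sum>y\<in>X. if y = x then \<psi> x * (2 * of_real pi) ^ CARD('d) else 0)"
      by (intro sum.cong refl) auto
    finally show ?thesis using that by (simp add: mult.commute)
  qed
  then have "\<forall>\<^sub>F X in finite_subsets_at_top UNIV. I X = (2 * of_real pi) ^ CARD('d) * \<psi> x"
    unfolding eventually_finite_subsets_at_top by (intro exI[of _ "{x}"]) auto
  then have "(I \<longlongrightarrow> (2 * of_real pi) ^ CARD('d) * \<psi> x) (finite_subsets_at_top UNIV)"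
    by (rule tendsto_eventually)
  then have "J = (2 * of_real pi) ^ CARD('d) * \<psi> x"
    using tendsto_unique[OF _ lim] by (simp add: finite_subsets_at_top_neq_bot)
  moreover have "J = integral (cell c) (\<lambda>\<xi>. chr (- x) \<xi> * fourier \<psi> \<xi>)" using J by (simp add: integral_unique)
  moreover have "\<dots> = (LINT \<xi>|lborel. indicator (cell c) \<xi> *\<^sub>R (chr (- x) \<xi> * fourier \<psi> \<xi>))"
    by (rule cell_cont_integral(2)) (intro continuous_intros continuous_fourier[OF \<psi>])
  ultimately show ?thesis by simp
qed

section \<open>The maximum of the Fourier transform\<close>

lemma reduce_to_torus: "\<exists>k :: int ^ 'd::finite. \<xi> + (2 * pi) *\<^sub>R real_vec k \<in> torus"
proof -
  define k :: "int ^ 'd" where "k = (\<chi> j. - \<lceil>(\<xi> $ j - pi) / (2 * pi)\<rceil>)"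
  have "- pi < (\<xi> + (2 * pi) *\<^sub>R real_vec k) $ j \<and> (\<xi> + (2 * pi) *\<^sub>R real_vec k) $ j \<le> pi" for j
  proof -
    define y where "y = (\<xi> $ j - pi) / (2 * pi)"
    have y: "\<xi> $ j = 2 * pi * y + pi" by (simp add: y_def)
    have c: "y \<le> of_int \<lceil>y\<rceil>" "of_int \<lceil>y\<rceil> < y + 1" by linarith+
    have e: "(\<xi> + (2 * pi) *\<^sub>R real_vec k) $ j = 2 * pi * (y - of_int \<lceil>y\<rceil>) + pi"
      by (simp add: k_def y_def[symmetric] y algebra_simps)
    have "2 * pi * (y - of_int \<lceil>y\<rceil>) \<le> 2 * pi * 0" by (rule mult_left_mono) (use c in auto)
    moreover have "2 * pi * (-1) < 2 * pi * (y - of_int \<lceil>y\<rceil>)" by (rule mult_strict_left_mono) (use c in auto)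
    ultimately show ?thesis unfolding e by simp
  qed
  then show ?thesis unfolding torus_def by blast
qed

text \<open>By periodicity the supremum over the half-open cube \<open>torus\<close> is a maximum over a closed cell.\<close>

lemma class_H_star_max:
  fixes \<phi> :: "int ^ 'd::finite \<Rightarrow> complex"
  assumes "\<phi> \<in> class_H_star"
  shows "norm (fourier \<phi> \<xi>) \<le> 1" "Omega \<phi> \<noteq> {}"
proof -
  have s: "(\<lambda>x. norm (\<phi> x)) summable_on UNIV" and sup: "(SUP \<xi>\<in>torus. norm (fourier \<phi> \<xi>)) = 1"
    using assms by (auto simp: class_H_star_def class_H_def)
  let ?C = "cell (- pi) :: (real ^ 'd) set"
  have "compact ?C" by (simp add: cell_def)
  moreover have "?C \<noteq> {}" using mem_cell[of "\<chi> j. 0" "- pi"] by auto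
  moreover have "continuous_on ?C (\<lambda>\<xi>. norm (fourier \<phi> \<xi>))"
    by (intro continuous_on_norm continuous_on_subset[OF continuous_fourier[OF s]]) auto
  ultimately obtain x where x: "\<forall>y\<in>?C. norm (fourier \<phi> y) \<le> norm (fourier \<phi> x)"
    using continuous_attains_sup[of ?C "\<lambda>\<xi>. norm (fourier \<phi> \<xi>)"] by auto
  have tC: "torus \<subseteq> ?C" by (auto simp: torus_def mem_cell less_imp_le)
  obtain k where k: "x + (2 * pi) *\<^sub>R real_vec k \<in> torus" using reduce_to_torus by blast
  have tx: "norm (fourier \<phi> (x + (2 * pi) *\<^sub>R real_vec k)) = norm (fourier \<phi> x)" by (simp add: fourier_periodic)
  have bdd: "bdd_above ((\<lambda>\<xi>. norm (fourier \<phi> \<xi>)) ` torus)"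
    using x tC by (intro bdd_aboveI2[of _ _ "norm (fourier \<phi> x)"]) auto
  have "norm (fourier \<phi> x) \<le> 1" using cSUP_upper[OF k bdd] unfolding sup tx .
  moreover have "(SUP \<xi>\<in>torus. norm (fourier \<phi> \<xi>)) \<le> norm (fourier \<phi> x)"
    by (rule cSUP_least) (use k x tC in auto)
  ultimately have 1: "norm (fourier \<phi> x) = 1" using sup by simp
  then show "Omega \<phi> \<noteq> {}" using k tx by (auto simp: Omega_def)
  obtain k' where k': "\<xi> + (2 * pi) *\<^sub>R real_vec k' \<in> torus" using reduce_to_torus by blast
  then have "norm (fourier \<phi> (\<xi> + (2 * pi) *\<^sub>R real_vec k')) \<le> norm (fourier \<phi> x)" using x tC by blast
  then show "norm (fourier \<phi> \<xi>) \<le> 1" using 1 by (simp add: fourier_periodic)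
qed

section \<open>A cutoff function\<close>

lemma max0_square_deriv: "((\<lambda>u::real. (max 0 u)\<^sup>2) has_real_derivative 2 * max 0 u) (at u)"
proof (cases "u = 0")
  case True
  have "((\<lambda>h::real. (max 0 h)\<^sup>2 / h) \<longlongrightarrow> 0) (at 0)"
  proof (rule Lim_null_comparison)
    show "\<forall>\<^sub>F h in at 0. norm ((max 0 h)\<^sup>2 / h) \<le> \<bar>h\<bar>"
      by (rule always_eventually) (auto simp: max_def power2_eq_square)
    show "((\<lambda>h::real. \<bar>h\<bar>) \<longlongrightarrow> 0) (at 0)"
      using tendsto_rabs[OF tendsto_ident_at[of "0::real" UNIV]] by simp
  qed
  then show ?thesis using True by (simp add: DERIV_def)
next
  case False
  then consider "u > 0" | "u < 0" by linarith
  then show ?thesis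
  proof cases
    case 1
    have ev: "\<forall>\<^sub>F v in nhds u. (max 0 v)\<^sup>2 = v\<^sup>2"
      using eventually_nhds_in_open[of "{0<..}" u] 1 by (auto elim!: eventually_mono)
    have "((\<lambda>v. v\<^sup>2) has_real_derivative 2 * u) (at u)" by (auto intro!: derivative_eq_intros)
    then show ?thesis using 1 by (simp add: DERIV_cong_ev[OF refl ev refl])
  next
    case 2
    have ev: "\<forall>\<^sub>F v in nhds u. (max 0 v)\<^sup>2 = 0"
      using eventually_nhds_in_open[of "{..<0}" u] 2 by (auto elim!: eventually_mono)
    then show ?thesis using 2 by (simp add: DERIV_cong_ev[OF refl ev refl])
  qed
qed

text \<open>A continuously differentiable bump with bounded gradient; one derivative is all that
  \<open>shift_bound\<close> uses, and it makes an elementary formula possible.\<close>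

definition cutoff :: "real \<Rightarrow> real \<Rightarrow> (real ^ 'd::finite \<Rightarrow> real) \<Rightarrow> (real ^ 'd \<Rightarrow> real ^ 'd \<Rightarrow> real) \<Rightarrow> real \<Rightarrow> bool"
  where "cutoff a b \<theta> d\<theta> K \<longleftrightarrow> (\<forall>x. (\<theta> has_derivative d\<theta> x) (at x)) \<and>
    (\<forall>v. continuous_on UNIV (\<lambda>x. d\<theta> x v)) \<and> (\<forall>x. 0 \<le> \<theta> x \<and> \<theta> x \<le> 1) \<and>
    (\<forall>x. norm x \<le> a \<longrightarrow> \<theta> x = 1 \<and> (\<forall>v. d\<theta> x v = 0)) \<and>
    (\<forall>x. norm x \<ge> b \<longrightarrow> \<theta> x = 0 \<and> (\<forall>v. d\<theta> x v = 0)) \<and>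
    K > 0 \<and> (\<forall>x v. \<bar>d\<theta> x v\<bar> \<le> K * norm v)"

text \<open>With \<open>p = (max 0 (b^2 - |x|^2))^2\<close> and \<open>e = (max 0 (|x|^2 - a^2))^2\<close> the quotient \<open>p / (p + e)\<close> works:
  the squares make it continuously differentiable, and \<open>p\<close> and \<open>e\<close> never vanish together.\<close>

lemma cutoff_exists:
  fixes a b :: real
  assumes a: "0 < a" and ab: "a < b"
  shows "\<exists>(\<theta> :: real ^ 'd::finite \<Rightarrow> real) d\<theta> K. cutoff a b \<theta> d\<theta> K"
proof -
  define c e where "c u = max 0 (b\<^sup>2 - u)" and "e u = max 0 (u - a\<^sup>2)" for u :: real
  define S where "S u = (c u)\<^sup>2 + (e u)\<^sup>2" for u
  define g where "g u = (c u)\<^sup>2 / S u" for u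
  define g' where "g' u = (- (2 * c u) * S u - (c u)\<^sup>2 * (- (2 * c u) + 2 * e u)) / (S u * S u)" for u
  have ab2: "a\<^sup>2 < b\<^sup>2" using a ab by (intro power_strict_mono) auto
  have S: "S u > 0" for u
  proof -
    have "c u > 0 \<or> e u > 0" using ab2 by (auto simp: c_def e_def max_def)
    then show ?thesis unfolding S_def by (auto simp: add_pos_nonneg add_nonneg_pos)
  qed
  have dc: "((\<lambda>u. (c u)\<^sup>2) has_real_derivative - (2 * c u)) (at u)" for u
  proof -
    have "((\<lambda>u. b\<^sup>2 - u) has_real_derivative -1) (at u)" by (auto intro!: derivative_eq_intros)
    from DERIV_chain2[OF max0_square_deriv this] show ?thesis by (simp add: c_def)
  qed
  have de: "((\<lambda>u. (e u)\<^sup>2) has_real_derivative 2 * e u) (at u)" for u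
  proof -
    have "((\<lambda>u. u - a\<^sup>2) has_real_derivative 1) (at u)" by (auto intro!: derivative_eq_intros)
    from DERIV_chain2[OF max0_square_deriv this] show ?thesis by (simp add: e_def)
  qed
  have dg: "(g has_real_derivative g' u) (at u)" for u
    unfolding g_def[abs_def] g'_def
    by (rule DERIV_divide[OF dc]) (use DERIV_add[OF dc de] S[of u] in \<open>auto simp: S_def[abs_def]\<close>)
  have cg': "continuous_on UNIV g'"
    unfolding g'_def S_def c_def e_def using S by (intro continuous_intros) (auto simp: S_def c_def e_def less_le)
  have g01: "0 \<le> g u" "g u \<le> 1" for u
    using S[of u] by (auto simp: g_def S_def divide_le_eq)
  have gin: "g u = 1" "g' u = 0" if "u \<le> a\<^sup>2" for u
  proof -
    have "e u = 0" using that by (simp add: e_def)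
    then show "g u = 1" "g' u = 0" using S[of u] by (auto simp: g_def g'_def S_def)
  qed
  have gout: "g u = 0" "g' u = 0" if "u \<ge> b\<^sup>2" for u
  proof -
    have "c u = 0" using that by (simp add: c_def)
    then show "g u = 0" "g' u = 0" by (auto simp: g_def g'_def)
  qed
  have "bounded (g' ` {0..b\<^sup>2})"
    by (intro compact_imp_bounded compact_continuous_image continuous_on_subset[OF cg']) auto
  then obtain B where "\<forall>x\<in>g' ` {0..b\<^sup>2}. norm x \<le> B" unfolding bounded_iff ..
  then have B: "\<bar>g' u\<bar> \<le> B" if "u \<in> {0..b\<^sup>2}" for u
    using that by (simp only: ball_simps real_norm_def)
  define \<theta> where "\<theta> x = g (x \<bullet> x)" for x :: "real ^ 'd"
  define d\<theta> where "d\<theta> x v = g' (x \<bullet> x) * (2 * (x \<bullet> v))" for x v :: "real ^ 'd"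
  have B0: "B \<ge> 0" using B[of 0] by fastforce
  have sq: "x \<bullet> x = (norm x)\<^sup>2" for x :: "real ^ 'd" by (simp add: power2_norm_eq_inner)
  show ?thesis unfolding cutoff_def
  proof (intro exI[of _ \<theta>] exI[of _ d\<theta>] exI[of _ "2 * B * b + 1"] conjI allI impI)
    fix x :: "real ^ 'd"
    have "((\<lambda>x. x \<bullet> x) has_derivative (\<lambda>v. 2 * (x \<bullet> v))) (at x)"
      by (auto intro!: derivative_eq_intros simp: inner_commute)
    moreover have "(g has_derivative (*) (g' (x \<bullet> x))) (at (x \<bullet> x))"
      using dg by (simp add: has_field_derivative_def)
    ultimately have "((\<lambda>x. g (x \<bullet> x)) has_derivative (\<lambda>v. g' (x \<bullet> x) * (2 * (x \<bullet> v)))) (at x)"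
      by (rule has_derivative_compose)
    then show "(\<theta> has_derivative d\<theta> x) (at x)" unfolding \<theta>_def[abs_def] d\<theta>_def[abs_def] .
  next
    fix v :: "real ^ 'd"
    show "continuous_on UNIV (\<lambda>x. d\<theta> x v)"
      unfolding d\<theta>_def by (intro continuous_intros continuous_on_compose2[OF cg']) auto
  next
    fix x v :: "real ^ 'd"
    show "0 \<le> \<theta> x" "\<theta> x \<le> 1" using g01 by (auto simp: \<theta>_def)
    show "\<theta> x = 1" "d\<theta> x v = 0" if "norm x \<le> a"
      using gin[of "x \<bullet> x"] power_mono[OF that, of 2] by (auto simp: \<theta>_def d\<theta>_def sq)
    show "\<theta> x = 0" "d\<theta> x v = 0" if "norm x \<ge> b"
      using gout[of "x \<bullet> x"] power_mono[OF that, of 2] a ab by (auto simp: \<theta>_def d\<theta>_def sq)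
    show "\<bar>d\<theta> x v\<bar> \<le> (2 * B * b + 1) * norm v"
    proof (cases "norm x \<ge> b")
      case True
      then have "g' (x \<bullet> x) = 0" using gout(2)[of "x \<bullet> x"] power_mono[OF True, of 2] a ab by (auto simp: sq)
      then show ?thesis using B0 a ab by (simp add: d\<theta>_def)
    next
      case False
      then have "x \<bullet> x \<in> {0..b\<^sup>2}" unfolding sq by (auto intro!: power_mono)
      then have "\<bar>g' (x \<bullet> x)\<bar> \<le> B" by (rule B)
      moreover have "\<bar>2 * (x \<bullet> v)\<bar> \<le> 2 * (b * norm v)"
        using Cauchy_Schwarz_ineq2[of x v] False mult_right_mono[of "norm x" b "norm v"] by simp
      ultimately have "\<bar>d\<theta> x v\<bar> \<le> B * (2 * (b * norm v))"
        unfolding d\<theta>_def abs_mult[of "g' (x \<bullet> x)"] by (intro mult_mono) auto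
      also have "\<dots> \<le> (2 * B * b + 1) * norm v" by (simp add: algebra_simps)
      finally show ?thesis .
    qed
  next
    show "2 * B * b + 1 > 0" using B0 a ab by (simp add: add_nonneg_pos)
  qed
qed

section \<open>Legendre transforms\<close>

context
  fixes m :: "nat ^ 'd::finite" and A :: "real ^ 'd ^ 'd"
  assumes m1: "\<And>j. m $ j \<ge> 1" and A: "invertible A"
begin

text \<open>Up to constants the Legendre transform of \<open>\<eta> \<mapsto> quasi m (matrix_inv A *v \<eta>)\<close>: the exponent
  \<open>1 + 1 / (2 m\<^sub>j - 1) = 2 m\<^sub>j / (2 m\<^sub>j - 1)\<close> is conjugate to \<open>2 m\<^sub>j\<close>.\<close>

definition dual_gauge :: "real ^ 'd \<Rightarrow> real"
  where "dual_gauge y = (\<Sum>j\<in>UNIV. \<bar>(y v* A) $ j\<bar> powr (1 + 1 / (2 * real (m $ j) - 1)))"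

lemma dual_gauge_nonneg: "dual_gauge y \<ge> 0"
  unfolding dual_gauge_def by (intro sum_nonneg) auto

text \<open>Either the second term on the left already dominates the first, or \<open>|\<eta>|\<close> is so small that
  \<open>|w \<eta>|\<close> is bounded by the right side.\<close>

lemma young_upper:
  fixes w \<eta> c :: real
  assumes c: "c > 0" and k: "k \<ge> (1::nat)"
  shows "w * \<eta> - c * \<bar>\<eta>\<bar> ^ (2 * k) \<le> max 1 (1 / c) * \<bar>w\<bar> powr (1 + 1 / (2 * real k - 1))"
proof -
  define r where "r = 2 * real k - 1"
  have r: "r \<ge> 1" using k by (simp add: r_def)
  have k1: "real (2 * k - 1) = r" using k by (simp add: r_def of_nat_diff)
  have pw: "\<bar>\<eta>\<bar> ^ (2 * k) = \<bar>\<eta>\<bar> * \<bar>\<eta>\<bar> ^ (2 * k - 1)"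
    using k by (metis power_eq_if mult_eq_0_iff not_one_le_zero zero_neq_numeral)
  have le: "w * \<eta> \<le> \<bar>w\<bar> * \<bar>\<eta>\<bar>" by (metis abs_ge_self abs_mult)
  show ?thesis
  proof (cases "c * \<bar>\<eta>\<bar> ^ (2 * k - 1) \<ge> \<bar>w\<bar>")
    case True
    then have "\<bar>w\<bar> * \<bar>\<eta>\<bar> \<le> c * \<bar>\<eta>\<bar> ^ (2 * k - 1) * \<bar>\<eta>\<bar>" by (intro mult_right_mono) auto
    then have "w * \<eta> - c * \<bar>\<eta>\<bar> ^ (2 * k) \<le> 0" using le unfolding pw by (simp add: mult_ac)
    moreover have "0 \<le> max 1 (1 / c) * \<bar>w\<bar> powr (1 + 1 / (2 * real k - 1))" by (intro mult_nonneg_nonneg) auto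
    ultimately show ?thesis by linarith
  next
    case False
    then have h: "\<bar>\<eta>\<bar> ^ (2 * k - 1) \<le> \<bar>w\<bar> / c" using c by (simp add: field_simps)
    have "\<bar>\<eta>\<bar> \<le> (\<bar>w\<bar> / c) powr (1 / r)"
    proof (cases "\<eta> = 0")
      case False
      then have "\<bar>\<eta>\<bar> ^ (2 * k - 1) = \<bar>\<eta>\<bar> powr r" unfolding k1[symmetric] by (simp add: powr_realpow)
      then have "(\<bar>\<eta>\<bar> powr r) powr (1 / r) \<le> (\<bar>w\<bar> / c) powr (1 / r)"
        using h r by (intro powr_mono2) auto
      then show ?thesis using r False by (simp add: powr_powr)
    qed simp
    then have "\<bar>w\<bar> * \<bar>\<eta>\<bar> \<le> \<bar>w\<bar> * (\<bar>w\<bar> / c) powr (1 / r)" by (intro mult_left_mono) auto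
    also have "(\<bar>w\<bar> / c) powr (1 / r) = \<bar>w\<bar> powr (1 / r) * (1 / c) powr (1 / r)"
      using powr_mult[of "\<bar>w\<bar>" "1 / c" "1 / r"] by simp
    also have "\<bar>w\<bar> * (\<bar>w\<bar> powr (1 / r) * (1 / c) powr (1 / r)) = (1 / c) powr (1 / r) * \<bar>w\<bar> powr (1 + 1 / r)"
      by (cases "w = 0") (simp_all add: powr_add)
    also have "\<dots> \<le> max 1 (1 / c) * \<bar>w\<bar> powr (1 + 1 / r)"
    proof (intro mult_right_mono)
      have "(1 / c) powr (1 / r) \<le> (max 1 (1 / c)) powr (1 / r)" using c r by (intro powr_mono2) auto
      also have "\<dots> \<le> (max 1 (1 / c)) powr 1" using r by (intro powr_mono) auto
      finally show "(1 / c) powr (1 / r) \<le> max 1 (1 / c)" by simp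
    qed auto
    finally have "\<bar>w\<bar> * \<bar>\<eta>\<bar> \<le> max 1 (1 / c) * \<bar>w\<bar> powr (1 + 1 / r)" .
    moreover have "0 \<le> c * \<bar>\<eta>\<bar> ^ (2 * k)" using c by simp
    ultimately show ?thesis using le by (simp add: r_def)
  qed
qed

lemma quasi_real: "quasi m (cplx_vec x) = (\<Sum>j\<in>UNIV. \<bar>x $ j\<bar> ^ (2 * m $ j))"
  by (simp add: quasi_def)

lemma legendre_upper:
  assumes c: "c > 0" and R: "\<And>\<xi>. R \<xi> \<ge> c * quasi m (cplx_vec (matrix_inv A *v \<xi>))"
  shows "legendre R y \<le> max 1 (1 / c) * dual_gauge y"
  unfolding legendre_def
proof (rule cSUP_least)
  fix \<xi> :: "real ^ 'd"
  define \<eta> where "\<eta> = matrix_inv A *v \<xi>"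
  have "\<xi> = A *v \<eta>" using matrix_inv_mult(2)[OF A] by (simp add: \<eta>_def matrix_vector_mul_assoc)
  then have "y \<bullet> \<xi> = (y v* A) \<bullet> \<eta>" by (simp add: dot_lmul_matrix)
  then have "y \<bullet> \<xi> - R \<xi> \<le> (\<Sum>j\<in>UNIV. (y v* A) $ j * \<eta> $ j) - c * (\<Sum>j\<in>UNIV. \<bar>\<eta> $ j\<bar> ^ (2 * m $ j))"
    using R[of \<xi>] by (simp add: inner_vec_def quasi_real \<eta>_def)
  also have "\<dots> = (\<Sum>j\<in>UNIV. (y v* A) $ j * \<eta> $ j - c * \<bar>\<eta> $ j\<bar> ^ (2 * m $ j))"
    by (simp add: sum_subtractf sum_distrib_left)
  also have "\<dots> \<le> (\<Sum>j\<in>UNIV. max 1 (1 / c) * \<bar>(y v* A) $ j\<bar> powr (1 + 1 / (2 * real (m $ j) - 1)))"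
    by (intro sum_mono young_upper c m1)
  also have "\<dots> = max 1 (1 / c) * dual_gauge y" by (simp add: dual_gauge_def sum_distrib_left)
  finally show "y \<bullet> \<xi> - R \<xi> \<le> max 1 (1 / c) * dual_gauge y" .
qed simp

text \<open>In the coordinates of the semi-elliptic form the shift is \<open>\<epsilon>\<close> times the maximiser of the
  Legendre transform, up to constants: \<open>\<epsilon> sgn w\<^sub>j |w\<^sub>j|^(1 / (2 m\<^sub>j - 1))\<close> with \<open>w = A\<^sup>T y\<close>. The gain is
  linear in \<open>\<epsilon>\<close> and the loss at least quadratic, so a small \<open>\<epsilon>\<close> leaves half of the gain and keeps
  the shift small.\<close>

lemma choose_shift:
  "\<exists>K>0. \<forall>M \<epsilon> y. 0 < \<epsilon> \<longrightarrow> \<epsilon> \<le> 1 \<longrightarrow> 0 \<le> M \<longrightarrow> M * \<epsilon> \<le> 1 / 2 \<longrightarrow>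
    (\<exists>\<nu>. \<epsilon> / 2 * dual_gauge y \<le> y \<bullet> \<nu> - M * quasi m (cplx_vec (matrix_inv A *v \<nu>)) \<and> norm \<nu> \<le> K * \<epsilon> * (1 + norm y))"
proof -
  obtain K1 where K1: "K1 > 0" "\<And>x. norm (A *v x) \<le> norm x * K1"
    using bounded_linear.pos_bounded[OF matrix_vector_mul_bounded_linear[of A]] by blast
  obtain K2 where K2: "K2 > 0" "\<And>x. norm (transpose A *v x) \<le> norm x * K2"
    using bounded_linear.pos_bounded[OF matrix_vector_mul_bounded_linear[of "transpose A"]] by blast
  define K where "K = real CARD('d) * (1 + K2) * K1"
  have K: "K > 0" using K1 K2 by (simp add: K_def)
  show ?thesis
  proof (intro exI[of _ K] conjI K allI impI)
    fix M \<epsilon> :: real and y :: "real ^ 'd"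
    assume \<epsilon>: "0 < \<epsilon>" "\<epsilon> \<le> 1" and M: "0 \<le> M" "M * \<epsilon> \<le> 1 / 2"
    define w where "w = y v* A"
    define \<eta> :: "real ^ 'd" where "\<eta> = (\<chi> j. \<epsilon> * sgn (w $ j) * \<bar>w $ j\<bar> powr (1 / (2 * real (m $ j) - 1)))"
    define \<nu> where "\<nu> = A *v \<eta>"
    have r: "2 * real (m $ j) - 1 \<ge> 1" for j using m1[of j] by simp
    have B\<nu>: "matrix_inv A *v \<nu> = \<eta>" using matrix_inv_mult(1)[OF A] by (simp add: \<nu>_def matrix_vector_mul_assoc)
    have pw: "w $ j * \<eta> $ j - M * \<bar>\<eta> $ j\<bar> ^ (2 * m $ j) \<ge> \<epsilon> / 2 * \<bar>w $ j\<bar> powr (1 + 1 / (2 * real (m $ j) - 1))" for j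
    proof (cases "w $ j = 0")
      case True
      then have "\<eta> $ j = 0" by (simp add: \<eta>_def)
      moreover have "(0::real) ^ (2 * m $ j) = 0" by (rule zero_power) (use m1[of j] in linarith)
      ultimately have e: "M * \<bar>\<eta> $ j\<bar> ^ (2 * m $ j) = 0" by (simp only: abs_zero mult_zero_right)
      show ?thesis unfolding e using True by simp
    next
      case False
      define r where "r = 2 * real (m $ j) - 1"
      have r1: "r \<ge> 1" using m1[of j] by (simp add: r_def)
      have 1: "w $ j * \<eta> $ j = \<epsilon> * \<bar>w $ j\<bar> powr (1 + 1 / r)"
      proof -
        have "w $ j * \<eta> $ j = \<epsilon> * (w $ j * sgn (w $ j)) * \<bar>w $ j\<bar> powr (1 / r)" by (simp add: \<eta>_def r_def)
        also have "w $ j * sgn (w $ j) = \<bar>w $ j\<bar>" by (simp add: abs_sgn)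
        finally show ?thesis using False by (simp add: powr_add)
      qed
      have "\<bar>\<eta> $ j\<bar> = \<epsilon> * \<bar>w $ j\<bar> powr (1 / r)"
        using False \<epsilon> by (simp add: \<eta>_def r_def abs_mult abs_sgn_eq)
      then have "\<bar>\<eta> $ j\<bar> ^ (2 * m $ j) = \<epsilon> ^ (2 * m $ j) * (\<bar>w $ j\<bar> powr (1 / r)) ^ (2 * m $ j)"
        by (simp only: power_mult_distrib)
      also have "(\<bar>w $ j\<bar> powr (1 / r)) ^ (2 * m $ j) = \<bar>w $ j\<bar> powr (1 + 1 / r)"
      proof -
        have "(\<bar>w $ j\<bar> powr (1 / r)) ^ (2 * m $ j) = (\<bar>w $ j\<bar> powr (1 / r)) powr real (2 * m $ j)"
          using False by (subst powr_realpow) auto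
        also have "\<dots> = \<bar>w $ j\<bar> powr (1 / r * real (2 * m $ j))" by (rule powr_powr)
        also have "1 / r * real (2 * m $ j) = 1 + 1 / r" using r1 by (simp add: r_def field_simps)
        finally show ?thesis .
      qed
      also have "\<epsilon> ^ (2 * m $ j) * \<bar>w $ j\<bar> powr (1 + 1 / r) \<le> \<epsilon> ^ 2 * \<bar>w $ j\<bar> powr (1 + 1 / r)"
        using \<epsilon> m1[of j] by (intro mult_right_mono power_decreasing) auto
      finally have "M * \<bar>\<eta> $ j\<bar> ^ (2 * m $ j) \<le> M * (\<epsilon> ^ 2 * \<bar>w $ j\<bar> powr (1 + 1 / r))"
        using M by (intro mult_left_mono)
      also have "\<dots> = (M * \<epsilon>) * (\<epsilon> * \<bar>w $ j\<bar> powr (1 + 1 / r))" by (simp add: power2_eq_square mult_ac)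
      also have "\<dots> \<le> 1 / 2 * (\<epsilon> * \<bar>w $ j\<bar> powr (1 + 1 / r))"
        using \<epsilon> by (intro mult_right_mono M) auto
      finally show ?thesis unfolding 1 r_def by simp
    qed
    have "\<epsilon> / 2 * dual_gauge y = (\<Sum>j\<in>UNIV. \<epsilon> / 2 * \<bar>w $ j\<bar> powr (1 + 1 / (2 * real (m $ j) - 1)))"
      by (simp add: dual_gauge_def w_def sum_distrib_left)
    also have "\<dots> \<le> (\<Sum>j\<in>UNIV. w $ j * \<eta> $ j - M * \<bar>\<eta> $ j\<bar> ^ (2 * m $ j))"
      by (intro sum_mono pw)
    also have "\<dots> = y \<bullet> \<nu> - M * quasi m (cplx_vec (matrix_inv A *v \<nu>))"
    proof -
      have "y \<bullet> \<nu> = w \<bullet> \<eta>" unfolding \<nu>_def w_def by (rule dot_lmul_matrix[symmetric])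
      then show ?thesis unfolding B\<nu> quasi_real by (simp add: inner_vec_def sum_subtractf sum_distrib_left)
    qed
    finally have 1: "\<epsilon> / 2 * dual_gauge y \<le> y \<bullet> \<nu> - M * quasi m (cplx_vec (matrix_inv A *v \<nu>))" .
    have "\<bar>\<eta> $ j\<bar> \<le> \<epsilon> * (1 + norm w)" for j
    proof -
      have "\<bar>w $ j\<bar> powr (1 / (2 * real (m $ j) - 1)) \<le> 1 + \<bar>w $ j\<bar>"
      proof (cases "\<bar>w $ j\<bar> \<le> 1")
        case True
        then have "\<bar>w $ j\<bar> powr (1 / (2 * real (m $ j) - 1)) \<le> 1 powr (1 / (2 * real (m $ j) - 1))"
          using r[of j] by (intro powr_mono2) auto
        then show ?thesis by simp
      next
        case False
        then have "\<bar>w $ j\<bar> powr (1 / (2 * real (m $ j) - 1)) \<le> \<bar>w $ j\<bar> powr 1"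
          using r[of j] by (intro powr_mono) auto
        then show ?thesis using False by simp
      qed
      also have "\<dots> \<le> 1 + norm w" using component_le_norm_cart[of w j] by simp
      finally have *: "\<bar>w $ j\<bar> powr (1 / (2 * real (m $ j) - 1)) \<le> 1 + norm w" .
      have "\<bar>\<eta> $ j\<bar> \<le> \<epsilon> * 1 * \<bar>w $ j\<bar> powr (1 / (2 * real (m $ j) - 1))"
        unfolding \<eta>_def vec_lambda_beta abs_mult using \<epsilon> by (intro mult_right_mono mult_mono) (auto simp: abs_sgn_eq)
      also have "\<dots> \<le> \<epsilon> * (1 + norm w)" using * \<epsilon> by simp
      finally show ?thesis .
    qed
    then have "(\<Sum>j\<in>UNIV. \<bar>\<eta> $ j\<bar>) \<le> (\<Sum>j\<in>(UNIV::'d set). \<epsilon> * (1 + norm w))" by (intro sum_mono)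
    then have "norm \<eta> \<le> real CARD('d) * (\<epsilon> * (1 + norm w))" using norm_le_l1_cart[of \<eta>] by simp
    moreover have "norm w \<le> norm y * K2" using K2(2)[of y] by (simp add: w_def transpose_matrix_vector)
    ultimately have "norm \<eta> \<le> real CARD('d) * (\<epsilon> * ((1 + K2) * (1 + norm y)))"
    proof -
      have "1 + norm y * K2 \<le> (1 + K2) * (1 + norm y)" using K2(1) by (simp add: algebra_simps)
      then have "1 + norm w \<le> (1 + K2) * (1 + norm y)" using \<open>norm w \<le> norm y * K2\<close> by linarith
      then have "real CARD('d) * (\<epsilon> * (1 + norm w)) \<le> real CARD('d) * (\<epsilon> * ((1 + K2) * (1 + norm y)))"
        using \<epsilon> by (intro mult_left_mono) auto
      then show ?thesis using \<open>norm \<eta> \<le> real CARD('d) * (\<epsilon> * (1 + norm w))\<close> by linarith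
    qed
    then have "norm \<eta> * K1 \<le> real CARD('d) * (\<epsilon> * ((1 + K2) * (1 + norm y))) * K1"
      using K1 by (intro mult_right_mono) auto
    then have "norm \<nu> \<le> K * \<epsilon> * (1 + norm y)"
      using K1(2)[of \<eta>] by (simp add: \<nu>_def K_def mult_ac)
    with 1 show "\<exists>\<nu>. \<epsilon> / 2 * dual_gauge y \<le> y \<bullet> \<nu> - M * quasi m (cplx_vec (matrix_inv A *v \<nu>)) \<and> norm \<nu> \<le> K * \<epsilon> * (1 + norm y)"
      by blast
  qed
qed

lemma dual_gauge_bounded: "\<exists>D>0. \<forall>y. norm y \<le> L \<longrightarrow> dual_gauge y \<le> D"
proof -
  obtain K2 where K2: "K2 > 0" "\<And>x. norm (transpose A *v x) \<le> norm x * K2"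
    using bounded_linear.pos_bounded[OF matrix_vector_mul_bounded_linear[of "transpose A"]] by blast
  define D where "D = (\<Sum>j\<in>(UNIV :: 'd set). (1 + \<bar>L\<bar> * K2) powr (1 + 1 / (2 * real (m $ j) - 1)))"
  have b: "1 + \<bar>L\<bar> * K2 > 0" using K2 by (simp add: add_pos_nonneg)
  show ?thesis
  proof (intro exI[of _ D] conjI allI impI)
    show "D > 0" unfolding D_def using b by (intro sum_pos) auto
    fix y :: "real ^ 'd" assume y: "norm y \<le> L"
    have "norm (y v* A) \<le> norm y * K2" using K2(2)[of y] by (simp add: transpose_matrix_vector)
    also have "\<dots> \<le> \<bar>L\<bar> * K2" using y K2 by (intro mult_right_mono) auto
    finally have n: "norm (y v* A) \<le> 1 + \<bar>L\<bar> * K2" by simp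
    show "dual_gauge y \<le> D" unfolding dual_gauge_def D_def
    proof (intro sum_mono powr_mono2)
      show "\<bar>(y v* A) $ j\<bar> \<le> 1 + \<bar>L\<bar> * K2" for j using n component_le_norm_cart[of "y v* A" j] by linarith
      show "0 \<le> 1 + 1 / (2 * real (m $ j) - 1)" for j using m1[of j] by simp
    qed auto
  qed
qed

lemma dual_gauge_lower: "\<exists>g>0. \<forall>y. norm y \<ge> 1 \<longrightarrow> dual_gauge y \<ge> g"
proof -
  have At: "invertible (transpose A)" using A by (simp add: invertible_det_nz det_transpose)
  obtain k where k: "k > 0" "\<And>x. k * norm x \<le> norm (transpose A *v x)" using matrix_norm_lower[OF m1 At] by blast
  define s where "s = min 1 (k / real CARD('d))"
  have s: "0 < s" "s \<le> 1" using k by (auto simp: s_def)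
  show ?thesis
  proof (intro exI[of _ "s ^ 2"] conjI allI impI)
    show "s ^ 2 > 0" using s by simp
    fix y :: "real ^ 'd" assume y: "norm y \<ge> 1"
    have "k \<le> k * norm y" using y k(1) by simp
    also have "\<dots> \<le> norm (y v* A)" using k(2)[of y] by (simp only: transpose_matrix_vector)
    finally have "k \<le> norm (y v* A)" .
    then have "k \<le> (\<Sum>j\<in>UNIV. \<bar>(y v* A) $ j\<bar>)" using norm_le_l1_cart[of "y v* A"] by linarith
    have "\<exists>j. \<bar>(y v* A) $ j\<bar> \<ge> s"
    proof (rule ccontr)
      assume "\<not> ?thesis"
      then have "(\<Sum>j\<in>UNIV. \<bar>(y v* A) $ j\<bar>) < (\<Sum>j\<in>(UNIV :: 'd set). s)" by (intro sum_strict_mono) (auto simp: not_le)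
      also have "\<dots> \<le> k" by (simp add: s_def min_def field_simps)
      finally show False using \<open>k \<le> (\<Sum>j\<in>UNIV. \<bar>(y v* A) $ j\<bar>)\<close> by simp
    qed
    then obtain j where j: "\<bar>(y v* A) $ j\<bar> \<ge> s" by blast
    have e: "0 \<le> 1 + 1 / (2 * real (m $ j) - 1)" "1 + 1 / (2 * real (m $ j) - 1) \<le> 2"
      using m1[of j] by (auto simp: divide_le_eq)
    have "s ^ 2 = s powr 2" using powr_realpow[of s 2] s by (simp only: of_nat_numeral)
    also have "\<dots> \<le> s powr (1 + 1 / (2 * real (m $ j) - 1))" using s e by (intro powr_mono') auto
    also have "\<dots> \<le> \<bar>(y v* A) $ j\<bar> powr (1 + 1 / (2 * real (m $ j) - 1))" using s e j by (intro powr_mono2) auto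
    also have "\<dots> \<le> dual_gauge y" unfolding dual_gauge_def by (rule member_le_sum) auto
    finally show "s ^ 2 \<le> dual_gauge y" .
  qed
qed

lemma quasi_lower_outside: "a > 0 \<Longrightarrow> \<exists>q>0. \<forall>x. norm x \<ge> a \<longrightarrow> quasi m (cplx_vec (matrix_inv A *v x)) \<ge> q"
proof -
  assume a: "a > 0"
  have B: "invertible (matrix_inv A)" using matrix_inv_mult[OF A] unfolding invertible_def by blast
  obtain k where k: "k > 0" "\<And>x. k * norm x \<le> norm (matrix_inv A *v x)" using matrix_norm_lower[OF m1 B] by blast
  define \<rho> where "\<rho> = min 1 (k * a / (2 * real CARD('d)))"
  have \<rho>: "0 < \<rho>" "\<rho> \<le> 1" using k a by (auto simp: \<rho>_def)
  show ?thesis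
  proof (intro exI[of _ "\<rho> ^ (2 * lcm_vec m)"] conjI allI impI)
    show "\<rho> ^ (2 * lcm_vec m) > 0" using \<rho> by simp
    fix x :: "real ^ 'd" assume x: "norm x \<ge> a"
    show "quasi m (cplx_vec (matrix_inv A *v x)) \<ge> \<rho> ^ (2 * lcm_vec m)"
    proof (rule ccontr)
      assume "\<not> ?thesis"
      then have "norm (cplx_vec (matrix_inv A *v x) $ j) \<le> \<rho> ^ (kappa m $ j)" for j
        using \<rho> by (intro quasi_bound[OF m1]) auto
      moreover have "\<rho> ^ (kappa m $ j) \<le> \<rho> ^ 1" for j using \<rho> kappa_ge_1[OF m1, of j] by (intro power_decreasing) auto
      ultimately have "\<bar>(matrix_inv A *v x) $ j\<bar> \<le> \<rho>" for j by (force intro: order_trans)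
      then have "(\<Sum>j\<in>UNIV. \<bar>(matrix_inv A *v x) $ j\<bar>) \<le> (\<Sum>j\<in>(UNIV :: 'd set). \<rho>)" by (intro sum_mono)
      then have "norm (matrix_inv A *v x) \<le> real CARD('d) * \<rho>" using norm_le_l1_cart[of "matrix_inv A *v x"] by simp
      also have "\<dots> \<le> real CARD('d) * (k * a / (2 * real CARD('d)))" by (intro mult_left_mono) (auto simp: \<rho>_def)
      also have "\<dots> = k * a / 2" by simp
      also have "\<dots> < k * a" using k a by simp
      also have "\<dots> \<le> k * norm x" using k x by simp
      finally show False using k(2)[of x] by simp
    qed
  qed
qed

end

section \<open>Local analysis at one point\<close>

abbreviation cpt :: "real ^ 'd \<Rightarrow> real ^ 'd \<Rightarrow> complex ^ 'd"
  where "cpt \<eta> \<nu> \<equiv> cplx_vec \<eta> - \<i> *s cplx_vec \<nu>"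

abbreviation pgauge :: "nat ^ 'd \<Rightarrow> real ^ 'd ^ 'd \<Rightarrow> real ^ 'd::finite \<Rightarrow> real"
  where "pgauge m A \<eta> \<equiv> quasi m (cplx_vec (matrix_inv A *v \<eta>))"

lemma norm_cpt_le: "norm (cpt \<eta> \<nu>) \<le> norm \<eta> + norm \<nu>"
proof -
  have "norm (\<i> *s cplx_vec \<nu>) = norm \<nu>" by (simp add: norm_vec_def norm_mult)
  then show ?thesis using norm_triangle_ineq4[of "cplx_vec \<eta>" "\<i> *s cplx_vec \<nu>"] by simp
qed

lemma cplx_mat_cpt: "cplx_mat B *v cpt \<eta> \<nu> = cpt (B *v \<eta>) (B *v \<nu>)"
  by (simp add: cplx_mat_def matrix_vector_mult_def vec_eq_iff sum_subtractf sum_distrib_left right_diff_distrib mult.left_commute)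

lemma cpt_scaleR: "cplx_vec x - (\<i> * complex_of_real s) *s cplx_vec \<nu> = cpt x (s *\<^sub>R \<nu>)"
  by (simp add: vec_eq_iff)

lemma cpt_0: "cpt x 0 = cplx_vec x"
  by (simp add: vec_eq_iff)

lemma continuous_on_cplx_mat: "continuous_on S g \<Longrightarrow> continuous_on S (\<lambda>z. cplx_mat A *v g z)"
  unfolding matrix_vector_mult_def by (intro continuous_intros)

lemma filterlim_matrix_at_0:
  fixes A :: "real ^ 'd::finite ^ 'd"
  assumes A: "invertible A"
  shows "filterlim (\<lambda>\<xi>. A *v \<xi>) (at 0) (at 0)"
  unfolding filterlim_at
proof
  have "A *v \<xi> \<noteq> 0" if "\<xi> \<noteq> 0" for \<xi>
  proof
    assume "A *v \<xi> = 0"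
    then have "matrix_inv A *v (A *v \<xi>) = 0" by simp
    then show False using that matrix_inv_mult(1)[OF A] by (simp add: matrix_vector_mul_assoc)
  qed
  then show "\<forall>\<^sub>F \<xi> in at 0. A *v \<xi> \<in> UNIV \<and> A *v \<xi> \<noteq> 0" by (auto simp: eventually_at_filter)
  have "isCont (\<lambda>\<xi>. A *v \<xi>) 0" by (rule linear_continuous_at[OF matrix_vector_mul_bounded_linear])
  then show "((\<lambda>\<xi>. A *v \<xi>) \<longlongrightarrow> 0) (at 0)" by (simp add: isCont_def)
qed

lemma cdiff_cplx_mat:
  assumes "\<forall>\<^sub>F z in nhds 0. cdiff U z"
  shows "\<forall>\<^sub>F z in nhds 0. cdiff (\<lambda>z. U (cplx_mat A *v z)) z"
proof -
  have "isCont (\<lambda>z. cplx_mat A *v z) 0"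
    using continuous_on_cplx_mat[OF continuous_on_id, of UNIV A] by (simp add: continuous_on_eq_continuous_at)
  then have "filterlim (\<lambda>z. cplx_mat A *v z) (nhds 0) (nhds 0)"
    using tendsto_at_iff_tendsto_nhds[of "\<lambda>z. cplx_mat A *v z" 0] by (simp add: isCont_def)
  with assms have "\<forall>\<^sub>F z in nhds 0. cdiff U (cplx_mat A *v z)" by (rule eventually_compose_filterlim)
  then show ?thesis
  proof eventually_elim
    case (elim z)
    show ?case
      using cdiff_compose_linear[of U "\<lambda>z. cplx_mat A *v z" z 0] elim
      by (simp add: matrix_vector_right_distrib vector_scalar_commute)
  qed
qed

text \<open>The estimates for semi-elliptic polynomials, carried over by \<open>z \<mapsto> matrix_inv A *v z\<close>.\<close>

lemma local_estimates:
  fixes P :: "'d::finite cpoly" and A :: "real ^ 'd ^ 'd"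
  assumes A: "invertible A" and p: "positive_semi_elliptic m (lin_subst A P)"
    and U: "\<forall>\<^sub>F z in nhds 0. cdiff U z" "U 0 = 0" "(\<lambda>\<xi>. norm (U (cplx_vec \<xi>))) \<in> o[at 0](real_part P)"
  shows "\<exists>c>0. \<exists>M>0. \<exists>C>0. \<exists>\<delta>>0. (\<forall>z. norm z \<le> 2 * \<delta> \<longrightarrow> cdiff U z) \<and> (\<forall>n\<ge>1. \<forall>\<eta> \<nu>.
     (\<forall>l\<le>N. norm (exp (- (of_nat n * eval_poly P (cpt \<eta> \<nu>))) * eval_poly (Q_poly A m U l n) (cpt \<eta> \<nu>))
       \<le> C * exp (real n * (- (c * pgauge m A \<eta>) + M * pgauge m A \<nu>))) \<and>
     (norm \<eta> \<le> \<delta> \<longrightarrow> norm \<nu> \<le> \<delta> \<longrightarrow>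
       norm (exp (- (of_nat n * eval_poly P (cpt \<eta> \<nu>))) *
         (exp (of_nat n * U (cpt \<eta> \<nu>)) - (\<Sum>l\<le>N. eval_poly (Q_poly A m U l n) (cpt \<eta> \<nu>))))
       \<le> C * real n powr (- (real (Suc N) / (2 * real (lcm_vec m)))) * exp (real n * (- (c * pgauge m A \<eta>) + M * pgauge m A \<nu>))))"
proof -
  let ?B = "matrix_inv A"
  define f where "f z = U (cplx_mat A *v z)" for z
  have m1: "m $ j \<ge> 1" for j using p by (simp add: positive_semi_elliptic_def)
  have f: "\<forall>\<^sub>F z in nhds 0. cdiff f z" unfolding f_def by (rule cdiff_cplx_mat[OF U(1)])
  have f0: "f 0 = 0" using U(2) by (simp add: f_def)
  have "(\<lambda>\<xi>. norm (U (cplx_vec (A *v \<xi>)))) \<in> o[at 0](\<lambda>\<xi>. real_part P (A *v \<xi>))"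
    by (rule landau_o.small.compose[OF U(3) filterlim_matrix_at_0[OF A]])
  then have fo: "(\<lambda>\<xi>. norm (f (cplx_vec \<xi>))) \<in> o[at 0](real_part (lin_subst A P))"
    by (simp add: f_def real_part_def[abs_def] eval_lin_subst cplx_mat_vec)
  obtain c M C \<delta>0 where cMC: "c > 0" "M > 0" "C > 0" "\<delta>0 > 0" and main: "\<forall>n\<ge>1. \<forall>\<xi> \<nu>.
     (\<forall>l\<le>N. norm (exp (- (of_nat n * eval_poly (lin_subst A P) (cpt \<xi> \<nu>))) *
        exp_coeff (\<lambda>l. of_nat n * (\<Sum>\<beta> | Lambda_weight m \<beta> = int l. maclaurin f \<beta> * monomial (cpt \<xi> \<nu>) \<beta>)) l)
        \<le> C * exp (real n * (- (c * quasi m (cplx_vec \<xi>)) + M * quasi m (cplx_vec \<nu>)))) \<and>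
     (quasi m (cpt \<xi> \<nu>) \<le> \<delta>0 \<longrightarrow>
       norm (exp (- (of_nat n * eval_poly (lin_subst A P) (cpt \<xi> \<nu>))) * (exp (of_nat n * f (cpt \<xi> \<nu>)) -
         (\<Sum>l\<le>N. exp_coeff (\<lambda>l. of_nat n * (\<Sum>\<beta> | Lambda_weight m \<beta> = int l. maclaurin f \<beta> * monomial (cpt \<xi> \<nu>) \<beta>)) l)))
       \<le> C * real n powr (- (real (Suc N) / (2 * real (lcm_vec m)))) *
         exp (real n * (- (c * quasi m (cplx_vec \<xi>)) + M * quasi m (cplx_vec \<nu>))))"
    using semi_elliptic_estimates[OF p f f0 fo, of N] by (elim exE conjE) (rule that)
  obtain d1 where d1: "d1 > 0" "\<And>z. norm z < d1 \<Longrightarrow> cdiff U z"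
    using U(1) unfolding eventually_nhds_metric by (auto simp: dist_norm)
  have "isCont (\<lambda>w. quasi m (cplx_mat ?B *v w)) 0"
    using continuous_on_quasi[OF m1 continuous_on_cplx_mat[OF continuous_on_id, of UNIV ?B]]
    by (simp add: continuous_on_eq_continuous_at)
  then have "((\<lambda>w. quasi m (cplx_mat ?B *v w)) \<longlongrightarrow> quasi m (cplx_mat ?B *v 0)) (nhds 0)"
    unfolding isCont_def by (rule iffD1[OF tendsto_at_iff_tendsto_nhds])
  moreover have "quasi m (cplx_mat ?B *v 0) = 0" using quasi_eq_0[OF m1, of 0] by simp
  ultimately have "\<forall>\<^sub>F w in nhds 0. quasi m (cplx_mat ?B *v w) < \<delta>0"
    using cMC(4) by (intro order_tendstoD(2)) auto
  then obtain d2 where d2: "d2 > 0" "\<And>w. norm w < d2 \<Longrightarrow> quasi m (cplx_mat ?B *v w) < \<delta>0"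
    unfolding eventually_nhds_metric by (auto simp: dist_norm)
  define \<delta> where "\<delta> = min d1 d2 / 3"
  have \<delta>: "\<delta> > 0" "3 * \<delta> \<le> d1" "3 * \<delta> \<le> d2" using d1 d2 by (auto simp: \<delta>_def)
  have Q: "exp_coeff (\<lambda>l. of_nat n * (\<Sum>\<beta> | Lambda_weight m \<beta> = int l. maclaurin f \<beta> * monomial (cplx_mat ?B *v z) \<beta>)) l
    = eval_poly (Q_poly A m U l n) z" for n l z
    unfolding eval_Q_poly exp_coeff_def f_def[abs_def] ..
  have Pe: "eval_poly (lin_subst A P) (cplx_mat ?B *v z) = eval_poly P z" and fe: "f (cplx_mat ?B *v z) = U z" for z
    by (simp_all add: eval_lin_subst f_def cplx_mat_inv_vec[OF A])
  note main' = main[THEN spec, THEN mp, THEN spec, THEN spec, of _ "?B *v \<eta>" "?B *v \<nu>" for \<eta> \<nu>, folded cplx_mat_cpt, unfolded Q Pe fe]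
  show ?thesis
  proof (rule exI[of _ c], rule conjI[OF cMC(1)], rule exI[of _ M], rule conjI[OF cMC(2)], rule exI[of _ C],
      rule conjI[OF cMC(3)], rule exI[of _ \<delta>], rule conjI[OF \<delta>(1)], intro conjI allI impI)
    show "cdiff U z" if "norm z \<le> 2 * \<delta>" for z using d1(2)[of z] that \<delta> by linarith
    fix n :: nat and \<eta> \<nu> :: "real ^ 'd"
    assume n: "n \<ge> 1"
    show "norm (exp (- (of_nat n * eval_poly P (cpt \<eta> \<nu>))) * eval_poly (Q_poly A m U l n) (cpt \<eta> \<nu>))
       \<le> C * exp (real n * (- (c * pgauge m A \<eta>) + M * pgauge m A \<nu>))" if "l \<le> N" for l
      by (rule main'[OF n, THEN conjunct1, rule_format, OF that])
    assume "norm \<eta> \<le> \<delta>" "norm \<nu> \<le> \<delta>"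
    then have "norm (cpt \<eta> \<nu>) < d2" using norm_cpt_le[of \<eta> \<nu>] \<delta> by linarith
    then have "quasi m (cplx_mat ?B *v cpt \<eta> \<nu>) \<le> \<delta>0" using d2(2) by fastforce
    then show "norm (exp (- (of_nat n * eval_poly P (cpt \<eta> \<nu>))) *
         (exp (of_nat n * U (cpt \<eta> \<nu>)) - (\<Sum>l\<le>N. eval_poly (Q_poly A m U l n) (cpt \<eta> \<nu>))))
       \<le> C * real n powr (- (real (Suc N) / (2 * real (lcm_vec m)))) * exp (real n * (- (c * pgauge m A \<eta>) + M * pgauge m A \<nu>))"
      by (rule main'[OF n, THEN conjunct2, rule_format])
  qed
qed

lemma cutoffD:
  assumes "cutoff a b \<theta> d\<theta> K"
  shows "(\<theta> has_derivative d\<theta> x) (at x)" "continuous_on UNIV (\<lambda>x. d\<theta> x v)" "0 \<le> \<theta> x" "\<theta> x \<le> 1"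
    "norm x \<le> a \<Longrightarrow> \<theta> x = 1" "norm x \<le> a \<Longrightarrow> d\<theta> x v = 0" "norm x \<ge> b \<Longrightarrow> \<theta> x = 0" "norm x \<ge> b \<Longrightarrow> d\<theta> x v = 0"
    "K > 0" "\<bar>d\<theta> x v\<bar> \<le> K * norm v" "continuous_on UNIV \<theta>"
proof -
  show d: "(\<theta> has_derivative d\<theta> x) (at x)" for x using assms by (simp add: cutoff_def)
  show "continuous_on UNIV \<theta>"
    by (rule continuous_at_imp_continuous_on) (simp add: has_derivative_continuous[OF d])
qed (use assms in \<open>simp_all add: cutoff_def\<close>)

lemma continuous_on_cdiff:
  assumes "\<And>z. cdiff D z" "continuous_on S g"
  shows "continuous_on S (\<lambda>x. D (g x))"
proof -
  have "continuous_on UNIV D"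
    by (rule continuous_at_imp_continuous_on) (simp add: cdiff_isCont[OF assms(1)])
  then show ?thesis by (rule continuous_on_compose2[OF _ assms(2)]) simp
qed

lemma continuous_on_cpt: "continuous_on S (\<lambda>x. cpt x \<nu>)"
  by (intro continuous_intros)

text \<open>With the cutoff \<open>\<theta>(x / R)\<close> the error in \<open>shift_bound\<close> is \<open>O(1 / R)\<close>, and both integrals converge as
  \<open>R\<close> tends to infinity.\<close>

lemma contour_shift:
  fixes D :: "complex ^ 'd::finite \<Rightarrow> complex" and \<nu> :: "real ^ 'd"
  assumes D: "\<And>z. cdiff D z" and \<beta>: "integrable lborel \<beta>"
    and b: "\<And>x s. 0 \<le> s \<Longrightarrow> s \<le> 1 \<Longrightarrow> norm (D (cpt x (s *\<^sub>R \<nu>))) \<le> \<beta> x"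
  shows "(LINT x|lborel. D (cpt x \<nu>)) = (LINT x|lborel. D (cplx_vec x))"
proof -
  obtain \<theta> :: "real ^ 'd \<Rightarrow> real" and d\<theta> K where cut: "cutoff 1 2 \<theta> d\<theta> K" using cutoff_exists[of 1 2] by auto
  note \<theta> = cutoffD[OF cut]
  define I where "I t R = (LINT x|lborel. of_real (\<theta> ((1 / R) *\<^sub>R x)) * D (cpt x (t *\<^sub>R \<nu>)))" for t R :: real
  have lim: "(\<lambda>k. I t (real (Suc k))) \<longlonglongrightarrow> (LINT x|lborel. D (cpt x (t *\<^sub>R \<nu>)))" if t: "0 \<le> t" "t \<le> 1" for t
    unfolding I_def
  proof (rule integral_dominated_convergence[where w = \<beta>])
    have cD: "continuous_on UNIV (\<lambda>x. D (cpt x (t *\<^sub>R \<nu>)))"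
      by (rule continuous_on_cdiff[OF D continuous_on_cpt])
    then show "(\<lambda>x. D (cpt x (t *\<^sub>R \<nu>))) \<in> borel_measurable lborel"
      by (simp add: borel_measurable_continuous_onI)
    show "(\<lambda>x. of_real (\<theta> ((1 / real (Suc k)) *\<^sub>R x)) * D (cpt x (t *\<^sub>R \<nu>))) \<in> borel_measurable lborel" for k
    proof -
      have "continuous_on UNIV (\<lambda>x. \<theta> ((1 / real (Suc k)) *\<^sub>R x))"
        by (rule continuous_on_compose2[OF \<theta>(11)]) (auto intro!: continuous_intros)
      then have "continuous_on UNIV (\<lambda>x. of_real (\<theta> ((1 / real (Suc k)) *\<^sub>R x)) * D (cpt x (t *\<^sub>R \<nu>)))"
        by (intro continuous_on_mult continuous_on_of_real cD)
      then show ?thesis by (simp add: borel_measurable_continuous_onI)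
    qed
    show "integrable lborel \<beta>" by (rule \<beta>)
    show "AE x in lborel. (\<lambda>k. of_real (\<theta> ((1 / real (Suc k)) *\<^sub>R x)) * D (cpt x (t *\<^sub>R \<nu>))) \<longlonglongrightarrow> D (cpt x (t *\<^sub>R \<nu>))"
    proof (rule AE_I2, rule tendsto_eventually)
      fix x :: "real ^ 'd"
      obtain k0 :: nat where k0: "norm x \<le> real k0" using real_arch_simple by blast
      have "\<theta> ((1 / real (Suc k)) *\<^sub>R x) = 1" if "k \<ge> k0" for k
        using k0 that by (intro \<theta>(5)) (simp add: divide_le_eq)
      then show "\<forall>\<^sub>F k in sequentially. of_real (\<theta> ((1 / real (Suc k)) *\<^sub>R x)) * D (cpt x (t *\<^sub>R \<nu>)) = D (cpt x (t *\<^sub>R \<nu>))"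
        unfolding eventually_sequentially by (intro exI[of _ k0]) simp
    qed
    show "AE x in lborel. norm (of_real (\<theta> ((1 / real (Suc k)) *\<^sub>R x)) * D (cpt x (t *\<^sub>R \<nu>))) \<le> \<beta> x" for k
    proof (rule AE_I2)
      fix x
      have "norm (of_real (\<theta> ((1 / real (Suc k)) *\<^sub>R x)) * D (cpt x (t *\<^sub>R \<nu>))) \<le> 1 * norm (D (cpt x (t *\<^sub>R \<nu>)))"
        unfolding norm_mult using \<theta>(3,4)[of "(1 / real (Suc k)) *\<^sub>R x"] by (intro mult_right_mono) auto
      then show "norm (of_real (\<theta> ((1 / real (Suc k)) *\<^sub>R x)) * D (cpt x (t *\<^sub>R \<nu>))) \<le> \<beta> x"
        using b[OF t, of x] by linarith
    qed
  qed
  have close: "norm (I 1 R - I 0 R) \<le> K * norm \<nu> * integral\<^sup>L lborel \<beta> / R" if R: "R > 0" for R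
  proof -
    have "norm ((LINT x|lborel. of_real (\<theta> ((1 / R) *\<^sub>R x)) * D (cplx_vec x - (\<i> * complex_of_real 1) *s cplx_vec \<nu>)) -
        (LINT x|lborel. of_real (\<theta> ((1 / R) *\<^sub>R x)) * D (cplx_vec x))) \<le> (LINT x|lborel. K * norm \<nu> / R * \<beta> x)"
    proof (rule shift_bound[where W = UNIV and d\<theta> = "\<lambda>x v. d\<theta> ((1 / R) *\<^sub>R x) ((1 / R) *\<^sub>R v)" and \<rho> = "2 * R"])
      show "((\<lambda>x. \<theta> ((1 / R) *\<^sub>R x)) has_derivative (\<lambda>v. d\<theta> ((1 / R) *\<^sub>R x) ((1 / R) *\<^sub>R v))) (at x)" for x
        by (rule has_derivative_compose[OF _ \<theta>(1)]) (auto intro!: derivative_eq_intros)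
      show "continuous_on UNIV (\<lambda>x. d\<theta> ((1 / R) *\<^sub>R x) ((1 / R) *\<^sub>R \<nu>))"
        by (rule continuous_on_compose2[OF \<theta>(2)]) (auto intro!: continuous_intros)
      show "\<theta> ((1 / R) *\<^sub>R x) = 0" if "norm x \<ge> 2 * R" for x
        using that R by (intro \<theta>(7)) (simp add: le_divide_eq)
      show "d\<theta> ((1 / R) *\<^sub>R x) ((1 / R) *\<^sub>R \<nu>) = 0" if "norm x \<ge> 2 * R" for x
        using that R by (intro \<theta>(8)) (simp add: le_divide_eq)
      show "integrable lborel (\<lambda>x. K * norm \<nu> / R * \<beta> x)" using \<beta> by simp
      fix x :: "real ^ 'd" and s :: real assume s: "0 \<le> s" "s \<le> 1"
      have "\<bar>d\<theta> ((1 / R) *\<^sub>R x) ((1 / R) *\<^sub>R \<nu>)\<bar> \<le> K * norm \<nu> / R" using \<theta>(10)[of "(1 / R) *\<^sub>R x" "(1 / R) *\<^sub>R \<nu>"] R by simp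
      then have "\<bar>d\<theta> ((1 / R) *\<^sub>R x) ((1 / R) *\<^sub>R \<nu>)\<bar> * norm (D (cpt x (s *\<^sub>R \<nu>))) \<le> K * norm \<nu> / R * \<beta> x"
        using R \<theta>(9) by (intro mult_mono b s) auto
      then show "norm (of_real (d\<theta> ((1 / R) *\<^sub>R x) ((1 / R) *\<^sub>R \<nu>)) * D (cplx_vec x - (\<i> * complex_of_real s) *s cplx_vec \<nu>))
          \<le> K * norm \<nu> / R * \<beta> x"
        unfolding cpt_scaleR norm_mult norm_of_real .
    qed (use D in auto)
    then show ?thesis unfolding I_def by (simp add: cpt_0)
  qed
  have "(\<lambda>k. I 1 (real (Suc k)) - I 0 (real (Suc k))) \<longlonglongrightarrow> 0"
  proof (rule Lim_null_comparison)
    show "\<forall>\<^sub>F k in sequentially. norm (I 1 (real (Suc k)) - I 0 (real (Suc k))) \<le> K * norm \<nu> * integral\<^sup>L lborel \<beta> / real (Suc k)"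
      by (intro always_eventually allI close) simp
    show "(\<lambda>k. K * norm \<nu> * integral\<^sup>L lborel \<beta> / real (Suc k)) \<longlonglongrightarrow> 0"
      by (rule LIMSEQ_Suc[OF lim_const_over_n])
  qed
  moreover have "(\<lambda>k. I 1 (real (Suc k)) - I 0 (real (Suc k))) \<longlonglongrightarrow>
      (LINT x|lborel. D (cpt x (1 *\<^sub>R \<nu>))) - (LINT x|lborel. D (cpt x (0 *\<^sub>R \<nu>)))"
    by (intro tendsto_diff lim) auto
  ultimately have "(LINT x|lborel. D (cpt x (1 *\<^sub>R \<nu>))) - (LINT x|lborel. D (cpt x (0 *\<^sub>R \<nu>))) = 0"
    by (rule LIMSEQ_unique[rotated])
  then show ?thesis by (simp add: cpt_0)
qed

abbreviation osc :: "real ^ 'd \<Rightarrow> complex ^ 'd::finite \<Rightarrow> complex"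
  where "osc y z \<equiv> exp (- (\<i> * cdot (cplx_vec y) z))"

lemma osc_real: "osc y (cplx_vec x) = exp (- (\<i> * complex_of_real (y \<bullet> x)))"
  by (simp add: cdot_def inner_vec_def)

lemma norm_osc: "norm (osc y (cpt x \<nu>)) = exp (- (y \<bullet> \<nu>))"
  by (simp add: cdot_def inner_vec_def sum_negf)

lemma cdiff_osc: "cdiff (osc y) z"
  unfolding cdot_def by (intro cdiff_exp cdiff_minus cdiff_mult cdiff_const cdiff_sum cdiff_component)

lemma pgauge_scale:
  assumes "0 \<le> s" "s \<le> 1"
  shows "pgauge m A (s *\<^sub>R \<nu>) \<le> pgauge m A \<nu>"
  unfolding quasi_def
proof (rule sum_mono)
  fix j
  have "norm (cplx_vec (matrix_inv A *v (s *\<^sub>R \<nu>)) $ j) = s * norm (cplx_vec (matrix_inv A *v \<nu>) $ j)"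
    using assms by (simp add: matrix_vector_mult_scaleR abs_mult norm_mult)
  also have "\<dots> \<le> 1 * norm (cplx_vec (matrix_inv A *v \<nu>) $ j)" using assms by (intro mult_right_mono) auto
  finally show "norm (cplx_vec (matrix_inv A *v (s *\<^sub>R \<nu>)) $ j) ^ (2 * m $ j) \<le> norm (cplx_vec (matrix_inv A *v \<nu>) $ j) ^ (2 * m $ j)"
    by (intro power_mono) auto
qed

text \<open>A non-integrable function has integral \<open>0\<close> by convention, so the bound holds for every \<open>f\<close>.\<close>

lemma norm_lebesgue_integral_le:
  fixes f :: "'a \<Rightarrow> complex"
  assumes g: "integrable M g" and le: "\<And>x. norm (f x) \<le> g x"
  shows "norm (integral\<^sup>L M f) \<le> integral\<^sup>L M g"
proof (cases "integrable M f")
  case True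
  then show ?thesis by (rule integral_norm_bound_integral_any[OF _ g]) (rule le)
next
  case False
  have "0 \<le> g x" for x using le[of x] norm_ge_zero order_trans by blast
  then have "0 \<le> integral\<^sup>L M g" by (intro Bochner_Integration.integral_nonneg) simp
  then show ?thesis using False by (simp add: not_integrable_integral_eq)
qed

section \<open>Expansion of the local integral\<close>

text \<open>A term that is exponentially small in \<open>n\<close> is absorbed by the right side of the expansion as long as
  the exponent \<open>G\<close> stays bounded.\<close>

lemma absorb_exponential:
  assumes \<kappa>: "\<kappa> > 0" and e: "e \<ge> 0" and D: "D > 0"
  shows "\<exists>Cp>0. \<forall>n\<ge>1. \<forall>G \<epsilon>. G \<le> D \<longrightarrow> 0 \<le> \<epsilon> \<longrightarrow> \<epsilon> \<le> \<kappa> / (2 * D) \<longrightarrow>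
    exp (- (real n * \<kappa>)) \<le> Cp * real n powr (- e) * exp (- (real n * (\<epsilon> * G)))"
proof -
  obtain Cp where Cp: "Cp > 0" "\<And>y. y \<ge> 0 \<Longrightarrow> y powr e \<le> Cp * exp (\<kappa> / 2 * y)"
    using powr_le_exp[OF e, of "\<kappa> / 2"] \<kappa> by auto
  have "exp (- (real n * \<kappa>)) \<le> Cp * real n powr (- e) * exp (- (real n * (\<epsilon> * G)))"
    if n: "n \<ge> 1" and G: "G \<le> D" "0 \<le> \<epsilon>" "\<epsilon> \<le> \<kappa> / (2 * D)" for n G \<epsilon>
  proof -
    have "\<epsilon> * G \<le> \<epsilon> * D" using G by (intro mult_left_mono)
    also have "\<dots> \<le> \<kappa> / (2 * D) * D" using G D by (intro mult_right_mono) auto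
    also have "\<dots> = \<kappa> / 2" using D by simp
    finally have "real n * (\<epsilon> * G) \<le> real n * (\<kappa> / 2)" by (intro mult_left_mono) auto
    then have 1: "exp (- (\<kappa> / 2 * real n)) \<le> exp (- (real n * (\<epsilon> * G)))" by (simp add: mult.commute)
    have "1 = real n powr e * real n powr (- e)" using n by (simp flip: powr_add)
    also have "\<dots> \<le> Cp * exp (\<kappa> / 2 * real n) * real n powr (- e)" by (intro mult_right_mono Cp(2)) auto
    finally have "1 * exp (- (\<kappa> / 2 * real n)) \<le> Cp * exp (\<kappa> / 2 * real n) * real n powr (- e) * exp (- (\<kappa> / 2 * real n))"
      by (intro mult_right_mono) auto
    also have "\<dots> = Cp * real n powr (- e) * (exp (\<kappa> / 2 * real n) * exp (- (\<kappa> / 2 * real n)))" by (simp only: mult_ac)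
    also have "exp (\<kappa> / 2 * real n) * exp (- (\<kappa> / 2 * real n)) = 1" by (rule exp_minus_inverse)
    finally have 2: "exp (- (\<kappa> / 2 * real n)) \<le> Cp * real n powr (- e)" by simp
    have "real n * \<kappa> = \<kappa> / 2 * real n + \<kappa> / 2 * real n" by (simp add: mult.commute)
    then have "exp (- (real n * \<kappa>)) = exp (- (\<kappa> / 2 * real n)) * exp (- (\<kappa> / 2 * real n))"
      unfolding exp_add[symmetric] by simp
    also have "\<dots> \<le> Cp * real n powr (- e) * exp (- (real n * (\<epsilon> * G)))"
      using Cp(1) by (intro mult_mono 1 2) auto
    finally show ?thesis .
  qed
  then show ?thesis using Cp(1) by blast
qed

lemma invertible_inv:
  fixes A :: "real ^ 'd::finite ^ 'd"
  assumes "invertible A"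
  shows "invertible (matrix_inv A)"
  using matrix_inv_mult[OF assms] unfolding invertible_def by blast

text \<open>The analysis at one point, with the constants of \<open>local_estimates\<close> fixed.\<close>

locale local_expansion =
  fixes P :: "'d::finite cpoly" and A :: "real ^ 'd ^ 'd" and m :: "nat ^ 'd" and U :: "complex ^ 'd \<Rightarrow> complex"
    and N :: nat and c M C \<delta> :: real
  assumes A: "invertible A" and m1: "\<And>j. m $ j \<ge> 1"
    and c: "c > 0" and M: "M > 0" and C: "C > 0" and \<delta>: "\<delta> > 0"
    and hol: "\<And>z. norm z \<le> 2 * \<delta> \<Longrightarrow> cdiff U z"
    and coeff_bound: "\<And>n l \<eta> \<nu>. n \<ge> 1 \<Longrightarrow> l \<le> N \<Longrightarrow>
      norm (exp (- (of_nat n * eval_poly P (cpt \<eta> \<nu>))) * eval_poly (Q_poly A m U l n) (cpt \<eta> \<nu>))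
       \<le> C * exp (real n * (- (c * pgauge m A \<eta>) + M * pgauge m A \<nu>))"
    and remainder_bound: "\<And>n \<eta> \<nu>. n \<ge> 1 \<Longrightarrow> norm \<eta> \<le> \<delta> \<Longrightarrow> norm \<nu> \<le> \<delta> \<Longrightarrow>
       norm (exp (- (of_nat n * eval_poly P (cpt \<eta> \<nu>))) *
         (exp (of_nat n * U (cpt \<eta> \<nu>)) - (\<Sum>l\<le>N. eval_poly (Q_poly A m U l n) (cpt \<eta> \<nu>))))
       \<le> C * real n powr (- (real (Suc N) / (2 * real (lcm_vec m)))) * exp (real n * (- (c * pgauge m A \<eta>) + M * pgauge m A \<nu>))"
begin

abbreviation "pg \<equiv> pgauge m A"

abbreviation "mterm n l z \<equiv> exp (- (of_nat n * eval_poly P z)) * eval_poly (Q_poly A m U l n) z"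

abbreviation "\<mu> \<equiv> \<Sum>j\<in>UNIV. 1 / (2 * real (m $ j))"

lemma pgauge_nonneg: "pg x \<ge> 0"
  by (rule quasi_nonneg[OF m1])

lemma pgauge_0: "pg 0 = 0"
proof -
  have "cplx_vec (matrix_inv A *v 0) = 0" by (simp add: vec_eq_iff)
  then show ?thesis using quasi_eq_0[OF m1] by blast
qed

lemma cdiff_mterm: "cdiff (\<lambda>z. mterm n l z * osc y z) z"
  by (intro cdiff_mult cdiff_osc cdiff_exp cdiff_minus cdiff_const cdiff_eval_poly)

lemma mterm_real_bound:
  assumes "n \<ge> 1" "l \<le> N"
  shows "norm (mterm n l (cplx_vec x) * osc y (cplx_vec x)) \<le> C * exp (- (real n * (c * pg x)))"
proof -
  have "norm (mterm n l (cplx_vec x)) \<le> C * exp (- (real n * (c * pg x)))"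
    using coeff_bound[OF assms, of x 0] unfolding cpt_0 pgauge_0 by simp
  moreover have "norm (osc y (cplx_vec x)) = 1"
    using norm_osc[of y x 0] unfolding cpt_0 by simp
  ultimately show ?thesis unfolding norm_mult[of "mterm n l (cplx_vec x)"] by simp
qed

lemma integrable_pgauge:
  assumes "t > 0"
  shows "integrable lborel (\<lambda>x. exp (- (t * (c * pg x))))"
  using integrable_quasi[OF m1 invertible_inv[OF A], of "t * c"] assms c by (simp add: mult.assoc)

lemma integrable_mterm:
  assumes n: "n \<ge> 1" and l: "l \<le> N"
  shows "integrable lborel (\<lambda>x. mterm n l (cplx_vec x) * osc y (cplx_vec x))"
proof (rule Bochner_Integration.integrable_bound)
  show "integrable lborel (\<lambda>x. C * exp (- (real n * (c * pg x))))"
    using integrable_pgauge[of "real n"] n by simp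
  have "continuous_on UNIV (\<lambda>x. mterm n l (cplx_vec x) * osc y (cplx_vec x))"
    by (rule continuous_on_cdiff[OF cdiff_mterm]) (intro continuous_intros)
  then show "(\<lambda>x. mterm n l (cplx_vec x) * osc y (cplx_vec x)) \<in> borel_measurable lborel"
    by (simp add: borel_measurable_continuous_onI)
  have "norm (C * exp (- (real n * (c * pg x)))) = C * exp (- (real n * (c * pg x)))" for x using C by simp
  then show "AE x in lborel. norm (mterm n l (cplx_vec x) * osc y (cplx_vec x)) \<le> norm (C * exp (- (real n * (c * pg x))))"
    using mterm_real_bound[OF n l] by simp
qed

lemma integral_pgauge:
  assumes "n \<ge> 1"
  shows "(LINT x|lborel. exp (- (real n * (c * pg x)))) = real n powr (- \<mu>) * (LINT x|lborel. exp (- (c * pg x)))"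
  by (rule integral_quasi_scaling[OF m1 invertible_inv[OF A] c]) (use assms in simp)

lemma integral_pgauge_nonneg: "(LINT x|lborel. exp (- (t * pg x))) \<ge> 0"
  by (intro Bochner_Integration.integral_nonneg) simp

text \<open>The terms of the expansion are entire, so the shift is unrestricted and the bound holds for all \<open>y\<close>.\<close>

lemma coefficient_term_bound:
  "\<exists>\<epsilon>>0. \<exists>C'>0. \<forall>n\<ge>1. \<forall>y. \<forall>l\<le>N. norm (LINT x|lborel. mterm n l (cplx_vec x) * osc y (cplx_vec x))
     \<le> C' * real n powr (- \<mu>) * exp (- (real n * (\<epsilon> * dual_gauge m A ((1 / real n) *\<^sub>R y))))"
proof -
  obtain K where K: "K > 0" and shift: "\<And>M \<epsilon> y. 0 < \<epsilon> \<Longrightarrow> \<epsilon> \<le> 1 \<Longrightarrow> 0 \<le> M \<Longrightarrow> M * \<epsilon> \<le> 1 / 2 \<Longrightarrow>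
    (\<exists>\<nu>. \<epsilon> / 2 * dual_gauge m A y \<le> y \<bullet> \<nu> - M * pg \<nu> \<and> norm \<nu> \<le> K * \<epsilon> * (1 + norm y))"
    using choose_shift[OF m1 A] by blast
  define \<epsilon> where "\<epsilon> = min 1 (1 / (2 * M))"
  have \<epsilon>: "0 < \<epsilon>" "\<epsilon> \<le> 1" using M by (auto simp: \<epsilon>_def)
  have "M * \<epsilon> \<le> M * (1 / (2 * M))" using M by (intro mult_left_mono) (auto simp: \<epsilon>_def)
  then have M\<epsilon>: "M * \<epsilon> \<le> 1 / 2" using M by simp
  define I where "I = (LINT x|lborel. exp (- (c * pg x)))"
  have I: "I \<ge> 0" unfolding I_def by (rule integral_pgauge_nonneg)
  have main: "norm (LINT x|lborel. mterm n l (cplx_vec x) * osc y (cplx_vec x))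
     \<le> (C * I + 1) * real n powr (- \<mu>) * exp (- (real n * (\<epsilon> / 2 * dual_gauge m A ((1 / real n) *\<^sub>R y))))"
    if n: "n \<ge> 1" and l: "l \<le> N" for n l y
  proof -
    define w where "w = (1 / real n) *\<^sub>R y"
    have y: "y = real n *\<^sub>R w" using n by (simp add: w_def)
    obtain \<nu> where \<nu>: "\<epsilon> / 2 * dual_gauge m A w \<le> w \<bullet> \<nu> - M * pg \<nu>"
      using shift[OF \<epsilon> less_imp_le[OF M] M\<epsilon>, of w] by blast
    have bd: "norm (mterm n l (cpt x \<kappa>) * osc y (cpt x \<kappa>)) \<le> C * exp (real n * (M * pg \<kappa>) - y \<bullet> \<kappa>) * exp (- (real n * (c * pg x)))" for x \<kappa>
    proof -
      have "norm (mterm n l (cpt x \<kappa>) * osc y (cpt x \<kappa>)) \<le> C * exp (real n * (- (c * pg x) + M * pg \<kappa>)) * exp (- (y \<bullet> \<kappa>))"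
        unfolding norm_mult[of "mterm n l (cpt x \<kappa>)"] norm_osc by (intro mult_right_mono coeff_bound n l) simp
      also have "\<dots> = C * exp (real n * (M * pg \<kappa>) - y \<bullet> \<kappa>) * exp (- (real n * (c * pg x)))"
        unfolding mult.assoc exp_add[symmetric] by (simp add: distrib_left right_diff_distrib)
      finally show ?thesis .
    qed
    have "(LINT x|lborel. mterm n l (cpt x \<nu>) * osc y (cpt x \<nu>)) = (LINT x|lborel. mterm n l (cplx_vec x) * osc y (cplx_vec x))"
    proof (rule contour_shift[OF cdiff_mterm])
      show "integrable lborel (\<lambda>x. C * exp (real n * (M * pg \<nu>) + \<bar>y \<bullet> \<nu>\<bar>) * exp (- (real n * (c * pg x))))"
        using integrable_pgauge[of "real n"] n by simp
      fix x :: "real ^ 'd" and s :: real assume s: "0 \<le> s" "s \<le> 1"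
      have "M * pg (s *\<^sub>R \<nu>) \<le> M * pg \<nu>" using M by (intro mult_left_mono pgauge_scale s) auto
      then have 1: "real n * (M * pg (s *\<^sub>R \<nu>)) \<le> real n * (M * pg \<nu>)" by (rule mult_left_mono) simp
      have "\<bar>s * (y \<bullet> \<nu>)\<bar> \<le> 1 * \<bar>y \<bullet> \<nu>\<bar>" unfolding abs_mult using s by (intro mult_right_mono) auto
      then have "- (y \<bullet> (s *\<^sub>R \<nu>)) \<le> \<bar>y \<bullet> \<nu>\<bar>" by simp
      with 1 have "exp (real n * (M * pg (s *\<^sub>R \<nu>)) - y \<bullet> (s *\<^sub>R \<nu>)) \<le> exp (real n * (M * pg \<nu>) + \<bar>y \<bullet> \<nu>\<bar>)"
        by simp
      then have "C * exp (real n * (M * pg (s *\<^sub>R \<nu>)) - y \<bullet> (s *\<^sub>R \<nu>)) * exp (- (real n * (c * pg x)))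
        \<le> C * exp (real n * (M * pg \<nu>) + \<bar>y \<bullet> \<nu>\<bar>) * exp (- (real n * (c * pg x)))"
        using C by (intro mult_right_mono mult_left_mono) auto
      with bd[of x "s *\<^sub>R \<nu>"]
      show "norm (mterm n l (cpt x (s *\<^sub>R \<nu>)) * osc y (cpt x (s *\<^sub>R \<nu>)))
        \<le> C * exp (real n * (M * pg \<nu>) + \<bar>y \<bullet> \<nu>\<bar>) * exp (- (real n * (c * pg x)))"
        by (rule order_trans)
    qed
    then have "norm (LINT x|lborel. mterm n l (cplx_vec x) * osc y (cplx_vec x)) = norm (LINT x|lborel. mterm n l (cpt x \<nu>) * osc y (cpt x \<nu>))"
      by simp
    also have "\<dots> \<le> (LINT x|lborel. C * exp (real n * (M * pg \<nu>) - y \<bullet> \<nu>) * exp (- (real n * (c * pg x))))"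
      by (rule norm_lebesgue_integral_le[OF _ bd]) (use integrable_pgauge[of "real n"] n in simp)
    also have "\<dots> = C * exp (real n * (M * pg \<nu>) - y \<bullet> \<nu>) * (real n powr (- \<mu>) * I)"
      unfolding I_def integral_pgauge[OF n, symmetric] by simp
    also have "\<dots> \<le> C * exp (- (real n * (\<epsilon> / 2 * dual_gauge m A w))) * (real n powr (- \<mu>) * I)"
    proof -
      have "real n * (\<epsilon> / 2 * dual_gauge m A w) \<le> real n * (w \<bullet> \<nu> - M * pg \<nu>)" by (intro mult_left_mono \<nu>) auto
      then have "real n * (M * pg \<nu>) - y \<bullet> \<nu> \<le> - (real n * (\<epsilon> / 2 * dual_gauge m A w))"
        by (simp add: y right_diff_distrib)
      then show ?thesis using C I by (intro mult_right_mono mult_left_mono) auto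
    qed
    also have "\<dots> = C * I * (real n powr (- \<mu>) * exp (- (real n * (\<epsilon> / 2 * dual_gauge m A w))))" by (simp only: mult_ac)
    also have "\<dots> \<le> (C * I + 1) * (real n powr (- \<mu>) * exp (- (real n * (\<epsilon> / 2 * dual_gauge m A w))))"
      by (intro mult_right_mono) auto
    finally show ?thesis by (simp only: mult.assoc w_def)
  qed
  have CI: "C * I + 1 > 0" using C I by (simp add: add_nonneg_pos)
  show ?thesis
    by (rule exI[of _ "\<epsilon> / 2"], rule conjI[OF half_gt_zero[OF \<epsilon>(1)]], rule exI[of _ "C * I + 1"], rule conjI[OF CI]) (intro allI impI main)
qed

text \<open>The difference is split into three parts: the remainder of the Taylor expansion on the shifted
  domain, the error of the shift, and the polynomial terms outside the cutoff. The last two are of order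
  \<open>e^(-n \<kappa>)\<close>. The bound on \<open>|y| / n\<close> makes the shift small enough for the domain of holomorphy, and keeps
  \<open>dual_gauge\<close> bounded so that \<open>e^(-n \<kappa>)\<close> can be absorbed.\<close>

lemma local_main:
  assumes cut: "cutoff a \<rho> \<theta> d\<theta> K\<theta>" and a: "0 < a" and \<rho>: "\<rho> \<le> \<delta>" and L: "L > 0"
  shows "\<exists>\<epsilon>>0. \<exists>C'>0. \<forall>n\<ge>1. \<forall>y. norm y \<le> real n * L \<longrightarrow>
    norm ((LINT x|lborel. of_real (\<theta> x) * (exp (of_nat n * (U (cplx_vec x) - eval_poly P (cplx_vec x))) * osc y (cplx_vec x)))
      - (\<Sum>l\<le>N. LINT x|lborel. mterm n l (cplx_vec x) * osc y (cplx_vec x)))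
    \<le> C' * real n powr (- (\<mu> + real (Suc N) / (2 * real (lcm_vec m)))) * exp (- (real n * (\<epsilon> * dual_gauge m A ((1 / real n) *\<^sub>R y))))"
proof -
  note \<theta> = cutoffD[OF cut]
  obtain K where K: "K > 0" and shift: "\<And>M \<epsilon> y. 0 < \<epsilon> \<Longrightarrow> \<epsilon> \<le> 1 \<Longrightarrow> 0 \<le> M \<Longrightarrow> M * \<epsilon> \<le> 1 / 2 \<Longrightarrow>
    (\<exists>\<nu>. \<epsilon> / 2 * dual_gauge m A y \<le> y \<bullet> \<nu> - M * pg \<nu> \<and> norm \<nu> \<le> K * \<epsilon> * (1 + norm y))"
    using choose_shift[OF m1 A] by blast
  obtain q where q: "q > 0" "\<And>x. norm x \<ge> a \<Longrightarrow> pg x \<ge> q" using quasi_lower_outside[OF m1 A a] by blast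
  obtain Dg where Dg: "Dg > 0" "\<And>y. norm y \<le> L \<Longrightarrow> dual_gauge m A y \<le> Dg" using dual_gauge_bounded[OF m1 A, of L] by blast
  define \<kappa> where "\<kappa> = c * q / 4"
  have \<kappa>: "\<kappa> > 0" using c q by (simp add: \<kappa>_def)
  have "continuous_on UNIV (\<lambda>x. pg x)"
    by (intro continuous_on_quasi[OF m1] continuous_on_cplx_vec linear_continuous_on matrix_vector_mul_bounded_linear)
  then have "isCont (\<lambda>x. pg x) 0" by (simp add: continuous_on_eq_continuous_at)
  then have "((\<lambda>x. pg x) \<longlongrightarrow> 0) (nhds 0)"
    using iffD1[OF tendsto_at_iff_tendsto_nhds, of "\<lambda>x. pg x" 0] unfolding isCont_def pgauge_0 by blast
  then have "\<forall>\<^sub>F x in nhds 0. pg x < \<kappa> / M" using \<kappa> M by (intro order_tendstoD(2)) auto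
  then obtain d1 where d1: "d1 > 0" "\<And>x. norm x < d1 \<Longrightarrow> pg x < \<kappa> / M"
    unfolding eventually_nhds_metric by (auto simp: dist_norm)
  define d where "d = min (\<delta> / 2) (min (d1 / 2) (\<kappa> / L))"
  have d: "d > 0" "d \<le> \<delta> / 2" "d \<le> d1 / 2" "d \<le> \<kappa> / L"
  proof -
    show "d > 0" using \<delta> d1(1) \<kappa> L by (simp add: d_def)
    show "d \<le> \<delta> / 2" unfolding d_def by (rule min.cobounded1)
    show "d \<le> d1 / 2" unfolding d_def by (rule min.coboundedI2[OF min.cobounded1])
    show "d \<le> \<kappa> / L" unfolding d_def by (rule min.coboundedI2[OF min.cobounded2])
  qed
  define \<epsilon> where "\<epsilon> = Min {1, 1 / (2 * M), d / (K * (1 + L))}"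
  have KL: "K * (1 + L) > 0" using K L by simp
  have \<epsilon>: "0 < \<epsilon>" "\<epsilon> \<le> 1" "\<epsilon> \<le> 1 / (2 * M)" "\<epsilon> \<le> d / (K * (1 + L))" using M d KL by (auto simp: \<epsilon>_def)
  have M\<epsilon>: "M * \<epsilon> \<le> 1 / 2" using mult_left_mono[OF \<epsilon>(3), of M] M by simp
  have K\<epsilon>: "K * \<epsilon> * (1 + L) \<le> d" using mult_left_mono[OF \<epsilon>(4), of "K * (1 + L)"] KL K L by (simp add: mult_ac)
  define b where "b = real (Suc N) / (2 * real (lcm_vec m))"
  have b: "b \<ge> 0" by (simp add: b_def)
  have \<mu>: "\<mu> \<ge> 0" by (intro sum_nonneg) simp
  obtain Cp where Cp: "Cp > 0" and absorb: "\<And>n G \<epsilon>. n \<ge> 1 \<Longrightarrow> G \<le> Dg \<Longrightarrow> 0 \<le> \<epsilon> \<Longrightarrow> \<epsilon> \<le> \<kappa> / (2 * Dg) \<Longrightarrow>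
    exp (- (real n * \<kappa>)) \<le> Cp * real n powr (- (\<mu> + b)) * exp (- (real n * (\<epsilon> * G)))"
    using absorb_exponential[OF \<kappa> add_nonneg_nonneg[OF \<mu> b] Dg(1)] by blast
  define \<epsilon>' where "\<epsilon>' = min (\<epsilon> / 2) (\<kappa> / (2 * Dg))"
  have \<epsilon>': "\<epsilon>' > 0" "\<epsilon>' \<le> \<epsilon> / 2" "\<epsilon>' \<le> \<kappa> / (2 * Dg)" using \<epsilon> \<kappa> Dg by (auto simp: \<epsilon>'_def)
  define I where "I = (LINT x|lborel. exp (- (c * pg x)))"
  define J where "J = (LINT x|lborel. exp (- (1 / 4 * (c * pg x))))"
  have IJ: "I \<ge> 0" "J \<ge> 0" unfolding I_def J_def by (intro Bochner_Integration.integral_nonneg; simp)+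
  have iJ: "integrable lborel (\<lambda>x. exp (- (1 / 4 * (c * pg x))))" by (rule integrable_pgauge) simp
  \<comment> \<open>Away from the origin, three quarters of the decay amount to \<open>3 \<kappa>\<close>: two of these pay for the shift
    and one remains. The last quarter makes the bound integrable.\<close>
  have far: "real n * (c * pg x) \<ge> real n * (3 * \<kappa>) + 1 / 4 * (c * pg x)" if n: "n \<ge> 1" and x: "norm x \<ge> a" for n :: nat and x
  proof -
    have "c * q \<le> c * pg x" using q(2)[OF x] c by (intro mult_left_mono) auto
    then have "3 * \<kappa> + 1 / 4 * (c * pg x) \<le> c * pg x" by (simp add: \<kappa>_def)
    then have "real n * (3 * \<kappa> + 1 / 4 * (c * pg x)) \<le> real n * (c * pg x)" by (intro mult_left_mono) auto
    moreover have "1 * (1 / 4 * (c * pg x)) \<le> real n * (1 / 4 * (c * pg x))"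
      using n c pgauge_nonneg by (intro mult_right_mono) auto
    ultimately show ?thesis by (simp only: distrib_left mult_1)
  qed
  define CC where "CC = C * I + K\<theta> * d * C * J * Cp + real (Suc N) * C * J * Cp + 1"
  have CC: "CC > 0" unfolding CC_def using C IJ Cp \<theta>(9) d(1) by (intro add_nonneg_pos add_nonneg_nonneg mult_nonneg_nonneg) auto
  have main: "norm ((LINT x|lborel. of_real (\<theta> x) * (exp (of_nat n * (U (cplx_vec x) - eval_poly P (cplx_vec x))) * osc y (cplx_vec x)))
      - (\<Sum>l\<le>N. LINT x|lborel. mterm n l (cplx_vec x) * osc y (cplx_vec x)))
    \<le> CC * real n powr (- (\<mu> + b)) * exp (- (real n * (\<epsilon>' * dual_gauge m A ((1 / real n) *\<^sub>R y))))"
    if n: "n \<ge> 1" and yL: "norm y \<le> real n * L" for n y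
  proof -
    define w where "w = (1 / real n) *\<^sub>R y"
    have n0: "real n > 0" using n by simp
    have y: "y = real n *\<^sub>R w" using n by (simp add: w_def)
    have w: "norm w \<le> L" using yL n0 by (simp add: w_def divide_le_eq mult.commute)
    define G where "G = dual_gauge m A w"
    have G: "G \<ge> 0" "G \<le> Dg" using dual_gauge_nonneg[OF m1 A] Dg(2)[OF w] by (auto simp: G_def)
    obtain \<nu> where \<nu>: "\<epsilon> / 2 * G \<le> w \<bullet> \<nu> - M * pg \<nu>" and "norm \<nu> \<le> K * \<epsilon> * (1 + norm w)"
      using shift[OF \<epsilon>(1,2) less_imp_le[OF M] M\<epsilon>, of w] unfolding G_def by blast
    moreover have "K * \<epsilon> * (1 + norm w) \<le> K * \<epsilon> * (1 + L)" using w K \<epsilon> by (intro mult_left_mono) auto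
    ultimately have \<nu>d: "norm \<nu> \<le> d" using K\<epsilon> by linarith
    define E where "E x = (\<Sum>l\<le>N. mterm n l (cplx_vec x) * osc y (cplx_vec x))" for x
    define D where "D z = exp (- (of_nat n * eval_poly P z)) *
         (exp (of_nat n * U z) - (\<Sum>l\<le>N. eval_poly (Q_poly A m U l n) z)) * osc y z" for z
    let ?nb = "real n powr (- b)" and ?n\<mu> = "real n powr (- \<mu>)" and ?G = "exp (- (real n * (\<epsilon>' * G)))"
    have nb: "real n powr (- (\<mu> + b)) = ?n\<mu> * ?nb" by (simp flip: powr_add)
    have nb1: "?nb \<le> 1" using n b powr_mono[of "- b" 0 "real n"] by simp
    have Db: "norm (D (cpt x (s *\<^sub>R \<nu>))) \<le> C * ?nb * exp (real n * (- (c * pg x) + M * pg (s *\<^sub>R \<nu>) - s * (w \<bullet> \<nu>)))"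
      if x: "norm x \<le> \<rho>" and s: "0 \<le> s" "s \<le> 1" for x s
    proof -
      have "norm (s *\<^sub>R \<nu>) \<le> 1 * norm \<nu>" unfolding norm_scaleR using s by (intro mult_right_mono) auto
      then have s\<nu>: "norm (s *\<^sub>R \<nu>) \<le> \<delta>" using \<nu>d d \<delta> by linarith
      have "norm (D (cpt x (s *\<^sub>R \<nu>))) \<le> C * ?nb * exp (real n * (- (c * pg x) + M * pg (s *\<^sub>R \<nu>))) * exp (- (y \<bullet> (s *\<^sub>R \<nu>)))"
        unfolding D_def norm_mult[of _ "osc y _"] norm_osc b_def using x \<rho> s\<nu>
        by (intro mult_right_mono remainder_bound[OF n]) auto
      also have "\<dots> = C * ?nb * exp (real n * (- (c * pg x) + M * pg (s *\<^sub>R \<nu>) - s * (w \<bullet> \<nu>)))"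
        unfolding mult.assoc[of _ "exp _"] exp_add[symmetric] y by (simp add: distrib_left right_diff_distrib)
      finally show ?thesis .
    qed
    have Dh: "cdiff D z" if "norm z \<le> 2 * \<delta>" for z
      unfolding D_def[abs_def] using hol[OF that] by (intro cdiff_mult cdiff_diff cdiff_exp cdiff_minus cdiff_sum cdiff_const cdiff_eval_poly cdiff_osc)
    \<comment> \<open>On the shifted domain the choice of \<open>\<nu>\<close> supplies the exponential factor.\<close>
    have T1: "norm (LINT x|lborel. of_real (\<theta> x) * D (cpt x \<nu>)) \<le> C * I * (?n\<mu> * ?nb * ?G)"
    proof -
      have "norm (LINT x|lborel. of_real (\<theta> x) * D (cpt x \<nu>)) \<le> (LINT x|lborel. C * ?nb * ?G * exp (- (real n * (c * pg x))))"
      proof (rule norm_lebesgue_integral_le)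
        show "integrable lborel (\<lambda>x. C * ?nb * ?G * exp (- (real n * (c * pg x))))" using integrable_pgauge[OF n0] by simp
        fix x
        show "norm (of_real (\<theta> x) * D (cpt x \<nu>)) \<le> C * ?nb * ?G * exp (- (real n * (c * pg x)))"
        proof (cases "norm x \<le> \<rho>")
          case True
          have "norm (of_real (\<theta> x) * D (cpt x \<nu>)) \<le> 1 * norm (D (cpt x \<nu>))"
            unfolding norm_mult using \<theta>(3,4)[of x] by (intro mult_right_mono) auto
          also have "\<dots> \<le> C * ?nb * exp (real n * (- (c * pg x) + M * pg \<nu> - w \<bullet> \<nu>))"
            using Db[OF True, of 1] by simp
          also have "\<dots> \<le> C * ?nb * exp (- (real n * (\<epsilon>' * G)) + - (real n * (c * pg x)))"
          proof -
            have "\<epsilon>' * G \<le> \<epsilon> / 2 * G" using G \<epsilon>' by (intro mult_right_mono) auto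
            then have "- (c * pg x) + M * pg \<nu> - w \<bullet> \<nu> \<le> - (\<epsilon>' * G) + - (c * pg x)" using \<nu> by linarith
            then have "real n * (- (c * pg x) + M * pg \<nu> - w \<bullet> \<nu>) \<le> real n * (- (\<epsilon>' * G) + - (c * pg x))"
              by (intro mult_left_mono) auto
            then show ?thesis using C by (intro mult_left_mono) (auto simp only: distrib_left mult_minus_right exp_le_cancel_iff intro: mult_nonneg_nonneg less_imp_le powr_ge_zero)
          qed
          finally show ?thesis by (simp only: exp_add mult.assoc)
        next
          case False
          then show ?thesis using \<theta>(7)[of x] C by simp
        qed
      qed
      also have "\<dots> = C * ?nb * ?G * (?n\<mu> * I)" unfolding I_def integral_pgauge[OF n, symmetric] by simp
      also have "\<dots> = C * I * (?n\<mu> * ?nb * ?G)" by (simp only: mult_ac)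
      finally show ?thesis .
    qed
    \<comment> \<open>The error of the shift lives where the cutoff varies, hence away from the origin.\<close>
    have T2: "norm ((LINT x|lborel. of_real (\<theta> x) * D (cpt x \<nu>)) - (LINT x|lborel. of_real (\<theta> x) * D (cplx_vec x)))
      \<le> K\<theta> * d * C * exp (- (real n * \<kappa>)) * J"
    proof -
      have "norm ((LINT x|lborel. of_real (\<theta> x) * D (cplx_vec x - (\<i> * complex_of_real 1) *s cplx_vec \<nu>)) - (LINT x|lborel. of_real (\<theta> x) * D (cplx_vec x)))
        \<le> (LINT x|lborel. K\<theta> * d * C * exp (- (real n * \<kappa>)) * exp (- (1 / 4 * (c * pg x))))"
      proof (rule shift_bound[where W = "ball 0 (2 * \<delta>)" and d\<theta> = d\<theta> and \<rho> = \<rho>])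
        show "integrable lborel (\<lambda>x. K\<theta> * d * C * exp (- (real n * \<kappa>)) * exp (- (1 / 4 * (c * pg x))))" using iJ by simp
        show "cdiff D z" if "z \<in> ball 0 (2 * \<delta>)" for z using that by (intro Dh) simp
        fix x :: "real ^ 'd" and s :: real assume s: "0 \<le> s" "s \<le> 1"
        have "norm (s *\<^sub>R \<nu>) \<le> 1 * norm \<nu>" unfolding norm_scaleR using s by (intro mult_right_mono) auto
        then have s\<nu>: "norm (s *\<^sub>R \<nu>) \<le> d" using \<nu>d by linarith
        show "cplx_vec x - (\<i> * complex_of_real s) *s cplx_vec \<nu> \<in> ball 0 (2 * \<delta>)" if "norm x \<le> \<rho>"
          unfolding cpt_scaleR mem_ball_0 using norm_cpt_le[of x "s *\<^sub>R \<nu>"] s\<nu> d that \<rho> \<delta> by linarith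
        show "norm (of_real (d\<theta> x \<nu>) * D (cplx_vec x - (\<i> * complex_of_real s) *s cplx_vec \<nu>))
          \<le> K\<theta> * d * C * exp (- (real n * \<kappa>)) * exp (- (1 / 4 * (c * pg x)))"
        proof (cases "a \<le> norm x \<and> norm x \<le> \<rho>")
          case True
          have "\<bar>d\<theta> x \<nu>\<bar> \<le> K\<theta> * norm \<nu>" by (rule \<theta>(10))
          also have "\<dots> \<le> K\<theta> * d" using \<nu>d \<theta>(9) by (intro mult_left_mono) auto
          finally have 1: "\<bar>d\<theta> x \<nu>\<bar> \<le> K\<theta> * d" .
          have "pg (s *\<^sub>R \<nu>) < \<kappa> / M" using s\<nu> d d1(1) by (intro d1(2)) linarith
          then have "M * pg (s *\<^sub>R \<nu>) \<le> \<kappa>" using M by (simp add: field_simps)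
          moreover have "- (s * (w \<bullet> \<nu>)) \<le> \<kappa>"
          proof -
            have "- (s * (w \<bullet> \<nu>)) \<le> \<bar>s\<bar> * \<bar>w \<bullet> \<nu>\<bar>" using abs_ge_minus_self[of "s * (w \<bullet> \<nu>)"] by (simp add: abs_mult)
            also have "\<dots> \<le> 1 * (norm w * norm \<nu>)" using s by (intro mult_mono Cauchy_Schwarz_ineq2) auto
            also have "\<dots> \<le> 1 * (L * (\<kappa> / L))" using w \<nu>d d(4) L by (intro mult_left_mono mult_mono) auto
            finally show ?thesis using L by simp
          qed
          ultimately have "real n * (- (c * pg x) + M * pg (s *\<^sub>R \<nu>) - s * (w \<bullet> \<nu>)) \<le> real n * (- (c * pg x) + 2 * \<kappa>)"
            by (intro mult_left_mono) auto
          also have "\<dots> \<le> - (real n * \<kappa>) + - (1 / 4 * (c * pg x))"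
          proof -
            have "real n * (- (c * pg x) + 2 * \<kappa>) = - (real n * (c * pg x)) + 2 * (real n * \<kappa>)"
              "real n * (3 * \<kappa>) = 3 * (real n * \<kappa>)" by (simp_all add: distrib_left right_diff_distrib)
            then show ?thesis using far[OF n, of x] True by linarith
          qed
          finally have e: "exp (real n * (- (c * pg x) + M * pg (s *\<^sub>R \<nu>) - s * (w \<bullet> \<nu>))) \<le> exp (- (real n * \<kappa>) + - (1 / 4 * (c * pg x)))"
            by (simp only: exp_le_cancel_iff)
          have "norm (D (cpt x (s *\<^sub>R \<nu>))) \<le> C * ?nb * exp (real n * (- (c * pg x) + M * pg (s *\<^sub>R \<nu>) - s * (w \<bullet> \<nu>)))"
            using True s by (intro Db) auto
          also have "\<dots> \<le> C * 1 * exp (- (real n * \<kappa>) + - (1 / 4 * (c * pg x)))"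
            using C nb1 by (intro mult_mono e) auto
          finally have "norm (D (cpt x (s *\<^sub>R \<nu>))) \<le> C * exp (- (real n * \<kappa>) + - (1 / 4 * (c * pg x)))" by simp
          then have "\<bar>d\<theta> x \<nu>\<bar> * norm (D (cpt x (s *\<^sub>R \<nu>))) \<le> (K\<theta> * d) * (C * exp (- (real n * \<kappa>) + - (1 / 4 * (c * pg x))))"
            using 1 \<theta>(9) d(1) by (intro mult_mono) auto
          then show ?thesis unfolding cpt_scaleR norm_mult norm_of_real exp_add by (simp only: mult.assoc)
        next
          case False
          then have "d\<theta> x \<nu> = 0" using \<theta>(6)[of x \<nu>] \<theta>(8)[of x \<nu>] by linarith
          then show ?thesis using C d(1) \<theta>(9) by simp
        qed
      qed (use \<theta> in auto)
      also have "\<dots> = K\<theta> * d * C * exp (- (real n * \<kappa>)) * J" by (simp add: J_def)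
      finally show ?thesis by simp
    qed
    \<comment> \<open>Where the cutoff differs from \<open>1\<close>, the polynomial terms are exponentially small.\<close>
    have T3: "norm (LINT x|lborel. of_real (1 - \<theta> x) * E x) \<le> real (Suc N) * C * exp (- (real n * \<kappa>)) * J"
    proof -
      have "norm (LINT x|lborel. of_real (1 - \<theta> x) * E x) \<le> (LINT x|lborel. real (Suc N) * C * exp (- (real n * \<kappa>)) * exp (- (1 / 4 * (c * pg x))))"
      proof (rule norm_lebesgue_integral_le)
        show "integrable lborel (\<lambda>x. real (Suc N) * C * exp (- (real n * \<kappa>)) * exp (- (1 / 4 * (c * pg x))))" using iJ by simp
        fix x
        show "norm (of_real (1 - \<theta> x) * E x) \<le> real (Suc N) * C * exp (- (real n * \<kappa>)) * exp (- (1 / 4 * (c * pg x)))"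
        proof (cases "norm x \<le> a")
          case True
          then show ?thesis using \<theta>(5)[of x] C by simp
        next
          case False
          have "norm (E x) \<le> (\<Sum>l\<le>N. C * exp (- (real n * (c * pg x))))"
            unfolding E_def by (rule order_trans[OF norm_sum sum_mono]) (intro mterm_real_bound n, simp)
          also have "\<dots> = real (Suc N) * C * exp (- (real n * (c * pg x)))" by simp
          also have "\<dots> \<le> real (Suc N) * C * exp (- (real n * \<kappa>) + - (1 / 4 * (c * pg x)))"
          proof -
            have "0 \<le> real n * \<kappa>" using \<kappa> by simp
            then have "- (real n * (c * pg x)) \<le> - (real n * \<kappa>) + - (1 / 4 * (c * pg x))"
              using far[OF n, of x] False by (simp add: distrib_left)
            then show ?thesis using C by (intro mult_left_mono) auto
          qed
          finally have "norm (E x) \<le> real (Suc N) * C * exp (- (real n * \<kappa>)) * exp (- (1 / 4 * (c * pg x)))"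
            by (simp only: exp_add mult.assoc)
          moreover have "norm (of_real (1 - \<theta> x) * E x) \<le> 1 * norm (E x)"
            unfolding norm_mult norm_of_real using \<theta>(3,4)[of x] by (intro mult_right_mono) auto
          ultimately show ?thesis by linarith
        qed
      qed
      also have "\<dots> = real (Suc N) * C * exp (- (real n * \<kappa>)) * J" by (simp add: J_def)
      finally show ?thesis .
    qed
    have iE: "integrable lborel E" unfolding E_def[abs_def]
      by (rule Bochner_Integration.integrable_sum) (use integrable_mterm[OF n] in simp)
    have i\<theta>E: "integrable lborel (\<lambda>x. of_real (\<theta> x) * E x)"
    proof (rule Bochner_Integration.integrable_bound[OF iE])
      have "(\<lambda>x. complex_of_real (\<theta> x)) \<in> borel_measurable lborel"
        using \<theta>(11) by (simp add: borel_measurable_continuous_onI continuous_on_of_real)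
      then show "(\<lambda>x. of_real (\<theta> x) * E x) \<in> borel_measurable lborel" using borel_measurable_integrable[OF iE] by (rule borel_measurable_times)
      have "norm (of_real (\<theta> x) * E x) \<le> 1 * norm (E x)" for x
        unfolding norm_mult norm_of_real using \<theta>(3,4)[of x] by (intro mult_right_mono) auto
      then show "AE x in lborel. norm (of_real (\<theta> x) * E x) \<le> norm (E x)" by simp
    qed
    have i\<theta>D: "integrable lborel (\<lambda>x. of_real (\<theta> x) * D (cplx_vec x))"
    proof (rule continuous_compact_support(1)[where \<rho> = \<rho> and B = UNIV])
      show "continuous_on UNIV (\<lambda>x. of_real (\<theta> x) * D (cplx_vec x))"
      proof (rule continuous_glue[where \<rho> = \<rho> and g = "\<lambda>x. x"])
        fix x :: "real ^ 'd" assume "norm x \<le> \<rho>"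
        then have "norm (cplx_vec x) \<le> 2 * \<delta>" using \<rho> \<delta> by simp
        then have "isCont D (cplx_vec x)" by (intro cdiff_isCont Dh)
        moreover have "isCont cplx_vec x"
          using continuous_on_cplx_vec[OF continuous_on_id, of UNIV] unfolding continuous_on_eq_continuous_at[OF open_UNIV] id_def by blast
        ultimately show "isCont (\<lambda>x. D (cplx_vec x)) x" by (rule isCont_o2[where f = cplx_vec and g = D, rotated])
      qed (use \<theta> in \<open>auto intro: continuous_on_id\<close>)
    qed (use \<theta>(7) in auto)
    have pt: "of_real (\<theta> x) * (exp (of_nat n * (U (cplx_vec x) - eval_poly P (cplx_vec x))) * osc y (cplx_vec x))
      = of_real (\<theta> x) * D (cplx_vec x) + of_real (\<theta> x) * E x" for x
    proof -
      have "exp (of_nat n * (U (cplx_vec x) - eval_poly P (cplx_vec x))) = exp (- (of_nat n * eval_poly P (cplx_vec x))) * exp (of_nat n * U (cplx_vec x))"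
      proof -
        have "of_nat n * (U (cplx_vec x) - eval_poly P (cplx_vec x)) = - (of_nat n * eval_poly P (cplx_vec x)) + of_nat n * U (cplx_vec x)"
          by (simp add: right_diff_distrib)
        then show ?thesis by (simp only: exp_add)
      qed
      moreover have "E x = exp (- (of_nat n * eval_poly P (cplx_vec x))) * (\<Sum>l\<le>N. eval_poly (Q_poly A m U l n) (cplx_vec x)) * osc y (cplx_vec x)"
        unfolding E_def by (simp only: sum_distrib_left sum_distrib_right)
      ultimately show ?thesis unfolding D_def by (simp only: ring_distribs) simp
    qed
    have split: "(LINT x|lborel. of_real (\<theta> x) * (exp (of_nat n * (U (cplx_vec x) - eval_poly P (cplx_vec x))) * osc y (cplx_vec x)))
      = (LINT x|lborel. of_real (\<theta> x) * D (cplx_vec x)) + (LINT x|lborel. of_real (\<theta> x) * E x)"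
      unfolding pt by (rule Bochner_Integration.integral_add[OF i\<theta>D i\<theta>E])
    have sum: "(\<Sum>l\<le>N. LINT x|lborel. mterm n l (cplx_vec x) * osc y (cplx_vec x)) = integral\<^sup>L lborel E"
      unfolding E_def by (rule Bochner_Integration.integral_sum[symmetric]) (use integrable_mterm[OF n] in simp)
    have outside: "(LINT x|lborel. of_real (1 - \<theta> x) * E x) = integral\<^sup>L lborel E - (LINT x|lborel. of_real (\<theta> x) * E x)"
      using Bochner_Integration.integral_diff[OF iE i\<theta>E] by (simp add: left_diff_distrib)
    have regroup: "a + b - e = t - (t - a) - (e - b)" for a b e t :: complex by simp
    have "norm ((LINT x|lborel. of_real (\<theta> x) * (exp (of_nat n * (U (cplx_vec x) - eval_poly P (cplx_vec x))) * osc y (cplx_vec x)))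
      - (\<Sum>l\<le>N. LINT x|lborel. mterm n l (cplx_vec x) * osc y (cplx_vec x)))
      = norm ((LINT x|lborel. of_real (\<theta> x) * D (cpt x \<nu>)) - ((LINT x|lborel. of_real (\<theta> x) * D (cpt x \<nu>)) - (LINT x|lborel. of_real (\<theta> x) * D (cplx_vec x)))
        - (LINT x|lborel. of_real (1 - \<theta> x) * E x))"
      unfolding split sum outside by (rule arg_cong[OF regroup])
    also have "\<dots> \<le> C * I * (?n\<mu> * ?nb * ?G) + K\<theta> * d * C * exp (- (real n * \<kappa>)) * J + real (Suc N) * C * exp (- (real n * \<kappa>)) * J"
      by (rule order_trans[OF norm_triangle_ineq4 add_mono[OF order_trans[OF norm_triangle_ineq4 add_mono[OF T1 T2]] T3]])
    also have "\<dots> = C * I * (?n\<mu> * ?nb * ?G) + (K\<theta> * d * C * J + real (Suc N) * C * J) * exp (- (real n * \<kappa>))"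
      unfolding distrib_right by (simp only: mult_ac add.assoc)
    also have "\<dots> \<le> C * I * (?n\<mu> * ?nb * ?G) + (K\<theta> * d * C * J + real (Suc N) * C * J) * (Cp * (?n\<mu> * ?nb) * ?G)"
      using absorb[OF n G(2) less_imp_le[OF \<epsilon>'(1)] \<epsilon>'(3)] C d(1) \<theta>(9) IJ unfolding nb
      by (intro add_left_mono mult_left_mono add_nonneg_nonneg mult_nonneg_nonneg) auto
    also have "\<dots> = (CC - 1) * (?n\<mu> * ?nb * ?G)"
    proof -
      have "CC - 1 = C * I + (K\<theta> * d * C * J + real (Suc N) * C * J) * Cp" by (simp add: CC_def distrib_right)
      then show ?thesis by (simp only: distrib_right mult.assoc)
    qed
    also have "\<dots> \<le> CC * (?n\<mu> * ?nb * ?G)" by (intro mult_right_mono) auto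
    finally show ?thesis unfolding nb G_def w_def by (simp only: mult.assoc)
  qed
  show ?thesis unfolding b_def[symmetric]
    by (rule exI[of _ \<epsilon>'], rule conjI[OF \<epsilon>'(1)], rule exI[of _ CC], rule conjI[OF CC]) (intro allI impI main)
qed

end

section \<open>Points of positive-homogeneous type\<close>

text \<open>Near the origin \<open>F(z + \<xi>\<^sub>0) / F(\<xi>\<^sub>0)\<close> is close to \<open>1\<close>, hence off the branch cut of the logarithm.
  That \<open>P\<close> vanishes at \<open>0\<close> follows from \<open>2 P(0) = P(0)\<close>.\<close>

lemma Upsilon_properties:
  fixes \<phi> :: "int ^ 'd::finite \<Rightarrow> complex"
  assumes \<phi>: "\<phi> \<in> class_H_star" and \<xi>0: "\<xi>0 \<in> Omega \<phi>" and P: "positive_homogeneous P"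
  shows "\<forall>\<^sub>F z in nhds 0. cdiff (Upsilon \<phi> \<xi>0 \<alpha> P) z" "Upsilon \<phi> \<xi>0 \<alpha> P 0 = 0"
    "\<exists>r>0. \<forall>\<eta>. norm \<eta> < r \<longrightarrow> fourier \<phi> (\<xi>0 + \<eta>) = fourier \<phi> \<xi>0 *
       exp (\<i> * complex_of_real (\<alpha> \<bullet> \<eta>) + (Upsilon \<phi> \<xi>0 \<alpha> P (cplx_vec \<eta>) - eval_poly P (cplx_vec \<eta>)))"
proof -
  define F where "F = fourier_cplx \<phi>"
  have "\<exists>F. holomorphic_extension \<phi> F" using \<phi> by (simp add: class_H_star_def class_H_def)
  then have "holomorphic_extension \<phi> F" unfolding F_def fourier_cplx_def by (rule someI_ex)
  then obtain V where V: "open V" "cplx_vec ` torus \<subseteq> V" "\<And>z. z \<in> V \<Longrightarrow> cdiff F z"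
    "\<And>\<xi>. cplx_vec \<xi> \<in> V \<Longrightarrow> F (cplx_vec \<xi>) = fourier \<phi> \<xi>"
    unfolding holomorphic_extension_def holomorphic_vec_on_iff by blast
  define a where "a = cplx_vec \<xi>0"
  have aV: "a \<in> V" using V(2) \<xi>0 by (auto simp: a_def Omega_def)
  have Fa: "F a = fourier \<phi> \<xi>0" using V(4) aV by (simp add: a_def)
  have Fa0: "F a \<noteq> 0" using \<xi>0 unfolding Fa Omega_def by auto
  define g where "g z = F (z + a) / F a" for z
  have cg: "cdiff g z" if "z + a \<in> V" for z
  proof -
    have "cdiff (\<lambda>z. F (z + a)) z"
      using cdiff_compose_linear[of F "\<lambda>z. z" z a] V(3)[OF that] by simp
    then have "cdiff (\<lambda>z. F (z + a) * inverse (F a)) z" by (rule cdiff_mult[OF _ cdiff_const])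
    then show ?thesis by (simp add: g_def[abs_def] divide_inverse)
  qed
  have g0: "g 0 = 1" using Fa0 by (simp add: g_def)
  have "isCont g 0" using aV by (intro cdiff_isCont cg) simp
  then have "(g \<longlongrightarrow> g 0) (nhds 0)" unfolding isCont_def by (rule iffD1[OF tendsto_at_iff_tendsto_nhds])
  then have "\<forall>\<^sub>F z in nhds 0. dist (g z) 1 < 1" unfolding g0 by (rule tendstoD) simp
  then obtain r1 where r1: "r1 > 0" "\<And>z. norm z < r1 \<Longrightarrow> dist (g z) 1 < 1"
    unfolding eventually_nhds_metric by (auto simp: dist_norm)
  obtain r2 where r2: "r2 > 0" "ball a r2 \<subseteq> V" using V(1) aV open_contains_ball by blast
  define r where "r = min r1 r2"
  have r: "r > 0" using r1 r2 by (simp add: r_def)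
  have inV: "z + a \<in> V" if "norm z < r" for z using that r2 by (auto simp: r_def dist_norm)
  have gpos: "g z \<notin> \<real>\<^sub>\<le>\<^sub>0" if "norm z < r" for z
  proof
    assume "g z \<in> \<real>\<^sub>\<le>\<^sub>0"
    then have "Re (g z) \<le> 0" by (simp add: complex_nonpos_Reals_iff)
    moreover have "\<bar>Re (g z - 1)\<bar> < 1" using r1(2)[of z] that abs_Re_le_cmod[of "g z - 1"] by (simp add: r_def dist_norm)
    ultimately show False by simp
  qed
  have Gam: "Gamma_log \<phi> \<xi>0 z = Ln (g z)" for z by (simp add: Gamma_log_def g_def F_def a_def)
  have Ue: "Upsilon \<phi> \<xi>0 \<alpha> P z = Ln (g z) - \<i> * cdot (cplx_vec \<alpha>) z + eval_poly P z" for z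
    by (simp add: Upsilon_def Gam)
  have "cdiff (Upsilon \<phi> \<xi>0 \<alpha> P) z" if "norm z < r" for z
  proof -
    have "cdiff (\<lambda>z. Ln (g z)) z" by (rule cdiff_compose[OF has_field_derivative_Ln[OF gpos[OF that]] cg[OF inV[OF that]]])
    moreover have "cdiff (\<lambda>z. cdot (cplx_vec \<alpha>) z) z"
      unfolding cdot_def by (intro cdiff_mult cdiff_const cdiff_sum cdiff_component)
    ultimately show ?thesis unfolding Ue[abs_def] by (intro cdiff_add cdiff_diff cdiff_mult cdiff_const cdiff_eval_poly)
  qed
  then show "\<forall>\<^sub>F z in nhds 0. cdiff (Upsilon \<phi> \<xi>0 \<alpha> P) z"
    unfolding eventually_nhds_metric using r by (auto simp: dist_norm)
  have P0: "eval_poly P 0 = 0"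
  proof -
    have z: "cplx_vec 0 = (0 :: complex ^ 'd)" by (simp add: vec_eq_iff)
    obtain E where "E \<in> Exp_set (\<lambda>\<xi>. eval_poly P (cplx_vec \<xi>))" using P unfolding positive_homogeneous_def by blast
    then have "complex_of_real 2 * eval_poly P (cplx_vec 0) = eval_poly P (cplx_vec (matrix_powr 2 E *v 0))"
      unfolding Exp_set_def by (simp only: mem_Collect_eq)
    then show ?thesis by (simp add: z)
  qed
  show "Upsilon \<phi> \<xi>0 \<alpha> P 0 = 0" unfolding Ue g0 by (simp add: P0 cdot_def)
  have "fourier \<phi> (\<xi>0 + \<eta>) = fourier \<phi> \<xi>0 *
       exp (\<i> * complex_of_real (\<alpha> \<bullet> \<eta>) + (Upsilon \<phi> \<xi>0 \<alpha> P (cplx_vec \<eta>) - eval_poly P (cplx_vec \<eta>)))" if "norm \<eta> < r" for \<eta>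
  proof -
    have n: "norm (cplx_vec \<eta>) < r" using that by simp
    have s: "cplx_vec \<eta> + a = cplx_vec (\<xi>0 + \<eta>)" by (simp add: a_def cplx_vec_add add.commute)
    have "fourier \<phi> (\<xi>0 + \<eta>) = F a * g (cplx_vec \<eta>)" using V(4)[of "\<xi>0 + \<eta>"] inV[OF n] Fa0 by (simp add: g_def s)
    also have "g (cplx_vec \<eta>) = exp (Ln (g (cplx_vec \<eta>)))" using gpos[OF n] by (subst exp_Ln) auto
    also have "Ln (g (cplx_vec \<eta>)) = \<i> * complex_of_real (\<alpha> \<bullet> \<eta>) + (Upsilon \<phi> \<xi>0 \<alpha> P (cplx_vec \<eta>) - eval_poly P (cplx_vec \<eta>))"
      by (simp add: Ue cdot_def inner_vec_def)
    finally show ?thesis by (simp add: Fa)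
  qed
  then show "\<exists>r>0. \<forall>\<eta>. norm \<eta> < r \<longrightarrow> fourier \<phi> (\<xi>0 + \<eta>) = fourier \<phi> \<xi>0 *
       exp (\<i> * complex_of_real (\<alpha> \<bullet> \<eta>) + (Upsilon \<phi> \<xi>0 \<alpha> P (cplx_vec \<eta>) - eval_poly P (cplx_vec \<eta>)))"
    using r by blast
qed

lemma exp_rapid:
  fixes P :: "'d::finite cpoly"
  assumes A: "invertible A" and m1: "\<And>j. m $ j \<ge> 1" and c: "c > 0" and n: "n \<ge> 1"
    and b: "\<And>\<eta>. norm (exp (- (of_nat n * eval_poly P (cplx_vec \<eta>)))) \<le> C * exp (- (real n * (c * pgauge m A \<eta>)))"
  shows "rapid (\<lambda>\<eta>. K * exp (- (of_nat n * eval_poly P (cplx_vec \<eta>))))"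
proof -
  have C: "C \<ge> 0"
  proof (rule ccontr)
    assume "\<not> C \<ge> 0"
    then have "C * exp (- (real n * (c * pgauge m A 0))) < 0" by (intro mult_neg_pos) auto
    then show False using b[of 0] norm_ge_zero[of "exp (- (of_nat n * eval_poly P (cplx_vec 0)))"] by linarith
  qed
  have "real n * c > 0" using n c by simp
  from quasi_exp_bound[OF m1 invertible_inv[OF A] this] obtain a K1 where a: "a > 0"
    and K1: "\<And>x. exp (- (real n * c * pgauge m A x)) \<le> K1 * exp (- (a * norm x))" by blast
  show ?thesis
  proof (rule rapidI[OF _ a])
    show "continuous_on UNIV (\<lambda>\<eta>. K * exp (- (of_nat n * eval_poly P (cplx_vec \<eta>))))"
      by (intro continuous_intros)
    fix \<eta>
    have "norm (K * exp (- (of_nat n * eval_poly P (cplx_vec \<eta>)))) \<le> norm K * (C * exp (- (real n * (c * pgauge m A \<eta>))))"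
      unfolding norm_mult by (intro mult_left_mono b) simp
    also have "\<dots> \<le> norm K * (C * (K1 * exp (- (a * norm \<eta>))))"
      using K1[of \<eta>] C by (intro mult_left_mono) (auto simp: mult.assoc)
    finally show "norm (K * exp (- (of_nat n * eval_poly P (cplx_vec \<eta>)))) \<le> (norm K * C * K1) * exp (- (a * norm \<eta>))"
      by (simp only: mult.assoc)
  qed
qed

text \<open>The attractor is the Fourier integral of \<open>e^(-n P) / (2 \<pi>)^d\<close>, and \<open>i \<partial>\<^sub>j\<close> acts as multiplication
  by \<open>\<xi>\<^sub>j\<close> under the integral.\<close>

lemma Q_op_attractor:
  fixes P :: "'d::finite cpoly"
  assumes "rapid (\<lambda>\<eta>. 1 / (2 * complex_of_real pi) ^ CARD('d) * exp (- (of_nat n * eval_poly P (cplx_vec \<eta>))))"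
  shows "(2 * complex_of_real pi) ^ CARD('d) * Q_op A m U l n (attractor P (real n)) y =
    (LINT x|lborel. exp (- (of_nat n * eval_poly P (cplx_vec x))) * eval_poly (Q_poly A m U l n) (cplx_vec x) * osc y (cplx_vec x))"
proof -
  let ?c = "(2 * complex_of_real pi) ^ CARD('d)"
  have c0: "?c \<noteq> 0" by simp
  have "attractor P (real n) = four (\<lambda>\<eta>. 1 / ?c * exp (- (of_nat n * eval_poly P (cplx_vec \<eta>))))"
  proof
    fix x
    have "attractor P (real n) x = (LINT \<xi>|lborel. 1 / ?c * (exp (- (of_nat n * eval_poly P (cplx_vec \<xi>))) * exp (- (\<i> * complex_of_real (x \<bullet> \<xi>)))))"
      unfolding attractor_def of_real_of_nat_eq by (rule Bochner_Integration.integral_mult_right_zero[symmetric])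
    then show "attractor P (real n) x = four (\<lambda>\<eta>. 1 / ?c * exp (- (of_nat n * eval_poly P (cplx_vec \<eta>)))) x"
      by (simp only: four_def mult.assoc)
  qed
  then have "Q_op A m U l n (attractor P (real n)) y
    = (LINT x|lborel. eval_poly (Q_poly A m U l n) (cplx_vec x) * (1 / ?c * exp (- (of_nat n * eval_poly P (cplx_vec x)))) * exp (- (\<i> * complex_of_real (y \<bullet> x))))"
    unfolding Q_op_def by (simp only: diff_op_four[OF assms] four_def)
  also have "\<dots> = (LINT x|lborel. 1 / ?c * (exp (- (of_nat n * eval_poly P (cplx_vec x))) * eval_poly (Q_poly A m U l n) (cplx_vec x) * osc y (cplx_vec x)))"
    unfolding osc_real by (simp only: mult_ac)
  also have "\<dots> = 1 / ?c * (LINT x|lborel. exp (- (of_nat n * eval_poly P (cplx_vec x))) * eval_poly (Q_poly A m U l n) (cplx_vec x) * osc y (cplx_vec x))"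
    by (rule Bochner_Integration.integral_mult_right_zero)
  finally show ?thesis using c0 by simp
qed

lemma norm_2pi_power: "norm ((2 * complex_of_real pi) ^ d) \<ge> 1"
proof -
  have "norm (2 * complex_of_real pi) = 2 * pi" by (simp add: norm_mult)
  then show ?thesis unfolding norm_power using pi_ge_two by (intro one_le_power) simp
qed

lemma Q_poly_0: "eval_poly (Q_poly A m U 0 n) z = 1"
  unfolding eval_Q_poly by simp

text \<open>Translating \<open>\<xi>\<^sub>0\<close> to the origin turns the local part of the inversion integral into the integral of
  \<open>local_main\<close> with \<open>y = x - n \<alpha>\<close>, up to a unimodular factor.\<close>

theorem point_expansion:
  fixes \<phi> :: "int ^ 'd::finite \<Rightarrow> complex" and P :: "'d cpoly" and A :: "real ^ 'd ^ 'd"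
  assumes \<phi>: "\<phi> \<in> class_H_star" and \<xi>0: "\<xi>0 \<in> Omega \<phi>" and data: "pos_hom_type_data \<phi> \<xi>0 \<alpha> P"
    and A: "invertible A" and p: "positive_semi_elliptic m (lin_subst A P)"
  defines "T \<equiv> \<lambda>l n x. exp (- (\<i> * complex_of_real (real_vec x \<bullet> \<xi>0))) * fourier \<phi> \<xi>0 ^ n *
      Q_op A m (Upsilon \<phi> \<xi>0 \<alpha> P) l n (attractor P (real n)) (real_vec x - real n *\<^sub>R \<alpha>)"
    and "G \<equiv> \<lambda>n x. dual_gauge m A ((1 / real n) *\<^sub>R (real_vec x - real n *\<^sub>R \<alpha>))"
  shows "\<exists>\<delta>>0. \<forall>a \<rho> \<theta> d\<theta> K L. 0 < a \<longrightarrow> \<rho> \<le> \<delta> \<longrightarrow> cutoff a \<rho> \<theta> d\<theta> K \<longrightarrow> L > 0 \<longrightarrow>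
      (\<exists>\<epsilon>>0. \<exists>C>0. \<forall>n\<ge>1. \<forall>x. norm (real_vec x - real n *\<^sub>R \<alpha>) \<le> real n * L \<longrightarrow>
        norm ((LINT \<xi>|lborel. of_real (\<theta> (\<xi> - \<xi>0)) * (chr (- x) \<xi> * fourier \<phi> \<xi> ^ n)) - (2 * complex_of_real pi) ^ CARD('d) * (\<Sum>l\<le>N. T l n x))
        \<le> C * real n powr (- (hom_order P + real (Suc N) / (2 * real (lcm_vec m)))) * exp (- (real n * (\<epsilon> * G n x))))"
    "\<exists>\<epsilon>>0. \<exists>C>0. \<forall>n\<ge>1. \<forall>x. \<forall>l\<le>N. norm (T l n x) \<le> C * real n powr (- hom_order P) * exp (- (real n * (\<epsilon> * G n x)))"
proof -
  define U where "U = Upsilon \<phi> \<xi>0 \<alpha> P"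
  have ph: "positive_homogeneous P" and lo: "(\<lambda>\<xi>. norm (U (cplx_vec \<xi>))) \<in> o[at 0](real_part P)"
    using data by (auto simp: pos_hom_type_data_def U_def)
  note Up = Upsilon_properties[OF \<phi> \<xi>0 ph, of \<alpha>, folded U_def]
  have m1: "m $ j \<ge> 1" for j using p by (simp add: positive_semi_elliptic_def)
  have ho: "hom_order P = (\<Sum>j\<in>UNIV. 1 / (2 * real (m $ j)))" by (rule hom_order_eq[OF m1 ph A p])
  have sum: "(\<lambda>x. norm (\<phi> x)) summable_on UNIV" using \<phi> by (simp add: class_H_star_def class_H_def)
  have f1: "norm (fourier \<phi> \<xi>0) = 1" using \<xi>0 by (simp add: Omega_def)
  obtain r where r: "r > 0" and loc: "\<And>\<eta>. norm \<eta> < r \<Longrightarrow> fourier \<phi> (\<xi>0 + \<eta>) = fourier \<phi> \<xi>0 *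
       exp (\<i> * complex_of_real (\<alpha> \<bullet> \<eta>) + (U (cplx_vec \<eta>) - eval_poly P (cplx_vec \<eta>)))"
    using Up(3) by blast
  obtain c M C \<delta> where pos: "c > 0" "M > 0" "C > 0" "\<delta> > 0" and hol0: "\<forall>z. norm z \<le> 2 * \<delta> \<longrightarrow> cdiff U z"
    and est: "\<forall>n\<ge>1. \<forall>\<eta> \<nu>.
     (\<forall>l\<le>N. norm (exp (- (of_nat n * eval_poly P (cpt \<eta> \<nu>))) * eval_poly (Q_poly A m U l n) (cpt \<eta> \<nu>))
       \<le> C * exp (real n * (- (c * pgauge m A \<eta>) + M * pgauge m A \<nu>))) \<and>
     (norm \<eta> \<le> \<delta> \<longrightarrow> norm \<nu> \<le> \<delta> \<longrightarrow>
       norm (exp (- (of_nat n * eval_poly P (cpt \<eta> \<nu>))) *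
         (exp (of_nat n * U (cpt \<eta> \<nu>)) - (\<Sum>l\<le>N. eval_poly (Q_poly A m U l n) (cpt \<eta> \<nu>))))
       \<le> C * real n powr (- (real (Suc N) / (2 * real (lcm_vec m)))) * exp (real n * (- (c * pgauge m A \<eta>) + M * pgauge m A \<nu>)))"
    using local_estimates[OF A p Up(1,2) lo, of N] by (elim exE conjE) (rule that)
  note cb = est[THEN spec, THEN mp, THEN spec, THEN spec, THEN conjunct1, THEN spec, THEN mp]
  note rb = est[THEN spec, THEN mp, THEN spec, THEN spec, THEN conjunct2, THEN mp, THEN mp]
  note hol = hol0[THEN spec, THEN mp]
  interpret local_expansion P A m U N c M C \<delta>
    by (unfold_locales; (fact A m1 pos | erule hol | erule (1) cb | erule (2) rb))
  note lm = local_main and ct = coefficient_term_bound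
  let ?pi = "(2 * complex_of_real pi) ^ CARD('d)"
  let ?h = "\<lambda>n x. real_vec x - real n *\<^sub>R \<alpha>"
  let ?pre = "\<lambda>n x. exp (- (\<i> * complex_of_real (real_vec x \<bullet> \<xi>0))) * fourier \<phi> \<xi>0 ^ n"
  let ?I = "\<lambda>l n y. LINT x|lborel. exp (- (of_nat n * eval_poly P (cplx_vec x))) * eval_poly (Q_poly A m U l n) (cplx_vec x) * osc y (cplx_vec x)"
  have rap: "rapid (\<lambda>\<eta>. K * exp (- (of_nat n * eval_poly P (cplx_vec \<eta>))))" if n: "n \<ge> 1" for K n
  proof (rule exp_rapid[OF A m1 pos(1) n])
    show "norm (exp (- (of_nat n * eval_poly P (cplx_vec \<eta>)))) \<le> C * exp (- (real n * (c * pgauge m A \<eta>)))" for \<eta>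
      using cb[OF n, of 0 \<eta> 0] unfolding cpt_0 Q_poly_0 pgauge_0 by simp
  qed
  have T: "?pi * T l n x = ?pre n x * ?I l n (?h n x)" if n: "n \<ge> 1" for l n x
    unfolding T_def U_def[symmetric] Q_op_attractor[OF rap[OF n], symmetric] by (simp only: mult_ac)
  have pre1: "norm (?pre n x) = 1" for n x by (simp add: norm_mult norm_power f1)
  show "\<exists>\<delta>>0. \<forall>a \<rho> \<theta> d\<theta> K L. 0 < a \<longrightarrow> \<rho> \<le> \<delta> \<longrightarrow> cutoff a \<rho> \<theta> d\<theta> K \<longrightarrow> L > 0 \<longrightarrow>
      (\<exists>\<epsilon>>0. \<exists>C>0. \<forall>n\<ge>1. \<forall>x. norm (?h n x) \<le> real n * L \<longrightarrow>
        norm ((LINT \<xi>|lborel. of_real (\<theta> (\<xi> - \<xi>0)) * (chr (- x) \<xi> * fourier \<phi> \<xi> ^ n)) - ?pi * (\<Sum>l\<le>N. T l n x))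
        \<le> C * real n powr (- (hom_order P + real (Suc N) / (2 * real (lcm_vec m)))) * exp (- (real n * (\<epsilon> * G n x))))"
  proof (rule exI[of _ "min \<delta> (r / 2)"], rule conjI, use pos r in simp, intro allI impI)
    fix a \<rho> K L :: real and \<theta> :: "real ^ 'd \<Rightarrow> real" and d\<theta>
    assume a: "0 < a" and \<rho>: "\<rho> \<le> min \<delta> (r / 2)" and cut: "cutoff a \<rho> \<theta> d\<theta> K" and L: "L > 0"
    have \<rho>\<delta>: "\<rho> \<le> \<delta>" and \<rho>r: "\<rho> < r" using \<rho> r by auto
    obtain \<epsilon> C' where \<epsilon>: "\<epsilon> > 0" and C': "C' > 0" and main: "\<forall>n\<ge>1. \<forall>y. norm y \<le> real n * L \<longrightarrow>
      norm ((LINT x|lborel. of_real (\<theta> x) * (exp (of_nat n * (U (cplx_vec x) - eval_poly P (cplx_vec x))) * osc y (cplx_vec x)))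
      - (\<Sum>l\<le>N. ?I l n y))
      \<le> C' * real n powr (- ((\<Sum>j\<in>UNIV. 1 / (2 * real (m $ j))) + real (Suc N) / (2 * real (lcm_vec m)))) * exp (- (real n * (\<epsilon> * dual_gauge m A ((1 / real n) *\<^sub>R y))))"
      using lm[OF cut a \<rho>\<delta> L] by (elim exE conjE) (rule that)
    show "\<exists>\<epsilon>>0. \<exists>C>0. \<forall>n\<ge>1. \<forall>x. norm (?h n x) \<le> real n * L \<longrightarrow>
        norm ((LINT \<xi>|lborel. of_real (\<theta> (\<xi> - \<xi>0)) * (chr (- x) \<xi> * fourier \<phi> \<xi> ^ n)) - ?pi * (\<Sum>l\<le>N. T l n x))
        \<le> C * real n powr (- (hom_order P + real (Suc N) / (2 * real (lcm_vec m)))) * exp (- (real n * (\<epsilon> * G n x)))"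
    proof (rule exI[of _ \<epsilon>], rule conjI[OF \<epsilon>], rule exI[of _ C'], rule conjI[OF C'], intro allI impI)
      fix n :: nat and x :: "int ^ 'd"
      assume n: "1 \<le> n" and x: "norm (?h n x) \<le> real n * L"
      let ?J = "LINT \<eta>|lborel. of_real (\<theta> \<eta>) * (exp (of_nat n * (U (cplx_vec \<eta>) - eval_poly P (cplx_vec \<eta>))) * osc (?h n x) (cplx_vec \<eta>))"
      have "(LINT \<xi>|lborel. of_real (\<theta> (\<xi> - \<xi>0)) * (chr (- x) \<xi> * fourier \<phi> \<xi> ^ n))
        = (LINT \<eta>|lborel. of_real (\<theta> (\<eta> + \<xi>0 - \<xi>0)) * (chr (- x) (\<eta> + \<xi>0) * fourier \<phi> (\<eta> + \<xi>0) ^ n))"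
      proof (rule lborel_integral_translate[symmetric])
        have "continuous_on UNIV (\<lambda>\<xi>. \<theta> (\<xi> - \<xi>0))"
          by (rule continuous_on_compose2[OF cutoffD(11)[OF cut]]) (auto intro!: continuous_intros)
        then have "continuous_on UNIV (\<lambda>\<xi>. of_real (\<theta> (\<xi> - \<xi>0)) * (chr (- x) \<xi> * fourier \<phi> \<xi> ^ n))"
          by (intro continuous_on_mult continuous_on_of_real continuous_on_power continuous_fourier[OF sum] continuous_intros)
        then show "(\<lambda>\<xi>. of_real (\<theta> (\<xi> - \<xi>0)) * (chr (- x) \<xi> * fourier \<phi> \<xi> ^ n)) \<in> borel_measurable borel"
          by (rule borel_measurable_continuous_onI)
      qed
      also have "\<dots> = (LINT \<eta>|lborel. ?pre n x * (of_real (\<theta> \<eta>) * (exp (of_nat n * (U (cplx_vec \<eta>) - eval_poly P (cplx_vec \<eta>))) * osc (?h n x) (cplx_vec \<eta>))))"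
      proof (rule Bochner_Integration.integral_cong[OF refl])
        fix \<eta> :: "real ^ 'd"
        show "of_real (\<theta> (\<eta> + \<xi>0 - \<xi>0)) * (chr (- x) (\<eta> + \<xi>0) * fourier \<phi> (\<eta> + \<xi>0) ^ n)
          = ?pre n x * (of_real (\<theta> \<eta>) * (exp (of_nat n * (U (cplx_vec \<eta>) - eval_poly P (cplx_vec \<eta>))) * osc (?h n x) (cplx_vec \<eta>)))"
        proof (cases "norm \<eta> \<le> \<rho>")
          case True
          have "real_vec (- x) = - real_vec x" by (simp add: vec_eq_iff)
          then have 1: "chr (- x) (\<eta> + \<xi>0) = exp (- (\<i> * complex_of_real (real_vec x \<bullet> \<xi>0))) * exp (- (\<i> * complex_of_real (real_vec x \<bullet> \<eta>)))"
            unfolding exp_add[symmetric] by (intro arg_cong[of _ _ exp]) (simp add: inner_add_right right_diff_distrib)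
          have 2: "fourier \<phi> (\<eta> + \<xi>0) ^ n = fourier \<phi> \<xi>0 ^ n * (exp (of_nat n * (\<i> * complex_of_real (\<alpha> \<bullet> \<eta>))) * exp (of_nat n * (U (cplx_vec \<eta>) - eval_poly P (cplx_vec \<eta>))))"
            using loc[of \<eta>] True \<rho>r by (simp add: add.commute[of \<eta>] power_mult_distrib exp_of_nat_mult[symmetric] distrib_left exp_add del: mult_exp_exp)
          have "osc (?h n x) (cplx_vec \<eta>) = exp (- (\<i> * complex_of_real (real_vec x \<bullet> \<eta>)) + of_nat n * (\<i> * complex_of_real (\<alpha> \<bullet> \<eta>)))"
            unfolding osc_real by (simp add: inner_diff_left right_diff_distrib mult.left_commute)
          also have "\<dots> = exp (- (\<i> * complex_of_real (real_vec x \<bullet> \<eta>))) * exp (of_nat n * (\<i> * complex_of_real (\<alpha> \<bullet> \<eta>)))"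
            by (rule exp_add)
          finally have 3: "osc (?h n x) (cplx_vec \<eta>) = \<dots>" .
          show ?thesis unfolding 1 2 3 add_diff_cancel_right' by (simp only: mult_ac)
        next
          case False
          then have "\<theta> \<eta> = 0" by (intro cutoffD(7)[OF cut]) simp
          then show ?thesis by simp
        qed
      qed
      also have "\<dots> = ?pre n x * ?J" by (rule Bochner_Integration.integral_mult_right_zero)
      finally have 1: "(LINT \<xi>|lborel. of_real (\<theta> (\<xi> - \<xi>0)) * (chr (- x) \<xi> * fourier \<phi> \<xi> ^ n)) = ?pre n x * ?J" .
      have 2: "?pi * (\<Sum>l\<le>N. T l n x) = ?pre n x * (\<Sum>l\<le>N. ?I l n (?h n x))"
        unfolding sum_distrib_left T[OF n] ..
      show "norm ((LINT \<xi>|lborel. of_real (\<theta> (\<xi> - \<xi>0)) * (chr (- x) \<xi> * fourier \<phi> \<xi> ^ n)) - ?pi * (\<Sum>l\<le>N. T l n x))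
        \<le> C' * real n powr (- (hom_order P + real (Suc N) / (2 * real (lcm_vec m)))) * exp (- (real n * (\<epsilon> * G n x)))"
        unfolding 1 2 right_diff_distrib[symmetric] norm_mult[of "?pre n x"] pre1 mult_1 ho G_def
        by (rule main[THEN spec, THEN mp, THEN spec, THEN mp, OF n x])
    qed
  qed
  obtain \<epsilon> C' where \<epsilon>: "\<epsilon> > 0" and C': "C' > 0" and main: "\<forall>n\<ge>1. \<forall>y. \<forall>l\<le>N. norm (?I l n y)
     \<le> C' * real n powr (- (\<Sum>j\<in>UNIV. 1 / (2 * real (m $ j)))) * exp (- (real n * (\<epsilon> * dual_gauge m A ((1 / real n) *\<^sub>R y))))"
    using ct by (elim exE conjE) (rule that)
  show "\<exists>\<epsilon>>0. \<exists>C>0. \<forall>n\<ge>1. \<forall>x. \<forall>l\<le>N. norm (T l n x) \<le> C * real n powr (- hom_order P) * exp (- (real n * (\<epsilon> * G n x)))"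
  proof (rule exI[of _ \<epsilon>], rule conjI[OF \<epsilon>], rule exI[of _ C'], rule conjI[OF C'], intro allI impI)
    fix n :: nat and x :: "int ^ 'd" and l
    assume n: "1 \<le> n" and l: "l \<le> N"
    have "norm ?pi \<ge> 1" by (rule norm_2pi_power)
    then have "1 * norm (T l n x) \<le> norm ?pi * norm (T l n x)" by (intro mult_right_mono) auto
    also have "\<dots> = norm (?pi * T l n x)" by (simp only: norm_mult)
    also have "\<dots> = norm (?I l n (?h n x))" unfolding T[OF n] norm_mult[of "?pre n x"] pre1 by simp
    finally have "norm (T l n x) \<le> norm (?I l n (?h n x))" by simp
    also have "\<dots> \<le> C' * real n powr (- hom_order P) * exp (- (real n * (\<epsilon> * G n x)))"
      unfolding ho G_def by (rule main[THEN spec, THEN mp, THEN spec, THEN spec, THEN mp, OF n l])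
    finally show "norm (T l n x) \<le> C' * real n powr (- hom_order P) * exp (- (real n * (\<epsilon> * G n x)))" .
  qed
qed

section \<open>Localisation near the maximum points\<close>

text \<open>A common radius for finitely many conditions that persist when the radius shrinks.\<close>

lemma finite_uniform_positive:
  fixes Q :: "'i \<Rightarrow> real \<Rightarrow> bool"
  assumes "finite I" "\<And>i. i \<in> I \<Longrightarrow> \<exists>d>0. Q i d" "\<And>i d d'. i \<in> I \<Longrightarrow> Q i d \<Longrightarrow> 0 < d' \<Longrightarrow> d' \<le> d \<Longrightarrow> Q i d'"
  shows "\<exists>d>0. \<forall>i\<in>I. Q i d"
  using assms
proof (induction I rule: finite_induct)
  case empty
  show ?case by (intro exI[of _ 1]) simp
next
  case (insert i I)
  obtain d1 where d1: "d1 > 0" "\<forall>i\<in>I. Q i d1" using insert.IH insert.prems by blast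
  obtain d2 where d2: "d2 > 0" "Q i d2" using insert.prems(1) by blast
  show ?case
  proof (intro exI[of _ "min d1 d2"] conjI ballI)
    show "min d1 d2 > 0" using d1 d2 by simp
    fix j assume j: "j \<in> insert i I"
    show "Q j (min d1 d2)"
    proof (cases "j = i")
      case True
      then show ?thesis using insert.prems(2)[of i d2 "min d1 d2"] d1 d2 by simp
    next
      case False
      then show ?thesis using insert.prems(2)[of j d1 "min d1 d2"] j d1 d2 by simp
    qed
  qed
qed

text \<open>The points of \<open>Omega \<phi>\<close> lie in the half-open cube and may touch its upper faces. Moving the cell
  down by less than the least distance to the lower faces makes all of them interior, and no translate by
  a period falls into the moved cell.\<close>

lemma Omega_cell:
  fixes \<phi> :: "int ^ 'd::finite \<Rightarrow> complex"
  assumes \<phi>: "\<phi> \<in> class_H_star" and fin: "finite (Omega \<phi>)"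
  shows "\<exists>c r. 0 < r \<and> (\<forall>\<eta>\<in>Omega \<phi>. cball \<eta> r \<subseteq> cell c) \<and> (\<forall>\<xi>\<in>cell c. norm (fourier \<phi> \<xi>) = 1 \<longrightarrow> \<xi> \<in> Omega \<phi>)"
proof -
  define S where "S = (\<lambda>(\<eta>, j). \<eta> $ j) ` (Omega \<phi> \<times> (UNIV :: 'd set))"
  have "finite S" "S \<noteq> {}" using fin class_H_star_max(2)[OF \<phi>] by (auto simp: S_def)
  define s where "s = Min S"
  have "s \<in> S" using \<open>finite S\<close> \<open>S \<noteq> {}\<close> by (simp add: s_def)
  then have s: "s > - pi" by (auto simp: S_def Omega_def torus_def)
  have sle: "s \<le> \<eta> $ j" if "\<eta> \<in> Omega \<phi>" for \<eta> j
    unfolding s_def using \<open>finite S\<close> that by (intro Min_le) (auto simp: S_def)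
  have pile: "\<eta> $ j \<le> pi" if "\<eta> \<in> Omega \<phi>" for \<eta> j using that by (simp add: Omega_def torus_def)
  define c where "c = (s - pi) / 2"
  have c: "- pi < c" "c < s" using s by (auto simp: c_def)
  show ?thesis
  proof (rule exI[of _ c], rule exI[of _ "min (s - c) (c + pi)"], intro conjI ballI impI)
    show "0 < min (s - c) (c + pi)" using c by simp
    show "cball \<eta> (min (s - c) (c + pi)) \<subseteq> cell c" if \<eta>: "\<eta> \<in> Omega \<phi>" for \<eta>
    proof
      fix \<xi> :: "real ^ 'd" assume "\<xi> \<in> cball \<eta> (min (s - c) (c + pi))"
      then have n: "norm (\<xi> - \<eta>) \<le> min (s - c) (c + pi)" by (simp add: dist_norm norm_minus_commute)
      have "c \<le> \<xi> $ j \<and> \<xi> $ j \<le> c + 2 * pi" for j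
        using component_le_norm_cart[of "\<xi> - \<eta>" j] n sle[OF \<eta>, of j] pile[OF \<eta>, of j] by (auto simp: abs_le_iff)
      then show "\<xi> \<in> cell c" by (simp add: mem_cell)
    qed
    fix \<xi> :: "real ^ 'd" assume \<xi>: "\<xi> \<in> cell c" and f1: "norm (fourier \<phi> \<xi>) = 1"
    obtain k :: "int ^ 'd" where k: "\<xi> + (2 * pi) *\<^sub>R real_vec k \<in> torus" using reduce_to_torus by blast
    then have \<Omega>: "\<xi> + (2 * pi) *\<^sub>R real_vec k \<in> Omega \<phi>" using f1 by (simp add: Omega_def fourier_periodic)
    have "k $ j = 0" for j
    proof -
      have b: "c \<le> \<xi> $ j" "\<xi> $ j \<le> c + 2 * pi" using \<xi> by (auto simp: mem_cell)
      have "s \<le> \<xi> $ j + 2 * pi * of_int (k $ j)" "\<xi> $ j + 2 * pi * of_int (k $ j) \<le> pi"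
        using sle[OF \<Omega>, of j] pile[OF \<Omega>, of j] by auto
      then have "2 * pi * (-1) < 2 * pi * of_int (k $ j)" "2 * pi * of_int (k $ j) < 2 * pi * 1" using b c by linarith+
      then have "(-1 :: real) < of_int (k $ j)" "of_int (k $ j) < (1 :: real)"
        using mult_less_cancel_left_pos[of "2 * pi"] pi_gt_zero by (simp_all only: zero_less_mult_iff zero_less_numeral simp_thms)
      then show ?thesis by linarith
    qed
    then have "k = 0" by (simp add: vec_eq_iff)
    then show "\<xi> \<in> Omega \<phi>" using \<Omega> by (simp add: real_vec_def vec_eq_iff[symmetric] zero_vec_def[symmetric])
  qed
qed

text \<open>On the part of the cell that avoids the balls of radius \<open>\<rho> / 2\<close>, \<open>|fourier \<phi>|\<close> is at most some
  \<open>q < 1\<close> by compactness; inside these balls exactly one of the cutoffs equals \<open>1\<close> and the others vanish.\<close>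

lemma localise:
  fixes \<phi> :: "int ^ 'd::finite \<Rightarrow> complex"
  assumes \<phi>: "\<phi> \<in> class_H_star" and fin: "finite (Omega \<phi>)"
    and cell: "\<And>\<eta>. \<eta> \<in> Omega \<phi> \<Longrightarrow> cball \<eta> \<rho> \<subseteq> cell c"
    and only: "\<And>\<xi>. \<xi> \<in> cell c \<Longrightarrow> norm (fourier \<phi> \<xi>) = 1 \<Longrightarrow> \<xi> \<in> Omega \<phi>"
    and sep: "\<And>\<eta> \<eta>'. \<eta> \<in> Omega \<phi> \<Longrightarrow> \<eta>' \<in> Omega \<phi> \<Longrightarrow> \<eta> \<noteq> \<eta>' \<Longrightarrow> 2 * \<rho> \<le> dist \<eta> \<eta>'"
    and \<rho>: "\<rho> > 0" and cut: "cutoff (\<rho> / 2) \<rho> \<theta> d\<theta> K"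
  shows "\<exists>\<kappa>>0. \<exists>V>0. \<forall>n\<ge>1. \<forall>x. norm ((2 * complex_of_real pi) ^ CARD('d) * conv_power \<phi> n x
    - (\<Sum>\<eta>\<in>Omega \<phi>. LINT \<xi>|lborel. of_real (\<theta> (\<xi> - \<eta>)) * (chr (- x) \<xi> * fourier \<phi> \<xi> ^ n))) \<le> V * exp (- (real n * \<kappa>))"
proof -
  note \<theta> = cutoffD[OF cut]
  have sum: "(\<lambda>x. norm (\<phi> x)) summable_on UNIV" using \<phi> by (simp add: class_H_star_def class_H_def)
  have cf: "continuous_on S (fourier \<phi>)" for S using continuous_fourier[OF sum] continuous_on_subset by blast
  define S where "S = cell c - (\<Union>\<eta>\<in>Omega \<phi>. ball \<eta> (\<rho> / 2))"
  have "compact S" unfolding S_def cell_def by (intro compact_diff compact_cbox open_UN ballI open_ball)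
  have "\<exists>q. 0 < q \<and> q < 1 \<and> (\<forall>\<xi>\<in>S. norm (fourier \<phi> \<xi>) \<le> q)"
  proof (cases "S = {}")
    case True
    then show ?thesis by (intro exI[of _ "1 / 2"]) simp
  next
    case False
    obtain \<xi>m where \<xi>m: "\<xi>m \<in> S" "\<forall>\<xi>\<in>S. norm (fourier \<phi> \<xi>) \<le> norm (fourier \<phi> \<xi>m)"
      using continuous_attains_sup[OF \<open>compact S\<close> False, of "\<lambda>\<xi>. norm (fourier \<phi> \<xi>)"] continuous_on_norm[OF cf] by blast
    have "norm (fourier \<phi> \<xi>m) \<noteq> 1"
    proof
      assume "norm (fourier \<phi> \<xi>m) = 1"
      then have "\<xi>m \<in> Omega \<phi>" using \<xi>m(1) only by (auto simp: S_def)
      moreover have "\<xi>m \<in> ball \<xi>m (\<rho> / 2)" using \<rho> by simp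
      ultimately show False using \<xi>m(1) unfolding S_def by blast
    qed
    then have "norm (fourier \<phi> \<xi>m) < 1" using class_H_star_max(1)[OF \<phi>, of \<xi>m] by simp
    then show ?thesis using \<xi>m(2) by (intro exI[of _ "max (1 / 2) (norm (fourier \<phi> \<xi>m))"]) auto
  qed
  then obtain q where q: "0 < q" "q < 1" "\<And>\<xi>. \<xi> \<in> S \<Longrightarrow> norm (fourier \<phi> \<xi>) \<le> q" by blast
  define \<kappa> where "\<kappa> = - ln q"
  have \<kappa>: "\<kappa> > 0" using q by (simp add: \<kappa>_def)
  have qn: "q ^ n = exp (- (real n * \<kappa>))" for n using q by (simp add: \<kappa>_def exp_of_nat_mult)
  define I where "I = (LINT \<xi>|lborel. indicator (cell c) (\<xi> :: real ^ 'd) :: real)"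
  have iI: "integrable lborel (indicator (cell c) :: real ^ 'd \<Rightarrow> real)"
    using borel_integrable_compact[of "cell c" "\<lambda>_. 1 :: real"] by (simp add: cell_def)
  have I: "I \<ge> 0" unfolding I_def by (intro Bochner_Integration.integral_nonneg) simp
  define k where "k = real (card (Omega \<phi>)) + 1"
  have main: "norm ((2 * complex_of_real pi) ^ CARD('d) * conv_power \<phi> n x
    - (\<Sum>\<eta>\<in>Omega \<phi>. LINT \<xi>|lborel. of_real (\<theta> (\<xi> - \<eta>)) * (chr (- x) \<xi> * fourier \<phi> \<xi> ^ n))) \<le> (k * I + 1) * exp (- (real n * \<kappa>))"
    if n: "n \<ge> 1" for n x
  proof -
    define g where "g \<xi> = chr (- x) \<xi> * fourier \<phi> \<xi> ^ n" for \<xi>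
    have cg: "continuous_on UNIV g" unfolding g_def by (intro continuous_on_mult continuous_on_power cf continuous_intros)
    have i1: "integrable lborel (\<lambda>\<xi>. indicator (cell c) \<xi> *\<^sub>R g \<xi>)" by (rule cell_cont_integral(1)[OF cg])
    have i2: "integrable lborel (\<lambda>\<xi>. of_real (\<theta> (\<xi> - \<eta>)) * g \<xi>)" for \<eta>
    proof (rule continuous_compact_support(1)[where \<rho> = "norm \<eta> + \<rho>" and B = UNIV])
      have "continuous_on UNIV (\<lambda>\<xi>. \<theta> (\<xi> - \<eta>))"
        by (rule continuous_on_compose2[OF \<theta>(11)]) (auto intro!: continuous_intros)
      then show "continuous_on UNIV (\<lambda>\<xi>. of_real (\<theta> (\<xi> - \<eta>)) * g \<xi>)" by (intro continuous_on_mult continuous_on_of_real cg)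
      fix \<xi> :: "real ^ 'd" assume "norm \<xi> \<ge> norm \<eta> + \<rho>"
      then have "norm (\<xi> - \<eta>) \<ge> \<rho>" using norm_triangle_ineq2[of \<xi> \<eta>] by linarith
      then show "of_real (\<theta> (\<xi> - \<eta>)) * g \<xi> = 0" using \<theta>(7) by simp
    qed simp
    define w :: "real ^ 'd \<Rightarrow> real" where "w \<xi> = indicator (cell c) \<xi> - (\<Sum>\<eta>\<in>Omega \<phi>. \<theta> (\<xi> - \<eta>))" for \<xi>
    have i3: "integrable lborel (\<lambda>\<xi>. \<Sum>\<eta>\<in>Omega \<phi>. of_real (\<theta> (\<xi> - \<eta>)) * g \<xi>)"
      by (rule Bochner_Integration.integrable_sum) (rule i2)
    have e1: "(2 * complex_of_real pi) ^ CARD('d) * conv_power \<phi> n x = (LINT \<xi>|lborel. indicator (cell c) \<xi> *\<^sub>R g \<xi>)"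
      unfolding g_def conv_power_fourier(2)[OF sum n, symmetric] by (rule fourier_inversion[OF conv_power_fourier(1)[OF sum n]])
    have e2: "(\<Sum>\<eta>\<in>Omega \<phi>. LINT \<xi>|lborel. of_real (\<theta> (\<xi> - \<eta>)) * g \<xi>) = (LINT \<xi>|lborel. (\<Sum>\<eta>\<in>Omega \<phi>. of_real (\<theta> (\<xi> - \<eta>)) * g \<xi>))"
      by (rule Bochner_Integration.integral_sum[symmetric]) (rule i2)
    have "(2 * complex_of_real pi) ^ CARD('d) * conv_power \<phi> n x - (\<Sum>\<eta>\<in>Omega \<phi>. LINT \<xi>|lborel. of_real (\<theta> (\<xi> - \<eta>)) * g \<xi>)
      = (LINT \<xi>|lborel. indicator (cell c) \<xi> *\<^sub>R g \<xi> - (\<Sum>\<eta>\<in>Omega \<phi>. of_real (\<theta> (\<xi> - \<eta>)) * g \<xi>))"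
      unfolding e1 e2 by (rule Bochner_Integration.integral_diff[OF i1 i3, symmetric])
    also have "\<dots> = (LINT \<xi>|lborel. of_real (w \<xi>) * g \<xi>)"
      by (simp add: w_def scaleR_conv_of_real left_diff_distrib sum_distrib_right)
    finally have eq: "(2 * complex_of_real pi) ^ CARD('d) * conv_power \<phi> n x - (\<Sum>\<eta>\<in>Omega \<phi>. LINT \<xi>|lborel. of_real (\<theta> (\<xi> - \<eta>)) * g \<xi>)
      = (LINT \<xi>|lborel. of_real (w \<xi>) * g \<xi>)" .
    have "norm (LINT \<xi>|lborel. of_real (w \<xi>) * g \<xi>) \<le> (LINT \<xi>|lborel. k * q ^ n * indicator (cell c) (\<xi> :: real ^ 'd))"
    proof (rule norm_lebesgue_integral_le)
      show "integrable lborel (\<lambda>\<xi>. k * q ^ n * indicator (cell c) (\<xi> :: real ^ 'd))" using iI by simp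
      fix \<xi> :: "real ^ 'd"
      have k0: "k \<ge> 0" by (simp add: k_def)
      consider (out) "\<xi> \<notin> cell c" | (near) \<eta> where "\<eta> \<in> Omega \<phi>" "\<xi> \<in> ball \<eta> (\<rho> / 2)" | (S) "\<xi> \<in> S" unfolding S_def by blast
      then show "norm (of_real (w \<xi>) * g \<xi>) \<le> k * q ^ n * indicator (cell c) \<xi>"
      proof cases
        case out
        have "\<theta> (\<xi> - \<eta>) = 0" if "\<eta> \<in> Omega \<phi>" for \<eta>
        proof (rule \<theta>(7))
          have "\<xi> \<notin> cball \<eta> \<rho>" using out cell[OF that] by blast
          then show "norm (\<xi> - \<eta>) \<ge> \<rho>" by (simp add: dist_norm norm_minus_commute)
        qed
        then have "w \<xi> = 0" using out by (simp add: w_def)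
        then show ?thesis using out by simp
      next
        case near
        then have d: "dist \<xi> \<eta> < \<rho> / 2" by (simp add: dist_commute)
        have "\<theta> (\<xi> - \<eta>') = (if \<eta>' = \<eta> then 1 else 0)" if \<eta>': "\<eta>' \<in> Omega \<phi>" for \<eta>'
        proof (cases "\<eta>' = \<eta>")
          case True
          then show ?thesis using \<theta>(5)[of "\<xi> - \<eta>"] d by (simp add: dist_norm)
        next
          case False
          have "2 * \<rho> \<le> dist \<eta>' \<eta>" by (rule sep[OF \<eta>' near(1) False])
          also have "\<dots> \<le> dist \<xi> \<eta>' + dist \<xi> \<eta>" using dist_triangle3 .
          finally have "norm (\<xi> - \<eta>') \<ge> \<rho>" using d \<rho> by (simp add: dist_norm)
          then show ?thesis using False \<theta>(7) by simp
        qed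
        then have "(\<Sum>\<eta>'\<in>Omega \<phi>. \<theta> (\<xi> - \<eta>')) = (\<Sum>\<eta>'\<in>Omega \<phi>. if \<eta>' = \<eta> then 1 else 0)" by (intro sum.cong) auto
        also have "\<dots> = 1" using near(1) fin by simp
        finally have s1: "(\<Sum>\<eta>'\<in>Omega \<phi>. \<theta> (\<xi> - \<eta>')) = 1" .
        have "\<xi> \<in> cball \<eta> \<rho>" using d \<rho> by (simp add: dist_commute)
        then have "\<xi> \<in> cell c" using cell[OF near(1)] by blast
        then have "w \<xi> = 0" by (simp add: w_def s1)
        then show ?thesis using k0 q by simp
      next
        case S
        have "\<bar>w \<xi>\<bar> \<le> \<bar>indicator (cell c) \<xi>\<bar> + (\<Sum>\<eta>\<in>Omega \<phi>. \<bar>\<theta> (\<xi> - \<eta>)\<bar>)"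
          unfolding w_def by (rule order_trans[OF abs_triangle_ineq4 add_left_mono[OF sum_abs]])
        also have "\<dots> \<le> 1 + (\<Sum>\<eta>\<in>Omega \<phi>. 1)"
          using \<theta>(3,4) by (intro add_mono sum_mono) (auto simp: indicator_def abs_le_iff intro: order_trans[of _ 0])
        finally have w: "\<bar>w \<xi>\<bar> \<le> k" by (simp add: k_def)
        have "norm (g \<xi>) \<le> q ^ n" unfolding g_def norm_mult norm_power using q(3)[OF S] by (simp add: power_mono)
        then have "\<bar>w \<xi>\<bar> * norm (g \<xi>) \<le> k * q ^ n" using w k0 by (intro mult_mono) auto
        then show ?thesis using S by (simp add: norm_mult S_def)
      qed
    qed
    also have "\<dots> = k * I * exp (- (real n * \<kappa>))" by (simp add: I_def qn mult_ac)
    also have "\<dots> \<le> (k * I + 1) * exp (- (real n * \<kappa>))" by (intro mult_right_mono) auto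
    finally show ?thesis unfolding g_def[symmetric] eq .
  qed
  have "k * I + 1 > 0" using I by (simp add: k_def add_nonneg_pos)
  then show ?thesis using \<kappa> main by (intro exI[of _ \<kappa>] conjI exI[of _ "k * I + 1"]) auto
qed

lemma conv_power_support:
  fixes \<phi> :: "int ^ 'd::finite \<Rightarrow> complex"
  assumes \<phi>: "\<And>x. norm (real_vec x) > L \<Longrightarrow> \<phi> x = 0" and n: "n \<ge> 1" and x: "norm (real_vec x) > real n * L"
  shows "conv_power \<phi> n x = 0"
proof -
  have "\<forall>x. norm (real_vec x) > real (Suc k) * L \<longrightarrow> ((\<lambda>\<psi>. conv \<psi> \<phi>) ^^ k) \<phi> x = 0" for k
  proof (induction k)
    case 0
    then show ?case using \<phi> by simp
  next
    case (Suc k)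
    show ?case
    proof (intro allI impI)
      fix x :: "int ^ 'd" assume x: "norm (real_vec x) > real (Suc (Suc k)) * L"
      have "((\<lambda>\<psi>. conv \<psi> \<phi>) ^^ k) \<phi> (x - y) * \<phi> y = 0" for y
      proof (cases "norm (real_vec y) > L")
        case False
        have "norm (real_vec x) \<le> norm (real_vec (x - y)) + norm (real_vec y)"
          using norm_triangle_ineq[of "real_vec (x - y)" "real_vec y"] by (simp add: real_vec_diff)
        then have "norm (real_vec (x - y)) > real (Suc k) * L" using x False by (simp add: distrib_right)
        then show ?thesis using Suc.IH by simp
      qed (simp add: \<phi>)
      then have "conv (((\<lambda>\<psi>. conv \<psi> \<phi>) ^^ k) \<phi>) \<phi> x = 0" unfolding conv_def by (simp only: infsum_0_simp)
      then show "((\<lambda>\<psi>. conv \<psi> \<phi>) ^^ Suc k) \<phi> x = 0" by simp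
    qed
  qed
  from this[of "n - 1"] show ?thesis using n x by (simp add: conv_power_def)
qed

section \<open>Assembling the expansion\<close>

lemma bchoice2:
  assumes "\<forall>k\<in>S. \<exists>\<epsilon>>0. \<exists>C>0. Q k (\<epsilon> :: real) (C :: real)"
  shows "\<exists>\<epsilon> C. \<forall>k\<in>S. \<epsilon> k > 0 \<and> C k > 0 \<and> Q k (\<epsilon> k) (C k)"
proof -
  have "\<forall>k\<in>S. \<exists>p. fst p > 0 \<and> snd p > 0 \<and> Q k (fst p) (snd p)" using assms by fastforce
  then obtain f where "\<forall>k\<in>S. fst (f k) > 0 \<and> snd (f k) > 0 \<and> Q k (fst (f k)) (snd (f k))" by (rule bchoice[THEN exE])
  then show ?thesis by (intro exI[of _ "\<lambda>k. fst (f k)"] exI[of _ "\<lambda>k. snd (f k)"])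
qed

locale expansion_data =
  fixes \<phi> :: "int ^ 'd::finite \<Rightarrow> complex"
    and K :: nat
    and \<xi> \<alpha> :: "nat \<Rightarrow> real ^ 'd"
    and P :: "nat \<Rightarrow> 'd cpoly"
    and A :: "nat \<Rightarrow> real ^ 'd ^ 'd"
    and m :: "nat \<Rightarrow> nat ^ 'd"
    and lam :: "nat \<Rightarrow> nat"
  assumes \<phi>: "\<phi> \<in> class_H_star"
    and bij: "bij_betw \<xi> {1..K} (Omega \<phi>)"
    and data: "\<And>k. k \<in> {1..K} \<Longrightarrow> pos_hom_type_data \<phi> (\<xi> k) (\<alpha> k) (P k)"
    and A: "\<And>k. k \<in> {1..K} \<Longrightarrow> invertible (A k)"
    and p: "\<And>k. k \<in> {1..K} \<Longrightarrow> positive_semi_elliptic (m k) (lin_subst (A k) (P k))"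
begin

definition T :: "nat \<Rightarrow> nat \<Rightarrow> nat \<Rightarrow> int ^ 'd \<Rightarrow> complex"
  where "T k l n x = exp (- (\<i> * complex_of_real (real_vec x \<bullet> \<xi> k))) * fourier \<phi> (\<xi> k) ^ n *
    Q_op (A k) (m k) (Upsilon \<phi> (\<xi> k) (\<alpha> k) (P k)) l n (attractor (P k) (real n)) (real_vec x - real n *\<^sub>R \<alpha> k)"

definition G :: "nat \<Rightarrow> nat \<Rightarrow> int ^ 'd \<Rightarrow> real"
  where "G k n x = dual_gauge (m k) (A k) ((1 / real n) *\<^sub>R (real_vec x - real n *\<^sub>R \<alpha> k))"

definition rate :: "nat \<Rightarrow> real"
  where "rate k = hom_order (P k) + (real (lam k) + 1) / (2 * real (lcm_vec (m k)))"

definition majorant :: "(nat \<Rightarrow> real) \<Rightarrow> (nat \<Rightarrow> real) \<Rightarrow> nat \<Rightarrow> nat \<Rightarrow> int ^ 'd \<Rightarrow> real"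
  where "majorant \<epsilon> C k n x = C k * real n powr (- rate k) * exp (- (real n * (\<epsilon> k * G k n x)))"

lemma m1: "k \<in> {1..K} \<Longrightarrow> m k $ j \<ge> 1"
  using p by (simp add: positive_semi_elliptic_def)

lemma rate_nonneg: "k \<in> {1..K} \<Longrightarrow> rate k \<ge> 0"
  using hom_order_eq[OF m1 _ A p, of k] data[of k] by (simp add: rate_def pos_hom_type_data_def sum_nonneg)

lemma finite_Omega: "finite (Omega \<phi>)"
  using bij_betw_finite[OF bij] by simp

lemma \<xi>_Omega: "k \<in> {1..K} \<Longrightarrow> \<xi> k \<in> Omega \<phi>"
  using bij by (auto simp: bij_betw_def)

lemma K_pos: "K \<ge> 1"
proof (rule ccontr)
  assume "\<not> K \<ge> 1"
  then have "{1..K} = {}" by simp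
  then show False using bij class_H_star_max(2)[OF \<phi>] by (simp add: bij_betw_def)
qed

lemma real_Suc_eq: "real (Suc (lam k)) = real (lam k) + 1"
  by simp

lemma G_nonneg: "k \<in> {1..K} \<Longrightarrow> G k n x \<ge> 0"
  unfolding G_def by (rule dual_gauge_nonneg[OF m1 A])

text \<open>There is at least one point in \<open>Omega \<phi>\<close>, so the exponentially small error of \<open>localise\<close> can be
  charged to each term of the sum.\<close>

lemma expansion_bounded:
  assumes L: "L > 0"
  shows "\<exists>\<epsilon> C. (\<forall>k\<in>{1..K}. \<epsilon> k > 0 \<and> C k > 0) \<and> (\<forall>n x. n \<ge> 1 \<and> norm (real_vec x) \<le> real n * L \<longrightarrow>
    norm (conv_power \<phi> n x - (\<Sum>k\<in>{1..K}. \<Sum>l\<le>lam k. T k l n x)) \<le> (\<Sum>k\<in>{1..K}. majorant \<epsilon> C k n x))"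
proof -
  let ?pi = "(2 * complex_of_real pi) ^ CARD('d)"
  obtain c r0 where r0: "0 < r0" and cell: "\<forall>\<eta>\<in>Omega \<phi>. cball \<eta> r0 \<subseteq> cell c"
    and only: "\<forall>\<xi>\<in>cell c. norm (fourier \<phi> \<xi>) = 1 \<longrightarrow> \<xi> \<in> Omega \<phi>"
    using Omega_cell[OF \<phi> finite_Omega] by blast
  have "\<exists>d>0. \<forall>\<eta>\<in>Omega \<phi>. \<forall>\<eta>'\<in>Omega \<phi>. \<eta>' \<noteq> \<eta> \<longrightarrow> d \<le> dist \<eta> \<eta>'"
    by (rule finite_uniform_positive[OF finite_Omega]) (use finite_set_avoid[OF finite_Omega] in \<open>force+\<close>)
  then obtain sep where sep: "sep > 0" "\<And>\<eta> \<eta>'. \<eta> \<in> Omega \<phi> \<Longrightarrow> \<eta>' \<in> Omega \<phi> \<Longrightarrow> \<eta>' \<noteq> \<eta> \<Longrightarrow> sep \<le> dist \<eta> \<eta>'" by blast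
  define Local where "Local k \<delta> \<longleftrightarrow> (\<forall>a \<rho> \<theta> d\<theta> K L. 0 < a \<longrightarrow> \<rho> \<le> \<delta> \<longrightarrow> cutoff a \<rho> \<theta> d\<theta> K \<longrightarrow> L > 0 \<longrightarrow>
      (\<exists>\<epsilon>>0. \<exists>C>0. \<forall>n\<ge>1. \<forall>x. norm (real_vec x - real n *\<^sub>R \<alpha> k) \<le> real n * L \<longrightarrow>
        norm ((LINT \<zeta>|lborel. of_real (\<theta> (\<zeta> - \<xi> k)) * (chr (- x) \<zeta> * fourier \<phi> \<zeta> ^ n)) - ?pi * (\<Sum>l\<le>lam k. T k l n x))
        \<le> C * real n powr (- rate k) * exp (- (real n * (\<epsilon> * G k n x)))))" for k \<delta>
  have "\<exists>\<delta>>0. \<forall>k\<in>{1..K}. Local k \<delta>"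
  proof (rule finite_uniform_positive)
    show "\<exists>\<delta>>0. Local k \<delta>" if k: "k \<in> {1..K}" for k
      unfolding Local_def T_def G_def rate_def real_Suc_eq[symmetric]
      by (rule point_expansion(1)[OF \<phi> \<xi>_Omega[OF k] data[OF k] A[OF k] p[OF k]])
    show "Local k d'" if "Local k d" "d' \<le> d" for k d d'
      unfolding Local_def
    proof (intro allI impI)
      fix a \<rho> K0 L :: real and \<theta> :: "real ^ 'd \<Rightarrow> real" and d\<theta> assume h: "0 < a" "\<rho> \<le> d'" "cutoff a \<rho> \<theta> d\<theta> K0" "(0::real) < L"
      have "\<rho> \<le> d" using h(2) that(2) by simp
      from that(1)[unfolded Local_def, rule_format, OF h(1) this h(3,4)]
      show "\<exists>\<epsilon>>0. \<exists>C>0. \<forall>n\<ge>1. \<forall>x. norm (real_vec x - real n *\<^sub>R \<alpha> k) \<le> real n * L \<longrightarrow>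
        norm ((LINT \<zeta>|lborel. of_real (\<theta> (\<zeta> - \<xi> k)) * (chr (- x) \<zeta> * fourier \<phi> \<zeta> ^ n)) - ?pi * (\<Sum>l\<le>lam k. T k l n x))
        \<le> C * real n powr (- rate k) * exp (- (real n * (\<epsilon> * G k n x)))" .
    qed
  qed simp
  then obtain \<delta> where \<delta>: "\<delta> > 0" "\<And>k. k \<in> {1..K} \<Longrightarrow> Local k \<delta>" by blast
  define \<rho> where "\<rho> = min r0 (min (sep / 2) \<delta>)"
  have \<rho>: "\<rho> > 0" "\<rho> \<le> r0" "\<rho> \<le> \<delta>" "2 * \<rho> \<le> sep" using r0 sep(1) \<delta>(1) by (auto simp: \<rho>_def min_def)
  obtain \<theta> :: "real ^ 'd \<Rightarrow> real" and d\<theta> K\<theta> where cut: "cutoff (\<rho> / 2) \<rho> \<theta> d\<theta> K\<theta>"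
    using cutoff_exists[of "\<rho> / 2" \<rho>] \<rho>(1) by auto
  define J where "J \<eta> n x = (LINT \<zeta>|lborel. of_real (\<theta> (\<zeta> - \<eta>)) * (chr (- x) \<zeta> * fourier \<phi> \<zeta> ^ n))" for \<eta> n x
  have "\<exists>\<kappa>>0. \<exists>V>0. \<forall>n\<ge>1. \<forall>x. norm (?pi * conv_power \<phi> n x - (\<Sum>\<eta>\<in>Omega \<phi>. J \<eta> n x)) \<le> V * exp (- (real n * \<kappa>))"
    unfolding J_def
  proof (rule localise[OF \<phi> finite_Omega _ _ _ \<rho>(1) cut])
    show "cball \<eta> \<rho> \<subseteq> cell c" if "\<eta> \<in> Omega \<phi>" for \<eta> using cell that subset_cball[OF \<rho>(2), of \<eta>] by blast
    show "\<zeta> \<in> Omega \<phi>" if "\<zeta> \<in> cell c" "norm (fourier \<phi> \<zeta>) = 1" for \<zeta> using only that by blast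
    show "2 * \<rho> \<le> dist \<eta> \<eta>'" if "\<eta> \<in> Omega \<phi>" "\<eta>' \<in> Omega \<phi>" "\<eta> \<noteq> \<eta>'" for \<eta> \<eta>'
      using sep(2)[OF that(1,2)] that(3) \<rho>(4) by auto
  qed
  then obtain \<kappa> V where \<kappa>: "\<kappa> > 0" and V: "V > 0"
    and rest: "\<And>n x. n \<ge> 1 \<Longrightarrow> norm (?pi * conv_power \<phi> n x - (\<Sum>\<eta>\<in>Omega \<phi>. J \<eta> n x)) \<le> V * exp (- (real n * \<kappa>))" by blast
  define Q where "Q k \<epsilon> C \<longleftrightarrow> (\<forall>n\<ge>1. \<forall>x. norm (real_vec x) \<le> real n * L \<longrightarrow>
      norm (J (\<xi> k) n x - ?pi * (\<Sum>l\<le>lam k. T k l n x)) + V * exp (- (real n * \<kappa>))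
      \<le> C * real n powr (- rate k) * exp (- (real n * (\<epsilon> * G k n x))))" for k \<epsilon> C
  have "\<exists>\<epsilon>>0. \<exists>C>0. Q k \<epsilon> C" if k: "k \<in> {1..K}" for k
  proof -
    define L' where "L' = L + norm (\<alpha> k)"
    have L': "L' > 0" unfolding L'_def using L norm_ge_zero[of "\<alpha> k"] by linarith
    have near: "norm (real_vec x - real n *\<^sub>R \<alpha> k) \<le> real n * L'" if "norm (real_vec x) \<le> real n * L" for n x
      using norm_triangle_ineq4[of "real_vec x" "real n *\<^sub>R \<alpha> k"] that by (simp add: L'_def distrib_left)
    have \<rho>2: "\<rho> / 2 > 0" using \<rho>(1) by simp
    obtain \<epsilon>1 C1 where 1: "\<epsilon>1 > 0" "C1 > 0" "\<forall>n\<ge>1. \<forall>x. norm (real_vec x - real n *\<^sub>R \<alpha> k) \<le> real n * L' \<longrightarrow>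
        norm (J (\<xi> k) n x - ?pi * (\<Sum>l\<le>lam k. T k l n x)) \<le> C1 * real n powr (- rate k) * exp (- (real n * (\<epsilon>1 * G k n x)))"
      using \<delta>(2)[OF k, unfolded Local_def, THEN spec, THEN spec, THEN spec, THEN spec, THEN spec, THEN spec, THEN mp, THEN mp, THEN mp, THEN mp,
        OF \<rho>2 \<rho>(3) cut L', folded J_def] by (elim exE conjE) (rule that)
    obtain D where D: "D > 0" "\<And>y. norm y \<le> L' \<Longrightarrow> dual_gauge (m k) (A k) y \<le> D"
      using dual_gauge_bounded[OF m1[OF k] A[OF k], of L'] by blast
    obtain Cp where Cp: "Cp > 0" and absorb: "\<And>n G \<epsilon>. n \<ge> 1 \<Longrightarrow> G \<le> D \<Longrightarrow> 0 \<le> \<epsilon> \<Longrightarrow> \<epsilon> \<le> \<kappa> / (2 * D) \<Longrightarrow>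
        exp (- (real n * \<kappa>)) \<le> Cp * real n powr (- rate k) * exp (- (real n * (\<epsilon> * G)))"
      using absorb_exponential[OF \<kappa> rate_nonneg[OF k] D(1)] by blast
    define \<epsilon> where "\<epsilon> = min \<epsilon>1 (\<kappa> / (2 * D))"
    have \<epsilon>: "\<epsilon> > 0" "\<epsilon> \<le> \<epsilon>1" "\<epsilon> \<le> \<kappa> / (2 * D)" using 1 \<kappa> D(1) by (auto simp: \<epsilon>_def)
    have C: "C1 + V * Cp > 0" using 1 V Cp by (simp add: add_pos_pos)
    show ?thesis unfolding Q_def
    proof (rule exI[of _ \<epsilon>], rule conjI[OF \<epsilon>(1)], rule exI[of _ "C1 + V * Cp"], rule conjI[OF C], intro allI impI)
      fix n :: nat and x :: "int ^ 'd" assume n: "1 \<le> n" and x: "norm (real_vec x) \<le> real n * L"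
      let ?E = "real n powr (- rate k) * exp (- (real n * (\<epsilon> * G k n x)))"
      have "norm ((1 / real n) *\<^sub>R (real_vec x - real n *\<^sub>R \<alpha> k)) \<le> L'"
        using near[OF x] n by (simp add: divide_le_eq mult.commute)
      then have GD: "G k n x \<le> D" unfolding G_def by (rule D(2))
      have "\<epsilon> * G k n x \<le> \<epsilon>1 * G k n x" using \<epsilon> G_nonneg[OF k] by (intro mult_right_mono) auto
      then have "real n * (\<epsilon> * G k n x) \<le> real n * (\<epsilon>1 * G k n x)" by (intro mult_left_mono) auto
      then have "C1 * real n powr (- rate k) * exp (- (real n * (\<epsilon>1 * G k n x))) \<le> C1 * ?E"
        using 1 by (simp add: mult.assoc mult_left_mono)
      then have "norm (J (\<xi> k) n x - ?pi * (\<Sum>l\<le>lam k. T k l n x)) \<le> C1 * ?E"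
        using 1(3)[THEN spec, THEN mp, OF n, THEN spec, THEN mp, OF near[OF x]] by linarith
      moreover have "V * exp (- (real n * \<kappa>)) \<le> V * (Cp * ?E)"
        using absorb[OF n GD less_imp_le[OF \<epsilon>(1)] \<epsilon>(3)] V by (intro mult_left_mono) (auto simp: mult.assoc)
      ultimately have "norm (J (\<xi> k) n x - ?pi * (\<Sum>l\<le>lam k. T k l n x)) + V * exp (- (real n * \<kappa>)) \<le> C1 * ?E + V * (Cp * ?E)"
        by (rule add_mono)
      also have "\<dots> = (C1 + V * Cp) * real n powr (- rate k) * exp (- (real n * (\<epsilon> * G k n x)))"
        by (simp only: distrib_right mult.assoc)
      finally show "norm (J (\<xi> k) n x - ?pi * (\<Sum>l\<le>lam k. T k l n x)) + V * exp (- (real n * \<kappa>))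
        \<le> (C1 + V * Cp) * real n powr (- rate k) * exp (- (real n * (\<epsilon> * G k n x)))" .
    qed
  qed
  then have "\<forall>k\<in>{1..K}. \<exists>\<epsilon>>0. \<exists>C>0. Q k \<epsilon> C" by (rule ballI)
  from bchoice2[of "{1..K}" Q, OF this]
  obtain \<epsilon> C where \<epsilon>C: "\<forall>k\<in>{1..K}. \<epsilon> k > 0 \<and> C k > 0 \<and> Q k (\<epsilon> k) (C k)" by (elim exE) (rule that)
  have "norm (conv_power \<phi> n x - (\<Sum>k\<in>{1..K}. \<Sum>l\<le>lam k. T k l n x)) \<le> (\<Sum>k\<in>{1..K}. majorant \<epsilon> C k n x)"
    if n: "n \<ge> 1" and x: "norm (real_vec x) \<le> real n * L" for n x
  proof -
    let ?d = "conv_power \<phi> n x - (\<Sum>k\<in>{1..K}. \<Sum>l\<le>lam k. T k l n x)"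
    have J: "(\<Sum>\<eta>\<in>Omega \<phi>. J \<eta> n x) = (\<Sum>k\<in>{1..K}. J (\<xi> k) n x)"
      by (rule sum.reindex_bij_betw[OF bij, symmetric])
    have regroup: "a - b = (a - c) + (c - b)" for a b c :: complex by simp
    have "1 * norm ?d \<le> norm ?pi * norm ?d" by (intro mult_right_mono norm_2pi_power) simp
    also have "\<dots> = norm (?pi * conv_power \<phi> n x - (\<Sum>k\<in>{1..K}. ?pi * (\<Sum>l\<le>lam k. T k l n x)))"
      unfolding norm_mult[symmetric] right_diff_distrib sum_distrib_left ..
    also have "\<dots> = norm ((?pi * conv_power \<phi> n x - (\<Sum>\<eta>\<in>Omega \<phi>. J \<eta> n x)) + (\<Sum>k\<in>{1..K}. J (\<xi> k) n x - ?pi * (\<Sum>l\<le>lam k. T k l n x)))"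
      unfolding J sum_subtractf by (rule arg_cong[OF regroup])
    also have "\<dots> \<le> V * exp (- (real n * \<kappa>)) + (\<Sum>k\<in>{1..K}. norm (J (\<xi> k) n x - ?pi * (\<Sum>l\<le>lam k. T k l n x)))"
      by (rule order_trans[OF norm_triangle_ineq add_mono[OF rest[OF n] norm_sum]])
    also have "V * exp (- (real n * \<kappa>)) \<le> (\<Sum>k\<in>{1..K}. V * exp (- (real n * \<kappa>)))"
    proof -
      have "1 * (V * exp (- (real n * \<kappa>))) \<le> real K * (V * exp (- (real n * \<kappa>)))" using K_pos V by (intro mult_right_mono) auto
      then show ?thesis by simp
    qed
    also have "(\<Sum>k\<in>{1..K}. V * exp (- (real n * \<kappa>))) + (\<Sum>k\<in>{1..K}. norm (J (\<xi> k) n x - ?pi * (\<Sum>l\<le>lam k. T k l n x)))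
      = (\<Sum>k\<in>{1..K}. norm (J (\<xi> k) n x - ?pi * (\<Sum>l\<le>lam k. T k l n x)) + V * exp (- (real n * \<kappa>)))"
      by (simp only: sum.distrib add.commute)
    also have "\<dots> \<le> (\<Sum>k\<in>{1..K}. majorant \<epsilon> C k n x)"
    proof (rule sum_mono)
      fix k assume k: "k \<in> {1..K}"
      show "norm (J (\<xi> k) n x - ?pi * (\<Sum>l\<le>lam k. T k l n x)) + V * exp (- (real n * \<kappa>)) \<le> majorant \<epsilon> C k n x"
        unfolding majorant_def by (rule \<epsilon>C[unfolded Q_def, THEN bspec, OF k, THEN conjunct2, THEN conjunct2, THEN spec, THEN mp, OF n, THEN spec, THEN mp, OF x])
    qed
    finally show ?thesis by simp
  qed
  then show ?thesis using \<epsilon>C by blast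
qed

lemma majorant_mono:
  assumes k: "k \<in> {1..K}" and "0 \<le> C1 k" "C1 k \<le> C2 k" "\<epsilon>2 k \<le> \<epsilon>1 k"
  shows "majorant \<epsilon>1 C1 k n x \<le> majorant \<epsilon>2 C2 k n x"
  unfolding majorant_def
proof (intro mult_mono)
  have "\<epsilon>2 k * G k n x \<le> \<epsilon>1 k * G k n x" using assms G_nonneg[OF k] by (intro mult_right_mono) auto
  then have "real n * (\<epsilon>2 k * G k n x) \<le> real n * (\<epsilon>1 k * G k n x)" by (intro mult_left_mono) auto
  then show "exp (- (real n * (\<epsilon>1 k * G k n x))) \<le> exp (- (real n * (\<epsilon>2 k * G k n x)))" by simp
qed (use assms in auto)

text \<open>The number \<open>L\<close> is chosen such that \<open>|x| > n L\<close> forces both \<open>\<phi>\<^sup>(\<^sup>n\<^sup>)(x) = 0\<close> and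
  \<open>|x - n \<alpha>\<^sub>k| \<ge> n\<close>. Then \<open>dual_gauge\<close> is bounded below, and half of the exponential decay of the terms
  supplies the missing power of \<open>n\<close>.\<close>

lemma expansion_finite_support:
  assumes fin: "finite {x. \<phi> x \<noteq> 0}"
  shows "\<exists>\<epsilon> C. (\<forall>k\<in>{1..K}. \<epsilon> k > 0 \<and> C k > 0) \<and> (\<forall>n x. n \<ge> 1 \<longrightarrow>
    norm (conv_power \<phi> n x - (\<Sum>k\<in>{1..K}. \<Sum>l\<le>lam k. T k l n x)) \<le> (\<Sum>k\<in>{1..K}. majorant \<epsilon> C k n x))"
proof -
  define L0 where "L0 = (\<Sum>x | \<phi> x \<noteq> 0. norm (real_vec x))"
  have L0: "L0 \<ge> 0" unfolding L0_def by (intro sum_nonneg) simp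
  have supp: "\<phi> x = 0" if "norm (real_vec x) > L0" for x
  proof (rule ccontr)
    assume "\<phi> x \<noteq> 0"
    then have "norm (real_vec x) \<le> L0" unfolding L0_def using fin by (intro member_le_sum) auto
    then show False using that by simp
  qed
  define L where "L = 1 + L0 + (\<Sum>k\<in>{1..K}. norm (\<alpha> k))"
  have \<alpha>L: "norm (\<alpha> k) + 1 \<le> L" if "k \<in> {1..K}" for k
    using member_le_sum[of k "{1..K}" "\<lambda>k. norm (\<alpha> k)"] that L0 by (simp add: L_def)
  have L: "L > 0" "L0 \<le> L" using L0 sum_nonneg[of "{1..K}" "\<lambda>k. norm (\<alpha> k)"] by (simp_all add: L_def)
  obtain \<epsilon>1 C1 where 1: "\<forall>k\<in>{1..K}. \<epsilon>1 k > 0 \<and> C1 k > 0" and near: "\<forall>n x. n \<ge> 1 \<and> norm (real_vec x) \<le> real n * L \<longrightarrow>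
    norm (conv_power \<phi> n x - (\<Sum>k\<in>{1..K}. \<Sum>l\<le>lam k. T k l n x)) \<le> (\<Sum>k\<in>{1..K}. majorant \<epsilon>1 C1 k n x)"
    using expansion_bounded[OF L(1)] by blast
  define Q where "Q k \<epsilon> C \<longleftrightarrow> (\<forall>n\<ge>1. \<forall>x. norm (real_vec x) > real n * L \<longrightarrow>
      (\<Sum>l\<le>lam k. norm (T k l n x)) \<le> C * real n powr (- rate k) * exp (- (real n * (\<epsilon> * G k n x))))" for k \<epsilon> C
  have "\<exists>\<epsilon>>0. \<exists>C>0. Q k \<epsilon> C" if k: "k \<in> {1..K}" for k
  proof -
    obtain \<epsilon> C where \<epsilon>: "\<epsilon> > 0" and C: "C > 0" and b: "\<forall>n\<ge>1. \<forall>x. \<forall>l\<le>lam k. norm (T k l n x) \<le> C * real n powr (- hom_order (P k)) * exp (- (real n * (\<epsilon> * G k n x)))"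
      using point_expansion(2)[OF \<phi> \<xi>_Omega[OF k] data[OF k] A[OF k] p[OF k], of "lam k", folded T_def G_def] by (elim exE conjE) (rule that)
    obtain g where g: "g > 0" "\<And>y. norm y \<ge> 1 \<Longrightarrow> dual_gauge (m k) (A k) y \<ge> g"
      using dual_gauge_lower[OF m1[OF k] A[OF k]] by blast
    define b0 where "b0 = (real (lam k) + 1) / (2 * real (lcm_vec (m k)))"
    have b0: "b0 \<ge> 0" by (simp add: b0_def)
    obtain Cp where Cp: "Cp > 0" "\<And>y. y \<ge> 0 \<Longrightarrow> y powr b0 \<le> Cp * exp (\<epsilon> * g / 2 * y)"
      using powr_le_exp[OF b0, of "\<epsilon> * g / 2"] \<epsilon> g(1) by auto
    define C' where "C' = (real (lam k) + 1) * C * Cp"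
    have C': "C' > 0" using C Cp(1) by (simp add: C'_def)
    have \<epsilon>2: "\<epsilon> / 2 > 0" using \<epsilon> by simp
    show ?thesis unfolding Q_def
    proof (rule exI[of _ "\<epsilon> / 2"], rule conjI[OF \<epsilon>2], rule exI[of _ C'], rule conjI[OF C'], intro allI impI)
      fix n :: nat and x :: "int ^ 'd" assume n: "1 \<le> n" and x: "real n * L < norm (real_vec x)"
      have n0: "real n > 0" using n by simp
      have "real n * (norm (\<alpha> k) + 1) \<le> real n * L" using \<alpha>L[OF k] by (intro mult_left_mono) auto
      moreover have "norm (real n *\<^sub>R \<alpha> k) = real n * norm (\<alpha> k)" by simp
      ultimately have "real n \<le> norm (real_vec x - real n *\<^sub>R \<alpha> k)"
        using norm_triangle_ineq2[of "real_vec x" "real n *\<^sub>R \<alpha> k"] x by (simp only: distrib_left mult_1_right)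
      then have "norm ((1 / real n) *\<^sub>R (real_vec x - real n *\<^sub>R \<alpha> k)) \<ge> 1" using n0 by (simp add: le_divide_eq)
      then have Gg: "G k n x \<ge> g" unfolding G_def by (rule g(2))
      have "exp (- (real n * (\<epsilon> * G k n x))) \<le> Cp * real n powr (- b0) * exp (- (real n * (\<epsilon> / 2 * G k n x)))"
      proof -
        have "real n powr b0 * real n powr (- b0) = 1" using n0 by (simp flip: powr_add)
        then have "1 \<le> Cp * exp (\<epsilon> * g / 2 * real n) * real n powr (- b0)"
          using mult_right_mono[OF Cp(2)[of "real n"], of "real n powr (- b0)"] by simp
        then have "1 * exp (- (\<epsilon> * g / 2 * real n)) \<le> Cp * exp (\<epsilon> * g / 2 * real n) * real n powr (- b0) * exp (- (\<epsilon> * g / 2 * real n))"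
          by (intro mult_right_mono) auto
        also have "\<dots> = Cp * real n powr (- b0) * (exp (\<epsilon> * g / 2 * real n) * exp (- (\<epsilon> * g / 2 * real n)))" by (simp only: mult_ac)
        also have "\<dots> = Cp * real n powr (- b0)" by (simp only: exp_minus_inverse mult_1_right)
        finally have e: "exp (- (\<epsilon> * g / 2 * real n)) \<le> Cp * real n powr (- b0)" by simp
        have "\<epsilon> / 2 * g * real n \<le> \<epsilon> / 2 * G k n x * real n" using Gg \<epsilon> by (intro mult_right_mono mult_left_mono) auto
        then have "- (real n * (\<epsilon> * G k n x)) \<le> - (\<epsilon> * g / 2 * real n) + - (real n * (\<epsilon> / 2 * G k n x))" by (simp add: mult_ac)
        then have "exp (- (real n * (\<epsilon> * G k n x))) \<le> exp (- (\<epsilon> * g / 2 * real n)) * exp (- (real n * (\<epsilon> / 2 * G k n x)))"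
          unfolding exp_add[symmetric] by (simp only: exp_le_cancel_iff)
        also have "\<dots> \<le> Cp * real n powr (- b0) * exp (- (real n * (\<epsilon> / 2 * G k n x)))" by (intro mult_right_mono e) simp
        finally show ?thesis .
      qed
      then have step: "C * real n powr (- hom_order (P k)) * exp (- (real n * (\<epsilon> * G k n x)))
        \<le> C * real n powr (- hom_order (P k)) * (Cp * real n powr (- b0) * exp (- (real n * (\<epsilon> / 2 * G k n x))))"
        using C by (intro mult_left_mono) auto
      have rate: "real n powr (- rate k) = real n powr (- hom_order (P k)) * real n powr (- b0)"
        unfolding powr_add[symmetric] by (simp add: rate_def b0_def)
      have "(\<Sum>l\<le>lam k. norm (T k l n x)) \<le> (\<Sum>l\<le>lam k. C * real n powr (- hom_order (P k)) * (Cp * real n powr (- b0) * exp (- (real n * (\<epsilon> / 2 * G k n x)))))"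
      proof (rule sum_mono)
        fix l assume "l \<in> {..lam k}"
        then have "l \<le> lam k" by simp
        from b[THEN spec, THEN mp, OF n, THEN spec, THEN spec, THEN mp, OF this] step
        show "norm (T k l n x) \<le> C * real n powr (- hom_order (P k)) * (Cp * real n powr (- b0) * exp (- (real n * (\<epsilon> / 2 * G k n x))))"
          by (rule order_trans)
      qed
      also have "\<dots> = (real (lam k) + 1) * (C * real n powr (- hom_order (P k)) * (Cp * real n powr (- b0) * exp (- (real n * (\<epsilon> / 2 * G k n x)))))"
        by simp
      also have "\<dots> = C' * real n powr (- rate k) * exp (- (real n * (\<epsilon> / 2 * G k n x)))"
        unfolding rate C'_def by (simp only: mult_ac)
      finally show "(\<Sum>l\<le>lam k. norm (T k l n x)) \<le> C' * real n powr (- rate k) * exp (- (real n * (\<epsilon> / 2 * G k n x)))" .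
    qed
  qed
  then have "\<forall>k\<in>{1..K}. \<exists>\<epsilon>>0. \<exists>C>0. Q k \<epsilon> C" by (rule ballI)
  from bchoice2[of "{1..K}" Q, OF this]
  obtain \<epsilon>2 C2 where 2: "\<forall>k\<in>{1..K}. \<epsilon>2 k > 0 \<and> C2 k > 0 \<and> Q k (\<epsilon>2 k) (C2 k)" by (elim exE) (rule that)
  define \<epsilon> where "\<epsilon> k = min (\<epsilon>1 k) (\<epsilon>2 k)" for k
  define C where "C k = max (C1 k) (C2 k)" for k
  have "norm (conv_power \<phi> n x - (\<Sum>k\<in>{1..K}. \<Sum>l\<le>lam k. T k l n x)) \<le> (\<Sum>k\<in>{1..K}. majorant \<epsilon> C k n x)" if n: "n \<ge> 1" for n x
  proof (cases "norm (real_vec x) \<le> real n * L")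
    case True
    have "norm (conv_power \<phi> n x - (\<Sum>k\<in>{1..K}. \<Sum>l\<le>lam k. T k l n x)) \<le> (\<Sum>k\<in>{1..K}. majorant \<epsilon>1 C1 k n x)"
      by (rule near[THEN spec, THEN spec, THEN mp, OF conjI[OF n True]])
    also have "\<dots> \<le> (\<Sum>k\<in>{1..K}. majorant \<epsilon> C k n x)"
      by (intro sum_mono majorant_mono) (use 1 in \<open>auto simp: \<epsilon>_def C_def less_imp_le\<close>)
    finally show ?thesis .
  next
    case False
    then have x: "norm (real_vec x) > real n * L" by simp
    have "real n * L0 \<le> real n * L" using L by (intro mult_left_mono) auto
    then have c0: "conv_power \<phi> n x = 0" using x by (intro conv_power_support[where L = L0, OF supp n]) linarith+
    have "norm (conv_power \<phi> n x - (\<Sum>k\<in>{1..K}. \<Sum>l\<le>lam k. T k l n x)) = norm (\<Sum>k\<in>{1..K}. \<Sum>l\<le>lam k. T k l n x)"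
      unfolding c0 by (simp only: diff_0 norm_minus_cancel)
    also have "\<dots> \<le> (\<Sum>k\<in>{1..K}. \<Sum>l\<le>lam k. norm (T k l n x))"
      by (rule order_trans[OF norm_sum sum_mono[OF norm_sum]])
    also have "\<dots> \<le> (\<Sum>k\<in>{1..K}. majorant \<epsilon>2 C2 k n x)"
    proof (rule sum_mono)
      fix k assume k: "k \<in> {1..K}"
      show "(\<Sum>l\<le>lam k. norm (T k l n x)) \<le> majorant \<epsilon>2 C2 k n x"
        unfolding majorant_def by (rule 2[unfolded Q_def, THEN bspec, OF k, THEN conjunct2, THEN conjunct2, THEN spec, THEN mp, OF n, THEN spec, THEN mp, OF x])
    qed
    also have "\<dots> \<le> (\<Sum>k\<in>{1..K}. majorant \<epsilon> C k n x)"
      by (intro sum_mono majorant_mono) (use 2 in \<open>auto simp: \<epsilon>_def C_def less_imp_le\<close>)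
    finally show ?thesis .
  qed
  moreover have "\<forall>k\<in>{1..K}. \<epsilon> k > 0 \<and> C k > 0" using 1 2 by (auto simp: \<epsilon>_def C_def less_max_iff_disj)
  ultimately show ?thesis by blast
qed

lemma legendre_le_G:
  assumes k: "k \<in> {1..K}"
  shows "\<exists>D>0. \<forall>n x. legendre (real_part (P k)) ((1 / real n) *\<^sub>R (real_vec x - real n *\<^sub>R \<alpha> k)) \<le> D * G k n x"
proof -
  obtain c M where c: "c > 0" and lb: "\<And>\<xi> \<nu>. Re (eval_poly (lin_subst (A k) (P k)) (cplx_vec \<xi> - \<i> *s cplx_vec \<nu>))
      \<ge> c * quasi (m k) (cplx_vec \<xi>) - M * quasi (m k) (cplx_vec \<nu>)"
    using semi_elliptic_lower_bound[OF m1[OF k] p[OF k]] by blast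
  have "real_part (P k) \<zeta> \<ge> c * pgauge (m k) (A k) \<zeta>" for \<zeta>
  proof -
    have "cplx_vec 0 = (0 :: complex ^ 'd)" by (simp add: vec_eq_iff)
    then have "quasi (m k) (cplx_vec 0) = 0" using quasi_eq_0[OF m1[OF k]] by blast
    moreover have "A k *v (matrix_inv (A k) *v \<zeta>) = \<zeta>"
      using matrix_inv_mult(2)[OF A[OF k]] by (simp add: matrix_vector_mul_assoc)
    ultimately show ?thesis
      using lb[of "matrix_inv (A k) *v \<zeta>" 0] unfolding cpt_0 by (simp add: real_part_def eval_lin_subst cplx_mat_vec)
  qed
  from legendre_upper[OF m1[OF k] A[OF k] c this]
  show ?thesis unfolding G_def by (intro exI[of _ "max 1 (1 / c)"]) auto
qed

text \<open>The dual gauge dominates the Legendre transform of \<open>Re P\<close>, so a bound in terms of the former is a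
  bound in terms of the latter.\<close>

lemma legendre_form:
  assumes "\<exists>\<epsilon> C. (\<forall>k\<in>{1..K}. \<epsilon> k > 0 \<and> C k > 0) \<and> (\<forall>n x. Q n x \<longrightarrow> E n x \<le> (\<Sum>k\<in>{1..K}. majorant \<epsilon> C k n x))"
  shows "\<exists>M C :: nat \<Rightarrow> real. (\<forall>k\<in>{1..K}. M k > 0 \<and> C k > 0) \<and> (\<forall>n x. Q n x \<longrightarrow>
    E n x \<le> (\<Sum>k=1..K. C k / real n powr (hom_order (P k) + (real (lam k) + 1) / (2 * real (lcm_vec (m k)))) *
      exp (- (real n * M k * legendre (real_part (P k)) ((1 / real n) *\<^sub>R (real_vec x - real n *\<^sub>R \<alpha> k))))))"
proof -
  obtain \<epsilon> C where \<epsilon>C: "\<forall>k\<in>{1..K}. \<epsilon> k > 0 \<and> C k > 0" and E: "\<forall>n x. Q n x \<longrightarrow> E n x \<le> (\<Sum>k\<in>{1..K}. majorant \<epsilon> C k n x)"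
    using assms by blast
  have "\<forall>k\<in>{1..K}. \<exists>D>0. \<forall>n x. legendre (real_part (P k)) ((1 / real n) *\<^sub>R (real_vec x - real n *\<^sub>R \<alpha> k)) \<le> D * G k n x"
    using legendre_le_G by blast
  then obtain D where D: "\<forall>k\<in>{1..K}. D k > 0 \<and> (\<forall>n x. legendre (real_part (P k)) ((1 / real n) *\<^sub>R (real_vec x - real n *\<^sub>R \<alpha> k)) \<le> D k * G k n x)"
    by (rule bchoice[THEN exE])
  define M where "M k = \<epsilon> k / D k" for k
  have M: "\<forall>k\<in>{1..K}. M k > 0 \<and> C k > 0" using \<epsilon>C D by (simp add: M_def)
  have le: "majorant \<epsilon> C k n x \<le> C k / real n powr (hom_order (P k) + (real (lam k) + 1) / (2 * real (lcm_vec (m k)))) *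
      exp (- (real n * M k * legendre (real_part (P k)) ((1 / real n) *\<^sub>R (real_vec x - real n *\<^sub>R \<alpha> k))))" if k: "k \<in> {1..K}" for k n x
  proof -
    let ?l = "legendre (real_part (P k)) ((1 / real n) *\<^sub>R (real_vec x - real n *\<^sub>R \<alpha> k))"
    have Dk: "D k > 0" "?l \<le> D k * G k n x" and Ck: "C k > 0" and Mk: "M k > 0" using D k \<epsilon>C M by auto
    have "M k * ?l \<le> M k * (D k * G k n x)" using Dk Mk by (intro mult_left_mono) auto
    also have "\<dots> = \<epsilon> k * G k n x" using Dk(1) by (simp add: M_def)
    finally have "real n * (M k * ?l) \<le> real n * (\<epsilon> k * G k n x)" by (intro mult_left_mono) auto
    then have "exp (- (real n * (\<epsilon> k * G k n x))) \<le> exp (- (real n * M k * ?l))" by (simp add: mult.assoc)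
    moreover have "C k * real n powr (- rate k) = C k / real n powr (hom_order (P k) + (real (lam k) + 1) / (2 * real (lcm_vec (m k))))"
      unfolding rate_def powr_minus_divide by simp
    moreover have "C k * real n powr (- rate k) \<ge> 0" using Ck by simp
    ultimately show ?thesis unfolding majorant_def by (metis mult_left_mono)
  qed
  have "\<forall>n x. Q n x \<longrightarrow> E n x \<le> (\<Sum>k=1..K. C k / real n powr (hom_order (P k) + (real (lam k) + 1) / (2 * real (lcm_vec (m k)))) *
      exp (- (real n * M k * legendre (real_part (P k)) ((1 / real n) *\<^sub>R (real_vec x - real n *\<^sub>R \<alpha> k)))))"
  proof (intro allI impI)
    fix n x assume "Q n x"
    with E have "E n x \<le> (\<Sum>k\<in>{1..K}. majorant \<epsilon> C k n x)" by blast
    also note sum_mono[OF le]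
    finally show "E n x \<le> (\<Sum>k=1..K. C k / real n powr (hom_order (P k) + (real (lam k) + 1) / (2 * real (lcm_vec (m k)))) *
      exp (- (real n * M k * legendre (real_part (P k)) ((1 / real n) *\<^sub>R (real_vec x - real n *\<^sub>R \<alpha> k)))))" .
  qed
  with M show ?thesis by (intro exI[of _ M] exI[of _ C] conjI)
qed

end

theorem theorem1p11:
  fixes \<phi> :: "int ^ 'd::finite \<Rightarrow> complex"
    and K :: nat
    and \<xi> \<alpha> :: "nat \<Rightarrow> real ^ 'd"
    and P :: "nat \<Rightarrow> 'd cpoly"
    and A :: "nat \<Rightarrow> real ^ 'd ^ 'd"
    and m :: "nat \<Rightarrow> nat ^ 'd"
  assumes "\<phi> \<in> class_H_star"
    and "\<forall>\<eta>\<in>Omega \<phi>. pos_hom_type \<phi> \<eta>"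
    and "bij_betw \<xi> {1..K} (Omega \<phi>)"
    and "\<forall>k\<in>{1..K}. pos_hom_type_data \<phi> (\<xi> k) (\<alpha> k) (P k)"
    and "\<forall>k\<in>{1..K}. invertible (A k) \<and> positive_semi_elliptic (m k) (lin_subst (A k) (P k))"
  shows
    "(\<forall>L::real. L > 0 \<longrightarrow> (\<forall>lam :: nat \<Rightarrow> nat. \<exists>M C :: nat \<Rightarrow> real.
        (\<forall>k\<in>{1..K}. M k > 0 \<and> C k > 0) \<and>
        (\<forall>n::nat. \<forall>x :: int ^ 'd. n \<ge> 1 \<and> norm (real_vec x) \<le> real n * L \<longrightarrow>
          norm (conv_power \<phi> n x
            - (\<Sum>k=1..K. \<Sum>l=0..lam k.
                 exp (- (\<i> * complex_of_real (real_vec x \<bullet> \<xi> k))) * fourier \<phi> (\<xi> k) ^ n *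
                 Q_op (A k) (m k) (Upsilon \<phi> (\<xi> k) (\<alpha> k) (P k)) l n
                   (attractor (P k) (real n)) (real_vec x - real n *\<^sub>R \<alpha> k)))
          \<le> (\<Sum>k=1..K. C k / real n powr (hom_order (P k) + (real (lam k) + 1) / (2 * real (lcm_vec (m k)))) *
                 exp (- (real n * M k *
                   legendre (real_part (P k)) ((1 / real n) *\<^sub>R (real_vec x - real n *\<^sub>R \<alpha> k))))))))
     \<and>
     (finite {x. \<phi> x \<noteq> 0} \<longrightarrow> (\<forall>lam :: nat \<Rightarrow> nat. \<exists>M C :: nat \<Rightarrow> real.
        (\<forall>k\<in>{1..K}. M k > 0 \<and> C k > 0) \<and>
        (\<forall>n::nat. \<forall>x :: int ^ 'd. n \<ge> 1 \<longrightarrow>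
          norm (conv_power \<phi> n x
            - (\<Sum>k=1..K. \<Sum>l=0..lam k.
                 exp (- (\<i> * complex_of_real (real_vec x \<bullet> \<xi> k))) * fourier \<phi> (\<xi> k) ^ n *
                 Q_op (A k) (m k) (Upsilon \<phi> (\<xi> k) (\<alpha> k) (P k)) l n
                   (attractor (P k) (real n)) (real_vec x - real n *\<^sub>R \<alpha> k)))
          \<le> (\<Sum>k=1..K. C k / real n powr (hom_order (P k) + (real (lam k) + 1) / (2 * real (lcm_vec (m k)))) *
                 exp (- (real n * M k *
                   legendre (real_part (P k)) ((1 / real n) *\<^sub>R (real_vec x - real n *\<^sub>R \<alpha> k))))))))"
proof -
  have data: "expansion_data \<phi> K \<xi> \<alpha> P A m" using assms by unfold_locales auto
  show ?thesis
  proof (intro conjI allI impI, goal_cases)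
    case (1 L lam)
    interpret expansion_data \<phi> K \<xi> \<alpha> P A m lam by (rule data)
    show ?case
      unfolding T_def[symmetric] atLeast0AtMost
      by (rule legendre_form[OF expansion_bounded[OF 1]])
  next
    case (2 lam)
    interpret expansion_data \<phi> K \<xi> \<alpha> P A m lam by (rule data)
    show ?case
      unfolding T_def[symmetric] atLeast0AtMost
      by (rule legendre_form[OF expansion_finite_support[OF 2(1)]])
  qed
qed

end
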